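(* Let $K$ be a global function field with constant field $\mathbb{F}_q$. For any fixed set $S\subseteq\mathcal{P}$ of prime divisors having natural density $\delta(S)$, $$\sum_{\deg A=n}Q_S(A)=\delta(S)c_Kq^n+o(q^n)\quad(n\to\infty),$$ the sum running over effective divisors $A$ of degree $n$.
   Context: $K$ is a finite extension of $\mathbb{F}_p(x)$ with constant field $\mathbb{F}_q$; $\mathcal{P}$ is its set of prime divisors (places), $\deg P$ given by $|P|=q^{\deg P}$. Effective divisors are finite formal sums $\sum a_PP$ with $a_P\ge0$. For effective $D$, $d^+(D)=\max\{\deg P:P\mid D\}$ ($d^+(0)=0$) and $Q_S(D)=\#\{P\in S:P\mid D,\ \deg P=d^+(D)\}$. $S$ has natural density $\delta(S)$ if $\lim_{n\to\infty}\#\{P\in S:\deg P=n\}/\#\{P\in\mathcal{P}:\deg P=n\}=\delta(S)$ exists. $c_K=h_Kq^{1-g_K}/(q-1)$ with $h_K$ the class number and $g_K$ the genus of $K$. *)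

theory Defs
  imports "HOL-Algebra.Algebra" "HOL-Library.Landau_Symbols"
begin

definition prime_subfield :: "('a, 'b) ring_scheme \<Rightarrow> 'a set" where
  "prime_subfield K = generate_field K {}"

text \<open>A finite extension of \<open>\<bbbF>\<^sub>p(x)\<close>, the rational function field being realised as the
  subfield generated by an element \<open>x\<close> transcendental over the prime field.\<close>

locale global_function_field = field K for K (structure) +
  assumes prime_subfield_card: "Factorial_Ring.prime (card (prime_subfield K))"
    and finite_over_rational:
      "\<exists>x \<in> carrier K. (transcendental over prime_subfield K) x \<and>
          finite_dimension (generate_field K {x}) (carrier K)"

text \<open>The constant field is the algebraic closure of the prime field in \<open>K\<close>.\<close>

definition constant_field :: "('a, 'b) ring_scheme \<Rightarrow> 'a set" where
  "constant_field K = {a \<in> carrier K. (ring.algebraic K over prime_subfield K) a}"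

definition discrete_valuation_ring :: "('a, 'b) ring_scheme \<Rightarrow> bool" where
  "discrete_valuation_ring R \<longleftrightarrow>
     principal_domain R \<and> (\<exists>P. {I. maximalideal I R} = {P} \<and> P \<noteq> {\<zero>\<^bsub>R\<^esub>})"

text \<open>A prime divisor is represented by its valuation ring \<open>V\<close>: a discrete valuation ring
  containing the constant field and having quotient field \<open>K\<close>.\<close>

definition prime_divisors :: "('a, 'b) ring_scheme \<Rightarrow> 'a set set" where
  "prime_divisors K = {V. subring V K \<and> constant_field K \<subseteq> V \<and>
     discrete_valuation_ring (K\<lparr>carrier := V\<rparr>) \<and>
     (\<forall>x \<in> carrier K. \<exists>a \<in> V. \<exists>b \<in> V - {\<zero>\<^bsub>K\<^esub>}. x = a \<otimes>\<^bsub>K\<^esub> inv\<^bsub>K\<^esub> b)}"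

definition place_ideal :: "('a, 'b) ring_scheme \<Rightarrow> 'a set \<Rightarrow> 'a set" where
  "place_ideal K V = (THE P. maximalideal P (K\<lparr>carrier := V\<rparr>))"

text \<open>The order of a nonzero \<open>x\<close> at \<open>V\<close>: the exponent \<open>n\<close> in \<open>x = u t\<^sup>n\<close> with \<open>u\<close> a unit of \<open>V\<close>
  and \<open>t\<close> a uniformizer; it is only used for \<open>x \<noteq> 0\<close>.\<close>

definition place_ord :: "('a, 'b) ring_scheme \<Rightarrow> 'a set \<Rightarrow> 'a \<Rightarrow> int" where
  "place_ord K V x = (THE n. \<exists>t \<in> V. \<exists>u \<in> Units (K\<lparr>carrier := V\<rparr>).
     place_ideal K V = PIdl\<^bsub>K\<lparr>carrier := V\<rparr>\<^esub> t \<and> x = u \<otimes>\<^bsub>K\<^esub> (t [^]\<^bsub>K\<^esub> n))"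

definition place_norm :: "('a, 'b) ring_scheme \<Rightarrow> 'a set \<Rightarrow> nat" where
  "place_norm K V = card (carrier (K\<lparr>carrier := V\<rparr> Quot place_ideal K V))"

definition place_degree :: "('a, 'b) ring_scheme \<Rightarrow> 'a set \<Rightarrow> nat" where
  "place_degree K V = (THE d. place_norm K V = card (constant_field K) ^ d)"

abbreviation divisor_group :: "('a, 'b) ring_scheme \<Rightarrow> ('a set \<Rightarrow>\<^sub>0 int) monoid" where
  "divisor_group K \<equiv> free_Abelian_group (prime_divisors K)"

definition divisor_degree :: "('a, 'b) ring_scheme \<Rightarrow> ('a set \<Rightarrow>\<^sub>0 int) \<Rightarrow> int" where
  "divisor_degree K D =
     (\<Sum>P \<in> Poly_Mapping.keys D. Poly_Mapping.lookup D P * int (place_degree K P))"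

definition effective_divisors :: "('a, 'b) ring_scheme \<Rightarrow> ('a set \<Rightarrow>\<^sub>0 int) set" where
  "effective_divisors K =
     {D \<in> carrier (divisor_group K). \<forall>P. 0 \<le> Poly_Mapping.lookup D P}"

definition principal_divisors :: "('a, 'b) ring_scheme \<Rightarrow> ('a set \<Rightarrow>\<^sub>0 int) set" where
  "principal_divisors K = {D \<in> carrier (divisor_group K).
     \<exists>x \<in> carrier K - {\<zero>\<^bsub>K\<^esub>}. \<forall>P \<in> prime_divisors K. Poly_Mapping.lookup D P = place_ord K P x}"

definition class_number :: "('a, 'b) ring_scheme \<Rightarrow> nat" where
  "class_number K = order
     ((divisor_group K)\<lparr>carrier := {D \<in> carrier (divisor_group K). divisor_degree K D = 0}\<rparr>
        Mod principal_divisors K)"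

definition riemann_roch_space :: "('a, 'b) ring_scheme \<Rightarrow> ('a set \<Rightarrow>\<^sub>0 int) \<Rightarrow> 'a set" where
  "riemann_roch_space K D = {x \<in> carrier K. x \<noteq> \<zero>\<^bsub>K\<^esub> \<longrightarrow>
     (\<forall>P \<in> prime_divisors K. 0 \<le> place_ord K P x + Poly_Mapping.lookup D P)}"

definition riemann_roch_dim :: "('a, 'b) ring_scheme \<Rightarrow> ('a set \<Rightarrow>\<^sub>0 int) \<Rightarrow> nat" where
  "riemann_roch_dim K D = (ring.dim K over constant_field K) (riemann_roch_space K D)"

text \<open>The genus is \<open>max\<^sub>D (deg D - l(D) + 1)\<close>; the maximum exists by Riemann's theorem.\<close>

definition genus :: "('a, 'b) ring_scheme \<Rightarrow> int" where
  "genus K = (GREATEST g. \<exists>D \<in> carrier (divisor_group K).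
     g = divisor_degree K D - int (riemann_roch_dim K D) + 1)"

definition c_const :: "('a, 'b) ring_scheme \<Rightarrow> real" where
  "c_const K = (let q = real (card (constant_field K)) in
     real (class_number K) * q powi (1 - genus K) / (q - 1))"

definition has_natural_density :: "('a, 'b) ring_scheme \<Rightarrow> 'a set set \<Rightarrow> real \<Rightarrow> bool" where
  "has_natural_density K S \<delta> \<longleftrightarrow>
     (\<lambda>n. real (card {P \<in> S. place_degree K P = n}) /
          real (card {P \<in> prime_divisors K. place_degree K P = n})) \<longlonglongrightarrow> \<delta>"

text \<open>For effective \<open>D\<close>, a prime divisor \<open>P\<close> divides \<open>D\<close> iff \<open>P\<close> lies in the support of \<open>D\<close>.\<close>

definition d_plus :: "('a, 'b) ring_scheme \<Rightarrow> ('a set \<Rightarrow>\<^sub>0 int) \<Rightarrow> nat" where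
  "d_plus K D = (if D = 0 then 0 else Max (place_degree K ` Poly_Mapping.keys D))"

definition Q_count :: "('a, 'b) ring_scheme \<Rightarrow> 'a set set \<Rightarrow> ('a set \<Rightarrow>\<^sub>0 int) \<Rightarrow> nat" where
  "Q_count K S D = card {P \<in> S. P \<in> Poly_Mapping.keys D \<and> place_degree K P = d_plus K D}"

end

theory Submission
  imports Defs
begin

text \<open>
  The field carries finite additive groups \<open>B e\<close> of size at most \<open>C ^ (e + 1)\<close> on which multiplication by a
  fixed element costs, up to a common denominator, only a bounded number of levels. Counting in these groups
  bounds the index of \<open>yH\<close> in \<open>H\<close> for every additive subgroup \<open>H \<supseteq> yH\<close>. Hence valuation rings are discrete
  with finite residue fields, elements have finitely many zeros and poles, and Riemann's theorem holds. This
  gives finiteness of the class number \<open>h\<close> and \<open>h (q ^ (n + 1 - g) - 1) / (q - 1)\<close> effective divisors in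
  each large degree \<open>n\<close> that occurs.

  All degrees occur (F. K. Schmidt): if \<open>d > 1\<close> divided every degree, adjoin a root of unity \<open>\<theta>\<close> outside \<open>K\<close>
  whose order divides \<open>q ^ d - 1\<close>. Every place then splits into at least two places of the same norm, and the
  extension has too many effective divisors.

  Removing a prime of maximal degree from \<open>A\<close> gives \<open>\<Sum>Q\<^sub>S(A) = \<Sum>k. \<pi>\<^sub>S(k) \<Psi>(n - k, k)\<close>, where \<open>\<Psi>(m, k)\<close>
  counts the effective divisors of degree \<open>m\<close> with all primes of degree at most \<open>k\<close>. The density compares this
  sum for \<open>k \<ge> k\<^sub>0\<close> with the one for all primes; the terms \<open>k < k\<^sub>0\<close> grow polynomially in \<open>n\<close>. Finally the excess
  \<open>\<Sum>(Q(A) - 1)\<close> over \<open>k \<ge> k\<^sub>0\<close> counts pairs of distinct primes of equal degree and is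
  \<open>O(q ^ n \<Sum>\<pi>(k)\<^sup>2 / q ^ (2 * k)) = O(q ^ n / k\<^sub>0)\<close>.
\<close>

section \<open>Index bounds from growth\<close>

text \<open>At the start there are no degrees, residue fields or valuations, so finiteness comes
  from counting alone. If \<open>W\<close> represents distinct cosets of yH in H, the sums w_0 + y
  w_1 + ... + y^(m-1) w_(m-1) are distinct, while clearing denominators puts them into a level of
  size exponential in m, at a rate that depends on y only. Run with y = 1/z, the same expansions
  supply the functions with large poles in Riemann's theorem, and the equality of the degrees of
  zeros and poles follows from that estimate instead of preceding it. The count of divisors uses
  l(D) in large degrees, where Riemann's theorem gives it exactly; the bound \<pi>(k) = O(q^k / k)
  comes from the zeros of x^(q^k) - x. The obstacle is that these counts speak only of degrees that
  some divisor has. That all degrees occur is shown by comparing orders of growth in two fields,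
  which needs the whole theory for the extension as well, without determining its constant field.
  This dictates hypotheses that pass to extensions and a comparison of places by norms rather than
  by degrees.\<close>

lemma power_bound_imp_le:
  fixes a b c :: nat
  assumes "\<And>m. a ^ m \<le> c * b ^ m"
  shows "a \<le> b"
proof (rule ccontr)
  assume "\<not> a \<le> b"
  then have ab: "a \<ge> b + 1" by simp
  have a0: "b > 0"
  proof (rule ccontr)
    assume "\<not> b > 0" then show False using assms[of 1] ab by simp
  qed
  have bern: "b ^ m + m * b ^ (m - 1) \<le> a ^ m" for m
  proof -
    have "b ^ m + m * b ^ (m - 1) \<le> (b + 1) ^ m"
    proof (induction m)
      case (Suc m)
      have "m * b ^ (m - 1) * b = m * b ^ m" by (cases m) (auto simp: algebra_simps)
      then have "b ^ Suc m + Suc m * b ^ (Suc m - 1) \<le> (b ^ m + m * b ^ (m - 1)) * (b + 1)"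
        by (cases m) (auto simp: algebra_simps)
      also have "\<dots> \<le> (b + 1) ^ m * (b + 1)" using Suc mult_le_mono1 by blast
      finally show ?case by (simp add: mult.commute)
    qed simp
    also have "\<dots> \<le> a ^ m" using ab by (intro power_mono) auto
    finally show ?thesis .
  qed
  \<comment> \<open>At this exponent the second Bernoulli term alone, (cb + 1) b^(cb), already
    exceeds the bound c b^(cb + 1).\<close>
  let ?m = "c * b + 1"
  have "?m * b ^ (c * b) \<le> c * b ^ ?m"
    using order_trans[OF order_trans[OF le_add2 bern[of ?m]] assms[of ?m]] unfolding add_diff_cancel_right' .
  then have "?m * b ^ (c * b) \<le> (c * b) * b ^ (c * b)" unfolding power_add power_one_right by (metis mult.assoc mult.commute)
  then have "?m \<le> c * b" using a0 by (metis mult_le_cancel2 zero_less_power)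
  then show False by simp
qed

text \<open>The last clause replaces a degree function: once a common denominator \<open>c\<close> is cleared, multiplication by \<open>y\<close>
  raises the level of the filtration by at most \<open>d\<close>.\<close>

definition growth :: "('a, 'b) ring_scheme \<Rightarrow> (nat \<Rightarrow> 'a set) \<Rightarrow> nat \<Rightarrow> bool" where
  "growth K B C \<longleftrightarrow>
     (\<forall>e. finite (B e) \<and> B e \<subseteq> carrier K \<and> card (B e) \<le> C ^ Suc e \<and> \<zero>\<^bsub>K\<^esub> \<in> B e) \<and>
     \<one>\<^bsub>K\<^esub> \<in> B 0 \<and>
     (\<forall>e. \<forall>a\<in>B e. \<forall>b\<in>B e. a \<oplus>\<^bsub>K\<^esub> b \<in> B e) \<and>
     (\<forall>Y. finite Y \<longrightarrow> Y \<subseteq> carrier K \<longrightarrow>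
        (\<exists>c\<in>carrier K - {\<zero>\<^bsub>K\<^esub>}. \<exists>d. \<forall>y\<in>Y. \<forall>m. \<forall>b\<in>B m. (c \<otimes>\<^bsub>K\<^esub> y) \<otimes>\<^bsub>K\<^esub> b \<in> B (m + d)))"

text \<open>A relative version of \<open>a_rcosets\<close>: \<open>G\<close> need not be the
  carrier, so indices of subgroups inside the field are counted without passing to another
  ring.\<close>

definition (in ring) cosets :: "'a set \<Rightarrow> 'a set \<Rightarrow> 'a set set" where
  "cosets G H = (\<lambda>a. H +> a) ` G"

context ring begin

lemma additive_subgroup_minus:
  assumes "additive_subgroup H R" "a \<in> H" "b \<in> H" shows "a \<ominus> b \<in> H"
  using assms additive_subgroup.a_closed additive_subgroup.a_inv_closed
  by (metis a_minus_def abelian_subgroup.intro abelian_subgroup_axioms_def additive_subgroup.a_subgroup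
      additive_subgroup_def add.subgroupE(3))

lemma minus_minus_cancel:
  assumes "a \<in> carrier R" "b \<in> carrier R" "c \<in> carrier R"
  shows "a \<ominus> c \<ominus> (b \<ominus> c) = a \<ominus> b" "(a \<ominus> b) \<oplus> (b \<ominus> c) = a \<ominus> c" "(a \<ominus> b) \<oplus> b = a" "(a \<oplus> b) \<ominus> b = a" "b \<oplus> (a \<ominus> b) = a"
    "\<ominus> (a \<ominus> b) = b \<ominus> a" "(a \<oplus> c) \<ominus> b \<ominus> c = a \<ominus> b"
  using assms by (algebra; simp)+

lemma coset_eq_iff:
  assumes H: "additive_subgroup H R" and "a \<in> carrier R" "b \<in> carrier R"
  shows "H +> a = H +> b \<longleftrightarrow> a \<ominus> b \<in> H"
proof
  have Hc: "H \<subseteq> carrier R" using H additive_subgroup.a_subset by blast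
  assume "H +> a = H +> b"
  moreover have "a \<in> H +> a"
    using assms additive_subgroup.zero_closed[OF H] by (force simp: a_r_coset_def')
  ultimately obtain h where h: "h \<in> H" "a = h \<oplus> b" by (auto simp: a_r_coset_def')
  then have "a \<ominus> b = h" using Hc assms minus_minus_cancel(4)[of h b b] by blast
  then show "a \<ominus> b \<in> H" using h by simp
next
  have Hc: "H \<subseteq> carrier R" using H additive_subgroup.a_subset by blast
  have *: "H +> x \<subseteq> H +> y" if "x \<in> carrier R" "y \<in> carrier R" "x \<ominus> y \<in> H" for x y
  proof
    fix z assume "z \<in> H +> x"
    then obtain h where h: "h \<in> H" "z = h \<oplus> x" by (auto simp: a_r_coset_def')
    then have "z = (h \<oplus> (x \<ominus> y)) \<oplus> y"
      using that Hc minus_minus_cancel(3)[of x y y] by (simp add: a_assoc subsetD)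
    moreover have "h \<oplus> (x \<ominus> y) \<in> H" using h that H by (simp add: additive_subgroup.a_closed)
    ultimately show "z \<in> H +> y" unfolding a_r_coset_def' by blast
  qed
  assume ab: "a \<ominus> b \<in> H"
  have "\<zero> \<ominus> (a \<ominus> b) \<in> H" using ab H additive_subgroup.zero_closed additive_subgroup_minus by blast
  then have "b \<ominus> a \<in> H" using assms by (metis a_minus_def minus_closed minus_minus_cancel(6) l_zero add.inv_closed)
  then show "H +> a = H +> b" using * ab assms by blast
qed

text \<open>A system of representatives for any family of cosets. The later counting arguments work
  with representatives, because these can be multiplied and combined into expansions.\<close>

lemma cosets_incongruent:
  assumes H: "additive_subgroup H R" and G: "G \<subseteq> carrier R" and "Z \<subseteq> cosets G H"
  obtains W where "W \<subseteq> G" "inj_on (\<lambda>a. H +> a) W" "(\<lambda>a. H +> a) ` W = Z"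
proof -
  have "Z \<subseteq> (\<lambda>a. H +> a) ` G" using assms(3) unfolding cosets_def by simp
  then show ?thesis using subset_image_inj[of Z "\<lambda>a. H +> a" G] that by metis
qed

text \<open>Lagrange's formula in the direction that deduces finiteness of \<open>G\<close> from
  finiteness of the subgroup and of the index; Riemann-Roch spaces are built up through it one place
  at a time.\<close>

lemma cosets_finite_card:
  assumes G: "additive_subgroup G R" and H: "additive_subgroup H R" and HG: "H \<subseteq> G"
    and "finite (cosets G H)" "finite H"
  shows "finite G" "card G = card (cosets G H) * card H"
proof -
  have Gc: "G \<subseteq> carrier R" using G additive_subgroup.a_subset by blast
  have Hc: "H \<subseteq> carrier R" using HG Gc by simp
  obtain W where W: "W \<subseteq> G" "inj_on (\<lambda>a. H +> a) W" "(\<lambda>a. H +> a) ` W = cosets G H"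
    using cosets_incongruent[OF H Gc order_refl] by metis
  have finW: "finite W" using W assms(4) finite_imageD by metis
  let ?f = "\<lambda>(w,h). h \<oplus> w"
  have inj: "inj_on ?f (W \<times> H)"
  proof (rule inj_onI, clarify)
    fix w h w' h' assume A: "w \<in> W" "h \<in> H" "w' \<in> W" "h' \<in> H" "h \<oplus> w = h' \<oplus> w'"
    then have C: "w \<in> carrier R" "w' \<in> carrier R" "h \<in> carrier R" "h' \<in> carrier R" using W Gc Hc by auto
    have "w \<ominus> w' = (h \<oplus> w) \<ominus> h \<ominus> w'" using C by (algebra; simp)
    also have "\<dots> = h' \<ominus> h" using A(5) C by (simp, algebra; simp)
    finally have "w \<ominus> w' \<in> H" using additive_subgroup_minus[OF H] A by simp
    then have "w = w'" using coset_eq_iff[OF H] C W(2) A inj_onD by metis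
    then show "w = w' \<and> h = h'" using A(5) C by simp
  qed
  have "?f ` (W \<times> H) = G"
  proof
    show "?f ` (W \<times> H) \<subseteq> G" using W HG G by (auto simp: additive_subgroup.a_closed subset_iff)
    show "G \<subseteq> ?f ` (W \<times> H)"
    proof
      fix g assume g: "g \<in> G"
      then obtain w where w: "w \<in> W" "H +> w = H +> g" using W(3) unfolding cosets_def by (metis imageE imageI)
      then have c: "w \<in> carrier R" "g \<in> carrier R" using W Gc g by auto
      then have "g \<ominus> w \<in> H" using coset_eq_iff[OF H] w by metis
      moreover have "g = (g \<ominus> w) \<oplus> w" using c minus_minus_cancel by simp
      ultimately show "g \<in> ?f ` (W \<times> H)" using w by force
    qed
  qed
  then have bij: "bij_betw ?f (W \<times> H) G" using inj by (simp add: bij_betw_def)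
  then show "finite G" using finW assms(5) bij_betw_finite by blast
  have "card G = card W * card H" using bij_betw_same_card[OF bij] by (simp add: card_cartesian_product)
  also have "card W = card (cosets G H)" using W card_image by metis
  finally show "card G = card (cosets G H) * card H" .
qed

text \<open>\<open>f\<close> injects representatives modulo \<open>H\<close> into cosets of
  \<open>H'\<close>. It need not be additive; reflecting congruence is enough.\<close>

lemma cosets_card_mono:
  assumes H: "additive_subgroup H R" and H': "additive_subgroup H' R"
    and sub: "G \<subseteq> carrier R" "G' \<subseteq> carrier R" and "finite (cosets G' H')"
    and f: "\<And>a. a \<in> G \<Longrightarrow> f a \<in> G'"
    and inj: "\<And>a b. a \<in> G \<Longrightarrow> b \<in> G \<Longrightarrow> f a \<ominus> f b \<in> H' \<Longrightarrow> a \<ominus> b \<in> H"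
  shows "finite (cosets G H)" "card (cosets G H) \<le> card (cosets G' H')"
proof -
  obtain W where W: "W \<subseteq> G" "inj_on (\<lambda>a. H +> a) W" "(\<lambda>a. H +> a) ` W = cosets G H"
    using cosets_incongruent[OF H sub(1) order_refl] by metis
  have "inj_on (\<lambda>a. H' +> f a) W"
  proof (rule inj_onI)
    fix a b assume A: "a \<in> W" "b \<in> W" "H' +> f a = H' +> f b"
    then have "f a \<ominus> f b \<in> H'" using coset_eq_iff[OF H'] f W sub by (meson subsetD)
    then have "H +> a = H +> b" using inj A W sub coset_eq_iff[OF H] by (meson subsetD)
    then show "a = b" using W A inj_onD by metis
  qed
  moreover have "(\<lambda>a. H' +> f a) ` W \<subseteq> cosets G' H'" using W f unfolding cosets_def by auto
  ultimately have "finite W" "card W \<le> card (cosets G' H')"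
    using assms(5) by (meson inj_on_finite, meson card_inj_on_le)
  then show "finite (cosets G H)" "card (cosets G H) \<le> card (cosets G' H')"
    using W card_image[OF W(2)] by (metis finite_imageI, metis)
qed

end

text \<open>Expansions w_0 + y w_1 + ... + y^(m-1) w_(m-1) with digits in \<open>W\<close>, in
  Horner form.\<close>

fun (in ring) digit_sums :: "'a set \<Rightarrow> 'a \<Rightarrow> nat \<Rightarrow> 'a set" where
  "digit_sums W y 0 = {\<zero>}"
| "digit_sums W y (Suc m) = (\<lambda>(w, z). w \<oplus> y \<otimes> z) ` (W \<times> digit_sums W y m)"

definition (in ring) dilate :: "'a \<Rightarrow> 'a set \<Rightarrow> 'a set" where "dilate y A = (\<lambda>a. y \<otimes> a) ` A"

context domain begin

lemma pow_nonzero: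
  assumes "c \<in> carrier R" "c \<noteq> \<zero>" shows "c [^] (m :: nat) \<noteq> \<zero>"
  using assms by (induction m) (auto simp: integral_iff)

lemma dilate_additive_subgroup:
  assumes "additive_subgroup H R" "y \<in> carrier R"
  shows "additive_subgroup (dilate y H) R"
proof (rule additive_subgroup.intro, rule add.subgroupI)
  have Hc: "H \<subseteq> carrier R" using assms additive_subgroup.a_subset by blast
  show "dilate y H \<subseteq> carrier R" using Hc assms unfolding dilate_def by auto
  show "dilate y H \<noteq> {}" using additive_subgroup.zero_closed[OF assms(1)] unfolding dilate_def by auto
  show "\<ominus> a \<in> dilate y H" if "a \<in> dilate y H" for a
  proof -
    obtain h where h: "h \<in> H" "a = y \<otimes> h" using \<open>a \<in> dilate y H\<close> unfolding dilate_def by auto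
    then have "\<ominus> a = y \<otimes> (\<ominus> h)" using Hc assms by (simp add: r_minus subsetD)
    moreover have "\<ominus> h \<in> H" using additive_subgroup.a_inv_closed[OF assms(1) h(1)] .
    ultimately show ?thesis unfolding dilate_def by blast
  qed
  show "a \<oplus> b \<in> dilate y H" if ab: "a \<in> dilate y H" "b \<in> dilate y H" for a b
  proof -
    obtain h h' where h: "h \<in> H" "a = y \<otimes> h" "h' \<in> H" "b = y \<otimes> h'" using ab unfolding dilate_def by blast
    then have "a \<oplus> b = y \<otimes> (h \<oplus> h')" using Hc assms by (simp add: r_distr subsetD)
    moreover have "h \<oplus> h' \<in> H" using additive_subgroup.a_closed[OF assms(1) h(1,3)] .
    ultimately show ?thesis unfolding dilate_def by blast
  qed
qed

text \<open>Expansions to the base y are unique: everything after the leading digit lies in yG, so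
  that digit is determined by its coset, and the rest follows after cancelling y.\<close>

lemma digit_sums_card:
  assumes "additive_subgroup G R" "y \<in> carrier R" "y \<noteq> \<zero>" "dilate y G \<subseteq> G"
    and W: "W \<subseteq> G" "inj_on (\<lambda>a. dilate y G +> a) W" "finite W"
  shows "digit_sums W y m \<subseteq> G \<and> card (digit_sums W y m) = card W ^ m \<and> finite (digit_sums W y m)"
proof (induction m)
  case 0 then show ?case using assms(1) additive_subgroup.zero_closed by auto
next
  case (Suc m)
  have Gc: "G \<subseteq> carrier R" using assms additive_subgroup.a_subset by blast
  have yG: "additive_subgroup (dilate y G) R" using dilate_additive_subgroup assms by blast
  have 1: "digit_sums W y (Suc m) \<subseteq> G"
  proof
    fix x assume "x \<in> digit_sums W y (Suc m)"
    then obtain w z where wz: "w \<in> W" "z \<in> digit_sums W y m" "x = w \<oplus> y \<otimes> z" by auto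
    then have "y \<otimes> z \<in> G" using Suc assms(4) unfolding dilate_def by blast
    moreover have "w \<in> G" using wz W by blast
    ultimately show "x \<in> G" using wz(3) additive_subgroup.a_closed[OF assms(1)] by blast
  qed
  have inj: "inj_on (\<lambda>(w, z). w \<oplus> y \<otimes> z) (W \<times> digit_sums W y m)"
  proof (rule inj_onI, clarify)
    fix w z w' z' assume A: "w \<in> W" "z \<in> digit_sums W y m" "w' \<in> W" "z' \<in> digit_sums W y m"
      "w \<oplus> y \<otimes> z = w' \<oplus> y \<otimes> z'"
    then have C: "w \<in> carrier R" "w' \<in> carrier R" "z \<in> carrier R" "z' \<in> carrier R"
      using W Gc Suc by auto
    have yz: "y \<otimes> z \<in> carrier R" "y \<otimes> z' \<in> carrier R" using C assms(2) by auto
    have "w \<ominus> w' = (w \<oplus> y \<otimes> z) \<ominus> y \<otimes> z \<ominus> w'" using C yz minus_minus_cancel(4) by simp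
    also have "\<dots> = (y \<otimes> z' \<oplus> w') \<ominus> y \<otimes> z \<ominus> w'" using A(5) C yz a_comm by simp
    also have "\<dots> = y \<otimes> z' \<ominus> y \<otimes> z" using C yz minus_minus_cancel(7) by simp
    finally have ww: "w \<ominus> w' = y \<otimes> z' \<ominus> y \<otimes> z" .
    have "y \<otimes> z \<in> dilate y G" "y \<otimes> z' \<in> dilate y G" using A Suc unfolding dilate_def by blast+
    then have "w \<ominus> w' \<in> dilate y G" unfolding ww using additive_subgroup_minus[OF yG] by blast
    then have "dilate y G +> w = dilate y G +> w'" using coset_eq_iff[OF yG] C by blast
    then have w: "w = w'" using inj_onD[OF W(2) _ A(1,3)] by simp
    then have "y \<otimes> z = y \<otimes> z'" using A(5) C assms(2) by simp
    then show "w = w' \<and> z = z'" using w m_lcancel assms C by blast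
  qed
  have "card (digit_sums W y (Suc m)) = card W ^ Suc m" "finite (digit_sums W y (Suc m))"
    using Suc W(3) by (simp_all add: card_image[OF inj] card_cartesian_product)
  then show ?case using 1 by blast
qed

end

context field begin

text \<open>The m-digit sums give card W ^ m elements of \<open>H\<close>. Multiplication by c0 c^m
  moves them into level e0 + m d: the digits cost c0 and e0 once, each factor y costs c and d.
  Letting m grow leaves card W <= C ^ d. The essential point is that d comes from y alone, so one
  bound serves every \<open>H\<close>; later \<open>H\<close> is an intersection of arbitrarily many
  valuation rings.\<close>

lemma index_bound:
  assumes G: "growth R B C" and y: "y \<in> carrier R" "y \<noteq> \<zero>"
  obtains N where "\<And>H. additive_subgroup H R \<Longrightarrow> dilate y H \<subseteq> H \<Longrightarrow>
      finite (cosets H (dilate y H)) \<and> card (cosets H (dilate y H)) \<le> N"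
proof -
  note G' = G[unfolded growth_def]
  have B: "finite (B e)" "B e \<subseteq> carrier R" "card (B e) \<le> C ^ Suc e" "\<zero> \<in> B e" for e using G' by auto
  have B1: "\<one> \<in> B 0" using G' by auto
  have Bmul: "\<exists>c\<in>carrier R - {\<zero>}. \<exists>d. \<forall>y\<in>Y. \<forall>m. \<forall>b\<in>B m. (c \<otimes> y) \<otimes> b \<in> B (m + d)"
    if "finite Y" "Y \<subseteq> carrier R" for Y using G' that by presburger
  have Badd: "a \<oplus> b \<in> B e" if "a \<in> B e" "b \<in> B e" for a b e using G' that by auto
  \<comment> \<open>One denominator is chosen for y and 1 together, because digits of low order
    receive the surplus powers of c without an accompanying factor y.\<close>
  have "\<exists>c\<in>carrier R - {\<zero>}. \<exists>d. \<forall>y\<in>{y, \<one>}. \<forall>m. \<forall>b\<in>B m. (c \<otimes> y) \<otimes> b \<in> B (m + d)"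
    using Bmul[of "{y, \<one>}"] y by simp
  then obtain c d where c: "c \<in> carrier R" "c \<noteq> \<zero>"
    and c0y: "\<forall>y\<in>{y, \<one>}. \<forall>m. \<forall>b\<in>B m. (c \<otimes> y) \<otimes> b \<in> B (m + d)" by auto
  have cy: "\<And>m b. b \<in> B m \<Longrightarrow> (c \<otimes> y) \<otimes> b \<in> B (m + d)"
    and c1: "\<And>m b. b \<in> B m \<Longrightarrow> c \<otimes> b \<in> B (m + d)" using c0y c by auto
  have main: "card W \<le> C ^ d" if H: "additive_subgroup H R" "dilate y H \<subseteq> H"
    and W: "finite W" "W \<subseteq> H" "inj_on (\<lambda>a. dilate y H +> a) W" for H W
  proof -
    have Hc: "H \<subseteq> carrier R" using H additive_subgroup.a_subset by blast
    have "\<exists>c\<in>carrier R - {\<zero>}. \<exists>d. \<forall>y\<in>W. \<forall>m. \<forall>b\<in>B m. (c \<otimes> y) \<otimes> b \<in> B (m + d)"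
      using Bmul[OF W(1)] W Hc by simp
    then obtain c0 e0 where c0: "c0 \<in> carrier R" "c0 \<noteq> \<zero>"
      and c0W: "\<And>w m b. w \<in> W \<Longrightarrow> b \<in> B m \<Longrightarrow> (c0 \<otimes> w) \<otimes> b \<in> B (m + e0)" by blast
    have c0w: "c0 \<otimes> w \<in> B e0" if "w \<in> W" for w
      using c0W[OF that, of "\<one>" 0] B1 that W Hc c0 by auto
    have pw: "c [^] m \<otimes> b \<in> B (e + m * d)" if "b \<in> B e" for m :: nat and b e
    proof (induction m)
      case 0 then show ?case using that B(2)[of e] by auto
    next
      case (Suc m)
      have "c [^] Suc m \<otimes> b = c \<otimes> (c [^] m \<otimes> b)" using c that B(2)[of e] by (simp add: m_ac subsetD)
      then show ?case using c1[OF Suc] by (simp add: algebra_simps)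
    qed
    have in_B: "(c0 \<otimes> c [^] m) \<otimes> z \<in> B (e0 + m * d)" if "z \<in> digit_sums W y m" for z and m :: nat
      using that
    proof (induction m arbitrary: z)
      case 0 then show ?case using B c0 by simp
    next
      case (Suc m)
      obtain w u where wu: "w \<in> W" "u \<in> digit_sums W y m" "z = w \<oplus> y \<otimes> u" using Suc.prems by auto
      have cc: "w \<in> carrier R" "u \<in> carrier R"
        using wu W Hc digit_sums_card[OF H(1) y H(2) W(2,3,1)] by blast+
      have "(c0 \<otimes> c [^] Suc m) \<otimes> z = c [^] Suc m \<otimes> (c0 \<otimes> w) \<oplus> (c \<otimes> y) \<otimes> ((c0 \<otimes> c [^] m) \<otimes> u)"
        using cc c c0 y wu(3) by (simp add: r_distr m_ac)
      moreover have "c [^] Suc m \<otimes> (c0 \<otimes> w) \<in> B (e0 + Suc m * d)" using pw c0w wu by blast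
      moreover have "(c \<otimes> y) \<otimes> ((c0 \<otimes> c [^] m) \<otimes> u) \<in> B (e0 + Suc m * d)"
        using cy[OF Suc.IH[OF wu(2)]] by (simp add: algebra_simps)
      ultimately show ?case using Badd by simp
    qed
    have "card W ^ m \<le> C ^ Suc e0 * (C ^ d) ^ m" for m :: nat
    proof -
      have D: "digit_sums W y m \<subseteq> H" "card (digit_sums W y m) = card W ^ m" "finite (digit_sums W y m)"
        using digit_sums_card[OF H(1) y H(2) W(2,3,1)] by auto
      have nz: "c0 \<otimes> c [^] m \<noteq> \<zero>" "c0 \<otimes> c [^] m \<in> carrier R"
        using c c0 pow_nonzero[OF c] by (auto simp: integral_iff)
      have "inj_on (\<lambda>z. (c0 \<otimes> c [^] m) \<otimes> z) (digit_sums W y m)"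
      proof (rule inj_onI)
        fix z z' assume A: "z \<in> digit_sums W y m" "z' \<in> digit_sums W y m" "(c0 \<otimes> c [^] m) \<otimes> z = (c0 \<otimes> c [^] m) \<otimes> z'"
        then have "z \<in> carrier R" "z' \<in> carrier R" using D(1) Hc by auto
        then show "z = z'" using A(3) nz m_lcancel by blast
      qed
      moreover have "(\<lambda>z. (c0 \<otimes> c [^] m) \<otimes> z) ` digit_sums W y m \<subseteq> B (e0 + m * d)" using in_B by blast
      ultimately have "card (digit_sums W y m) \<le> card (B (e0 + m * d))" using B(1) card_inj_on_le by metis
      also have "\<dots> \<le> C ^ Suc (e0 + m * d)" by (rule B(3))
      also have "\<dots> = C ^ Suc e0 * (C ^ d) ^ m" by (simp add: power_add power_mult mult.commute)
      finally show ?thesis using D by simp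
    qed
    then show ?thesis by (rule power_bound_imp_le)
  qed
  show ?thesis
  proof (rule that)
    fix H assume H: "additive_subgroup H R" "dilate y H \<subseteq> H"
    have yH: "additive_subgroup (dilate y H) R" using dilate_additive_subgroup H y by blast
    have Hc: "H \<subseteq> carrier R" using H additive_subgroup.a_subset by blast
    have "card Z \<le> C ^ d" if Z: "finite Z" "Z \<subseteq> cosets H (dilate y H)" for Z
    proof -
      obtain W where W: "W \<subseteq> H" "inj_on (\<lambda>a. dilate y H +> a) W" "(\<lambda>a. dilate y H +> a) ` W = Z"
        using cosets_incongruent[OF yH Hc Z(2)] .
      then have "card W \<le> C ^ d" using main[OF H _ W(1,2)] Z finite_imageD by metis
      then show ?thesis using W card_image by metis
    qed
    then show "finite (cosets H (dilate y H)) \<and> card (cosets H (dilate y H)) \<le> C ^ d"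
      by (intro finite_if_finite_subsets_card_bdd) blast
  qed
qed

end

section \<open>Extension of ideals to valuation rings\<close>

text \<open>Values at z of polynomials of degree at most n with coefficients in \<open>S\<close>, in
  Horner form. For an ideal \<open>I\<close> of a ring \<open>A\<close> the union over n is the
  extension of \<open>I\<close> to A[z].\<close>

fun (in ring) pols :: "'a set \<Rightarrow> 'a \<Rightarrow> nat \<Rightarrow> 'a set" where
  "pols S z 0 = S"
| "pols S z (Suc n) = {a \<oplus> z \<otimes> b |a b. a \<in> S \<and> b \<in> pols S z n}"

context ring begin

lemma additive_subgroupI':
  assumes "S \<subseteq> carrier R" "\<zero> \<in> S" "\<And>a b. a \<in> S \<Longrightarrow> b \<in> S \<Longrightarrow> a \<oplus> b \<in> S" "\<And>a. a \<in> S \<Longrightarrow> \<ominus> a \<in> S"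
  shows "additive_subgroup S R"
  using assms by (intro additive_subgroupI add.subgroupI) auto

lemma subring_additive_subgroup:
  assumes "subring V R" shows "additive_subgroup V R"
  using subringE[OF assms] by (intro additive_subgroupI') auto

end

context domain begin

lemma pols_additive_subgroup:
  assumes S: "additive_subgroup S R" and z: "z \<in> carrier R"
  shows "additive_subgroup (pols S z n) R"
proof (induction n)
  case 0 then show ?case using S by simp
next
  case (Suc n)
  note Sc = additive_subgroup.a_subset[OF S] and Pc = additive_subgroup.a_subset[OF Suc]
  show ?case
  proof (rule additive_subgroupI')
    show "pols S z (Suc n) \<subseteq> carrier R" using Sc Pc z by auto
    have "\<zero> = \<zero> \<oplus> z \<otimes> \<zero>" using z by simp
    then show "\<zero> \<in> pols S z (Suc n)"
      using additive_subgroup.zero_closed[OF S] additive_subgroup.zero_closed[OF Suc] by (auto intro!: exI)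
    show "x \<oplus> y \<in> pols S z (Suc n)" if xy: "x \<in> pols S z (Suc n)" "y \<in> pols S z (Suc n)" for x y
    proof -
      obtain a b a' b' where e: "a \<in> S" "b \<in> pols S z n" "x = a \<oplus> z \<otimes> b"
        "a' \<in> S" "b' \<in> pols S z n" "y = a' \<oplus> z \<otimes> b'" using xy by auto
      have "a \<in> carrier R" "a' \<in> carrier R" "b \<in> carrier R" "b' \<in> carrier R" using e Sc Pc by auto
      then have "x \<oplus> y = (a \<oplus> a') \<oplus> z \<otimes> (b \<oplus> b')" using e(3,6) z by (simp add: r_distr a_ac)
      moreover have "a \<oplus> a' \<in> S" "b \<oplus> b' \<in> pols S z n"
        using additive_subgroup.a_closed[OF S e(1,4)] additive_subgroup.a_closed[OF Suc e(2,5)] by auto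
      ultimately show ?thesis by auto
    qed
    show "\<ominus> x \<in> pols S z (Suc n)" if xy: "x \<in> pols S z (Suc n)" for x
    proof -
      obtain a b where e: "a \<in> S" "b \<in> pols S z n" "x = a \<oplus> z \<otimes> b" using xy by auto
      have "a \<in> carrier R" "b \<in> carrier R" using e Sc Pc by auto
      then have "\<ominus> x = (\<ominus> a) \<oplus> z \<otimes> (\<ominus> b)" using e(3) z by (simp add: r_minus minus_add)
      moreover have "\<ominus> a \<in> S" "\<ominus> b \<in> pols S z n"
        using additive_subgroup.a_inv_closed[OF S e(1)] additive_subgroup.a_inv_closed[OF Suc e(2)] by auto
      ultimately show ?thesis by auto
    qed
  qed
qed

lemma pols_in_carrier:
  assumes "additive_subgroup S R" "z \<in> carrier R" shows "pols S z n \<subseteq> carrier R"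
  using pols_additive_subgroup[OF assms] by (rule additive_subgroup.a_subset)

lemma pols_Suc:
  assumes S: "additive_subgroup S R" and z: "z \<in> carrier R"
  shows "pols S z n \<subseteq> pols S z (Suc n)"
proof (induction n)
  case 0
  show ?case
  proof
    fix a assume a: "a \<in> pols S z 0"
    then have "a \<in> carrier R" using additive_subgroup.a_subset[OF S] by auto
    then have "a = a \<oplus> z \<otimes> \<zero>" using z by simp
    then show "a \<in> pols S z (Suc 0)" using a additive_subgroup.zero_closed[OF S] by auto
  qed
next
  case (Suc n) then show ?case by auto
qed

lemma pols_mono:
  assumes S: "additive_subgroup S R" and z: "z \<in> carrier R" and "m \<le> n"
  shows "pols S z m \<subseteq> pols S z n"
  using lift_Suc_mono_le[of "pols S z", OF pols_Suc[OF S z] \<open>m \<le> n\<close>] .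

lemma pols_base:
  assumes S: "additive_subgroup S R" and z: "z \<in> carrier R" shows "S \<subseteq> pols S z n"
  using pols_mono[OF S z, of 0 n] by simp

lemma pols_shift:
  assumes S: "additive_subgroup S R" and z: "z \<in> carrier R" and "b \<in> pols S z n"
  shows "z \<otimes> b \<in> pols S z (Suc n)"
proof -
  have "z \<otimes> b = \<zero> \<oplus> z \<otimes> b" using pols_in_carrier[OF S z, of n] assms by auto
  then show ?thesis using assms additive_subgroup.zero_closed[OF S] by auto
qed

lemma pols_shift_pow:
  assumes S: "additive_subgroup S R" and z: "z \<in> carrier R" and "b \<in> pols S z n"
  shows "z [^] (m::nat) \<otimes> b \<in> pols S z (m + n)"
proof (induction m)
  case 0 then show ?case using pols_in_carrier[OF S z, of n] assms by auto
next
  case (Suc m)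
  have "b \<in> carrier R" using pols_in_carrier[OF S z, of n] assms by auto
  then have "z [^] Suc m \<otimes> b = z \<otimes> (z [^] m \<otimes> b)" using z by (simp add: m_ac)
  then show ?case using pols_shift[OF S z Suc] by simp
qed

lemma pols_smult:
  assumes S: "additive_subgroup S R" and z: "z \<in> carrier R" and c: "c \<in> carrier R"
    and cS: "\<And>s. s \<in> S \<Longrightarrow> c \<otimes> s \<in> T" and "b \<in> pols S z n"
  shows "c \<otimes> b \<in> pols T z n"
  using assms(5)
proof (induction n arbitrary: b)
  case 0 then show ?case using cS by simp
next
  case (Suc n)
  then obtain a b' where e: "a \<in> S" "b' \<in> pols S z n" "b = a \<oplus> z \<otimes> b'" by auto
  have "a \<in> carrier R" "b' \<in> carrier R"
    using e additive_subgroup.a_subset[OF S] pols_in_carrier[OF S z, of n] by auto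
  then have "c \<otimes> b = c \<otimes> a \<oplus> z \<otimes> (c \<otimes> b')" using e(3) z c by (simp add: r_distr m_ac)
  then show ?case using Suc.IH[OF e(2)] cS[OF e(1)] by auto
qed

lemma pols_mult:
  assumes S: "additive_subgroup S R" and T: "additive_subgroup T R" and z: "z \<in> carrier R"
    and ST: "\<And>s t. s \<in> S \<Longrightarrow> t \<in> T \<Longrightarrow> s \<otimes> t \<in> T" and "a \<in> pols S z m" "b \<in> pols T z n"
  shows "a \<otimes> b \<in> pols T z (m + n)"
  using assms(5)
proof (induction m arbitrary: a)
  note Sc = additive_subgroup.a_subset[OF S]
  case 0
  then show ?case using pols_smult[OF T z _ ST assms(6)] Sc by auto
next
  note Sc = additive_subgroup.a_subset[OF S]
  case (Suc m)
  then obtain s a' where e: "s \<in> S" "a' \<in> pols S z m" "a = s \<oplus> z \<otimes> a'" by auto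
  have c: "s \<in> carrier R" "a' \<in> carrier R" "b \<in> carrier R"
    using e Sc pols_in_carrier[OF S z, of m] pols_in_carrier[OF T z, of n] assms(6) by auto
  have "s \<otimes> b \<in> pols T z n" using pols_smult[OF T z c(1) ST[OF e(1)] assms(6)] .
  then have "s \<otimes> b \<in> pols T z (Suc m + n)" using pols_mono[OF T z, of n "Suc m + n"] by auto
  moreover have "z \<otimes> (a' \<otimes> b) \<in> pols T z (Suc m + n)" using pols_shift[OF T z Suc.IH[OF e(2)]] by simp
  moreover have "a \<otimes> b = s \<otimes> b \<oplus> z \<otimes> (a' \<otimes> b)" using e(3) c z by (simp add: l_distr m_assoc)
  ultimately show ?case using additive_subgroup.a_closed[OF pols_additive_subgroup[OF T z], of "s \<otimes> b" "Suc m + n"] by metis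
qed

text \<open>The Horner form exposes the constant term; this splits off the leading term instead,
  which is what a relation of integrality or an elimination acts on.\<close>

lemma pols_top:
  assumes S: "additive_subgroup S R" and z: "z \<in> carrier R" and "b \<in> pols S z (Suc n)"
  shows "\<exists>s\<in>pols S z n. \<exists>a\<in>S. b = s \<oplus> a \<otimes> z [^] Suc n"
  using assms(3)
proof (induction n arbitrary: b)
  case 0
  then obtain a b' where e: "a \<in> S" "b' \<in> S" "b = a \<oplus> z \<otimes> b'" by auto
  have "b' \<in> carrier R" using e additive_subgroup.a_subset[OF S] by auto
  then have "b = a \<oplus> b' \<otimes> z [^] Suc 0" using e(3) z by (simp add: m_comm)
  then show ?case using e by auto
next
  case (Suc n)
  then obtain a b' where e: "a \<in> S" "b' \<in> pols S z (Suc n)" "b = a \<oplus> z \<otimes> b'" by auto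
  obtain s c where s: "s \<in> pols S z n" "c \<in> S" "b' = s \<oplus> c \<otimes> z [^] Suc n" using Suc.IH[OF e(2)] by blast
  have c: "a \<in> carrier R" "s \<in> carrier R" "c \<in> carrier R"
    using e s additive_subgroup.a_subset[OF S] pols_in_carrier[OF S z, of n] by auto
  have "b = (a \<oplus> z \<otimes> s) \<oplus> c \<otimes> z [^] Suc (Suc n)"
    using e(3) s(3) c z by (simp add: r_distr m_ac a_ac)
  moreover have "a \<oplus> z \<otimes> s \<in> pols S z (Suc n)" using e s by auto
  ultimately show ?case using s(2) by blast
qed

end

context field begin

lemma inv_mem: "x \<in> carrier R \<Longrightarrow> x \<noteq> \<zero> \<Longrightarrow> inv x \<in> carrier R"
  and inv_nz: "x \<in> carrier R \<Longrightarrow> x \<noteq> \<zero> \<Longrightarrow> inv x \<noteq> \<zero>"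
  and inv_l: "x \<in> carrier R \<Longrightarrow> x \<noteq> \<zero> \<Longrightarrow> inv x \<otimes> x = \<one>"
  and inv_r: "x \<in> carrier R \<Longrightarrow> x \<noteq> \<zero> \<Longrightarrow> x \<otimes> inv x = \<one>"
  and inv_i: "x \<in> carrier R \<Longrightarrow> x \<noteq> \<zero> \<Longrightarrow> inv (inv x) = x"
  using field_Units by (auto simp: Units_l_inv Units_r_inv)

lemma inv_m:
  assumes "x \<in> carrier R" "x \<noteq> \<zero>" "y \<in> carrier R" "y \<noteq> \<zero>"
  shows "inv (x \<otimes> y) = inv x \<otimes> inv y"
proof -
  have "(inv x \<otimes> inv y) \<otimes> (x \<otimes> y) = (inv x \<otimes> x) \<otimes> (inv y \<otimes> y)"
    using assms inv_mem[of x] inv_mem[of y] by (simp add: m_ac)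
  then have "(inv x \<otimes> inv y) \<otimes> (x \<otimes> y) = \<one>" using assms by (simp add: inv_l)
  then show ?thesis using assms inv_mem inv_unique'[of "x \<otimes> y" "inv x \<otimes> inv y"] by (simp add: m_comm)
qed

text \<open>Clearing the denominator z^n turns a polynomial in 1/z into the polynomial in z with
  reversed coefficients.\<close>

lemma pols_reverse:
  assumes S: "additive_subgroup S R" and z: "z \<in> carrier R" "z \<noteq> \<zero>"
    and "b \<in> pols S (inv z) m" "m \<le> n"
  shows "z [^] n \<otimes> b \<in> pols S z n"
  using assms(4,5)
proof (induction m arbitrary: b n)
  case 0
  then show ?case using pols_shift_pow[OF S z(1), of b 0 n] by simp
next
  case (Suc m)
  obtain n' where n: "n = Suc n'" using Suc.prems by (cases n) auto
  obtain a b' where e: "a \<in> S" "b' \<in> pols S (inv z) m" "b = a \<oplus> inv z \<otimes> b'" using Suc.prems by auto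
  note iz = inv_mem[OF z]
  have c: "a \<in> carrier R" "b' \<in> carrier R"
    using e additive_subgroup.a_subset[OF S] pols_in_carrier[OF S iz, of m] by auto
  have "z [^] n \<otimes> b = z [^] n \<otimes> a \<oplus> (z [^] n' \<otimes> b') \<otimes> (z \<otimes> inv z)"
    using e(3) c z iz unfolding n by (simp add: r_distr m_ac)
  also have "\<dots> = z [^] n \<otimes> a \<oplus> z [^] n' \<otimes> b'" using c z by (simp add: inv_r)
  finally have "z [^] n \<otimes> b = z [^] n \<otimes> a \<oplus> z [^] n' \<otimes> b'" .
  moreover have "z [^] n' \<otimes> b' \<in> pols S z n" using Suc.IH[OF e(2), of n'] Suc.prems pols_Suc[OF S z(1), of n'] unfolding n by auto
  moreover have "z [^] n \<otimes> a \<in> pols S z n" using pols_shift_pow[OF S z(1), of a 0 n] e by simp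
  ultimately show ?case using additive_subgroup.a_closed[OF pols_additive_subgroup[OF S z(1)]] by simp
qed

text \<open>A subring together with a proper ideal of it: the objects that are ordered by inclusion
  in Chevalley's extension theorem.\<close>

definition ring_ideal_pair :: "'a set \<Rightarrow> 'a set \<Rightarrow> bool" where
  "ring_ideal_pair A I \<longleftrightarrow> subring A R \<and> additive_subgroup I R \<and> I \<subseteq> A \<and>
     (\<forall>a\<in>A. \<forall>i\<in>I. a \<otimes> i \<in> I) \<and> \<one> \<notin> I"

text \<open>Let 1 be a polynomial of degree n + 1 in z and one of degree m <= n + 1 in 1/z, both
  over \<open>I\<close>. The second relation reads r = 1 - b0 = b'/z. Multiplying the first by r
  replaces its leading term a z^(n+1) by a z^n b', which has degree at most n, so the relation
  becomes shorter.\<close>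

lemma pols_pair_elimination:
  assumes P: "ring_ideal_pair A I" and z: "z \<in> carrier R" "z \<noteq> \<zero>"
    and n: "\<one> \<in> pols I z (Suc n)" and m: "\<one> \<in> pols I (inv z) m" "m \<le> Suc n"
  shows "\<one> \<in> pols I z n"
proof -
  have A: "subring A R" and I: "additive_subgroup I R" "I \<subseteq> A" and AI: "\<And>a i. a \<in> A \<Longrightarrow> i \<in> I \<Longrightarrow> a \<otimes> i \<in> I"
    and 1: "\<one> \<notin> I" using P unfolding ring_ideal_pair_def by auto
  note As = subringE[OF A] and Ic = additive_subgroup.a_subset[OF I(1)]
  have iz: "inv z \<in> carrier R" using inv_mem z by blast
  obtain m' where m': "m = Suc m'" using m 1 by (cases m) auto
  obtain b0 b' where b: "b0 \<in> I" "b' \<in> pols I (inv z) m'" "\<one> = b0 \<oplus> inv z \<otimes> b'" using m m' by auto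
  obtain s a where s: "s \<in> pols I z n" "a \<in> I" "\<one> = s \<oplus> a \<otimes> z [^] Suc n"
    using pols_top[OF I(1) z(1) n] by blast
  have c: "b0 \<in> carrier R" "b' \<in> carrier R" "s \<in> carrier R" "a \<in> carrier R"
    using b s Ic pols_in_carrier[OF I(1) iz, of m'] pols_in_carrier[OF I(1) z(1), of n] by auto
  define r where "r = inv z \<otimes> b'"
  have r: "r \<in> carrier R" using c iz r_def by auto
  have rb: "r = \<one> \<ominus> b0" using b(3) r c unfolding r_def[symmetric]
    using minus_minus_cancel(4)[of r b0 b0] by (simp add: a_comm)
  have "\<one> = b0 \<oplus> r \<otimes> \<one>" using b(3) unfolding r_def[symmetric] r_one[OF r] .
  also have "\<dots> = b0 \<oplus> r \<otimes> (s \<oplus> a \<otimes> z [^] Suc n)" by (subst s(3)) (rule refl)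
  also have "\<dots> = b0 \<oplus> (r \<otimes> s \<oplus> a \<otimes> (z [^] n \<otimes> b' \<otimes> (z \<otimes> inv z)))"
    using c r z iz unfolding r_def by (simp add: r_distr m_ac)
  also have "\<dots> = b0 \<oplus> (r \<otimes> s \<oplus> a \<otimes> (z [^] n \<otimes> b'))" using z c by (simp add: inv_r)
  finally have eq: "\<one> = b0 \<oplus> (r \<otimes> s \<oplus> a \<otimes> (z [^] n \<otimes> b'))" .
  have "r \<in> A" unfolding rb a_minus_def using As b(1) I(2) by auto
  then have 1: "r \<otimes> s \<in> pols I z n" using pols_smult[OF I(1) z(1) r AI s(1)] by blast
  have "z [^] n \<otimes> b' \<in> pols I z n" using pols_reverse[OF I(1) z b(2), of n] m(2) m' by simp
  then have 2: "a \<otimes> (z [^] n \<otimes> b') \<in> pols I z n"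
    using pols_smult[OF I(1) z(1) c(4) AI] s(2) I(2) by blast
  have 3: "b0 \<in> pols I z n" using pols_base[OF I(1) z(1)] b(1) by blast
  note add = additive_subgroup.a_closed[OF pols_additive_subgroup[OF I(1) z(1), of n]]
  show ?thesis using add[OF 3 add[OF 1 2]] eq by simp
qed

lemma pols_pair:
  assumes P: "ring_ideal_pair A I" and z: "z \<in> carrier R" and 1: "\<And>n. \<one> \<notin> pols I z n"
  shows "ring_ideal_pair (\<Union>n. pols A z n) (\<Union>n. pols I z n)"
proof -
  have A: "subring A R" and I: "additive_subgroup I R" "I \<subseteq> A" and AI: "\<And>a i. a \<in> A \<Longrightarrow> i \<in> I \<Longrightarrow> a \<otimes> i \<in> I"
    using P unfolding ring_ideal_pair_def by auto
  note As = subringE[OF A] and A' = subring_additive_subgroup[OF A]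
  have add: "x \<oplus> y \<in> (\<Union>n. pols S z n)" if S: "additive_subgroup S R" "x \<in> (\<Union>n. pols S z n)" "y \<in> (\<Union>n. pols S z n)" for S x y
  proof -
    obtain m n where "x \<in> pols S z m" "y \<in> pols S z n" using S by auto
    then have "x \<in> pols S z (max m n)" "y \<in> pols S z (max m n)"
      using pols_mono[OF S(1) z, of m "max m n"] pols_mono[OF S(1) z, of n "max m n"] by auto
    then show ?thesis using additive_subgroup.a_closed[OF pols_additive_subgroup[OF S(1) z]] by blast
  qed
  have sub: "additive_subgroup (\<Union>n. pols S z n) R" if S: "additive_subgroup S R" for S
  proof (rule additive_subgroupI')
    show "(\<Union>n. pols S z n) \<subseteq> carrier R" using pols_in_carrier[OF S z] by auto
    show "\<zero> \<in> (\<Union>n. pols S z n)" using additive_subgroup.zero_closed[OF pols_additive_subgroup[OF S z]] by blast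
    show "x \<oplus> y \<in> (\<Union>n. pols S z n)" if "x \<in> (\<Union>n. pols S z n)" "y \<in> (\<Union>n. pols S z n)" for x y
      using add[OF S that] .
    show "\<ominus> x \<in> (\<Union>n. pols S z n)" if "x \<in> (\<Union>n. pols S z n)" for x
      using that additive_subgroup.a_inv_closed[OF pols_additive_subgroup[OF S z]] by blast
  qed
  have mono: "pols I z n \<subseteq> pols A z n" for n
    using I(2) by (induction n) auto
  have "subring (\<Union>n. pols A z n) R"
  proof (rule subringI)
    show "(\<Union>n. pols A z n) \<subseteq> carrier R" using pols_in_carrier[OF A' z] by auto
    show "\<one> \<in> (\<Union>n. pols A z n)" using As(3) pols_base[OF A' z, of 0] by blast
    show "\<ominus> x \<in> (\<Union>n. pols A z n)" if "x \<in> (\<Union>n. pols A z n)" for x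
      using that additive_subgroup.a_inv_closed[OF pols_additive_subgroup[OF A' z]] by blast
    show "x \<oplus> y \<in> (\<Union>n. pols A z n)" if "x \<in> (\<Union>n. pols A z n)" "y \<in> (\<Union>n. pols A z n)" for x y
      using add[OF A' that] .
    show "x \<otimes> y \<in> (\<Union>n. pols A z n)" if "x \<in> (\<Union>n. pols A z n)" "y \<in> (\<Union>n. pols A z n)" for x y
      using that pols_mult[OF A' A' z As(6)] by blast
  qed
  moreover have "\<forall>a\<in>(\<Union>n. pols A z n). \<forall>i\<in>(\<Union>n. pols I z n). a \<otimes> i \<in> (\<Union>n. pols I z n)"
    using pols_mult[OF A' I(1) z AI] by blast
  ultimately show ?thesis unfolding ring_ideal_pair_def using sub[OF I(1)] mono 1 by blast
qed

text \<open>A maximal pair exists by Zorn's lemma. If neither z nor 1/z were in \<open>V\<close>,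
  maximality would put 1 into both I[z] and I[1/z]. Take both relations of least degree; the
  elimination then shortens the longer one.\<close>

lemma chevalley_extension:
  assumes P0: "ring_ideal_pair A0 I0"
  obtains V I where "A0 \<subseteq> V" "I0 \<subseteq> I" "ring_ideal_pair V I"
    "\<And>z. z \<in> carrier R \<Longrightarrow> z \<noteq> \<zero> \<Longrightarrow> z \<in> V \<or> inv z \<in> V"
proof -
  let ?fst = "\<lambda>Z. {a. (True, a) \<in> Z}" and ?snd = "\<lambda>Z. {a. (False, a) \<in> Z}"
  \<comment> \<open>A pair is coded as a single set of tagged elements, so that plain inclusion
    orders both components at once.\<close>
  define \<A> where "\<A> = {Z :: (bool \<times> 'a) set. ring_ideal_pair (?fst Z) (?snd Z) \<and> A0 \<subseteq> ?fst Z \<and> I0 \<subseteq> ?snd Z}"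
  have "\<exists>M\<in>\<A>. \<forall>Z\<in>\<A>. M \<subseteq> Z \<longrightarrow> Z = M"
  proof (rule subset_Zorn_nonempty)
    have "{True} \<times> A0 \<union> {False} \<times> I0 \<in> \<A>" using P0 unfolding \<A>_def by simp
    then show "\<A> \<noteq> {}" by blast
    fix \<C> assume ne: "\<C> \<noteq> {}" and ch: "subset.chain \<A> \<C>"
    have cA: "\<C> \<subseteq> \<A>" and tot: "\<And>Z Z'. Z \<in> \<C> \<Longrightarrow> Z' \<in> \<C> \<Longrightarrow> Z \<subseteq> Z' \<or> Z' \<subseteq> Z"
      using ch unfolding subset_chain_def by auto
    have ex2: "\<exists>Z\<in>\<C>. p \<in> Z \<and> q \<in> Z" if pq: "p \<in> \<Union>\<C>" "q \<in> \<Union>\<C>" for p q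
    proof -
      obtain Z Z' where Z: "Z \<in> \<C>" "p \<in> Z" "Z' \<in> \<C>" "q \<in> Z'" using pq by blast
      then show ?thesis using tot[OF Z(1,3)] by blast
    qed
    have pr: "subring (?fst Z) R" "additive_subgroup (?snd Z) R" "?snd Z \<subseteq> ?fst Z"
      "\<And>a i. a \<in> ?fst Z \<Longrightarrow> i \<in> ?snd Z \<Longrightarrow> a \<otimes> i \<in> ?snd Z" "\<one> \<notin> ?snd Z" "A0 \<subseteq> ?fst Z" "I0 \<subseteq> ?snd Z"
      if "Z \<in> \<C>" for Z
      using that cA unfolding \<A>_def ring_ideal_pair_def by auto
    obtain Z0 where Z0: "Z0 \<in> \<C>" using ne by blast
    have s: "subring (?fst (\<Union>\<C>)) R"
    proof (rule subringI)
      show "?fst (\<Union>\<C>) \<subseteq> carrier R" using subringE(1)[OF pr(1)] by blast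
      show "\<one> \<in> ?fst (\<Union>\<C>)" using subringE(3)[OF pr(1)[OF Z0]] Z0 by blast
      show "\<ominus> h \<in> ?fst (\<Union>\<C>)" if "h \<in> ?fst (\<Union>\<C>)" for h using that subringE(5)[OF pr(1)] by blast
      show "h \<otimes> h' \<in> ?fst (\<Union>\<C>)" if hh: "h \<in> ?fst (\<Union>\<C>)" "h' \<in> ?fst (\<Union>\<C>)" for h h'
      proof -
        obtain Z where "Z \<in> \<C>" "h \<in> ?fst Z" "h' \<in> ?fst Z" using ex2[of "(True,h)" "(True,h')"] hh by blast
        then show ?thesis using subringE(6)[OF pr(1), of Z h h'] by blast
      qed
      show "h \<oplus> h' \<in> ?fst (\<Union>\<C>)" if hh: "h \<in> ?fst (\<Union>\<C>)" "h' \<in> ?fst (\<Union>\<C>)" for h h'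
      proof -
        obtain Z where "Z \<in> \<C>" "h \<in> ?fst Z" "h' \<in> ?fst Z" using ex2[of "(True,h)" "(True,h')"] hh by blast
        then show ?thesis using subringE(7)[OF pr(1), of Z h h'] by blast
      qed
    qed
    have i: "additive_subgroup (?snd (\<Union>\<C>)) R"
    proof (rule additive_subgroupI')
      show "?snd (\<Union>\<C>) \<subseteq> carrier R" using additive_subgroup.a_subset[OF pr(2)] by blast
      show "\<zero> \<in> ?snd (\<Union>\<C>)" using additive_subgroup.zero_closed[OF pr(2)[OF Z0]] Z0 by blast
      show "\<ominus> h \<in> ?snd (\<Union>\<C>)" if "h \<in> ?snd (\<Union>\<C>)" for h using that additive_subgroup.a_inv_closed[OF pr(2)] by blast
      show "h \<oplus> h' \<in> ?snd (\<Union>\<C>)" if hh: "h \<in> ?snd (\<Union>\<C>)" "h' \<in> ?snd (\<Union>\<C>)" for h h'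
      proof -
        obtain Z where "Z \<in> \<C>" "h \<in> ?snd Z" "h' \<in> ?snd Z" using ex2[of "(False,h)" "(False,h')"] hh by blast
        then show ?thesis using additive_subgroup.a_closed[OF pr(2), of Z h h'] by blast
      qed
    qed
    have m: "a \<otimes> j \<in> ?snd (\<Union>\<C>)" if aj: "a \<in> ?fst (\<Union>\<C>)" "j \<in> ?snd (\<Union>\<C>)" for a j
    proof -
      obtain Z where "Z \<in> \<C>" "a \<in> ?fst Z" "j \<in> ?snd Z" using ex2[of "(True,a)" "(False,j)"] aj by blast
      then show ?thesis using pr(4)[of Z a j] by blast
    qed
    have "?snd (\<Union>\<C>) \<subseteq> ?fst (\<Union>\<C>)" "\<one> \<notin> ?snd (\<Union>\<C>)" using pr(3,5) by blast+
    moreover have "A0 \<subseteq> ?fst (\<Union>\<C>)" "I0 \<subseteq> ?snd (\<Union>\<C>)" using pr(6,7)[OF Z0] Z0 by blast+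
    ultimately show "\<Union>\<C> \<in> \<A>" unfolding \<A>_def ring_ideal_pair_def using s i m by blast
  qed
  then obtain M where M: "M \<in> \<A>" and max: "\<And>Z. Z \<in> \<A> \<Longrightarrow> M \<subseteq> Z \<Longrightarrow> Z = M" by blast
  define V I where "V = ?fst M" and "I = ?snd M"
  have VI: "ring_ideal_pair V I" "A0 \<subseteq> V" "I0 \<subseteq> I" using M unfolding \<A>_def V_def I_def by auto
  then have I: "additive_subgroup I R" and V: "subring V R" and 1: "\<one> \<notin> I" unfolding ring_ideal_pair_def by auto
  have ex: "\<exists>n. \<one> \<in> pols I z n" if z: "z \<in> carrier R" "z \<notin> V" for z
  proof (rule ccontr)
    assume "\<nexists>n. \<one> \<in> pols I z n"
    then have P: "ring_ideal_pair (\<Union>n. pols V z n) (\<Union>n. pols I z n)" using pols_pair[OF VI(1) z(1)] by blast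
    let ?Z = "{True} \<times> (\<Union>n. pols V z n) \<union> {False} \<times> (\<Union>n. pols I z n)"
    have sub: "V \<subseteq> (\<Union>n. pols V z n)" "I \<subseteq> (\<Union>n. pols I z n)"
      using pols_base[OF subring_additive_subgroup[OF V] z(1)] pols_base[OF I z(1)] by blast+
    have fs: "?fst ?Z = (\<Union>n. pols V z n)" "?snd ?Z = (\<Union>n. pols I z n)" by auto
    have "?Z \<in> \<A>" unfolding \<A>_def mem_Collect_eq fs using P sub VI by blast
    moreover have "M \<subseteq> ?Z"
    proof
      fix p assume p: "p \<in> M"
      obtain b a where "p = (b, a)" by (cases p)
      then have "if b then a \<in> V else a \<in> I" using p unfolding V_def I_def by auto
      then have "if b then a \<in> (\<Union>n. pols V z n) else a \<in> (\<Union>n. pols I z n)" using sub by (auto split: if_splits)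
      then show "p \<in> ?Z" using \<open>p = (b, a)\<close> by (cases b) simp_all
    qed
    ultimately have "?Z = M" using max by blast
    moreover have "z \<in> (\<Union>n. pols V z n)"
    proof -
      have "z = \<zero> \<oplus> z \<otimes> \<one>" using z by simp
      then have "z \<in> pols V z (Suc 0)" using subringE(2,3)[OF V] by auto
      then show ?thesis by blast
    qed
    ultimately have "z \<in> V" unfolding V_def by blast
    then show False using z by blast
  qed
  have "z \<in> V \<or> inv z \<in> V" if z: "z \<in> carrier R" "z \<noteq> \<zero>" for z
  proof (rule ccontr)
    assume "\<not> (z \<in> V \<or> inv z \<in> V)"
    then have e: "\<exists>n. \<one> \<in> pols I z n" "\<exists>n. \<one> \<in> pols I (inv z) n" using ex z inv_mem by blast+
    define n where "n = (LEAST n. \<one> \<in> pols I z n)"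
    define m where "m = (LEAST n. \<one> \<in> pols I (inv z) n)"
    have n: "\<one> \<in> pols I z n" "\<And>k. \<one> \<in> pols I z k \<Longrightarrow> n \<le> k"
      unfolding n_def using LeastI_ex[OF e(1)] by (simp_all add: Least_le)
    have m: "\<one> \<in> pols I (inv z) m" "\<And>k. \<one> \<in> pols I (inv z) k \<Longrightarrow> m \<le> k"
      unfolding m_def using LeastI_ex[OF e(2)] by (simp_all add: Least_le)
    obtain n' where n': "n = Suc n'" using n(1) 1 by (cases n) auto
    obtain m' where m': "m = Suc m'" using m(1) 1 by (cases m) auto
    show False
    proof (cases "m \<le> n")
      case True
      have "\<one> \<in> pols I z n'" using pols_pair_elimination[OF VI(1) z _ m(1), of n'] n(1) True unfolding n' by blast
      then show False using n(2)[of n'] n' by simp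
    next
      case False
      have "\<one> \<in> pols I (inv (inv z)) n" using n(1) inv_i[OF z] by simp
      then have "\<one> \<in> pols I (inv z) m'"
        using pols_pair_elimination[OF VI(1) inv_mem[OF z] inv_nz[OF z], of m' n] m(1) False unfolding m' by simp
      then show False using m(2)[of m'] m' by simp
    qed
  qed
  then show ?thesis using that VI by blast
qed

end

section \<open>Places\<close>

context field begin

lemma inv_eqI: "x \<in> carrier R \<Longrightarrow> y \<in> carrier R \<Longrightarrow> x \<otimes> y = \<one> \<Longrightarrow> inv x = y"
  using inv_unique'[of x y] by (simp add: m_comm)

lemma PIdl_sub: "PIdl\<^bsub>R\<lparr>carrier := V\<rparr>\<^esub> a = dilate a V" if "V \<subseteq> carrier R" "a \<in> carrier R"
proof -
  have "x \<otimes> a = a \<otimes> x" if "x \<in> V" for x using that \<open>V \<subseteq> carrier R\<close> \<open>a \<in> carrier R\<close> m_comm by blast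
  then have "{x \<otimes> a |x. x \<in> V} = (\<otimes>) a ` V" unfolding image_def by (auto; metis)
  then show ?thesis unfolding cgenideal_def dilate_def by simp
qed

lemma subring_domain:
  assumes V: "subring V R" shows "domain (R\<lparr>carrier := V\<rparr>)" "ring (R\<lparr>carrier := V\<rparr>)"
proof -
  show r: "ring (R\<lparr>carrier := V\<rparr>)" using subring_is_ring[OF V] .
  show "domain (R\<lparr>carrier := V\<rparr>)" using subcring_iff subcringI'[OF V] subdomain_is_domain subdomainI' V
    by (metis subdomain_iff subringE(1))
qed

text \<open>The restricted ring shares addition, multiplication, zero and one with the field, but
  its negation is defined through its own carrier; the agreement of the two negations is the content
  here.\<close>

lemma sub_ideal_iff:
  assumes V: "subring V R"
  shows "ideal J (R\<lparr>carrier := V\<rparr>) \<longleftrightarrow> additive_subgroup J R \<and> J \<subseteq> V \<and> (\<forall>a\<in>V. \<forall>j\<in>J. a \<otimes> j \<in> J)"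
proof
  assume "ideal J (R\<lparr>carrier := V\<rparr>)"
  then interpret I: ideal J "R\<lparr>carrier := V\<rparr>" .
  interpret S: domain "R\<lparr>carrier := V\<rparr>" using subring_domain[OF V] by blast
  have JV: "J \<subseteq> V" using I.a_subset by simp
  have neg: "\<ominus> a \<in> J" if "a \<in> J" for a
  proof -
    have m1: "\<ominus> \<one> \<in> V" using subringE(3,5)[OF V] by blast
    have "(\<ominus> \<one>) \<otimes> a \<in> J" using I.I_l_closed[OF that, of "\<ominus> \<one>"] m1 by simp
    moreover have "a \<in> carrier R" using that JV subringE(1)[OF V] by blast
    then have "(\<ominus> \<one>) \<otimes> a = \<ominus> a" by (simp add: l_minus)
    ultimately show ?thesis by simp
  qed
  have "additive_subgroup J R"
    using JV subringE(1)[OF V] additive_subgroup.zero_closed[OF I.additive_subgroup_axioms]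
      additive_subgroup.a_closed[OF I.additive_subgroup_axioms] neg by (intro additive_subgroupI') auto
  then show "additive_subgroup J R \<and> J \<subseteq> V \<and> (\<forall>a\<in>V. \<forall>j\<in>J. a \<otimes> j \<in> J)" using JV I.I_l_closed by auto
next
  assume A: "additive_subgroup J R \<and> J \<subseteq> V \<and> (\<forall>a\<in>V. \<forall>j\<in>J. a \<otimes> j \<in> J)"
  interpret S: domain "R\<lparr>carrier := V\<rparr>" using subring_domain[OF V] by blast
  have J: "additive_subgroup J R" using A by blast
  have neg: "\<ominus>\<^bsub>R\<lparr>carrier := V\<rparr>\<^esub> a \<in> J" if a: "a \<in> J" for a
  proof -
    have aV: "a \<in> V" using a A by blast
    have m: "\<ominus> a \<in> J" "\<ominus> a \<in> V" using additive_subgroup.a_inv_closed[OF J a] A by auto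
    have "a \<oplus> (\<ominus> a) = \<zero>" using aV subringE(1)[OF V] r_neg by blast
    then have "\<ominus>\<^bsub>R\<lparr>carrier := V\<rparr>\<^esub> a = \<ominus> a" using S.minus_equality[of "\<ominus> a" a] aV m S.a_comm[of a "\<ominus> a"] by simp
    then show ?thesis using m by simp
  qed
  have "additive_subgroup J (R\<lparr>carrier := V\<rparr>)"
    using A additive_subgroup.zero_closed[OF J] additive_subgroup.a_closed[OF J] neg
    by (intro S.additive_subgroupI') auto
  moreover have "\<forall>a\<in>V. \<forall>j\<in>J. j \<otimes> a \<in> J"
  proof (intro ballI)
    fix a j assume aj: "a \<in> V" "j \<in> J"
    then have "j \<otimes> a = a \<otimes> j" using A subringE(1)[OF V] m_comm[of j a] by blast
    then show "j \<otimes> a \<in> J" using A aj by simp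
  qed
  ultimately show "ideal J (R\<lparr>carrier := V\<rparr>)"
    using A S.ring_axioms by (intro ideal.intro) (auto simp: ideal_axioms_def)
qed

lemma sub_Units:
  assumes V: "subring V R"
  shows "Units (R\<lparr>carrier := V\<rparr>) = {x \<in> V. x \<noteq> \<zero> \<and> inv x \<in> V}"
proof
  note Vs = subringE[OF V]
  show "Units (R\<lparr>carrier := V\<rparr>) \<subseteq> {x \<in> V. x \<noteq> \<zero> \<and> inv x \<in> V}"
  proof
    fix x assume "x \<in> Units (R\<lparr>carrier := V\<rparr>)"
    then obtain y where y: "x \<in> V" "y \<in> V" "x \<otimes> y = \<one>" unfolding Units_def by auto
    then have c: "x \<in> carrier R" "y \<in> carrier R" using Vs by auto
    have "x \<noteq> \<zero>" using y(3) c by auto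
    moreover have "inv x = y" using inv_eqI[OF c y(3)] by simp
    ultimately show "x \<in> {x \<in> V. x \<noteq> \<zero> \<and> inv x \<in> V}" using y by auto
  qed
  show "{x \<in> V. x \<noteq> \<zero> \<and> inv x \<in> V} \<subseteq> Units (R\<lparr>carrier := V\<rparr>)"
    unfolding Units_def using Vs(1) inv_l inv_r by auto
qed

lemma dilate_sub_ideal:
  assumes V: "subring V R" and a: "a \<in> V" shows "ideal (dilate a V) (R\<lparr>carrier := V\<rparr>)" "dilate a V \<subseteq> V" "a \<in> dilate a V"
proof -
  note Vs = subringE[OF V]
  have ac: "a \<in> carrier R" using a Vs by auto
  show sub: "dilate a V \<subseteq> V" unfolding dilate_def using Vs a by auto
  have "a = a \<otimes> \<one>" using ac by simp
  then show "a \<in> dilate a V" unfolding dilate_def using Vs(3) by blast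
  have "b \<otimes> j \<in> dilate a V" if "b \<in> V" "j \<in> dilate a V" for b j
  proof -
    obtain v where v: "v \<in> V" "j = a \<otimes> v" using \<open>j \<in> dilate a V\<close> unfolding dilate_def by blast
    have "b \<otimes> j = a \<otimes> (b \<otimes> v)" using v \<open>b \<in> V\<close> Vs(1) ac m_lcomm[of b a v] by blast
    then show ?thesis unfolding dilate_def using Vs(6)[OF \<open>b \<in> V\<close> v(1)] by blast
  qed
  then show "ideal (dilate a V) (R\<lparr>carrier := V\<rparr>)"
    unfolding sub_ideal_iff[OF V] using sub dilate_additive_subgroup[OF subring_additive_subgroup[OF V] ac] by blast
qed

lemma one_in_ideal:
  assumes V: "subring V R" and J: "ideal J (R\<lparr>carrier := V\<rparr>)" and x: "x \<in> J" "x \<noteq> \<zero>" "inv x \<in> V"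
  shows "J = V"
proof -
  have A: "J \<subseteq> V" "\<And>a j. a \<in> V \<Longrightarrow> j \<in> J \<Longrightarrow> a \<otimes> j \<in> J" using J unfolding sub_ideal_iff[OF V] by auto
  have xc: "x \<in> carrier R" using x A subringE(1)[OF V] by auto
  have "inv x \<otimes> x \<in> J" using A x by blast
  then have "\<one> \<in> J" using inv_l[OF xc x(2)] by simp
  then have "a \<in> J" if "a \<in> V" for a using A(2)[OF that, of \<one>] that subringE(1)[OF V] by auto
  then show ?thesis using A by blast
qed

text \<open>The index of aV in V measures divisibility before an order function exists.
  Representatives modulo aV stay incongruent modulo asV, and w0 + a is a further one: it agrees with
  w0 modulo a, but not modulo as, since a lies outside asV when s is not a unit.\<close>

lemma index_less:
  assumes g: "growth R B C" and V: "subring V R" and a: "a \<in> V" "a \<noteq> \<zero>" and s: "s \<in> V" "s \<noteq> \<zero>" "inv s \<notin> V"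
  shows "card (cosets V (dilate a V)) < card (cosets V (dilate (a \<otimes> s) V))"
proof -
  note Vs = subringE[OF V] and Va = subring_additive_subgroup[OF V]
  have c: "a \<in> carrier R" "s \<in> carrier R" using a s Vs by auto
  have as: "a \<otimes> s \<in> V" "a \<otimes> s \<in> carrier R" "a \<otimes> s \<noteq> \<zero>" using a s Vs c by (auto simp: integral_iff)
  have fin: "finite (cosets V (dilate x V))" if x: "x \<in> V" "x \<noteq> \<zero>" for x
  proof -
    have "x \<in> carrier R" using x Vs by auto
    then obtain N where "\<And>H. additive_subgroup H R \<Longrightarrow> dilate x H \<subseteq> H \<Longrightarrow> finite (cosets H (dilate x H)) \<and> card (cosets H (dilate x H)) \<le> N"
      using index_bound[OF g _ x(2)] by blast
    then show ?thesis using Va dilate_sub_ideal(2)[OF V x(1)] by blast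
  qed
  note aV = dilate_additive_subgroup[OF Va c(1)] and asV = dilate_additive_subgroup[OF Va as(2)]
  obtain W where W: "W \<subseteq> V" "inj_on (\<lambda>x. dilate a V +> x) W" "(\<lambda>x. dilate a V +> x) ` W = cosets V (dilate a V)"
    using cosets_incongruent[OF aV Vs(1) order_refl] by metis
  have finW: "finite W" "card W = card (cosets V (dilate a V))"
    using W fin[OF a] card_image[OF W(2)] by (metis finite_imageD, metis)
  have "W \<noteq> {}" using W(3) Vs(2) unfolding cosets_def by auto
  then obtain w0 where w0: "w0 \<in> W" by blast
  have sub: "dilate (a \<otimes> s) V \<subseteq> dilate a V"
  proof
    fix x assume "x \<in> dilate (a \<otimes> s) V"
    then obtain v where v: "v \<in> V" "x = (a \<otimes> s) \<otimes> v" unfolding dilate_def by blast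
    then have "x = a \<otimes> (s \<otimes> v)" using c Vs(1) m_assoc[of a s v] by blast
    then show "x \<in> dilate a V" unfolding dilate_def using Vs(6)[OF s(1) v(1)] by blast
  qed
  have na: "a \<notin> dilate (a \<otimes> s) V"
  proof
    assume "a \<in> dilate (a \<otimes> s) V"
    then obtain v where v: "v \<in> V" "a = (a \<otimes> s) \<otimes> v" unfolding dilate_def by blast
    have vc: "v \<in> carrier R" using v Vs by auto
    have "a \<otimes> \<one> = a \<otimes> (s \<otimes> v)" using v(2) c vc by (simp add: m_assoc)
    then have "s \<otimes> v = \<one>" using m_lcancel[OF a(2) c(1), of \<one> "s \<otimes> v"] c vc by auto
    then have "inv s = v" using inv_eqI[OF c(2) vc] by simp
    then show False using s(3) v(1) by simp
  qed
  let ?w = "w0 \<oplus> a"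
  have wV: "?w \<in> V" "insert ?w W \<subseteq> V" using W w0 a Vs by auto
  have wc: "w0 \<in> carrier R" using W w0 Vs by auto
  have eqW: "w = w'" if "w \<in> W" "w' \<in> W" "w \<ominus> w' \<in> dilate a V" for w w'
    using that coset_eq_iff[OF aV, of w w'] inj_onD[OF W(2), of w w'] W(1) Vs(1) by blast
  have ww0: "?w \<ominus> w0 = a" using wc c by (simp add: a_comm minus_minus_cancel(4))
  have adil: "a \<in> dilate a V" using dilate_sub_ideal(3)[OF V a(1)] .
  have nw: "?w \<ominus> w \<notin> dilate (a \<otimes> s) V" if w: "w \<in> W" for w
  proof
    assume A: "?w \<ominus> w \<in> dilate (a \<otimes> s) V"
    have wcc: "w \<in> carrier R" using W w Vs by auto
    have "(?w \<ominus> w) \<ominus> a \<in> dilate a V" using A sub adil additive_subgroup_minus[OF aV] by blast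
    moreover have "(?w \<ominus> w) \<ominus> a = w0 \<ominus> w" using minus_minus_cancel(7)[OF wc wcc c(1)] .
    ultimately have "w0 = w" using eqW[OF w0 w] by simp
    then show False using A na ww0 by simp
  qed
  have inj: "inj_on (\<lambda>x. dilate (a \<otimes> s) V +> x) (insert ?w W)"
  proof -
    have 1: "inj_on (\<lambda>x. dilate (a \<otimes> s) V +> x) W"
    proof (rule inj_onI)
      fix x y assume xy: "x \<in> W" "y \<in> W" "dilate (a \<otimes> s) V +> x = dilate (a \<otimes> s) V +> y"
      then have "x \<ominus> y \<in> dilate (a \<otimes> s) V" using coset_eq_iff[OF asV, of x y] W(1) Vs(1) by blast
      then show "x = y" using eqW xy sub by blast
    qed
    have 2: "dilate (a \<otimes> s) V +> ?w \<noteq> dilate (a \<otimes> s) V +> w" if "w \<in> W" for w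
      using nw[OF that] coset_eq_iff[OF asV, of ?w w] that W(1) Vs(1) wV by blast
    show ?thesis using 1 2 by (simp add: inj_on_insert) blast
  qed
  have nin: "?w \<notin> W"
  proof
    assume "?w \<in> W"
    then show False using nw[of ?w] additive_subgroup.zero_closed[OF asV] r_neg[of ?w] wV Vs(1) unfolding a_minus_def by auto
  qed
  have "Suc (card W) = card (insert ?w W)" using nin finW by simp
  also have "\<dots> = card ((\<lambda>x. dilate (a \<otimes> s) V +> x) ` insert ?w W)" using card_image[OF inj] by simp
  also have "\<dots> \<le> card (cosets V (dilate (a \<otimes> s) V))"
    using wV(2) unfolding cosets_def by (intro card_mono[OF fin[OF as(1,3), unfolded cosets_def]] image_mono)
  finally show ?thesis using finW by simp
qed

text \<open>In a valuation ring, if a does not divide b then a is b times a nonunit, hence has the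
  larger index. So an element of least index generates its ideal, and a nonunit of least index
  generates the maximal ideal. The element y guarantees a nonzero nonunit, that is, V differs from
  the whole field.\<close>

lemma valuation_ring_in_prime_divisors:
  assumes g: "growth R B C" and V: "subring V R"
    and val: "\<And>z. z \<in> carrier R \<Longrightarrow> z \<noteq> \<zero> \<Longrightarrow> z \<in> V \<or> inv z \<in> V"
    and y: "y \<in> V" "y \<noteq> \<zero>" "inv y \<notin> V" and k: "constant_field R \<subseteq> V"
  shows "V \<in> prime_divisors R"
proof -
  note Vs = subringE[OF V]
  let ?S = "R\<lparr>carrier := V\<rparr>"
  interpret S: domain ?S using subring_domain[OF V] by blast
  define idx where "idx a = card (cosets V (dilate a V))" for a
  have key: "b \<in> dilate a V" if a: "a \<in> V" "a \<noteq> \<zero>" and b: "b \<in> V" and min: "b \<noteq> \<zero> \<Longrightarrow> idx a \<le> idx b" for a b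
  proof (cases "b = \<zero>")
    case True
    have "b = a \<otimes> \<zero>" using True a Vs(1) by auto
    then show ?thesis unfolding dilate_def using Vs(2) by blast
  next
    case False
    have c: "a \<in> carrier R" "b \<in> carrier R" using a b Vs by auto
    note ia = inv_mem[OF c(1) a(2)] and ib = inv_mem[OF c(2) False]
    let ?s = "inv a \<otimes> b"
    have b1: "a \<otimes> ?s = b"
    proof -
      have "a \<otimes> ?s = (a \<otimes> inv a) \<otimes> b" using c ia by (simp add: m_assoc)
      then show ?thesis using inv_r[OF c(1) a(2)] c by simp
    qed
    have s: "?s \<in> carrier R" "?s \<noteq> \<zero>" using c ia inv_nz[OF c(1) a(2)] False by (auto simp: integral_iff)
    show ?thesis
    proof (cases "?s \<in> V")
      case True then show ?thesis using b1 unfolding dilate_def by force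
    next
      case nV: False
      then have isV: "inv ?s \<in> V" using val[OF s] by blast
      have "b \<otimes> inv ?s = a \<otimes> (?s \<otimes> inv ?s)" using b1 c s inv_mem[OF s] m_assoc by metis
      then have "b \<otimes> inv ?s = a" using inv_r[OF s] c by simp
      then have "idx b < idx a"
        using index_less[OF g V b False isV inv_nz[OF s]] inv_i[OF s] nV unfolding idx_def by simp
      then show ?thesis using min[OF False] by simp
    qed
  qed
  have pd: "principal_domain ?S"
  proof (unfold_locales)
    fix J assume J: "ideal J ?S"
    have A: "additive_subgroup J R" "J \<subseteq> V" "\<And>a j. a \<in> V \<Longrightarrow> j \<in> J \<Longrightarrow> a \<otimes> j \<in> J" using J unfolding sub_ideal_iff[OF V] by auto
    show "\<exists>a\<in>carrier ?S. J = PIdl\<^bsub>?S\<^esub> a"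
    proof (cases "J = {\<zero>}")
      case True
      have "dilate \<zero> V = {\<zero>}" unfolding dilate_def using Vs(1,2) by (auto simp: subset_iff image_iff)
      then have "J = PIdl\<^bsub>?S\<^esub> \<zero>" using PIdl_sub[OF Vs(1), of \<zero>] True by simp
      then show ?thesis using Vs(2) by auto
    next
      case False
      then have "\<exists>a. a \<in> J - {\<zero>}" using additive_subgroup.zero_closed[OF A(1)] by blast
      then obtain a where a: "a \<in> J - {\<zero>}" "\<And>b. b \<in> J - {\<zero>} \<Longrightarrow> idx a \<le> idx b"
        using ex_has_least_nat[of "\<lambda>a. a \<in> J - {\<zero>}" _ idx] by blast
      have aV: "a \<in> V" "a \<noteq> \<zero>" using a A by auto
      have "J \<subseteq> dilate a V" using key[OF aV] a(2) A(2) by blast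
      moreover have "dilate a V \<subseteq> J"
      proof
        fix x assume "x \<in> dilate a V"
        then obtain v where "v \<in> V" "x = a \<otimes> v" unfolding dilate_def by blast
        then show "x \<in> J" using A(3)[of v a] a(1) m_comm[of a v] aV Vs(1) by (metis Diff_iff subsetD)
      qed
      ultimately have "J = PIdl\<^bsub>?S\<^esub> a" using PIdl_sub[OF Vs(1)] aV Vs(1) by auto
      then show ?thesis using aV by auto
    qed
  qed
  let ?nu = "\<lambda>x. x \<in> V \<and> x \<noteq> \<zero> \<and> inv x \<notin> V"
  obtain t where t: "?nu t" "\<And>b. ?nu b \<Longrightarrow> idx t \<le> idx b"
    using ex_has_least_nat[of ?nu y idx] y by blast
  have tV: "t \<in> V" "t \<noteq> \<zero>" using t by auto
  have tP: "PIdl\<^bsub>?S\<^esub> t = dilate t V" using PIdl_sub[OF Vs(1)] tV Vs(1) by auto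
  note idt = dilate_sub_ideal[OF V tV(1)]
  have proper: "dilate t V \<noteq> V"
  proof
    assume "dilate t V = V"
    then obtain v where v: "v \<in> V" "\<one> = t \<otimes> v" using Vs(3) unfolding dilate_def by (metis imageE)
    have "t \<in> carrier R" "v \<in> carrier R" using v tV Vs(1) by blast+
    then have "inv t = v" using inv_eqI v(2) by simp
    then show False using t(1) v by blast
  qed
  have sub: "J \<subseteq> dilate t V" if J: "ideal J ?S" "J \<noteq> V" for J
  proof
    fix x assume x: "x \<in> J"
    have JV: "J \<subseteq> V" using J unfolding sub_ideal_iff[OF V] by auto
    have "?nu x" if "x \<noteq> \<zero>" using x one_in_ideal[OF V J(1) x that] JV J(2) that by blast
    then show "x \<in> dilate t V" using key[OF tV, of x] t(2) x JV by blast
  qed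
  have "{J. maximalideal J ?S} = {PIdl\<^bsub>?S\<^esub> t}"
  proof (rule Set.set_eqI, unfold mem_Collect_eq singleton_iff, rule iffI)
    fix J assume "maximalideal J ?S"
    then interpret M: maximalideal J ?S .
    have "J \<noteq> V" using M.I_notcarr by simp
    then have "J \<subseteq> dilate t V" using sub M.is_ideal by blast
    then show "J = PIdl\<^bsub>?S\<^esub> t" using M.I_maximal[of "dilate t V"] idt proper unfolding tP by auto
  next
    fix J assume "J = PIdl\<^bsub>?S\<^esub> t"
    then have J: "J = dilate t V" using tP by simp
    show "maximalideal J ?S"
    proof (rule maximalidealI)
      show "ideal J ?S" "carrier ?S \<noteq> J" using idt proper unfolding J by auto
      fix J' assume "ideal J' ?S" "J \<subseteq> J'" "J' \<subseteq> carrier ?S"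
      then show "J' = J \<or> J' = carrier ?S" using sub[of J'] unfolding J by auto
    qed
  qed
  moreover have "PIdl\<^bsub>?S\<^esub> t \<noteq> {\<zero>}" unfolding tP using idt(3) tV by auto
  ultimately have dvr: "discrete_valuation_ring ?S" unfolding discrete_valuation_ring_def using pd by auto
  have "\<exists>a\<in>V. \<exists>b\<in>V - {\<zero>}. x = a \<otimes> inv b" if x: "x \<in> carrier R" for x
  proof (cases "x \<in> V")
    case True
    have "x = x \<otimes> inv \<one>" using x by simp
    then show ?thesis using True Vs(3) by (intro bexI[of _ x] bexI[of _ \<one>]) simp_all
  next
    case False
    then have nz: "x \<noteq> \<zero>" using Vs(2) by auto
    have "x = \<one> \<otimes> inv (inv x)" using inv_i[OF x nz] x by simp
    moreover have "inv x \<in> V - {\<zero>}" using val[OF x nz] False inv_nz[OF x nz] by blast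
    ultimately show ?thesis using Vs(3) by blast
  qed
  then show ?thesis unfolding prime_divisors_def using V k dvr by auto
qed

end

section \<open>Units, uniformizers and the order function of a place\<close>

context field begin

text \<open>Integer powers of nonzero elements agree with those in \<open>mult_of R\<close>, a
  group, and inherit its laws.\<close>

lemma int_pow_field:
  assumes x: "x \<in> carrier R" "x \<noteq> \<zero>"
  shows "x [^] (i + j :: int) = x [^] i \<otimes> x [^] j" "x [^] i \<in> carrier R" "x [^] i \<noteq> \<zero>"
    "x [^] (- i) = inv (x [^] i)" "x [^] (1 :: int) = x"
proof -
  interpret G: group "Multiplicative_Group.mult_of R" by (rule field_mult_group)
  have cn: "x [^] (n::nat) \<in> carrier (Multiplicative_Group.mult_of R)" for n
    using x pow_nonzero[OF x] by simp
  have e: "x [^] i = x [^]\<^bsub>Multiplicative_Group.mult_of R\<^esub> i" for i :: int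
    unfolding int_pow_def2 Multiplicative_Group.nat_pow_mult_of m_inv_mult_of[OF cn] ..
  have xc: "x \<in> carrier (Multiplicative_Group.mult_of R)" using x by simp
  have c: "x [^] i \<in> carrier R - {\<zero>}" for i :: int using G.int_pow_closed[OF xc, of i] unfolding e by simp
  show "x [^] (i + j :: int) = x [^] i \<otimes> x [^] j" unfolding e using G.int_pow_mult[OF xc] by simp
  show "x [^] i \<in> carrier R" "x [^] i \<noteq> \<zero>" using c[of i] by auto
  have "x [^] i \<in> carrier (Multiplicative_Group.mult_of R)" using c[of i] by simp
  from m_inv_mult_of[OF this] show "x [^] (- i) = inv (x [^] i)" using G.int_pow_neg[OF xc, of i] unfolding e by metis
  show "x [^] (1 :: int) = x" unfolding e using G.int_pow_1[OF xc] .
qed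

lemma int_pow_mult_distrib:
  assumes x: "x \<in> carrier R" "x \<noteq> \<zero>" and y: "y \<in> carrier R" "y \<noteq> \<zero>"
  shows "(x \<otimes> y) [^] (i :: int) = x [^] i \<otimes> y [^] i"
proof (cases "i < 0")
  case True
  have "(x \<otimes> y) [^] nat (- i) = x [^] nat (- i) \<otimes> y [^] nat (- i)" using nat_pow_distrib[OF x(1) y(1)] .
  then have "inv ((x \<otimes> y) [^] nat (- i)) = inv (x [^] nat (- i)) \<otimes> inv (y [^] nat (- i))"
    using inv_m[OF nat_pow_closed[OF x(1)] pow_nonzero[OF x] nat_pow_closed[OF y(1)] pow_nonzero[OF y]] by metis
  then show ?thesis using True unfolding int_pow_def2 by (simp only: if_True)
next
  case False
  then show ?thesis using nat_pow_distrib[OF x(1) y(1), of "nat i"] unfolding int_pow_def2 by simp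
qed

definition place_units :: "'a set \<Rightarrow> 'a set" where
  "place_units V = {x \<in> V. x \<noteq> \<zero> \<and> inv x \<in> V}"

context
  fixes V assumes V: "V \<in> prime_divisors R"
begin

lemma place_subring: "subring V R"
  using V unfolding prime_divisors_def by simp

lemmas pV = subringE[OF place_subring]

lemma place_principal: "principal_domain (R\<lparr>carrier := V\<rparr>)"
  using V unfolding prime_divisors_def discrete_valuation_ring_def by simp

lemma place_ideal_maximal:
  shows "maximalideal (place_ideal R V) (R\<lparr>carrier := V\<rparr>)"
    "\<And>J. maximalideal J (R\<lparr>carrier := V\<rparr>) \<Longrightarrow> J = place_ideal R V" "place_ideal R V \<noteq> {\<zero>}"
proof -
  obtain P where P: "{I. maximalideal I (R\<lparr>carrier := V\<rparr>)} = {P}" "P \<noteq> {\<zero>}"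
    using V unfolding prime_divisors_def discrete_valuation_ring_def by auto
  have iff: "maximalideal J (R\<lparr>carrier := V\<rparr>) \<longleftrightarrow> J = P" for J
  proof -
    have "J \<in> {I. maximalideal I (R\<lparr>carrier := V\<rparr>)} \<longleftrightarrow> J \<in> {P}" unfolding P(1) ..
    then show ?thesis by simp
  qed
  then have "place_ideal R V = P" unfolding place_ideal_def by simp
  then show "maximalideal (place_ideal R V) (R\<lparr>carrier := V\<rparr>)"
    "\<And>J. maximalideal J (R\<lparr>carrier := V\<rparr>) \<Longrightarrow> J = place_ideal R V" "place_ideal R V \<noteq> {\<zero>}"
    using iff P by auto
qed

lemma place_ideal_props:
  shows "additive_subgroup (place_ideal R V) R" "place_ideal R V \<subseteq> V"
    "\<And>a j. a \<in> V \<Longrightarrow> j \<in> place_ideal R V \<Longrightarrow> a \<otimes> j \<in> place_ideal R V" "place_ideal R V \<noteq> V"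
    "ideal (place_ideal R V) (R\<lparr>carrier := V\<rparr>)"
proof -
  show i: "ideal (place_ideal R V) (R\<lparr>carrier := V\<rparr>)"
    using place_ideal_maximal(1) by (rule maximalideal.axioms(1))
  show "additive_subgroup (place_ideal R V) R" "place_ideal R V \<subseteq> V"
    "\<And>a j. a \<in> V \<Longrightarrow> j \<in> place_ideal R V \<Longrightarrow> a \<otimes> j \<in> place_ideal R V"
    using i unfolding sub_ideal_iff[OF place_subring] by auto
  show "place_ideal R V \<noteq> V" using maximalideal.I_notcarr[OF place_ideal_maximal(1)] by auto
qed

text \<open>A nonzero nonunit has an irreducible divisor, which generates a maximal ideal in a
  principal domain; as there is only one maximal ideal, the nonunit lies in it.\<close>

lemma place_ideal_iff: "x \<in> place_ideal R V \<longleftrightarrow> x \<in> V \<and> (x = \<zero> \<or> inv x \<notin> V)"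
proof
  assume x: "x \<in> place_ideal R V"
  then show "x \<in> V \<and> (x = \<zero> \<or> inv x \<notin> V)"
    using place_ideal_props(2,4) one_in_ideal[OF place_subring place_ideal_props(5) x] by blast
next
  assume x: "x \<in> V \<and> (x = \<zero> \<or> inv x \<notin> V)"
  show "x \<in> place_ideal R V"
  proof (cases "x = \<zero>")
    case True then show ?thesis using additive_subgroup.zero_closed[OF place_ideal_props(1)] by simp
  next
    case False
    interpret S: principal_domain "R\<lparr>carrier := V\<rparr>" by (rule place_principal)
    have "x \<notin> Units (R\<lparr>carrier := V\<rparr>)" using sub_Units[OF place_subring] x False by auto
    moreover have "x \<in> carrier (R\<lparr>carrier := V\<rparr>) - {\<zero>\<^bsub>R\<lparr>carrier := V\<rparr>\<^esub>}" using x False by simp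
    ultimately obtain b where b: "b \<in> V" "ring_irreducible\<^bsub>R\<lparr>carrier := V\<rparr>\<^esub> b" "b divides\<^bsub>R\<lparr>carrier := V\<rparr>\<^esub> x"
      using S.exists_irreducible_divisor by auto
    have "PIdl\<^bsub>R\<lparr>carrier := V\<rparr>\<^esub> b = place_ideal R V"
      using place_ideal_maximal(2)[OF S.irreducible_imp_maximalideal] b by simp
    then have "place_ideal R V = dilate b V" using PIdl_sub[OF pV(1)] b(1) pV(1) by auto
    moreover have "x \<in> dilate b V" using b(3) unfolding factor_def dilate_def by auto
    ultimately show ?thesis by simp
  qed
qed

lemma uniformizer_exists:
  obtains t where "t \<in> V" "t \<noteq> \<zero>" "place_ideal R V = dilate t V"
proof -
  interpret S: principal_domain "R\<lparr>carrier := V\<rparr>" by (rule place_principal)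
  obtain t where t: "t \<in> V" "place_ideal R V = PIdl\<^bsub>R\<lparr>carrier := V\<rparr>\<^esub> t" using S.exists_gen[OF place_ideal_props(5)] by auto
  then have e: "place_ideal R V = dilate t V" using PIdl_sub[OF pV(1)] pV(1) by auto
  have "t \<noteq> \<zero>"
  proof
    assume "t = \<zero>"
    then have "dilate t V = {\<zero>}" unfolding dilate_def using pV(1,2) by (auto simp: subset_iff image_iff)
    then show False using place_ideal_maximal(3) e by simp
  qed
  then show ?thesis using that t e by blast
qed

lemma place_units_mult: "a \<in> place_units V \<Longrightarrow> b \<in> place_units V \<Longrightarrow> a \<otimes> b \<in> place_units V"
proof -
  assume a: "a \<in> place_units V" and b: "b \<in> place_units V"
  then have "a \<in> V" "b \<in> V" "inv a \<in> V" "inv b \<in> V" "a \<noteq> \<zero>" "b \<noteq> \<zero>" unfolding place_units_def by auto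
  moreover have "a \<in> carrier R" "b \<in> carrier R" using calculation pV(1) by auto
  ultimately show ?thesis unfolding place_units_def using pV(6) inv_m by (auto simp: integral_iff)
qed

lemma place_units_inv: "a \<in> place_units V \<Longrightarrow> inv a \<in> place_units V"
  unfolding place_units_def using inv_i inv_nz pV(1) by auto

lemma place_units_nonzero: "a \<in> place_units V \<Longrightarrow> a \<in> carrier R" "a \<in> place_units V \<Longrightarrow> a \<noteq> \<zero>"
  unfolding place_units_def using pV(1) by auto

lemma place_units_pow: "a \<in> place_units V \<Longrightarrow> a [^] (n :: nat) \<in> place_units V"
proof (induction n)
  case 0 then show ?case unfolding place_units_def using pV(3) by simp
next
  case (Suc n) then show ?case using place_units_mult by simp
qed

lemma place_units_int_pow: "a \<in> place_units V \<Longrightarrow> a [^] (n :: int) \<in> place_units V"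
  unfolding int_pow_def2 using place_units_pow[of a "nat n"] place_units_inv[OF place_units_pow[of a "nat (- n)"]]
  by (auto simp only: split: if_split)

lemma place_unit_iff: "x \<in> V \<Longrightarrow> x \<in> place_units V \<longleftrightarrow> x \<notin> place_ideal R V"
  using place_ideal_iff unfolding place_units_def by blast

text \<open>Otherwise x is divisible by every power of t, so the intersection J of the ideals t^n V
  is nonzero and has a generator y. Dividing y by t stays inside J, so y = t y s for some s in V,
  and t would be a unit.\<close>

lemma place_decomposition_nat:
  assumes t: "t \<in> V" "t \<noteq> \<zero>" "place_ideal R V = dilate t V" and x: "x \<in> V" "x \<noteq> \<zero>"
  shows "\<exists>u\<in>place_units V. \<exists>n::nat. x = u \<otimes> t [^] n"
proof (rule ccontr)
  assume no: "\<not> ?thesis"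
  have tc: "t \<in> carrier R" and xc: "x \<in> carrier R" using t x pV(1) by auto
  have tnV: "t [^] n \<in> V" for n :: nat by (induction n) (use t pV in auto)
  define J where "J = (\<Inter>n::nat. dilate (t [^] n) V)"
  have sub: "additive_subgroup (dilate (t [^] n) V) R" for n :: nat
    using dilate_additive_subgroup[OF subring_additive_subgroup[OF place_subring]] tc by auto
  have J: "ideal J (R\<lparr>carrier := V\<rparr>)"
    unfolding sub_ideal_iff[OF place_subring]
  proof (intro conjI ballI)
    have 1: "J \<subseteq> dilate (t [^] (0::nat)) V" unfolding J_def by blast
    then show JV: "J \<subseteq> V" using dilate_sub_ideal(2)[OF place_subring tnV[of 0]] by blast
    show "additive_subgroup J R"
    proof (rule additive_subgroupI')
      show "J \<subseteq> carrier R" using JV pV(1) by blast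
      show "\<zero> \<in> J" unfolding J_def using additive_subgroup.zero_closed[OF sub] by blast
      show "a \<oplus> b \<in> J" if "a \<in> J" "b \<in> J" for a b
        using that unfolding J_def using additive_subgroup.a_closed[OF sub] by blast
      show "\<ominus> a \<in> J" if "a \<in> J" for a
        using that unfolding J_def using additive_subgroup.a_inv_closed[OF sub] by blast
    qed
    fix a j assume aj: "a \<in> V" "j \<in> J"
    have "a \<otimes> j \<in> dilate (t [^] n) V" for n :: nat
    proof -
      have "j \<in> dilate (t [^] n) V" using aj unfolding J_def by blast
      then show ?thesis using dilate_sub_ideal(1)[OF place_subring tnV[of n]] aj(1) unfolding sub_ideal_iff[OF place_subring] by blast
    qed
    then show "a \<otimes> j \<in> J" unfolding J_def by blast
  qed
  have "x \<in> dilate (t [^] n) V" for n :: nat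
  proof (induction n)
    case 0
    have "x = t [^] (0::nat) \<otimes> x" using xc by simp
    then show ?case using x(1) unfolding dilate_def by blast
  next
    case (Suc n)
    then obtain v where v: "v \<in> V" "x = t [^] n \<otimes> v" unfolding dilate_def by blast
    have vc: "v \<in> carrier R" using v pV(1) by auto
    have "v \<notin> place_units V"
    proof
      assume "v \<in> place_units V"
      then show False using no v(2) m_comm[of "t [^] n" v] tc vc by auto
    qed
    then have "v \<in> dilate t V" using place_unit_iff v(1) t(3) by blast
    then obtain w where w: "w \<in> V" "v = t \<otimes> w" unfolding dilate_def by blast
    have "x = t [^] Suc n \<otimes> w" using v(2) w tc pV(1) by (auto simp: m_assoc subset_iff)
    then show ?case using w(1) unfolding dilate_def by blast
  qed
  then have xJ: "x \<in> J" unfolding J_def by blast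
  interpret S: principal_domain "R\<lparr>carrier := V\<rparr>" by (rule place_principal)
  obtain y where y: "y \<in> V" "J = dilate y V" using S.exists_gen[OF J] PIdl_sub[OF pV(1)] pV(1) by auto
  have yc: "y \<in> carrier R" using y pV(1) by auto
  have y0: "y \<noteq> \<zero>"
  proof
    assume "y = \<zero>"
    then have "dilate y V = {\<zero>}" unfolding dilate_def using pV(1,2) by (auto simp: subset_iff image_iff)
    then show False using xJ x(2) y(2) by simp
  qed
  have yJ: "y \<in> J" using dilate_sub_ideal(3)[OF place_subring y(1)] y(2) by simp
  then have "y \<in> dilate (t [^] (1::nat)) V" unfolding J_def by blast
  then obtain z where z: "z \<in> V" "y = t \<otimes> z" unfolding dilate_def using tc by auto
  have zc: "z \<in> carrier R" using z pV(1) by auto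
  have "z \<in> dilate (t [^] n) V" for n :: nat
  proof -
    have "y \<in> dilate (t [^] Suc n) V" using yJ unfolding J_def by blast
    then obtain w where w: "w \<in> V" "y = t [^] Suc n \<otimes> w" unfolding dilate_def by blast
    have wc: "w \<in> carrier R" using w pV(1) by auto
    have "t \<otimes> z = t \<otimes> (t [^] n \<otimes> w)" using w(2) z(2) tc wc by (simp add: m_ac)
    then have "z = t [^] n \<otimes> w" using m_lcancel[OF t(2) tc zc, of "t [^] n \<otimes> w"] tc wc by simp
    then show ?thesis using w(1) unfolding dilate_def by blast
  qed
  then have "z \<in> dilate y V" using y(2) unfolding J_def by blast
  then obtain s where s: "s \<in> V" "z = y \<otimes> s" unfolding dilate_def by blast
  have sc: "s \<in> carrier R" using s pV(1) by auto
  have "y \<otimes> \<one> = y \<otimes> (t \<otimes> s)" using z(2) s(2) yc tc sc by (simp add: m_ac)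
  then have "t \<otimes> s = \<one>" using m_lcancel[OF y0 yc, of \<one> "t \<otimes> s"] tc sc by simp
  then have "inv t = s" using inv_eqI tc sc by blast
  moreover have "t \<in> place_ideal R V" using t(3) dilate_sub_ideal(3)[OF place_subring t(1)] by simp
  ultimately show False using place_ideal_iff t(2) s(1) by blast
qed

lemma place_decomposition:
  assumes t: "t \<in> V" "t \<noteq> \<zero>" "place_ideal R V = dilate t V" and x: "x \<in> carrier R" "x \<noteq> \<zero>"
  shows "\<exists>u\<in>place_units V. \<exists>n::int. x = u \<otimes> t [^] n"
proof -
  have tc: "t \<in> carrier R" using t pV(1) by auto
  obtain a b where ab: "a \<in> V" "b \<in> V" "b \<noteq> \<zero>" "x = a \<otimes> inv b"
  proof -
    have "\<forall>x\<in>carrier R. \<exists>a\<in>V. \<exists>b\<in>V - {\<zero>}. x = a \<otimes> inv b" using V unfolding prime_divisors_def by simp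
    then show ?thesis using x(1) that by blast
  qed
  have bc: "b \<in> carrier R" using ab pV(1) by auto
  have a0: "a \<noteq> \<zero>" using ab(4) x inv_mem[OF bc ab(3)] by auto
  obtain u n where u: "u \<in> place_units V" "a = u \<otimes> t [^] (n::nat)" using place_decomposition_nat[OF t ab(1) a0] by blast
  obtain w m where w: "w \<in> place_units V" "b = w \<otimes> t [^] (m::nat)" using place_decomposition_nat[OF t ab(2,3)] by blast
  note uc = place_units_nonzero[OF u(1)] and wc = place_units_nonzero[OF w(1)]
  note tn = int_pow_field[OF tc t(2)]
  have "x = u \<otimes> t [^] n \<otimes> (inv w \<otimes> inv (t [^] m))" using ab(4) u(2) w(2) inv_m[OF wc, of "t [^] m"] tc pow_nonzero[OF tc t(2)] by simp
  also have "inv (t [^] m) = t [^] (- int m)" using tn(4)[of "int m"] by (simp add: int_pow_int)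
  also have "t [^] n = t [^] (int n)" by (simp add: int_pow_int)
  also have "u \<otimes> t [^] (int n) \<otimes> (inv w \<otimes> t [^] (- int m)) = (u \<otimes> inv w) \<otimes> (t [^] (int n) \<otimes> t [^] (- int m))"
    using uc(1) inv_mem[OF wc] tn(2)[of "int n"] tn(2)[of "- int m"] by (simp add: m_ac)
  also have "t [^] (int n) \<otimes> t [^] (- int m) = t [^] (int n - int m)" using tn(1)[of "int n" "- int m"] by simp
  finally have "x = (u \<otimes> inv w) \<otimes> t [^] (int n - int m)" .
  then show ?thesis using place_units_mult[OF u(1) place_units_inv[OF w(1)]] by blast
qed

lemma uniformizer_pow_unit:
  assumes t: "t \<in> V" "t \<noteq> \<zero>" "place_ideal R V = dilate t V" and "t [^] (n::int) \<in> place_units V"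
  shows "n = 0"
proof -
  have tc: "t \<in> carrier R" using t pV(1) by auto
  have tI: "t \<in> place_ideal R V" using t(3) dilate_sub_ideal(3)[OF place_subring t(1)] by simp
  have tnV: "t [^] n \<in> V" for n :: nat by (induction n) (use t pV in auto)
  have *: "t [^] Suc m \<notin> place_units V" for m :: nat
  proof -
    have "t [^] Suc m \<in> place_ideal R V" using place_ideal_props(3)[OF tnV[of m] tI] by simp
    then show ?thesis using place_unit_iff place_ideal_props(2) by blast
  qed
  show ?thesis
  proof (cases n "0::int" rule: linorder_cases)
    case less
    define m where "m = nat (- n) - 1"
    have m: "- n = int (Suc m)" using less by (simp add: m_def)
    have "t [^] (- n) \<in> place_units V" using place_units_inv[OF assms(4)] int_pow_field(4)[OF tc t(2), of n] by simp
    then show ?thesis using *[of m] unfolding m int_pow_int by blast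
  next
    case greater
    define m where "m = nat n - 1"
    have m: "n = int (Suc m)" using greater by (simp add: m_def)
    then show ?thesis using *[of m] assms(4) unfolding m int_pow_int by blast
  qed simp
qed

text \<open>The definition of \<open>place_ord\<close> quantifies over the uniformizer too, so
  uniqueness must compare two generators of the maximal ideal. They differ by a unit, whose power is
  absorbed into the unit part.\<close>

lemma place_ordI:
  assumes t: "t \<in> V" "t \<noteq> \<zero>" "place_ideal R V = dilate t V" and u: "u \<in> place_units V" and x: "x = u \<otimes> t [^] (n::int)"
  shows "place_ord R V x = n"
  unfolding place_ord_def
proof (rule the_equality)
  have U: "Units (R\<lparr>carrier := V\<rparr>) = place_units V" using sub_Units[OF place_subring] unfolding place_units_def .
  have tc: "t \<in> carrier R" using t pV(1) by auto
  show "\<exists>t\<in>V. \<exists>u\<in>Units (R\<lparr>carrier := V\<rparr>). place_ideal R V = PIdl\<^bsub>R\<lparr>carrier := V\<rparr>\<^esub> t \<and> x = u \<otimes> t [^] n"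
    using t u x PIdl_sub[OF pV(1) tc] unfolding U by auto
  fix m :: int assume "\<exists>t\<in>V. \<exists>u\<in>Units (R\<lparr>carrier := V\<rparr>). place_ideal R V = PIdl\<^bsub>R\<lparr>carrier := V\<rparr>\<^esub> t \<and> x = u \<otimes> t [^] m"
  then obtain s w where s: "s \<in> V" "w \<in> place_units V" "place_ideal R V = PIdl\<^bsub>R\<lparr>carrier := V\<rparr>\<^esub> s" "x = w \<otimes> s [^] m"
    unfolding U by blast
  have sc: "s \<in> carrier R" using s pV(1) by auto
  have sd: "place_ideal R V = dilate s V" using s(3) PIdl_sub[OF pV(1) sc] by simp
  have "s \<in> dilate t V" "t \<in> dilate s V" using sd t(3) dilate_sub_ideal(3)[OF place_subring] s(1) t(1) by auto
  then obtain a b where a: "a \<in> V" "s = t \<otimes> a" and b: "b \<in> V" "t = s \<otimes> b" unfolding dilate_def by blast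
  have c: "a \<in> carrier R" "b \<in> carrier R" using a b pV(1) by auto
  have a0: "a \<noteq> \<zero>" using a(2) b(2) t(2) tc c by auto
  have "t \<otimes> \<one> = t" using tc by simp
  also have "\<dots> = (t \<otimes> a) \<otimes> b" using b(2) unfolding a(2)[symmetric] .
  also have "\<dots> = t \<otimes> (a \<otimes> b)" using m_assoc[OF tc c] .
  finally have "t \<otimes> \<one> = t \<otimes> (a \<otimes> b)" .
  then have "a \<otimes> b = \<one>" using m_lcancel[OF t(2) tc, of \<one> "a \<otimes> b"] c by simp
  then have "inv a = b" using inv_eqI c by blast
  then have aU: "a \<in> place_units V" unfolding place_units_def using a a0 b by blast
  have amU: "a [^] m \<in> place_units V" using place_units_int_pow[OF aU] .
  note uc = place_units_nonzero[OF u] and wc = place_units_nonzero[OF s(2)] and ac = place_units_nonzero[OF amU]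
  note tn = int_pow_field[OF tc t(2)]
  have "u \<otimes> t [^] n = w \<otimes> (t [^] m \<otimes> a [^] m)" using x s(4) int_pow_mult_distrib[OF tc t(2) c(1) a0] a(2) by simp
  then have "inv u \<otimes> (u \<otimes> t [^] n) \<otimes> t [^] (- m) = inv u \<otimes> (w \<otimes> (t [^] m \<otimes> a [^] m)) \<otimes> t [^] (- m)" by simp
  moreover have "inv u \<otimes> (u \<otimes> t [^] n) \<otimes> t [^] (- m) = (inv u \<otimes> u) \<otimes> (t [^] n \<otimes> t [^] (- m))"
    using uc inv_mem[OF uc] tn(2) by (simp add: m_ac)
  moreover have "inv u \<otimes> (w \<otimes> (t [^] m \<otimes> a [^] m)) \<otimes> t [^] (- m) = (inv u \<otimes> (w \<otimes> a [^] m)) \<otimes> (t [^] m \<otimes> t [^] (- m))"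
    using uc inv_mem[OF uc] tn(2) wc ac by (simp add: m_ac)
  moreover have "t [^] n \<otimes> t [^] (- m) = t [^] (n - m)" "t [^] m \<otimes> t [^] (- m) = \<one>"
    using tn(1)[of n "- m"] tn(1)[of m "- m"] by simp_all
  ultimately have "t [^] (n - m) = inv u \<otimes> (w \<otimes> a [^] m)" using inv_l[OF uc] tn(2) uc inv_mem[OF uc] wc ac by simp
  then have "t [^] (n - m) \<in> place_units V"
    using place_units_mult[OF place_units_inv[OF u] place_units_mult[OF s(2) amU]] by simp
  then show "m = n" using uniformizer_pow_unit[OF t] by fastforce
qed

lemma place_ord_mult:
  assumes "x \<in> carrier R" "x \<noteq> \<zero>" "y \<in> carrier R" "y \<noteq> \<zero>"
  shows "place_ord R V (x \<otimes> y) = place_ord R V x + place_ord R V y"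
proof -
  obtain t where t: "t \<in> V" "t \<noteq> \<zero>" "place_ideal R V = dilate t V" by (rule uniformizer_exists)
  have tc: "t \<in> carrier R" using t pV(1) by auto
  obtain u n where u: "u \<in> place_units V" "x = u \<otimes> t [^] (n::int)" using place_decomposition[OF t assms(1,2)] by blast
  obtain w m where w: "w \<in> place_units V" "y = w \<otimes> t [^] (m::int)" using place_decomposition[OF t assms(3,4)] by blast
  note uc = place_units_nonzero[OF u(1)] and wc = place_units_nonzero[OF w(1)] and tn = int_pow_field[OF tc t(2)]
  have "x \<otimes> y = (u \<otimes> w) \<otimes> t [^] (n + m)" unfolding tn(1) u(2) w(2) using uc wc tn(2) by (simp add: m_ac)
  then have "place_ord R V (x \<otimes> y) = n + m" using place_ordI[OF t place_units_mult[OF u(1) w(1)]] by blast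
  then show ?thesis using place_ordI[OF t u] place_ordI[OF t w] by simp
qed

lemma place_ord_nonneg_iff:
  assumes "x \<in> carrier R" "x \<noteq> \<zero>"
  shows "0 \<le> place_ord R V x \<longleftrightarrow> x \<in> V" "1 \<le> place_ord R V x \<longleftrightarrow> x \<in> place_ideal R V"
proof -
  obtain t where t: "t \<in> V" "t \<noteq> \<zero>" "place_ideal R V = dilate t V" by (rule uniformizer_exists)
  have tc: "t \<in> carrier R" using t pV(1) by auto
  have tnV: "t [^] n \<in> V" for n :: nat by (induction n) (use t pV in auto)
  have tI: "t \<in> place_ideal R V" using t(3) dilate_sub_ideal(3)[OF place_subring t(1)] by simp
  obtain u n where u: "u \<in> place_units V" "x = u \<otimes> t [^] (n::int)" using place_decomposition[OF t assms(1,2)] by blast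
  note uc = place_units_nonzero[OF u(1)] and tn = int_pow_field[OF tc t(2)]
  have uV: "u \<in> V" using u(1) unfolding place_units_def by blast
  have o: "place_ord R V x = n" using place_ordI[OF t u] .
  have 1: "x \<in> V" if n0: "0 \<le> n"
  proof -
    define k where "k = nat n"
    have "n = int k" using n0 by (simp add: k_def)
    then have "x = u \<otimes> t [^] k" using u(2) by (simp add: int_pow_int)
    then show ?thesis using uV tnV pV(6) by blast
  qed
  have 2: "x \<in> place_ideal R V" if n1: "1 \<le> n"
  proof -
    define k where "k = nat n - 1"
    have k: "n = int (Suc k)" using n1 by (simp add: k_def)
    then have "x = u \<otimes> t [^] Suc k" using u(2) int_pow_int by metis
    moreover have "u \<otimes> t [^] k \<in> V" using uV tnV pV(6) by blast
    ultimately show ?thesis using place_ideal_props(3)[OF _ tI, of "u \<otimes> t [^] k"] uc tc by (simp add: m_assoc)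
  qed
  have 3: "x \<in> place_units V" if "n = 0" using u that uc by simp
  have 4: "x \<notin> V" if n4: "n < 0"
  proof
    assume xV: "x \<in> V"
    define k where "k = nat (- n) - 1"
    have k: "- n = int (Suc k)" using n4 by (simp add: k_def)
    have "x \<otimes> t [^] (- n) = u \<otimes> (t [^] n \<otimes> t [^] (- n))" unfolding u(2) using uc tn(2) by (simp add: m_assoc)
    also have "t [^] n \<otimes> t [^] (- n) = \<one>" using tn(1)[of n "- n"] by simp
    finally have "x \<otimes> t [^] (- n) = u" using uc by simp
    then have "u = (x \<otimes> t [^] k) \<otimes> t" unfolding k int_pow_int using assms(1) tc by (simp add: m_assoc)
    then have "u \<in> place_ideal R V" using place_ideal_props(3)[OF _ tI, of "x \<otimes> t [^] k"] pV(6)[OF xV tnV] by simp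
    then show False using place_unit_iff[OF uV] u(1) by blast
  qed
  show "0 \<le> place_ord R V x \<longleftrightarrow> x \<in> V" unfolding o using 1 4 by force
  have "x \<notin> place_ideal R V" if "n = 0" using 3[OF that] place_unit_iff place_ideal_props(2) by blast
  then show "1 \<le> place_ord R V x \<longleftrightarrow> x \<in> place_ideal R V" unfolding o using 2 4 place_ideal_props(2) by (cases n "0::int" rule: linorder_cases) auto
qed

lemma place_ord_one: "place_ord R V \<one> = 0"
  using place_ord_mult[of \<one> \<one>] by simp

lemma place_ord_inv: "x \<in> carrier R \<Longrightarrow> x \<noteq> \<zero> \<Longrightarrow> place_ord R V (inv x) = - place_ord R V x"
  using place_ord_mult[of x "inv x"] inv_mem inv_nz inv_r place_ord_one by auto

lemma place_ord_pow: "x \<in> carrier R \<Longrightarrow> x \<noteq> \<zero> \<Longrightarrow> place_ord R V (x [^] (n::nat)) = int n * place_ord R V x"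
  by (induction n) (auto simp: place_ord_one place_ord_mult pow_nonzero algebra_simps)

lemma uniformizer_ord: obtains t where "t \<in> carrier R" "t \<noteq> \<zero>" "place_ord R V t = 1"
proof -
  obtain t where t: "t \<in> V" "t \<noteq> \<zero>" "place_ideal R V = dilate t V" by (rule uniformizer_exists)
  have tc: "t \<in> carrier R" using t pV(1) by auto
  have "\<one> \<in> place_units V" unfolding place_units_def using pV(3) by simp
  moreover have "t = \<one> \<otimes> t [^] (1::int)" using int_pow_field(5)[OF tc t(2)] tc by simp
  ultimately show ?thesis using that tc t place_ordI[OF t] by blast
qed

lemma place_valuation: "x \<in> carrier R \<Longrightarrow> x \<noteq> \<zero> \<Longrightarrow> x \<in> V \<or> inv x \<in> V"
  using place_ord_nonneg_iff(1)[of x] place_ord_nonneg_iff(1)[of "inv x"] place_ord_inv[of x] inv_mem inv_nz by force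

end

end

section \<open>Approximation at finitely many places\<close>

text \<open>Fractional ideals at a place. Zero is added explicitly because \<open>place_ord\<close>
  has no meaningful value there.\<close>

definition fid :: "('a, 'b) ring_scheme \<Rightarrow> 'a set \<Rightarrow> int \<Rightarrow> 'a set" where
  "fid K P n = {x \<in> carrier K. x = \<zero>\<^bsub>K\<^esub> \<or> n \<le> place_ord K P x}"

lemma (in cring) minus_identities:
  assumes "a \<in> carrier R" "b \<in> carrier R" "c \<in> carrier R" "d \<in> carrier R"
  shows "a \<ominus> b = ((a \<oplus> c) \<ominus> (b \<oplus> d)) \<ominus> (c \<ominus> d)" "(b \<oplus> c) \<ominus> (b \<oplus> d) = c \<ominus> d"
    "a \<ominus> b = ((c \<ominus> d) \<ominus> (c \<ominus> a)) \<oplus> (d \<ominus> b)" "a \<ominus> (a \<oplus> b) = \<ominus> b"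
    "c \<otimes> (a \<ominus> b) = c \<otimes> a \<ominus> c \<otimes> b"
  using assms by (algebra; simp)+

context field begin

lemma fidI: "x \<in> carrier R \<Longrightarrow> (x \<noteq> \<zero> \<Longrightarrow> n \<le> place_ord R P x) \<Longrightarrow> x \<in> fid R P n"
  unfolding fid_def by blast

lemma fid_carrier: "fid R P n \<subseteq> carrier R" unfolding fid_def by blast

lemma fidD: "x \<in> fid R P n \<Longrightarrow> x \<noteq> \<zero> \<Longrightarrow> n \<le> place_ord R P x" unfolding fid_def by blast

lemma fid_antimono: "m \<le> n \<Longrightarrow> fid R P n \<subseteq> fid R P m" unfolding fid_def by auto

context
  fixes P assumes P: "P \<in> prime_divisors R"
begin

lemma fid_0: "fid R P 0 = P"
  using place_ord_nonneg_iff(1)[OF P] subringE(1,2)[OF place_subring[OF P]] unfolding fid_def by auto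

lemma fid_1: "fid R P 1 = place_ideal R P"
  using place_ord_nonneg_iff(2)[OF P] place_ideal_props(2)[OF P] subringE(1)[OF place_subring[OF P]]
    additive_subgroup.zero_closed[OF place_ideal_props(1)[OF P]] unfolding fid_def by auto

lemma fid_mult:
  assumes "a \<in> fid R P m" "b \<in> fid R P n" shows "a \<otimes> b \<in> fid R P (m + n)"
proof (rule fidI)
  have c: "a \<in> carrier R" "b \<in> carrier R" using assms fid_carrier by auto
  then show "a \<otimes> b \<in> carrier R" by simp
  assume "a \<otimes> b \<noteq> \<zero>"
  then have nz: "a \<noteq> \<zero>" "b \<noteq> \<zero>" using c by auto
  show "m + n \<le> place_ord R P (a \<otimes> b)"
    using place_ord_mult[OF P c(1) nz(1) c(2) nz(2)] fidD[OF assms(1) nz(1)] fidD[OF assms(2) nz(2)] by simp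
qed

text \<open>Write x + y as y (x/y + 1): the second factor lies in the valuation ring because x/y
  does.\<close>

lemma place_ord_add_aux:
  assumes x: "x \<in> carrier R" "x \<noteq> \<zero>" and y: "y \<in> carrier R" "y \<noteq> \<zero>" and s: "x \<oplus> y \<noteq> \<zero>"
    and le: "place_ord R P y \<le> place_ord R P x"
  shows "place_ord R P y \<le> place_ord R P (x \<oplus> y)"
proof -
  let ?z = "inv y \<otimes> x"
  have iy: "inv y \<in> carrier R" "inv y \<noteq> \<zero>" using inv_mem[OF y] inv_nz[OF y] by auto
  have z: "?z \<in> carrier R" "?z \<noteq> \<zero>" using iy x by (auto simp: integral_iff)
  have "place_ord R P ?z = place_ord R P x - place_ord R P y"
    using place_ord_mult[OF P iy x] place_ord_inv[OF P y] by simp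
  then have "?z \<in> P" using place_ord_nonneg_iff(1)[OF P z] le by simp
  then have zP: "?z \<oplus> \<one> \<in> P" using subringE(3,7)[OF place_subring[OF P]] by blast
  have "y \<otimes> (?z \<oplus> \<one>) = (y \<otimes> inv y) \<otimes> x \<oplus> y" using x y iy by (simp add: r_distr m_assoc)
  then have e: "y \<otimes> (?z \<oplus> \<one>) = x \<oplus> y" using x inv_r[OF y] by simp
  have nz: "?z \<oplus> \<one> \<noteq> \<zero>" using e s y by auto
  have "place_ord R P (x \<oplus> y) = place_ord R P y + place_ord R P (?z \<oplus> \<one>)"
    using place_ord_mult[OF P y _ nz] z e by simp
  then show ?thesis using place_ord_nonneg_iff(1)[OF P _ nz] zP z by simp
qed

text \<open>The ultrametric inequality, in the form in which it is used from here on.\<close>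

lemma fid_additive_subgroup: "additive_subgroup (fid R P n) R"
proof (rule additive_subgroupI')
  show "fid R P n \<subseteq> carrier R" by (rule fid_carrier)
  show "\<zero> \<in> fid R P n" by (rule fidI) auto
  show "\<ominus> a \<in> fid R P n" if a: "a \<in> fid R P n" for a
  proof -
    have ac: "a \<in> carrier R" using a fid_carrier by blast
    have m1: "\<ominus> \<one> \<in> fid R P 0" unfolding fid_0 using subringE(3,5)[OF place_subring[OF P]] by blast
    have "(\<ominus> \<one>) \<otimes> a = \<ominus> a" using ac by (simp add: l_minus)
    then show ?thesis using fid_mult[OF m1 a] by simp
  qed
  show "a \<oplus> b \<in> fid R P n" if ab: "a \<in> fid R P n" "b \<in> fid R P n" for a b
  proof (rule fidI)
    have c: "a \<in> carrier R" "b \<in> carrier R" using ab fid_carrier by auto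
    then show "a \<oplus> b \<in> carrier R" by simp
    assume s: "a \<oplus> b \<noteq> \<zero>"
    show "n \<le> place_ord R P (a \<oplus> b)"
    proof (cases "a = \<zero> \<or> b = \<zero>")
      case True then show ?thesis using c s ab fidD by fastforce
    next
      case False
      then have o: "n \<le> place_ord R P a" "n \<le> place_ord R P b" using ab fidD by auto
      have s': "b \<oplus> a \<noteq> \<zero>" "b \<oplus> a = a \<oplus> b" using s c by (auto simp: a_comm)
      show ?thesis
      proof (cases "place_ord R P b \<le> place_ord R P a")
        case True
        then have "place_ord R P b \<le> place_ord R P (a \<oplus> b)" using place_ord_add_aux[of a b] c s False by blast
        then show ?thesis using o by simp
      next
        case F: False
        then have "place_ord R P a \<le> place_ord R P (b \<oplus> a)" using place_ord_add_aux[of b a] c s' False by simp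
        then show ?thesis using o s' by simp
      qed
    qed
  qed
qed

lemma place_ord_add_dominant:
  assumes x: "x \<in> carrier R" "x \<noteq> \<zero>" and y: "y \<in> fid R P (place_ord R P x + 1)"
  shows "x \<oplus> y \<noteq> \<zero>" "place_ord R P (x \<oplus> y) = place_ord R P x"
proof -
  let ?o = "place_ord R P x"
  have yc: "y \<in> carrier R" using y fid_carrier by blast
  have nx: "x \<notin> fid R P (?o + 1)" using fidD[of x P "?o + 1"] x by auto
  have "x \<oplus> y \<notin> fid R P (?o + 1)"
  proof
    assume "x \<oplus> y \<in> fid R P (?o + 1)"
    then have "(x \<oplus> y) \<ominus> y \<in> fid R P (?o + 1)" using additive_subgroup_minus[OF fid_additive_subgroup _ y] by blast
    then show False using nx minus_minus_cancel(4)[OF x(1) yc yc] by simp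
  qed
  moreover have "x \<oplus> y \<in> fid R P ?o"
  proof -
    have "x \<in> fid R P ?o" "y \<in> fid R P ?o" using x y fid_antimono[of ?o "?o + 1" P] by (auto intro: fidI)
    then show ?thesis by (rule additive_subgroup.a_closed[OF fid_additive_subgroup])
  qed
  ultimately show "x \<oplus> y \<noteq> \<zero>" "place_ord R P (x \<oplus> y) = ?o" unfolding fid_def using x yc by auto
qed

lemma place_norm_cosets: "place_norm R P = card (cosets (fid R P 0) (fid R P 1))"
proof -
  have "a_rcosets\<^bsub>R\<lparr>carrier := P\<rparr>\<^esub> (place_ideal R P) = cosets P (place_ideal R P)"
    unfolding A_RCOSETS_def' cosets_def a_r_coset_def' by auto
  then show ?thesis unfolding place_norm_def FactRing_def fid_0 fid_1 by simp
qed

text \<open>A discrete valuation ring is a maximal proper subring. If x in Q had a pole at P, then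
  1/(t x^m), with t a uniformizer at Q, would lie in P for large m and therefore in Q, although its
  order at Q is at most -1.\<close>

lemma place_maximal:
  assumes Q: "Q \<in> prime_divisors R" and "P \<subseteq> Q" shows "P = Q"
proof
  show "Q \<subseteq> P"
  proof
    fix x assume x: "x \<in> Q"
    show "x \<in> P"
    proof (rule ccontr)
      assume nx: "x \<notin> P"
      have xc: "x \<in> carrier R" using x subringE(1)[OF place_subring[OF Q]] by blast
      have x0: "x \<noteq> \<zero>" using nx subringE(2)[OF place_subring[OF P]] by auto
      obtain t where t: "t \<in> carrier R" "t \<noteq> \<zero>" "place_ord R Q t = 1" by (rule uniformizer_ord[OF Q])
      have it: "inv t \<in> carrier R" "inv t \<noteq> \<zero>" using inv_mem[OF t(1,2)] inv_nz[OF t(1,2)] by auto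
      have o: "place_ord R P x < 0" using place_ord_nonneg_iff(1)[OF P xc x0] nx by simp
      define m where "m = nat (\<bar>place_ord R P (inv t)\<bar>)"
      have xm: "x [^] m \<in> carrier R" "x [^] m \<noteq> \<zero>" using xc x0 pow_nonzero by auto
      let ?y = "inv t \<otimes> inv (x [^] m)"
      have ix: "inv (x [^] m) \<in> carrier R" "inv (x [^] m) \<noteq> \<zero>" using inv_mem[OF xm] inv_nz[OF xm] by auto
      have y: "?y \<in> carrier R" "?y \<noteq> \<zero>" using it ix by (auto simp: integral_iff)
      have "place_ord R P ?y = place_ord R P (inv t) - int m * place_ord R P x"
        using place_ord_mult[OF P it ix] place_ord_inv[OF P xm] place_ord_pow[OF P xc x0] by simp
      moreover have "int m * place_ord R P x \<le> int m * (-1)" using o by (intro mult_left_mono) auto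
      ultimately have "0 \<le> place_ord R P ?y" unfolding m_def by simp
      then have "?y \<in> Q" using place_ord_nonneg_iff(1)[OF P y] assms(2) by blast
      then have "0 \<le> place_ord R Q ?y" using place_ord_nonneg_iff(1)[OF Q y] by simp
      moreover have "place_ord R Q ?y = - 1 - int m * place_ord R Q x"
        using place_ord_mult[OF Q it ix] place_ord_inv[OF Q xm] place_ord_inv[OF Q t(1,2)] t(3) place_ord_pow[OF Q xc x0] by simp
      moreover have "0 \<le> place_ord R Q x" using place_ord_nonneg_iff(1)[OF Q xc x0] x by simp
      ultimately show False by (smt (verit) mult_nonneg_nonneg of_nat_0_le_iff)
    qed
  qed
qed (rule assms(2))

end

lemma separate_two_places:
  assumes P: "P \<in> prime_divisors R" and Q: "Q \<in> prime_divisors R" and "P \<noteq> Q"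
  obtains u where "u \<in> carrier R" "u \<noteq> \<zero>" "0 < place_ord R P u" "place_ord R Q u < 0"
proof -
  obtain a where a: "a \<in> P" "a \<notin> Q" using place_maximal[OF P Q] assms(3) by blast
  obtain b where b: "b \<in> Q" "b \<notin> P" using place_maximal[OF Q P] assms(3) by blast
  have ac: "a \<in> carrier R" "a \<noteq> \<zero>" using a subringE(1)[OF place_subring[OF P]] subringE(2)[OF place_subring[OF Q]] by auto
  have bc: "b \<in> carrier R" "b \<noteq> \<zero>" using b subringE(1)[OF place_subring[OF Q]] subringE(2)[OF place_subring[OF P]] by auto
  have ib: "inv b \<in> carrier R" "inv b \<noteq> \<zero>" using inv_mem[OF bc] inv_nz[OF bc] by auto
  have "0 \<le> place_ord R P a" "place_ord R Q a < 0" "0 \<le> place_ord R Q b" "place_ord R P b < 0"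
    using place_ord_nonneg_iff(1)[OF P ac] place_ord_nonneg_iff(1)[OF Q ac] place_ord_nonneg_iff(1)[OF Q bc]
      place_ord_nonneg_iff(1)[OF P bc] a b by auto
  then have "0 < place_ord R P (a \<otimes> inv b)" "place_ord R Q (a \<otimes> inv b) < 0"
    using place_ord_mult[OF P ac ib] place_ord_mult[OF Q ac ib] place_ord_inv[OF P bc] place_ord_inv[OF Q bc] by auto
  moreover have "a \<otimes> inv b \<in> carrier R" "a \<otimes> inv b \<noteq> \<zero>" using ac ib by (auto simp: integral_iff)
  ultimately show ?thesis using that by blast
qed

text \<open>Let y serve for \<open>T\<close> and let u separate P from the new place Q. The exponent
  m exceeds all orders of y that matter, so at each place of T or at Q the orders of y and u^m
  differ, nothing cancels in y + u^m, and the smaller order, a negative one, survives.\<close>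

lemma separate_places:
  assumes P: "P \<in> prime_divisors R" and T: "finite T" "T \<subseteq> prime_divisors R" "P \<notin> T"
  shows "\<exists>z. z \<in> carrier R \<and> z \<noteq> \<zero> \<and> 0 < place_ord R P z \<and> (\<forall>Q\<in>T. place_ord R Q z < 0)"
  using T
proof (induction T rule: finite_induct)
  case empty
  obtain t where "t \<in> carrier R" "t \<noteq> \<zero>" "place_ord R P t = 1" by (rule uniformizer_ord[OF P])
  then show ?case by auto
next
  case (insert Q T)
  have Q: "Q \<in> prime_divisors R" "P \<noteq> Q" using insert by auto
  obtain y where y: "y \<in> carrier R" "y \<noteq> \<zero>" "0 < place_ord R P y" "\<forall>Q\<in>T. place_ord R Q y < 0"
    using insert by auto
  obtain u where u: "u \<in> carrier R" "u \<noteq> \<zero>" "0 < place_ord R P u" "place_ord R Q u < 0"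
    by (rule separate_two_places[OF P Q])
  define m where "m = Suc (nat (\<Sum>Q'\<in>insert Q T. \<bar>place_ord R Q' y\<bar>))"
  have um: "u [^] m \<in> carrier R" "u [^] m \<noteq> \<zero>" using u pow_nonzero by auto
  have m1: "0 < int m" unfolding m_def by (simp only: of_nat_0_less_iff zero_less_Suc)
  have ordm: "place_ord R Q' (u [^] m) = int m * place_ord R Q' u" if "Q' \<in> prime_divisors R" for Q'
    using place_ord_pow[OF that u(1,2)] .
  have ne: "place_ord R Q' (u [^] m) \<noteq> place_ord R Q' y \<or> place_ord R Q' (u [^] m) = 0" if Q': "Q' \<in> insert Q T" for Q'
  proof (cases "place_ord R Q' u = 0")
    case True
    have "Q' \<in> prime_divisors R" using Q' insert.prems by blast
    then show ?thesis using ordm True by simp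
  next
    case False
    have Q'p: "Q' \<in> prime_divisors R" using Q' insert.prems by blast
    have "\<bar>place_ord R Q' y\<bar> \<le> (\<Sum>Q'\<in>insert Q T. \<bar>place_ord R Q' y\<bar>)"
      using member_le_sum[of Q' "insert Q T" "\<lambda>Q'. \<bar>place_ord R Q' y\<bar>"] Q' insert.hyps(1) by simp
    then have "\<bar>place_ord R Q' y\<bar> < int m" unfolding m_def by simp
    also have "int m * 1 \<le> int m * \<bar>place_ord R Q' u\<bar>" using False by (intro mult_left_mono) auto
    then have "int m \<le> \<bar>int m * place_ord R Q' u\<bar>" by (simp add: abs_mult)
    finally show ?thesis using ordm[OF Q'p] by auto
  qed
  have y_neg: "place_ord R Q' (y \<oplus> u [^] m) < 0 \<and> y \<oplus> u [^] m \<noteq> \<zero>" if Q': "Q' \<in> insert Q T" for Q'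
  proof -
    have Q'p: "Q' \<in> prime_divisors R" using Q' insert.prems by blast
    have neg: "place_ord R Q' y < 0 \<or> place_ord R Q' (u [^] m) < 0"
    proof (cases "Q' = Q")
      case True
      have "int m * place_ord R Q u < 0" using u(4) m1 by (simp add: mult_less_0_iff)
      then show ?thesis using True ordm[OF Q(1)] by simp
    qed (use Q' y(4) in auto)
    have neq: "place_ord R Q' (u [^] m) \<noteq> place_ord R Q' y" using ne[OF Q'] neg by auto
    show ?thesis
    proof (cases "place_ord R Q' y < place_ord R Q' (u [^] m)")
      case True
      have "u [^] m \<in> fid R Q' (place_ord R Q' y + 1)" using um True by (intro fidI) auto
      then show ?thesis using place_ord_add_dominant[OF Q'p y(1,2)] True neg by auto
    next
      case False
      then have "y \<in> fid R Q' (place_ord R Q' (u [^] m) + 1)" using y neq by (intro fidI) auto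
      then show ?thesis using place_ord_add_dominant[OF Q'p um, of y] False neg a_comm[OF y(1) um(1)] by auto
    qed
  qed
  have pos: "0 < place_ord R P (y \<oplus> u [^] m)"
  proof -
    have "0 < int m * place_ord R P u" using u(3) m1 by simp
    then have "1 \<le> place_ord R P (u [^] m)" using ordm[OF P] by simp
    then have "y \<in> fid R P 1" "u [^] m \<in> fid R P 1" using y um by (auto intro!: fidI)
    then have "y \<oplus> u [^] m \<in> fid R P 1" by (rule additive_subgroup.a_closed[OF fid_additive_subgroup[OF P]])
    then show ?thesis using fidD[of "y \<oplus> u [^] m" P 1] y_neg[of Q] by auto
  qed
  show ?case using pos y_neg y(1) um(1) by (intro exI[of _ "y \<oplus> u [^] m"]) auto
qed

text \<open>With z of positive order at P and negative order at the other places, 1/(1 + z^m) tends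
  to 1 at P and to 0 elsewhere. So x = a/(1 + z^m) works for large m; the error at P is -x
  z^m.\<close>

lemma weak_approximation:
  assumes P: "P \<in> prime_divisors R" and T: "finite T" "T \<subseteq> prime_divisors R" and a: "a \<in> carrier R"
  shows "\<exists>x\<in>carrier R. x \<ominus> a \<in> fid R P n \<and> (\<forall>Q\<in>T - {P}. x \<in> fid R Q n)"
proof (cases "a = \<zero>")
  case True
  have "\<zero> \<in> fid R Q n" for Q by (rule fidI) auto
  then show ?thesis using True by (intro bexI[of _ \<zero>]) (auto simp: a_minus_def)
next
  case a0: False
  obtain z where z: "z \<in> carrier R" "z \<noteq> \<zero>" "0 < place_ord R P z" "\<forall>Q\<in>T - {P}. place_ord R Q z < 0"
    using separate_places[OF P, of "T - {P}"] T by blast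
  define m where "m = Suc (nat (\<bar>n\<bar> + \<bar>place_ord R P a\<bar> + (\<Sum>Q\<in>T. \<bar>place_ord R Q a\<bar>)))"
  have S0: "0 \<le> (\<Sum>Q\<in>T. \<bar>place_ord R Q a\<bar>)" by (intro sum_nonneg) auto
  then have "int m = 1 + (\<bar>n\<bar> + \<bar>place_ord R P a\<bar> + (\<Sum>Q\<in>T. \<bar>place_ord R Q a\<bar>))" unfolding m_def by simp
  then have m1: "0 < int m" "n \<le> int m + place_ord R P a" using S0 by linarith+
  have mQ: "n \<le> int m + place_ord R Q a" if "Q \<in> T" for Q
  proof -
    have "\<bar>place_ord R Q a\<bar> \<le> (\<Sum>Q\<in>T. \<bar>place_ord R Q a\<bar>)"
      using member_le_sum[of Q T "\<lambda>Q. \<bar>place_ord R Q a\<bar>"] that T(1) by simp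
    then show ?thesis unfolding m_def by simp
  qed
  have zm: "z [^] m \<in> carrier R" "z [^] m \<noteq> \<zero>" using z pow_nonzero by auto
  have zP: "int m \<le> place_ord R P (z [^] m)"
    using place_ord_pow[OF P z(1,2), of m] z(3) mult_left_mono[of 1 "place_ord R P z" "int m"] by simp
  have zQ: "place_ord R Q (z [^] m) \<le> - int m" if "Q \<in> T - {P}" for Q
  proof -
    have "place_ord R Q z < 0" using z(4) that by blast
    then have "Q \<in> prime_divisors R" "place_ord R Q z \<le> -1" using that T by auto
    then show ?thesis using place_ord_pow[OF _ z(1,2), of Q m] mult_left_mono[of "place_ord R Q z" "-1" "int m"] by simp
  qed
  let ?d = "\<one> \<oplus> z [^] m"
  have "z [^] m \<in> fid R P (place_ord R P \<one> + 1)" using zm zP place_ord_one[OF P] m1 by (intro fidI) auto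
  then have d: "?d \<noteq> \<zero>" "place_ord R P ?d = 0" using place_ord_add_dominant[OF P one_closed] place_ord_one[OF P] by auto
  have dc: "?d \<in> carrier R" using zm by simp
  have dQ: "place_ord R Q ?d \<le> - int m" if Q: "Q \<in> T - {P}" for Q
  proof -
    have Qp: "Q \<in> prime_divisors R" using Q T by auto
    have "\<one> \<in> fid R Q (place_ord R Q (z [^] m) + 1)"
      using zQ[OF Q] place_ord_one[OF Qp] m1 by (intro fidI) auto
    then show ?thesis using place_ord_add_dominant(2)[OF Qp zm, of \<one>] zQ[OF Q] a_comm[OF one_closed zm(1)] by simp
  qed
  note id = inv_mem[OF dc d(1)] inv_nz[OF dc d(1)]
  let ?x = "a \<otimes> inv ?d"
  have xc: "?x \<in> carrier R" "?x \<noteq> \<zero>" using a a0 id by (auto simp: integral_iff)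
  have "?x \<otimes> ?d = a" using a id dc inv_l[OF dc d(1)] by (simp add: m_assoc)
  moreover have "?x \<otimes> ?d = ?x \<oplus> ?x \<otimes> z [^] m" using xc zm by (simp add: r_distr)
  ultimately have ax: "a = ?x \<oplus> ?x \<otimes> z [^] m" by simp
  have "?x \<ominus> (?x \<oplus> ?x \<otimes> z [^] m) = \<ominus> (?x \<otimes> z [^] m)" using minus_identities(4)[OF xc(1) m_closed[OF xc(1) zm(1)]] xc zm by blast
  then have xa: "?x \<ominus> a = \<ominus> (?x \<otimes> z [^] m)" unfolding ax[symmetric] .
  have "?x \<otimes> z [^] m \<in> fid R P n"
  proof (rule fidI)
    show "?x \<otimes> z [^] m \<in> carrier R" using xc zm by simp
    have "place_ord R P (?x \<otimes> z [^] m) = place_ord R P a + place_ord R P (z [^] m)"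
      using place_ord_mult[OF P xc zm] place_ord_mult[OF P a a0 id] place_ord_inv[OF P dc d(1)] d(2) by simp
    then show "n \<le> place_ord R P (?x \<otimes> z [^] m)" using zP m1 by simp
  qed
  then have 1: "?x \<ominus> a \<in> fid R P n" unfolding xa by (rule additive_subgroup.a_inv_closed[OF fid_additive_subgroup[OF P]])
  have 2: "?x \<in> fid R Q n" if Q: "Q \<in> T - {P}" for Q
  proof (rule fidI)
    have Qp: "Q \<in> prime_divisors R" using Q T by auto
    have "place_ord R Q ?x = place_ord R Q a - place_ord R Q ?d"
      using place_ord_mult[OF Qp a a0 id] place_ord_inv[OF Qp dc d(1)] by simp
    then show "n \<le> place_ord R Q ?x" using dQ[OF Q] mQ[of Q] Q by simp
  qed (rule xc(1))
  show ?thesis using 1 2 xc(1) by blast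
qed

text \<open>Half of the Chinese remainder theorem, by induction on the total exponent. To raise the
  exponent at P by one, add y f(a) to the elements already found: y has order exactly D P - 1 at P
  and high order at the other places, a runs through representatives of the residue field at P, and
  f(a) approximates a at P and is integral elsewhere.\<close>

lemma approximation_reps:
  assumes T: "finite T" "T \<subseteq> prime_divisors R" and fin: "\<And>P. P \<in> T \<Longrightarrow> finite (cosets (fid R P 0) (fid R P 1))"
  shows "\<exists>W\<subseteq>{x \<in> carrier R. \<forall>P\<in>T. x \<in> fid R P 0}. finite W \<and> card W = (\<Prod>P\<in>T. place_norm R P ^ D P) \<and>
     (\<forall>w\<in>W. \<forall>w'\<in>W. (\<forall>P\<in>T. w \<ominus> w' \<in> fid R P (int (D P))) \<longrightarrow> w = w')"
proof (induction "\<Sum>P\<in>T. D P" arbitrary: D)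
  case 0
  then have "\<forall>P\<in>T. D P = 0" using T by simp
  then have "(\<Prod>P\<in>T. place_norm R P ^ D P) = 1" by simp
  moreover have "\<zero> \<in> fid R P 0" for P by (rule fidI) auto
  ultimately show ?case by (intro exI[of _ "{\<zero>}"]) auto
next
  case (Suc s)
  then have "\<exists>P\<in>T. D P \<noteq> 0" using T(1) by (metis sum.neutral nat.distinct(1))
  then obtain P where P: "P \<in> T" "D P \<noteq> 0" by blast
  define D' where "D' = D(P := D P - 1)"
  have Pp: "P \<in> prime_divisors R" using P T by blast
  have "(\<Sum>Q\<in>T. D Q) = Suc (\<Sum>Q\<in>T. D' Q)"
    using P T(1) by (simp add: sum.remove[of T P] D'_def)
  then have "s = (\<Sum>Q\<in>T. D' Q)" using Suc.hyps(2) by simp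
  from Suc.hyps(1)[OF this] obtain W where W: "W \<subseteq> {x \<in> carrier R. \<forall>P\<in>T. x \<in> fid R P 0}" "finite W"
    "card W = (\<Prod>P\<in>T. place_norm R P ^ D' P)"
    "\<And>w w'. w \<in> W \<Longrightarrow> w' \<in> W \<Longrightarrow> (\<forall>P\<in>T. w \<ominus> w' \<in> fid R P (int (D' P))) \<Longrightarrow> w = w'" by blast
  note f0 = fid_additive_subgroup[OF Pp, of 0] and f1 = fid_additive_subgroup[OF Pp, of 1]
  obtain Z where Z: "Z \<subseteq> fid R P 0" "inj_on (\<lambda>a. fid R P 1 +> a) Z" "(\<lambda>a. fid R P 1 +> a) ` Z = cosets (fid R P 0) (fid R P 1)"
    using cosets_incongruent[OF f1 fid_carrier order_refl] by metis
  have finZ: "finite Z" using Z(2,3) fin[OF P(1)] finite_imageD by metis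
  have cardZ: "card Z = place_norm R P" using card_image[OF Z(2)] Z(3) place_norm_cosets[OF Pp] by simp
  have "\<exists>x. \<forall>a\<in>Z. x a \<in> carrier R \<and> x a \<ominus> a \<in> fid R P 1 \<and> (\<forall>Q\<in>T - {P}. x a \<in> fid R Q 1)"
  proof (intro bchoice ballI)
    fix a assume "a \<in> Z"
    then have "a \<in> carrier R" using Z fid_carrier by blast
    from weak_approximation[OF Pp T this, of 1]
    show "\<exists>x. x \<in> carrier R \<and> x \<ominus> a \<in> fid R P 1 \<and> (\<forall>Q\<in>T - {P}. x \<in> fid R Q 1)" by blast
  qed
  then obtain f where f: "\<And>a. a \<in> Z \<Longrightarrow> f a \<in> carrier R" "\<And>a. a \<in> Z \<Longrightarrow> f a \<ominus> a \<in> fid R P 1"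
    "\<And>a Q. a \<in> Z \<Longrightarrow> Q \<in> T - {P} \<Longrightarrow> f a \<in> fid R Q 1" by blast
  have f0P: "f a \<in> fid R Q 0" if a: "a \<in> Z" and Q: "Q \<in> T" for a Q
  proof (cases "Q = P")
    case True
    have "a \<in> fid R P 0" using a Z(1) by blast
    then have ac: "a \<in> carrier R" "a \<in> fid R P 0" using fid_carrier by blast+
    have "f a \<ominus> a \<in> fid R P 0" using f(2)[OF a] fid_antimono[of 0 1 P] by auto
    then have "(f a \<ominus> a) \<oplus> a \<in> fid R P 0" using additive_subgroup.a_closed[OF f0 _ ac(2)] by blast
    then show ?thesis using minus_minus_cancel(3)[OF f(1)[OF a] ac(1) ac(1)] True by simp
  next
    case False then show ?thesis using f(3)[OF a, of Q] Q fid_antimono[of 0 1 Q] by auto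
  qed
  obtain t where t: "t \<in> carrier R" "t \<noteq> \<zero>" "place_ord R P t = 1" by (rule uniformizer_ord[OF Pp])
  let ?td = "t [^] (D P - 1)"
  have td: "?td \<in> carrier R" "?td \<noteq> \<zero>" "place_ord R P ?td = int (D P) - 1"
    using t pow_nonzero place_ord_pow[OF Pp t(1,2), of "D P - 1"] P(2) by auto
  define n where "n = int (\<Sum>Q\<in>T. D Q)"
  have Dn: "int (D Q) \<le> n" if "Q \<in> T" for Q unfolding n_def of_nat_le_iff using member_le_sum[of Q T D] that T(1) by simp
  obtain y where y: "y \<in> carrier R" "y \<ominus> ?td \<in> fid R P n" "\<forall>Q\<in>T - {P}. y \<in> fid R Q n"
    using weak_approximation[OF Pp T td(1), of n] by blast
  have "y \<ominus> ?td \<in> fid R P (place_ord R P ?td + 1)" using y(2) fid_antimono[of "place_ord R P ?td + 1" n P] Dn[OF P(1)] td(3) by auto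
  then have "?td \<oplus> (y \<ominus> ?td) \<noteq> \<zero>" "place_ord R P (?td \<oplus> (y \<ominus> ?td)) = int (D P) - 1"
    using place_ord_add_dominant[OF Pp td(1,2)] td(3) by auto
  then have yo: "y \<noteq> \<zero>" "place_ord R P y = int (D P) - 1"
    using minus_minus_cancel(5)[OF y(1) td(1) td(1)] by auto
  have yD': "y \<in> fid R Q (int (D' Q))" if Q: "Q \<in> T" for Q
  proof (cases "Q = P")
    case True
    then show ?thesis using yo y(1) P(2) unfolding D'_def by (intro fidI) auto
  next
    case False
    then show ?thesis using y(3) Q Dn[OF Q] fid_antimono[of "int (D' Q)" n Q] unfolding D'_def by auto
  qed
  have D'le: "int (D' Q) \<le> int (D Q)" "0 \<le> int (D' Q)" for Q unfolding D'_def by auto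
  let ?g = "\<lambda>(w, a). w \<oplus> y \<otimes> f a"
  have yf: "y \<otimes> f a \<in> fid R Q (int (D' Q))" "y \<otimes> f a \<in> carrier R" if "a \<in> Z" "Q \<in> T" for a Q
    using fid_mult[of Q y "int (D' Q)" "f a" 0] yD'[OF that(2)] f0P[OF that] that(2) T(2) y(1) f(1)[OF that(1)] by auto
  have Wc: "w \<in> carrier R" "\<And>Q. Q \<in> T \<Longrightarrow> w \<in> fid R Q 0" if "w \<in> W" for w using that W(1) by auto
  have key: "w = w' \<and> a = a'" if A: "w \<in> W" "a \<in> Z" "w' \<in> W" "a' \<in> Z"
    and e: "\<And>Q. Q \<in> T \<Longrightarrow> (w \<oplus> y \<otimes> f a) \<ominus> (w' \<oplus> y \<otimes> f a') \<in> fid R Q (int (D Q))" for w a w' a'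
  proof -
    have c: "w \<in> carrier R" "w' \<in> carrier R" "y \<otimes> f a \<in> carrier R" "y \<otimes> f a' \<in> carrier R"
      using Wc A yf(2)[OF _ P(1)] by auto
    have d1: "w \<ominus> w' = ((w \<oplus> y \<otimes> f a) \<ominus> (w' \<oplus> y \<otimes> f a')) \<ominus> (y \<otimes> f a \<ominus> y \<otimes> f a')"
      using minus_identities(1)[OF c] .
    have "w \<ominus> w' \<in> fid R Q (int (D' Q))" if Q: "Q \<in> T" for Q
    proof -
      have Qp: "Q \<in> prime_divisors R" using Q T by blast
      have s: "(w \<oplus> y \<otimes> f a) \<ominus> (w' \<oplus> y \<otimes> f a') \<in> fid R Q (int (D' Q))" using e[OF Q] fid_antimono[OF D'le(1)] by blast
      note am = additive_subgroup_minus[OF fid_additive_subgroup[OF Qp]]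
      show ?thesis unfolding d1 by (rule am[OF s am[OF yf(1)[OF A(2) Q] yf(1)[OF A(4) Q]]])
    qed
    then have ww: "w = w'" using W(4)[OF A(1,3)] by blast
    have fc: "f a \<in> carrier R" "f a' \<in> carrier R" using f(1) A by auto
    have "(w \<oplus> y \<otimes> f a) \<ominus> (w' \<oplus> y \<otimes> f a') = y \<otimes> (f a \<ominus> f a')"
      unfolding ww using minus_identities(2)[OF c(1) c(2) c(3,4)] minus_identities(5)[OF fc y(1) y(1)] by simp
    then have yy: "y \<otimes> (f a \<ominus> f a') \<in> fid R P (int (D P))" using e[OF P(1)] by simp
    have "f a \<ominus> f a' \<in> fid R P 1"
    proof (rule fidI)
      show fm: "f a \<ominus> f a' \<in> carrier R" using fc by simp
      assume nz: "f a \<ominus> f a' \<noteq> \<zero>"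
      then have "int (D P) \<le> place_ord R P (y \<otimes> (f a \<ominus> f a'))" using fidD[OF yy] y(1) yo(1) fm by (simp add: integral_iff)
      then show "1 \<le> place_ord R P (f a \<ominus> f a')" using place_ord_mult[OF Pp y(1) yo(1) fm nz] yo(2) by simp
    qed
    moreover have ac: "a \<in> carrier R" "a' \<in> carrier R" using A Z(1) fid_carrier by blast+
    have "a \<ominus> a' = ((f a \<ominus> f a') \<ominus> (f a \<ominus> a)) \<oplus> (f a' \<ominus> a')"
      using minus_identities(3)[OF ac fc] .
    ultimately have "a \<ominus> a' \<in> fid R P 1"
      using additive_subgroup.a_closed[OF f1 additive_subgroup_minus[OF f1 _ f(2)[OF A(2)]] f(2)[OF A(4)]] by simp
    then have "fid R P 1 +> a = fid R P 1 +> a'" using coset_eq_iff[OF f1 ac] by blast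
    then have "a = a'" using inj_onD[OF Z(2) _ A(2,4)] by simp
    then show ?thesis using ww by simp
  qed
  have zero: "\<zero> \<in> fid R Q n" for Q n by (rule fidI) auto
  have inj: "inj_on ?g (W \<times> Z)"
  proof (rule inj_onI, clarify)
    fix w a w' a' assume A: "w \<in> W" "a \<in> Z" "w' \<in> W" "a' \<in> Z" "w \<oplus> y \<otimes> f a = w' \<oplus> y \<otimes> f a'"
    have "w' \<oplus> y \<otimes> f a' \<in> carrier R" using Wc(1)[OF A(3)] yf(2)[OF A(4) P(1)] by simp
    then have "(w \<oplus> y \<otimes> f a) \<ominus> (w' \<oplus> y \<otimes> f a') = \<zero>" using A(5) r_neg unfolding a_minus_def by simp
    then show "w = w' \<and> a = a'" using key[OF A(1-4)] zero by simp
  qed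
  have "(\<Prod>Q\<in>T. place_norm R Q ^ D Q) = place_norm R P * (\<Prod>Q\<in>T. place_norm R Q ^ D' Q)"
  proof -
    have "(\<Prod>Q\<in>T - {P}. place_norm R Q ^ D' Q) = (\<Prod>Q\<in>T - {P}. place_norm R Q ^ D Q)" unfolding D'_def by (intro prod.cong) auto
    moreover have "place_norm R P ^ D P = place_norm R P * place_norm R P ^ D' P" using P(2) unfolding D'_def by (cases "D P") auto
    ultimately show ?thesis using prod.remove[OF T(1) P(1), of "\<lambda>Q. place_norm R Q ^ D Q"] prod.remove[OF T(1) P(1), of "\<lambda>Q. place_norm R Q ^ D' Q"] by simp
  qed
  then have card: "card (?g ` (W \<times> Z)) = (\<Prod>Q\<in>T. place_norm R Q ^ D Q)"
    using card_image[OF inj] W(3) cardZ by (simp add: card_cartesian_product mult.commute)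
  have sub: "?g ` (W \<times> Z) \<subseteq> {x \<in> carrier R. \<forall>P\<in>T. x \<in> fid R P 0}"
  proof (clarify, intro conjI ballI)
    fix w a assume A: "w \<in> W" "a \<in> Z"
    show "w \<oplus> y \<otimes> f a \<in> carrier R" using Wc(1)[OF A(1)] yf(2)[OF A(2) P(1)] by simp
    fix Q assume Q: "Q \<in> T"
    then have Qp: "Q \<in> prime_divisors R" using T by blast
    have "y \<otimes> f a \<in> fid R Q 0" using yf(1)[OF A(2) Q] fid_antimono[OF D'le(2)] by blast
    then show "w \<oplus> y \<otimes> f a \<in> fid R Q 0" using additive_subgroup.a_closed[OF fid_additive_subgroup[OF Qp] Wc(2)[OF A(1) Q]] by blast
  qed
  show ?case
  proof (intro exI[of _ "?g ` (W \<times> Z)"] conjI sub card ballI impI)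
    show "finite (?g ` (W \<times> Z))" using W(2) finZ by simp
    fix v v' assume "v \<in> ?g ` (W \<times> Z)" "v' \<in> ?g ` (W \<times> Z)" and vv: "\<forall>P\<in>T. v \<ominus> v' \<in> fid R P (int (D P))"
    then obtain w a w' a' where A: "w \<in> W" "a \<in> Z" "w' \<in> W" "a' \<in> Z" and v: "v = w \<oplus> y \<otimes> f a" "v' = w' \<oplus> y \<otimes> f a'" by auto
    have "w = w' \<and> a = a'" by (rule key[OF A]) (use vv v in auto)
    then show "v = v'" using v by simp
  qed
qed

end

section \<open>Torsion elements and function fields\<close>

context field begin

text \<open>Zero and the roots of unity. Over a finite field these are the algebraic elements, here
  described without polynomials.\<close>

definition torsion :: "'a \<Rightarrow> bool" where
  "torsion c \<longleftrightarrow> c = \<zero> \<or> (\<exists>m::nat. 0 < m \<and> c [^] m = \<one>)"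

lemma torsion_of_finite_powers:
  assumes y: "y \<in> carrier R" and fin: "finite (range (\<lambda>m::nat. y [^] m))" shows "torsion y"
proof (cases "y = \<zero>")
  case y0: False
  have "\<not> inj (\<lambda>m::nat. y [^] m)" using fin finite_imageD infinite_UNIV_nat by blast
  then obtain i j :: nat where ij: "i < j" "y [^] i = y [^] j" unfolding inj_def by (metis linorder_neqE_nat)
  have "y [^] j = y [^] i \<otimes> y [^] (j - i)" using ij(1) y nat_pow_mult[OF y, of i "j - i"] by simp
  then have "y [^] i \<otimes> \<one> = y [^] i \<otimes> y [^] (j - i)" using ij(2) y by simp
  then have "y [^] (j - i) = \<one>" by (metis m_lcancel pow_nonzero[OF y y0] nat_pow_closed[OF y] one_closed)
  moreover have "0 < j - i" using ij(1) by simp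
  ultimately show ?thesis unfolding torsion_def by blast
qed (simp add: torsion_def)

lemma finite_pols_card:
  assumes "finite S" shows "finite (pols S y n)" "card (pols S y n) \<le> card S ^ Suc n"
proof -
  have "finite (pols S y n) \<and> card (pols S y n) \<le> card S ^ Suc n"
  proof (induction n)
    case (Suc n)
    have e: "pols S y (Suc n) = (\<lambda>(a, b). a \<oplus> y \<otimes> b) ` (S \<times> pols S y n)" by force
    have "card (pols S y (Suc n)) \<le> card (S \<times> pols S y n)" unfolding e by (rule card_image_le) (use Suc assms in simp)
    also have "\<dots> \<le> card S * card S ^ Suc n" using Suc by (simp add: card_cartesian_product)
    finally show ?case using Suc assms unfolding e by simp
  qed (use assms in simp)
  then show "finite (pols S y n)" "card (pols S y n) \<le> card S ^ Suc n" by auto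
qed

text \<open>The relation folds degree n + 1 back to degree n, so all powers of y stay in one finite
  set and two of them coincide.\<close>

lemma integral_imp_torsion:
  assumes F: "subring F R" "finite F" and y: "y \<in> carrier R" and e: "y [^] Suc n \<in> pols F y n" shows "torsion y"
proof -
  note Fa = subring_additive_subgroup[OF F(1)] and Fr = subringE[OF F(1)]
  note padd = pols_additive_subgroup[OF Fa y]
  have shift: "y \<otimes> b \<in> pols F y n" if b: "b \<in> pols F y n" for b
  proof -
    obtain s a where s: "s \<in> pols F y n" "a \<in> F" "y \<otimes> b = s \<oplus> a \<otimes> y [^] Suc n"
      using pols_top[OF Fa y pols_shift[OF Fa y b]] by blast
    have "a \<otimes> y [^] Suc n \<in> pols F y n"
      using pols_smult[OF Fa y _ _ e, of a F] s(2) Fr(1,6) by blast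
    then show ?thesis using s(1,3) additive_subgroup.a_closed[OF padd] by simp
  qed
  have "y [^] m \<in> pols F y n" for m :: nat
  proof (induction m)
    case 0 then show ?case using pols_base[OF Fa y] Fr(3) by auto
  next
    case (Suc m) then show ?case using shift[OF Suc] y m_comm[of y "y [^] m"] by simp
  qed
  then have "finite (range (\<lambda>m::nat. y [^] m))" using finite_subset[OF _ finite_pols_card(1)[OF F(2), of y n]] by blast
  then show ?thesis by (rule torsion_of_finite_powers[OF y])
qed

lemma pols_subring:
  assumes F: "subring F R" and z: "z \<in> carrier R"
  shows "subring (\<Union>n. pols F z n) R" "F \<subseteq> (\<Union>n. pols F z n)" "z \<in> (\<Union>n. pols F z n)"
proof -
  note Fa = subring_additive_subgroup[OF F] and Fr = subringE[OF F]
  \<comment> \<open>With the zero ideal the construction of pairs becomes a statement about the ring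
    F[z] alone.\<close>
  have p0: "ring_ideal_pair F {\<zero>}"
    unfolding ring_ideal_pair_def using F Fr by (auto intro!: additive_subgroupI')
  have pz: "pols {\<zero>} z n = {\<zero>}" for n by (induction n) (use z in auto)
  have "ring_ideal_pair (\<Union>n. pols F z n) (\<Union>n. pols {\<zero>} z n)" by (rule pols_pair[OF p0 z]) (simp add: pz)
  then show "subring (\<Union>n. pols F z n) R" unfolding ring_ideal_pair_def by blast
  show "F \<subseteq> (\<Union>n. pols F z n)" using pols_base[OF Fa z, of 0] by blast
  have "z \<otimes> \<one> \<in> pols F z (Suc 0)" by (rule pols_shift[OF Fa z]) (use Fr(3) in simp)
  then have "z \<in> pols F z (Suc 0)" using r_one[OF z] by metis
  then show "z \<in> (\<Union>n. pols F z n)" by blast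
qed

text \<open>If \<open>\<one> = y\<inverse> b\<close> with \<open>b \<in> F[y\<inverse>]\<close>, multiplying by a power of \<open>y\<close> makes \<open>y\<close> integral over \<open>F\<close>.\<close>

lemma transcendental_pair:
  assumes F: "subring F R" "finite F" and y: "y \<in> carrier R" "\<not> torsion y"
  shows "ring_ideal_pair (\<Union>n. pols F (inv y) n) (dilate (inv y) (\<Union>n. pols F (inv y) n))"
    "inv y \<in> dilate (inv y) (\<Union>n. pols F (inv y) n)"
proof -
  have y0: "y \<noteq> \<zero>" using y unfolding torsion_def by auto
  note Fa = subring_additive_subgroup[OF F(1)]
  define z where "z = inv y"
  have z: "z \<in> carrier R" "z \<noteq> \<zero>" unfolding z_def using inv_mem[OF y(1) y0] inv_nz[OF y(1) y0] by auto
  define A where "A = (\<Union>n. pols F z n)"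
  have sub: "subring A R" and zA: "z \<in> A" unfolding A_def using pols_subring[OF F(1) z(1)] by auto
  have n1: "\<one> \<notin> dilate z A"
  proof
    assume "\<one> \<in> dilate z A"
    then obtain n b where b: "b \<in> pols F z n" "\<one> = z \<otimes> b" unfolding dilate_def A_def by blast
    have bc: "b \<in> carrier R" using b pols_in_carrier[OF Fa z(1)] by blast
    have "y [^] n \<otimes> b \<in> pols F y n" using pols_reverse[OF Fa y(1) y0, of b n n] b(1) unfolding z_def by simp
    moreover have "y [^] Suc n = y [^] n \<otimes> b"
    proof -
      have "y [^] Suc n = y [^] Suc n \<otimes> (z \<otimes> b)" unfolding b(2)[symmetric] using y by simp
      also have "\<dots> = (y \<otimes> z) \<otimes> (y [^] n \<otimes> b)" using y z bc by (simp add: m_ac)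
      also have "y \<otimes> z = \<one>" unfolding z_def using inv_r[OF y(1) y0] .
      finally show ?thesis using y bc by simp
    qed
    ultimately show False using integral_imp_torsion[OF F y(1), of n] y(2) by simp
  qed
  have "ring_ideal_pair A (dilate z A)"
    unfolding ring_ideal_pair_def
    using sub dilate_additive_subgroup[OF subring_additive_subgroup[OF sub] z(1)] n1
      dilate_sub_ideal(1)[OF sub zA] unfolding sub_ideal_iff[OF sub] by blast
  then show "ring_ideal_pair (\<Union>n. pols F (inv y) n) (dilate (inv y) (\<Union>n. pols F (inv y) n))"
    unfolding A_def z_def .
  show "inv y \<in> dilate (inv y) (\<Union>n. pols F (inv y) n)" using dilate_sub_ideal(3)[OF sub zA] unfolding A_def z_def .
qed

text \<open>If c^m = 1 and c is not in V, then 1/c is in V, but c equals (1/c)^(m-1).\<close>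

lemma torsion_in_valuation_ring:
  assumes V: "subring V R" and val: "\<And>z. z \<in> carrier R \<Longrightarrow> z \<noteq> \<zero> \<Longrightarrow> z \<in> V \<or> inv z \<in> V"
    and c: "c \<in> carrier R" "torsion c" shows "c \<in> V"
proof (cases "c = \<zero> \<or> c \<in> V")
  case False
  note Vs = subringE[OF V]
  have c0: "c \<noteq> \<zero>" "inv c \<in> V" using False val[OF c(1)] by auto
  obtain m :: nat where m: "0 < m" "c [^] m = \<one>" using c(2) c0(1) unfolding torsion_def by blast
  obtain r where r: "m = Suc r" using m(1) by (cases m) auto
  have "inv c [^] r \<in> V" by (induction r) (use c0 Vs in auto)
  moreover have "inv c [^] r = c"
  proof -
    have ic: "inv c \<in> carrier R" using inv_mem[OF c(1) c0(1)] .
    have "c [^] r \<otimes> inv c [^] r = (c \<otimes> inv c) [^] r" using nat_pow_distrib[OF c(1) ic, of r] by simp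
    then have 1: "c [^] r \<otimes> inv c [^] r = \<one>" using inv_r[OF c(1) c0(1)] by simp
    have "inv c [^] r = (c [^] r \<otimes> c) \<otimes> inv c [^] r" using m(2) r c ic by simp
    also have "\<dots> = c \<otimes> (c [^] r \<otimes> inv c [^] r)" using c ic by (simp add: m_ac)
    finally show ?thesis using 1 c by simp
  qed
  ultimately show ?thesis by simp
qed (use subringE(2)[OF V] in auto)

end

text \<open>These hypotheses, unlike a presentation over \<open>\<bbbF>\<^sub>p(x)\<close>, pass easily to constant field extensions.\<close>

locale ffield = field K for K (structure) +
  fixes k :: "'a set" and q :: nat and B :: "nat \<Rightarrow> 'a set" and C :: nat
  assumes k: "k = constant_field K" and q: "q = card k" and k_finite: "finite k" and k_subfield: "subfield k K"
    and k_torsion: "\<And>c. c \<in> k \<longleftrightarrow> c \<in> carrier K \<and> (c = \<zero> \<or> (\<exists>m::nat. 0 < m \<and> c [^] m = \<one>))"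
    and growth: "growth K B C" and nonconst: "\<exists>y\<in>carrier K. y \<notin> k"
begin

abbreviation PD where "PD \<equiv> prime_divisors K"
abbreviation ordP where "ordP \<equiv> place_ord K"

lemmas k_ring = subringE[OF subfieldE(1)[OF k_subfield]]

lemma k_additive: "additive_subgroup k K"
  using subring_additive_subgroup[OF subfieldE(1)[OF k_subfield]] .

lemma q_ge_2: "2 \<le> q"
proof -
  have "card {\<zero>, \<one>} \<le> card k" using k_ring(2,3) k_finite by (intro card_mono) auto
  then show ?thesis using q one_not_zero by simp
qed

lemma k_in_place: "P \<in> PD \<Longrightarrow> k \<subseteq> P"
  unfolding prime_divisors_def k by simp

lemma k_inv: "c \<in> k \<Longrightarrow> c \<noteq> \<zero> \<Longrightarrow> inv c \<in> k"
  using subfield_m_inv(1)[OF k_subfield] by simp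

lemma ord_const:
  assumes P: "P \<in> PD" and c: "c \<in> k" "c \<noteq> \<zero>" shows "ordP P c = 0"
proof -
  have cc: "c \<in> carrier K" using c k_ring(1) by auto
  have "0 \<le> ordP P c" using place_ord_nonneg_iff(1)[OF P cc c(2)] c k_in_place[OF P] by blast
  moreover have "0 \<le> ordP P (inv c)"
    using place_ord_nonneg_iff(1)[OF P inv_mem[OF cc c(2)] inv_nz[OF cc c(2)]] k_inv[OF c] k_in_place[OF P] by blast
  ultimately show ?thesis using place_ord_inv[OF P cc c(2)] by simp
qed

lemma index_finite:
  assumes "y \<in> carrier K" "y \<noteq> \<zero>" "additive_subgroup H K" "dilate y H \<subseteq> H"
  shows "finite (cosets H (dilate y H))"
proof -
  obtain N where "\<And>H. additive_subgroup H K \<Longrightarrow> dilate y H \<subseteq> H \<Longrightarrow>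
      finite (cosets H (dilate y H)) \<and> card (cosets H (dilate y H)) \<le> N" using index_bound[OF growth assms(1,2)] by blast
  then show ?thesis using assms(3,4) by blast
qed

text \<open>The maximal ideal is tP, so the index bound for multiplication by the uniformizer t
  applies to the residue field.\<close>

lemma residue_finite: assumes P: "P \<in> PD" shows "finite (cosets (fid K P 0) (fid K P 1))"
proof -
  obtain t where t: "t \<in> P" "t \<noteq> \<zero>" "place_ideal K P = dilate t P" by (rule uniformizer_exists[OF P])
  note sr = place_subring[OF P]
  have tc: "t \<in> carrier K" using t(1) subringE(1)[OF sr] by blast
  show ?thesis unfolding fid_0[OF P] fid_1[OF P] t(3)
    by (rule index_finite[OF tc t(2) subring_additive_subgroup[OF sr] dilate_sub_ideal(2)[OF sr t(1)]])
qed

lemma card_span: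
  assumes "independent k Us" shows "finite (Span k Us) \<and> card (Span k Us) = q ^ length Us"
  using assms
proof (induction Us rule: list.induct)
  case Nil
  then show ?case by simp
next
  case (Cons u Us)
  have ind: "independent k Us" and u: "u \<notin> Span k Us" "u \<in> carrier K"
    using Cons.prems by (auto elim: independent.cases)
  have Uc: "set Us \<subseteq> carrier K" using independent_in_carrier[OF ind] .
  let ?E = "Span k Us"
  have IH: "finite ?E" "card ?E = q ^ length Us" using Cons.IH[OF ind] by auto
  note sp = Span_subgroup_props[OF k_subfield Uc]
  have Ec: "?E \<subseteq> carrier K" using sp(1) .
  have Eadd: "additive_subgroup ?E K" using sp by (intro additive_subgroupI') auto
  let ?g = "\<lambda>(a, v). a \<otimes> u \<oplus> v"
  have "Span k (u # Us) = line_extension k u ?E" by simp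
  then have eq: "Span k (u # Us) = ?g ` (k \<times> ?E)" using line_extension_mem_iff[of _ k u ?E] by force
  have inj: "inj_on ?g (k \<times> ?E)"
  proof (rule inj_onI, clarify)
    fix a v a' v' assume A: "a \<in> k" "v \<in> ?E" "a' \<in> k" "v' \<in> ?E" "a \<otimes> u \<oplus> v = a' \<otimes> u \<oplus> v'"
    have c: "a \<in> carrier K" "a' \<in> carrier K" "v \<in> carrier K" "v' \<in> carrier K" using A k_ring(1) Ec by auto
    have "(a \<ominus> a') \<otimes> u = a \<otimes> u \<ominus> a' \<otimes> u" using c u by (simp add: a_minus_def l_distr l_minus)
    also have "\<dots> = ((a \<otimes> u \<oplus> v) \<ominus> (a' \<otimes> u \<oplus> v')) \<ominus> (v \<ominus> v')"
      using minus_identities(1)[of "a \<otimes> u" "a' \<otimes> u" v v'] c u by simp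
    also have "\<dots> = \<zero> \<ominus> (v \<ominus> v')" unfolding A(5) using c u by (simp add: a_minus_def r_neg)
    finally have "(a \<ominus> a') \<otimes> u \<in> ?E"
      using additive_subgroup_minus[OF Eadd] additive_subgroup.zero_closed[OF Eadd] A(2,4) by simp
    moreover have "a \<ominus> a' \<in> k" using additive_subgroup_minus[OF k_additive A(1,3)] .
    ultimately have "a \<ominus> a' = \<zero>" using Span_m_inv_simprule[OF k_subfield Uc _ u(2), of "a \<ominus> a'"] u(1) by blast
    then have "a = a'" using c by simp
    then show "a = a' \<and> v = v'" using A(5) c u by simp
  qed
  show ?case unfolding eq using IH k_finite card_image[OF inj] q by (simp add: card_cartesian_product)
qed

lemma k_space_card:
  assumes E: "additive_subgroup E K" "\<And>a e. a \<in> k \<Longrightarrow> e \<in> E \<Longrightarrow> a \<otimes> e \<in> E" and fin: "finite E"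
  shows "card E = q ^ (ring.dim K over k) E"
proof -
  obtain Us where Us: "set Us = E" using finite_list[OF fin] by blast
  have Uc: "set Us \<subseteq> carrier K" using Us additive_subgroup.a_subset[OF E(1)] by blast
  have "subalgebra k E K" using E(1) E(2) by (auto simp: subalgebra_def subalgebra_axioms_def additive_subgroup_def)
  then have "Span k Us = E" using subalgebra_Span_incl[OF k_subfield, of E Us] Span_base_incl[OF k_subfield Uc] Us by auto
  then have "finite_dimension k E" using Span_finite_dimension[OF k_subfield Uc] by simp
  then have "dimension ((dim over k) E) k E" using finite_dimensionE[OF k_subfield] by blast
  then obtain Vs where Vs: "independent k Vs" "length Vs = (dim over k) E" "Span k Vs = E" using exists_base[OF k_subfield] by blast
  then show ?thesis using card_span[OF Vs(1)] by simp
qed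

lemma k_smult_fid:
  assumes P: "P \<in> PD" and "a \<in> k" "x \<in> fid K P n" shows "a \<otimes> x \<in> fid K P n"
  using fid_mult[OF P, of a 0 x n] assms fid_0[OF P] k_in_place[OF P] by auto

text \<open>The residue field is a vector space over \<open>k\<close>, but only as a quotient.
  Instead take the span E of representatives inside K: the residue field has as many elements as E
  modulo its intersection with the maximal ideal. Both spaces have q-power cardinality, hence so
  does the quotient. The degree is positive because 0 and 1 are incongruent.\<close>

lemma place_norm_power:
  assumes P: "P \<in> PD" shows "place_norm K P = q ^ place_degree K P" "0 < place_degree K P"
proof -
  note f0 = fid_additive_subgroup[OF P, of 0] and f1 = fid_additive_subgroup[OF P, of 1]
  obtain Z where Z: "Z \<subseteq> fid K P 0" "inj_on (\<lambda>a. fid K P 1 +> a) Z" "(\<lambda>a. fid K P 1 +> a) ` Z = cosets (fid K P 0) (fid K P 1)"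
    using cosets_incongruent[OF f1 fid_carrier order_refl] by metis
  have finZ: "finite Z" using Z(2,3) residue_finite[OF P] finite_imageD by metis
  obtain Us where Us: "set Us = Z" using finite_list[OF finZ] by blast
  have Uc: "set Us \<subseteq> carrier K" using Us Z(1) fid_carrier by blast
  let ?E = "Span k Us"
  have finE: "finite ?E"
  proof -
    have "finite_dimension k ?E" using Span_finite_dimension[OF k_subfield Uc] .
    then have "dimension ((dim over k) ?E) k ?E" using finite_dimensionE[OF k_subfield] by blast
    then obtain Vs where Vs: "independent k Vs" "Span k Vs = ?E" using exists_base[OF k_subfield] by blast
    then show ?thesis using card_span[OF Vs(1)] by simp
  qed
  note sp = Span_subgroup_props[OF k_subfield Uc] and sm = Span_smult_closed[OF k_subfield Uc]
  have Eadd: "additive_subgroup ?E K" using sp by (intro additive_subgroupI') auto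
  have ZE: "Z \<subseteq> ?E" using Span_base_incl[OF k_subfield Uc] Us by simp
  have "subalgebra k (fid K P 0) K" using f0 k_smult_fid[OF P] by (auto simp: subalgebra_def subalgebra_axioms_def additive_subgroup_def)
  then have E0: "?E \<subseteq> fid K P 0" using subalgebra_Span_incl[OF k_subfield, of "fid K P 0" Us] Us Z(1) by auto
  let ?I = "?E \<inter> fid K P 1"
  have Iadd: "additive_subgroup ?I K"
    using sp additive_subgroup.zero_closed[OF f1] additive_subgroup.a_closed[OF f1] additive_subgroup.a_inv_closed[OF f1]
    by (intro additive_subgroupI') auto
  have "card (cosets ?E ?I) \<le> card (cosets (fid K P 0) (fid K P 1))" "finite (cosets ?E ?I)"
    using cosets_card_mono[OF Iadd f1 sp(1) fid_carrier residue_finite[OF P], of "\<lambda>x. x"] E0 additive_subgroup_minus[OF Eadd] by auto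
  moreover have "card (cosets (fid K P 0) (fid K P 1)) \<le> card (cosets ?E ?I)"
  proof -
    have "inj_on (\<lambda>a. ?I +> a) Z"
    proof (rule inj_onI)
      fix a b assume A: "a \<in> Z" "b \<in> Z" "?I +> a = ?I +> b"
      have c: "a \<in> carrier K" "b \<in> carrier K" using A(1,2) Z(1) fid_carrier by blast+
      then have "a \<ominus> b \<in> fid K P 1" using A(3) coset_eq_iff[OF Iadd c] by blast
      then have "fid K P 1 +> a = fid K P 1 +> b" using coset_eq_iff[OF f1 c] by blast
      then show "a = b" using inj_onD[OF Z(2) _ A(1,2)] by simp
    qed
    then have "card Z = card ((\<lambda>a. ?I +> a) ` Z)" by (simp add: card_image)
    also have "\<dots> \<le> card (cosets ?E ?I)" using ZE \<open>finite (cosets ?E ?I)\<close> unfolding cosets_def by (intro card_mono) auto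
    finally show ?thesis using card_image[OF Z(2)] Z(3) by simp
  qed
  ultimately have eq: "card (cosets ?E ?I) = place_norm K P" unfolding place_norm_cosets[OF P] by simp
  have "card ?E = place_norm K P * card ?I"
    using cosets_finite_card(2)[OF Eadd Iadd _ \<open>finite (cosets ?E ?I)\<close>] finE eq by simp
  moreover have "card ?E = q ^ (dim over k) ?E" using k_space_card[OF Eadd sm finE] by simp
  moreover have "card ?I = q ^ (dim over k) ?I"
    using k_space_card[OF Iadd, OF _ finite_subset[OF _ finE]] sm k_smult_fid[OF P] by blast
  ultimately have pw: "q ^ (dim over k) ?E = place_norm K P * q ^ (dim over k) ?I" by simp
  obtain a b where ab: "q ^ a = place_norm K P * q ^ b" using pw by blast
  have le: "b \<le> a"
  proof -
    have "place_norm K P \<noteq> 0" using ab q_ge_2 by (metis mult_0 not_numeral_le_zero power_eq_0_iff)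
    then have "q ^ b \<le> q ^ a" unfolding ab by simp
    then show ?thesis using q_ge_2 by (simp add: power_le_imp_le_exp)
  qed
  have n: "place_norm K P = q ^ (a - b)"
  proof -
    have "q ^ (a - b) * q ^ b = place_norm K P * q ^ b" using ab le by (simp flip: power_add)
    then show ?thesis using q_ge_2 by simp
  qed
  have "place_degree K P = a - b"
    unfolding place_degree_def n k[symmetric] q[symmetric]
  proof (rule the_equality)
    fix d assume "q ^ (a - b) = q ^ d" then show "d = a - b" using q_ge_2 by (simp add: power_inject_exp)
  qed simp
  then show 1: "place_norm K P = q ^ place_degree K P" using n by simp
  have "place_norm K P \<noteq> 1"
  proof
    assume A: "place_norm K P = 1"
    have "{fid K P 1 +> \<zero>, fid K P 1 +> \<one>} \<subseteq> cosets (fid K P 0) (fid K P 1)"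
      unfolding cosets_def fid_0[OF P] using subringE(2,3)[OF place_subring[OF P]] by auto
    then have "fid K P 1 +> \<zero> = fid K P 1 +> \<one>"
      using A unfolding place_norm_cosets[OF P] by (auto simp: card_1_singleton_iff)
    then have "\<one> \<ominus> \<zero> \<in> fid K P 1" using coset_eq_iff[OF f1 one_closed zero_closed] by simp
    then have "\<one> \<in> place_ideal K P" unfolding fid_1[OF P] by (simp add: a_minus_def)
    then show False using place_ideal_iff[OF P, of \<one>] subringE(3)[OF place_subring[OF P]] by simp
  qed
  then show "0 < place_degree K P" using 1 by (cases "place_degree K P") auto
qed

text \<open>For a finite set T of zeros let H be the ring of elements integral at T. Approximation
  yields at least 2 ^ card T elements of H that are incongruent modulo the maximal ideals at T,
  hence modulo yH. The index bound does not depend on H, so it limits the size of T.\<close>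

lemma zeros_finite:
  assumes y: "y \<in> carrier K" "y \<noteq> \<zero>" shows "finite {P \<in> PD. 1 \<le> ordP P y}"
proof -
  obtain N where N: "\<And>H. additive_subgroup H K \<Longrightarrow> dilate y H \<subseteq> H \<Longrightarrow>
      finite (cosets H (dilate y H)) \<and> card (cosets H (dilate y H)) \<le> N" using index_bound[OF growth y] by blast
  have "card T \<le> N" if T: "finite T" "T \<subseteq> {P \<in> PD. 1 \<le> ordP P y}" for T
  proof -
    have TP: "T \<subseteq> PD" using T by auto
    let ?H = "{x \<in> carrier K. \<forall>P\<in>T. x \<in> fid K P 0}"
    obtain W where W: "W \<subseteq> ?H" "finite W" "card W = (\<Prod>P\<in>T. place_norm K P ^ 1)"
      "\<forall>w\<in>W. \<forall>w'\<in>W. (\<forall>P\<in>T. w \<ominus> w' \<in> fid K P (int 1)) \<longrightarrow> w = w'"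
      using approximation_reps[OF T(1) TP, of "\<lambda>_. 1"] residue_finite TP by blast
    have f: "additive_subgroup (fid K P 0) K" if "P \<in> T" for P using fid_additive_subgroup TP that by blast
    have H: "additive_subgroup ?H K"
    proof (rule additive_subgroupI')
      show "\<zero> \<in> ?H" using additive_subgroup.zero_closed[OF f] by auto
      show "a \<oplus> b \<in> ?H" if "a \<in> ?H" "b \<in> ?H" for a b using that additive_subgroup.a_closed[OF f] by auto
      show "\<ominus> a \<in> ?H" if "a \<in> ?H" for a using that additive_subgroup.a_inv_closed[OF f] by auto
    qed auto
    have yf: "y \<otimes> h \<in> fid K P 1" if "h \<in> ?H" "P \<in> T" for h P
    proof -
      have "P \<in> PD" "y \<in> fid K P 1" using that T(2) y(1) by (auto intro!: fidI)
      then show ?thesis using fid_mult[of P y 1 h 0] that by simp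
    qed
    have yH: "dilate y ?H \<subseteq> ?H"
    proof
      fix x assume "x \<in> dilate y ?H"
      then obtain h where h: "h \<in> ?H" "x = y \<otimes> h" unfolding dilate_def by blast
      have "x \<in> fid K P 0" if "P \<in> T" for P using yf[OF h(1) that] h(2) fid_antimono[of 0 1 P] by auto
      then show "x \<in> ?H" using h y by auto
    qed
    have yHa: "additive_subgroup (dilate y ?H) K" using dilate_additive_subgroup[OF H y(1)] .
    have inj: "inj_on (\<lambda>a. dilate y ?H +> a) W"
    proof (rule inj_onI)
      fix a b assume A: "a \<in> W" "b \<in> W" "dilate y ?H +> a = dilate y ?H +> b"
      have c: "a \<in> carrier K" "b \<in> carrier K" using A(1,2) W(1) by auto
      have "a \<ominus> b \<in> dilate y ?H" using A(3) coset_eq_iff[OF yHa c] by blast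
      then have "\<forall>P\<in>T. a \<ominus> b \<in> fid K P (int 1)" using yf unfolding dilate_def by auto
      then show "a = b" using W(4) A(1,2) by blast
    qed
    have "2 ^ card T = (\<Prod>P\<in>T. 2::nat)" by simp
    also have "\<dots> \<le> (\<Prod>P\<in>T. place_norm K P ^ 1)"
    proof (rule prod_mono)
      fix P assume "P \<in> T"
      then have "P \<in> PD" using TP by blast
      then have "q ^ 1 \<le> place_norm K P" using place_norm_power[of P] q_ge_2 power_increasing[of 1 "place_degree K P" q] by simp
      then show "0 \<le> (2::nat) \<and> 2 \<le> place_norm K P ^ 1" using q_ge_2 by simp
    qed
    also have "\<dots> = card ((\<lambda>a. dilate y ?H +> a) ` W)" using card_image[OF inj] W(3) by simp
    also have "\<dots> \<le> card (cosets ?H (dilate y ?H))"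
      using N[OF H yH] W(1) unfolding cosets_def by (intro card_mono) auto
    also have "\<dots> \<le> N" using N[OF H yH] by blast
    finally show ?thesis using less_exp[of "card T"] by linarith
  qed
  then show ?thesis using finite_if_finite_subsets_card_bdd[of "{P \<in> PD. 1 \<le> ordP P y}" N] by blast
qed

lemma support_finite:
  assumes y: "y \<in> carrier K" "y \<noteq> \<zero>" shows "finite {P \<in> PD. ordP P y \<noteq> 0}"
proof -
  have "{P \<in> PD. ordP P y \<noteq> 0} \<subseteq> {P \<in> PD. 1 \<le> ordP P y} \<union> {P \<in> PD. 1 \<le> ordP P (inv y)}"
    using place_ord_inv[OF _ y] by auto
  then show ?thesis using zeros_finite[OF y] zeros_finite[OF inv_mem[OF y] inv_nz[OF y]] finite_subset by blast
qed

text \<open>The valuation ring from Chevalley's theorem is a place: members of the ideal are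
  nonunits, z keeps the ring from being the whole field, and the constants belong to it because they
  are zero or roots of unity.\<close>

lemma place_over_pair:
  assumes AI: "ring_ideal_pair A I" and z: "z \<in> I" "z \<noteq> \<zero>"
  obtains Q where "Q \<in> PD" "A \<subseteq> Q" "I \<subseteq> place_ideal K Q"
proof (rule chevalley_extension[OF AI])
  fix V J assume V: "A \<subseteq> V" "I \<subseteq> J" "ring_ideal_pair V J"
    "\<And>z. z \<in> carrier K \<Longrightarrow> z \<noteq> \<zero> \<Longrightarrow> z \<in> V \<or> inv z \<in> V"
  have Vr: "subring V K" and J: "J \<subseteq> V" "\<And>a j. a \<in> V \<Longrightarrow> j \<in> J \<Longrightarrow> a \<otimes> j \<in> J" "\<one> \<notin> J"
    using V(3) unfolding ring_ideal_pair_def by auto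
  have nu: "j \<in> V \<and> (j = \<zero> \<or> inv j \<notin> V)" if j: "j \<in> J" for j
  proof -
    have jc: "j \<in> carrier K" "j \<in> V" using j J(1) subringE(1)[OF Vr] by auto
    have "inv j \<notin> V" if nz: "j \<noteq> \<zero>"
    proof
      assume "inv j \<in> V"
      then have "inv j \<otimes> j \<in> J" using J(2) j by blast
      then show False using J(3) inv_l[OF jc(1) nz] by simp
    qed
    then show ?thesis using jc by blast
  qed
  have zV: "z \<in> V" "inv z \<notin> V" using nu[of z] z V(2) by auto
  have kV: "constant_field K \<subseteq> V"
    unfolding k[symmetric] using torsion_in_valuation_ring[OF Vr V(4)] k_torsion unfolding torsion_def by blast
  have "V \<in> PD" using valuation_ring_in_prime_divisors[OF growth Vr V(4) zV(1) z(2) zV(2) kV] by blast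
  moreover have "I \<subseteq> place_ideal K V" using calculation V(2) nu place_ideal_iff[of V] by blast
  ultimately show thesis using that V(1) by blast
qed

text \<open>The ideal generated by 1/y in k[1/y] is proper, since y is not torsion; a place over it
  makes 1/y vanish.\<close>

lemma pole_exists:
  assumes y: "y \<in> carrier K" "y \<notin> k" obtains P where "P \<in> PD" "ordP P y < 0"
proof -
  have y0: "y \<noteq> \<zero>" using y k_ring(2) by auto
  have nt: "\<not> torsion y" using k_torsion[of y] y unfolding torsion_def by blast
  have z: "inv y \<in> carrier K" "inv y \<noteq> \<zero>" using inv_mem[OF y(1) y0] inv_nz[OF y(1) y0] by auto
  note tp = transcendental_pair[OF subfieldE(1)[OF k_subfield] k_finite y(1) nt]
  show thesis
  proof (rule place_over_pair[OF tp z(2)])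
    fix Q assume Q: "Q \<in> PD" and I: "dilate (inv y) (\<Union>n. pols k (inv y) n) \<subseteq> place_ideal K Q"
    have "1 \<le> ordP Q (inv y)" using place_ord_nonneg_iff(2)[OF Q z] subsetD[OF I tp(2)] by blast
    then have "ordP Q y < 0" using place_ord_inv[OF Q y(1) y0] by simp
    then show thesis using that[OF Q] by blast
  qed
qed

lemma no_poles_imp_const:
  assumes "x \<in> carrier K" "x \<noteq> \<zero>" "\<And>P. P \<in> PD \<Longrightarrow> 0 \<le> ordP P x" shows "x \<in> k"
proof (rule ccontr)
  assume "x \<notin> k"
  then obtain P where "P \<in> PD" "ordP P x < 0" by (rule pole_exists[OF assms(1)])
  then show False using assms(3)[of P] by simp
qed

end

section \<open>Divisors and Riemann's theorem\<close>

abbreviation "lkp \<equiv> Poly_Mapping.lookup"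

context ffield begin

abbreviation dg where "dg P \<equiv> int (place_degree K P)"
abbreviation deg where "deg \<equiv> divisor_degree K"
abbreviation Div where "Div \<equiv> {D :: 'a set \<Rightarrow>\<^sub>0 int. Poly_Mapping.keys D \<subseteq> PD}"
abbreviation LL where "LL \<equiv> riemann_roch_space K"
abbreviation ll where "ll D \<equiv> int (riemann_roch_dim K D)"
text \<open>Riemann's theorem says that this quantity is bounded above; its maximum is the genus
  minus one.\<close>

abbreviation phi where "phi D \<equiv> deg D - ll D"
abbreviation eff where "eff \<equiv> effective_divisors K"

lemma dg_pos: "P \<in> PD \<Longrightarrow> 0 < dg P" using place_norm_power(2) by simp

lemma eff_iff: "D \<in> eff \<longleftrightarrow> D \<in> Div \<and> (\<forall>P. 0 \<le> lkp D P)"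
  unfolding effective_divisors_def by auto

lemma lkp_zero: "D \<in> Div \<Longrightarrow> P \<notin> PD \<Longrightarrow> lkp D P = 0"
  by (auto simp: in_keys_iff)

lemma Div_iff: "D \<in> Div \<longleftrightarrow> (\<forall>P. P \<notin> PD \<longrightarrow> lkp D P = 0)"
  by (auto simp: in_keys_iff)

lemma deg_superset:
  assumes "finite S" "Poly_Mapping.keys D \<subseteq> S" shows "deg D = (\<Sum>P\<in>S. lkp D P * dg P)"
  unfolding divisor_degree_def using assms by (intro sum.mono_neutral_left) (auto simp: in_keys_iff)

lemma deg_add: "deg (D + E) = deg D + deg E"
proof -
  let ?S = "Poly_Mapping.keys D \<union> Poly_Mapping.keys E"
  have "deg (D + E) = (\<Sum>P\<in>?S. lkp (D + E) P * dg P)" using keys_add[of D E] by (intro deg_superset) auto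
  also have "\<dots> = deg D + deg E"
    by (simp add: lookup_add distrib_right sum.distrib deg_superset[of ?S D] deg_superset[of ?S E])
  finally show ?thesis .
qed

lemma deg_0 [simp]: "deg 0 = 0" unfolding divisor_degree_def by simp

lemma deg_diff: "deg (D - E) = deg D - deg E" using deg_add[of "D - E" E] by simp

lemma deg_single [simp]: "deg (Poly_Mapping.single P n) = n * dg P"
  using deg_superset[of "{P}" "Poly_Mapping.single P n"] by simp

lemma deg_eff: "D \<in> eff \<Longrightarrow> 0 \<le> deg D"
  unfolding divisor_degree_def eff_iff by (intro sum_nonneg) auto

lemma Div_closed: "0 \<in> Div" "D \<in> Div \<Longrightarrow> E \<in> Div \<Longrightarrow> D + E \<in> Div" "D \<in> Div \<Longrightarrow> - D \<in> Div"
  "D \<in> Div \<Longrightarrow> E \<in> Div \<Longrightarrow> D - E \<in> Div" "P \<in> PD \<Longrightarrow> Poly_Mapping.single P n \<in> Div"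
  unfolding Div_iff by (auto simp: lookup_add lookup_minus lookup_single when_def)

lemma eff_induct [consumes 1, case_names zero add]:
  assumes E: "E \<in> eff" and Z: "Pr 0" and S: "\<And>E P. E \<in> eff \<Longrightarrow> P \<in> PD \<Longrightarrow> Pr E \<Longrightarrow> Pr (E + Poly_Mapping.single P 1)"
  shows "Pr E"
  using E
proof (induction "nat (deg E)" arbitrary: E rule: less_induct)
  case less
  show ?case
  proof (cases "E = 0")
    case True then show ?thesis using Z by simp
  next
    case False
    then obtain P where P: "P \<in> Poly_Mapping.keys E" by (metis ex_in_conv keys_eq_empty)
    have PP: "P \<in> PD" using P less.prems unfolding eff_iff by auto
    have "lkp E P \<noteq> 0" using P by (simp add: in_keys_iff)
    moreover have "0 \<le> lkp E P" using less.prems unfolding eff_iff by auto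
    ultimately have pos: "1 \<le> lkp E P" by simp
    let ?E = "E - Poly_Mapping.single P 1"
    have e: "?E \<in> eff" using less.prems pos Div_closed(4)[OF _ Div_closed(5)[OF PP]]
      unfolding eff_iff by (auto simp: lookup_minus lookup_single when_def)
    have "deg ?E = deg E - dg P" by (simp add: deg_diff)
    then have "nat (deg ?E) < nat (deg E)" using deg_eff[OF e] dg_pos[OF PP] by simp
    then have "Pr ?E" using less.hyps e by blast
    then have "Pr (?E + Poly_Mapping.single P 1)" using S[OF e PP] by blast
    then show ?thesis by simp
  qed
qed

lemma LL_iff: "x \<in> LL D \<longleftrightarrow> x \<in> carrier K \<and> (\<forall>P\<in>PD. x \<in> fid K P (- lkp D P))"
  unfolding riemann_roch_space_def fid_def by (auto simp: algebra_simps minus_le_iff)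

lemma LL_additive: "additive_subgroup (LL D) K"
proof (rule additive_subgroupI')
  note f = fid_additive_subgroup
  show "LL D \<subseteq> carrier K" "\<zero> \<in> LL D" using additive_subgroup.zero_closed[OF f] by (auto simp: LL_iff)
  show "a \<oplus> b \<in> LL D" if "a \<in> LL D" "b \<in> LL D" for a b using that additive_subgroup.a_closed[OF f] by (simp add: LL_iff)
  show "\<ominus> a \<in> LL D" if "a \<in> LL D" for a using that additive_subgroup.a_inv_closed[OF f] by (simp add: LL_iff)
qed

lemma LL_smult: "a \<in> k \<Longrightarrow> x \<in> LL D \<Longrightarrow> a \<otimes> x \<in> LL D"
  using k_smult_fid k_ring(1) by (auto simp: LL_iff)

lemma LL_mult: "x \<in> LL D \<Longrightarrow> y \<in> LL E \<Longrightarrow> x \<otimes> y \<in> LL (D + E)"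
proof -
  assume A: "x \<in> LL D" "y \<in> LL E"
  have "x \<otimes> y \<in> fid K P (- lkp D P + - lkp E P)" if "P \<in> PD" for P
    by (rule fid_mult[OF that]) (use A that in \<open>auto simp: LL_iff\<close>)
  then show ?thesis using A by (simp add: LL_iff lookup_add)
qed

lemma LL_mono: "(\<And>P. P \<in> PD \<Longrightarrow> lkp D P \<le> lkp E P) \<Longrightarrow> LL D \<subseteq> LL E"
proof
  fix x assume le: "\<And>P. P \<in> PD \<Longrightarrow> lkp D P \<le> lkp E P" and x: "x \<in> LL D"
  have "x \<in> fid K P (- lkp E P)" if "P \<in> PD" for P
    using x that fid_antimono[of "- lkp E P" "- lkp D P" P] le[OF that] unfolding LL_iff by auto
  then show "x \<in> LL E" using x unfolding LL_iff by blast
qed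

lemma LL_0: "LL 0 = k"
proof
  show "LL 0 \<subseteq> k"
  proof
    fix x assume x: "x \<in> LL 0"
    show "x \<in> k"
    proof (cases "x = \<zero>")
      case True then show ?thesis using k_ring(2) by simp
    next
      case False
      then show ?thesis using x no_poles_imp_const[of x] fidD[of x _ 0] by (auto simp: LL_iff)
    qed
  qed
  show "k \<subseteq> LL 0"
  proof
    fix x assume "x \<in> k"
    then have "x \<in> carrier K" "\<And>P. P \<in> PD \<Longrightarrow> x \<in> fid K P 0" using k_ring(1) k_in_place fid_0 by blast+
    then show "x \<in> LL 0" by (simp add: LL_iff)
  qed
qed

text \<open>Choose s of order D(P) + 1 at P. Multiplication by s sends L(D + P) into the valuation
  ring, and congruence modulo the maximal ideal pulls back to congruence modulo L(D), so the index
  of L(D) is at most the norm of P.\<close>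

lemma LL_step:
  assumes P: "P \<in> PD" and fin: "finite (LL D)"
  shows "finite (LL (D + Poly_Mapping.single P 1))"
    "card (LL (D + Poly_Mapping.single P 1)) \<le> q ^ place_degree K P * card (LL D)"
proof -
  let ?E = "D + Poly_Mapping.single P 1"
  have sub: "LL D \<subseteq> LL ?E" by (rule LL_mono) (simp add: lookup_add lookup_single when_def)
  obtain t where t: "t \<in> carrier K" "t \<noteq> \<zero>" "ordP P t = 1" by (rule uniformizer_ord[OF P])
  define s where "s = t [^] (lkp D P + 1)"
  have sP: "ordP P s = lkp D P + 1" "s \<in> carrier K" "s \<noteq> \<zero>"
  proof -
    show sc: "s \<in> carrier K" "s \<noteq> \<zero>" unfolding s_def using int_pow_field(2,3)[OF t(1,2)] by auto
    have nn: "ordP P (t [^] int n) = int n" for n using place_ord_pow[OF P t(1,2), of n] t(3) by (simp add: int_pow_int)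
    show "ordP P s = lkp D P + 1"
    proof (cases "0 \<le> lkp D P + 1")
      case True then show ?thesis using nn[of "nat (lkp D P + 1)"] unfolding s_def by simp
    next
      case False
      let ?u = "t [^] (- (lkp D P + 1))"
      have "ordP P ?u = - (lkp D P + 1)" using nn[of "nat (- (lkp D P + 1))"] False by simp
      moreover have "?u = inv s" unfolding s_def using int_pow_field(4)[OF t(1,2)] by blast
      ultimately show ?thesis using place_ord_inv[OF P sc] by simp
    qed
  qed
  note f1 = fid_additive_subgroup[OF P, of 1]
  have 1: "s \<otimes> x \<in> fid K P 0" if "x \<in> LL ?E" for x
  proof -
    have "x \<in> fid K P (- lkp D P - 1)" using that P by (auto simp: LL_iff lookup_add lookup_single when_def)
    moreover have "s \<in> fid K P (lkp D P + 1)" using sP by (intro fidI) auto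
    ultimately show ?thesis using fid_mult[OF P, of s "lkp D P + 1" x "- lkp D P - 1"] by simp
  qed
  have 2: "x \<ominus> y \<in> LL D" if xy: "x \<in> LL ?E" "y \<in> LL ?E" and d: "s \<otimes> x \<ominus> s \<otimes> y \<in> fid K P 1" for x y
  proof -
    have xyE: "x \<ominus> y \<in> LL ?E" using additive_subgroup_minus[OF LL_additive xy] .
    then have c: "x \<in> carrier K" "y \<in> carrier K" "x \<ominus> y \<in> carrier K" using xy by (auto simp: LL_iff)
    have "s \<otimes> (x \<ominus> y) \<in> fid K P 1" using d minus_identities(5)[OF c(1,2) sP(2) sP(2)] by simp
    then have "x \<ominus> y \<in> fid K P (- lkp D P)"
      using fidD[of "s \<otimes> (x \<ominus> y)" P 1] place_ord_mult[OF P sP(2,3) c(3)] sP c(3) by (intro fidI) (auto simp: integral_iff)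
    moreover have "x \<ominus> y \<in> fid K Q (- lkp D Q)" if "Q \<in> PD" "Q \<noteq> P" for Q
    proof -
      have "lkp ?E Q = lkp D Q" using that(2) by (simp add: lookup_add lookup_single when_def)
      then show ?thesis using xyE that(1) unfolding LL_iff by metis
    qed
    ultimately show ?thesis unfolding LL_iff using c(3) by blast
  qed
  have Ec: "LL ?E \<subseteq> carrier K" by (auto simp: LL_iff)
  note cm = cosets_card_mono[OF LL_additive[of D] f1 Ec fid_carrier residue_finite[OF P], of "\<lambda>x. s \<otimes> x", OF 1 2]
  have cs: "finite (cosets (LL ?E) (LL D))" "card (cosets (LL ?E) (LL D)) \<le> place_norm K P"
    using cm unfolding place_norm_cosets[OF P] by blast+
  show "finite (LL ?E)" using cosets_finite_card(1)[OF LL_additive LL_additive sub cs(1) fin] .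
  have "card (LL ?E) = card (cosets (LL ?E) (LL D)) * card (LL D)"
    using cosets_finite_card(2)[OF LL_additive LL_additive sub cs(1) fin] .
  also have "\<dots> \<le> q ^ place_degree K P * card (LL D)" using cs(2) place_norm_power(1)[OF P] by simp
  finally show "card (LL ?E) \<le> q ^ place_degree K P * card (LL D)" .
qed

text \<open>Turns a function on places into a divisor. The result is meaningful only for functions
  with finite support on \<open>PD\<close>, hence the finiteness premises throughout.\<close>

definition mk :: "('a set \<Rightarrow> int) \<Rightarrow> 'a set \<Rightarrow>\<^sub>0 int" where
  "mk f = Abs_poly_mapping (\<lambda>P. if P \<in> PD then f P else 0)"

lemma lkp_mk:
  assumes "finite {P \<in> PD. f P \<noteq> 0}" shows "lkp (mk f) P = (if P \<in> PD then f P else 0)"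
proof -
  have "{P. (if P \<in> PD then f P else 0) \<noteq> 0} = {P \<in> PD. f P \<noteq> 0}" by auto
  then show ?thesis unfolding mk_def using assms by (subst lookup_Abs_poly_mapping) auto
qed

lemma mk_Div: "finite {P \<in> PD. f P \<noteq> 0} \<Longrightarrow> mk f \<in> Div"
  unfolding Div_iff by (simp add: lkp_mk)

lemma LL_finite_eff: "E \<in> eff \<Longrightarrow> finite (LL E)"
proof (induction rule: eff_induct)
  case zero then show ?case unfolding LL_0 by (rule k_finite)
next
  case (add E P) then show ?case using LL_step(1) by blast
qed

lemma dominate:
  assumes D: "D \<in> Div" obtains E where "E \<in> eff" "D + E \<in> eff"
proof -
  have f: "finite {P \<in> PD. \<bar>lkp D P\<bar> \<noteq> 0}" by (rule finite_subset[of _ "Poly_Mapping.keys D"]) (auto simp: in_keys_iff)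
  have e: "mk (\<lambda>P. \<bar>lkp D P\<bar>) \<in> eff" unfolding eff_iff using mk_Div[OF f] by (auto simp: lkp_mk[OF f])
  have "D + mk (\<lambda>P. \<bar>lkp D P\<bar>) \<in> eff" unfolding eff_iff
    using Div_closed(2)[OF D mk_Div[OF f]] lkp_zero[OF D] by (auto simp: lookup_add lkp_mk[OF f])
  then show ?thesis using that e by blast
qed

lemma LL_finite: assumes D: "D \<in> Div" shows "finite (LL D)"
proof -
  obtain E where E: "E \<in> eff" "D + E \<in> eff" by (rule dominate[OF D])
  have "0 \<le> lkp E P" for P using E(1) unfolding eff_iff by blast
  then have "LL D \<subseteq> LL (D + E)" by (intro LL_mono) (simp add: lookup_add)
  then show ?thesis using LL_finite_eff[OF E(2)] finite_subset by blast
qed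

lemma card_LL: "D \<in> Div \<Longrightarrow> card (LL D) = q ^ riemann_roch_dim K D"
  unfolding riemann_roch_dim_def k[symmetric] using k_space_card[OF LL_additive LL_smult LL_finite] by blast

lemma ll_0: "ll 0 = 1"
proof -
  have "q ^ riemann_roch_dim K 0 = q ^ 1" using card_LL[OF Div_closed(1)] LL_0 q by simp
  then show ?thesis using power_inject_exp[of q "riemann_roch_dim K 0" 1] q_ge_2 by simp
qed

lemma ll_step:
  assumes D: "D \<in> Div" and P: "P \<in> PD" shows "ll (D + Poly_Mapping.single P 1) \<le> ll D + dg P"
proof -
  have "q ^ riemann_roch_dim K (D + Poly_Mapping.single P 1) \<le> q ^ (place_degree K P + riemann_roch_dim K D)"
    using LL_step(2)[OF P LL_finite[OF D]] card_LL[OF D] card_LL[OF Div_closed(2)[OF D Div_closed(5)[OF P]]] by (simp add: power_add)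
  then have "riemann_roch_dim K (D + Poly_Mapping.single P 1) \<le> place_degree K P + riemann_roch_dim K D"
    using q_ge_2 by (simp add: power_le_imp_le_exp)
  then show ?thesis by simp
qed

text \<open>Adding a place P raises the degree by deg P and l by at most deg P.\<close>

lemma phi_mono: assumes "E \<in> eff" "D \<in> Div" shows "phi D \<le> phi (D + E)"
  using assms(1)
proof (induction rule: eff_induct)
  case (add E P)
  have "D + E \<in> Div" using add(1) assms(2) Div_closed(2) unfolding eff_iff by blast
  then have "ll (D + E + Poly_Mapping.single P 1) \<le> ll (D + E) + dg P" using ll_step add(2) by blast
  then show ?case using add(3) by (simp add: deg_add add.assoc)
qed simp

lemma phi_mono':
  assumes "D \<in> Div" "E \<in> Div" "\<And>P. P \<in> PD \<Longrightarrow> lkp D P \<le> lkp E P" shows "phi D \<le> phi E"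
proof -
  have "lkp (E - D) P \<ge> 0" for P using assms(3)[of P] lkp_zero[OF assms(1), of P] lkp_zero[OF assms(2), of P]
    by (cases "P \<in> PD") (auto simp: lookup_minus)
  then have "E - D \<in> eff" unfolding eff_iff using Div_closed(4)[OF assms(2,1)] by blast
  then show ?thesis using phi_mono[of "E - D" D] assms(1) by simp
qed

lemma ll_le: "E \<in> eff \<Longrightarrow> ll E \<le> deg E + 1"
  using phi_mono[of E 0] Div_closed(1) ll_0 by simp

lemma LL_nonzero: assumes "D \<in> Div" "0 < ll D" obtains x where "x \<in> LL D" "x \<noteq> \<zero>"
proof -
  have "q ^ 1 \<le> card (LL D)" unfolding card_LL[OF assms(1)] using assms(2) q_ge_2 by (intro power_increasing) auto
  then have "1 < card (LL D)" using q_ge_2 by simp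
  then have "\<not> LL D \<subseteq> {\<zero>}" using card_mono[of "{\<zero>}" "LL D"] by auto
  then show ?thesis using that by blast
qed

definition prdiv :: "'a \<Rightarrow> 'a set \<Rightarrow>\<^sub>0 int" where "prdiv x = mk (\<lambda>P. ordP P x)"

lemma lkp_prdiv: "x \<in> carrier K \<Longrightarrow> x \<noteq> \<zero> \<Longrightarrow> lkp (prdiv x) P = (if P \<in> PD then ordP P x else 0)"
  unfolding prdiv_def by (rule lkp_mk[OF support_finite])

lemma prdiv_Div: "x \<in> carrier K \<Longrightarrow> x \<noteq> \<zero> \<Longrightarrow> prdiv x \<in> Div"
  unfolding prdiv_def by (rule mk_Div[OF support_finite])

lemma prdiv_mult: "x \<in> carrier K \<Longrightarrow> x \<noteq> \<zero> \<Longrightarrow> y \<in> carrier K \<Longrightarrow> y \<noteq> \<zero> \<Longrightarrow> prdiv (x \<otimes> y) = prdiv x + prdiv y"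
  by (rule poly_mapping_eqI) (simp add: lkp_prdiv lookup_add place_ord_mult integral_iff)

lemma prdiv_inv: "x \<in> carrier K \<Longrightarrow> x \<noteq> \<zero> \<Longrightarrow> prdiv (inv x) = - prdiv x"
  by (rule poly_mapping_eqI) (simp add: lkp_prdiv inv_mem inv_nz place_ord_inv)

lemma principal_iff: "D \<in> principal_divisors K \<longleftrightarrow> (\<exists>x\<in>carrier K - {\<zero>}. D = prdiv x)"
proof
  assume "D \<in> principal_divisors K"
  then obtain x where x: "x \<in> carrier K - {\<zero>}" "\<forall>P\<in>PD. lkp D P = ordP P x" "D \<in> Div" unfolding principal_divisors_def by auto
  have "D = prdiv x" by (rule poly_mapping_eqI) (use x lkp_zero[OF x(3)] lkp_prdiv[of x] in auto)
  then show "\<exists>x\<in>carrier K - {\<zero>}. D = prdiv x" using x by blast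
next
  assume "\<exists>x\<in>carrier K - {\<zero>}. D = prdiv x"
  then obtain x where x: "x \<in> carrier K" "x \<noteq> \<zero>" "D = prdiv x" by blast
  have "D \<in> carrier (divisor_group K)" using prdiv_Div[OF x(1,2)] x(3) by simp
  then show "D \<in> principal_divisors K" unfolding principal_divisors_def using x lkp_prdiv[OF x(1,2)] by auto
qed

lemma LL_shift:
  assumes x: "x \<in> carrier K" "x \<noteq> \<zero>" shows "bij_betw (\<lambda>f. f \<otimes> x) (LL (D + prdiv x)) (LL D)"
proof (rule bij_betwI[where g = "\<lambda>f. f \<otimes> inv x"])
  have xl: "x \<in> LL (- prdiv x)" using x by (auto simp: LL_iff lkp_prdiv intro!: fidI)
  have il: "inv x \<in> LL (prdiv x)" using x inv_mem[OF x] by (auto simp: LL_iff lkp_prdiv place_ord_inv intro!: fidI)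
  show "(\<lambda>f. f \<otimes> x) \<in> LL (D + prdiv x) \<rightarrow> LL D" using LL_mult[OF _ xl, of _ "D + prdiv x"] by auto
  show "(\<lambda>f. f \<otimes> inv x) \<in> LL D \<rightarrow> LL (D + prdiv x)" using LL_mult[OF _ il, of _ D] by auto
  fix f assume "f \<in> LL (D + prdiv x)"
  then have "f \<in> carrier K" by (simp add: LL_iff)
  then show "f \<otimes> x \<otimes> inv x = f" using x inv_mem[OF x] inv_r[OF x] by (simp add: m_assoc)
next
  fix f assume "f \<in> LL D"
  then have "f \<in> carrier K" by (simp add: LL_iff)
  then show "f \<otimes> inv x \<otimes> x = f" using x inv_mem[OF x] inv_l[OF x] by (simp add: m_assoc)
qed

lemma ll_shift:
  assumes x: "x \<in> carrier K" "x \<noteq> \<zero>" and D: "D \<in> Div" shows "ll (D + prdiv x) = ll D"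
proof -
  have "card (LL (D + prdiv x)) = card (LL D)" using bij_betw_same_card[OF LL_shift[OF x]] .
  then show ?thesis using card_LL[OF D] card_LL[OF Div_closed(2)[OF D prdiv_Div[OF x]]] q_ge_2 by (simp add: power_inject_exp)
qed

end

section \<open>Principal divisors have degree zero; Riemann's theorem and the genus\<close>

context ffield begin

lemma deg_mk:
  assumes "finite S" "S \<subseteq> PD" "{P \<in> PD. f P \<noteq> 0} \<subseteq> S"
  shows "deg (mk f) = (\<Sum>P\<in>S. f P * dg P)"
proof -
  have f: "finite {P \<in> PD. f P \<noteq> 0}" using assms finite_subset by blast
  have "Poly_Mapping.keys (mk f) \<subseteq> S" using assms(3) lkp_mk[OF f] by (auto simp: in_keys_iff split: if_splits)
  then have "deg (mk f) = (\<Sum>P\<in>S. lkp (mk f) P * dg P)" using deg_superset[OF assms(1)] by blast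
  also have "\<dots> = (\<Sum>P\<in>S. f P * dg P)" using assms(2) lkp_mk[OF f] by (intro sum.cong) auto
  finally show ?thesis .
qed

lemma deg_mk_linear:
  assumes f: "finite {P \<in> PD. f P \<noteq> 0}" and g: "finite {P \<in> PD. g P \<noteq> 0}"
  shows "deg (mk (\<lambda>P. a * f P + g P)) = a * deg (mk f) + deg (mk g)" "finite {P \<in> PD. a * f P + g P \<noteq> 0}"
proof -
  let ?S = "{P \<in> PD. f P \<noteq> 0} \<union> {P \<in> PD. g P \<noteq> 0}"
  have S: "finite ?S" "?S \<subseteq> PD" using f g by auto
  have sub: "{P \<in> PD. a * f P + g P \<noteq> 0} \<subseteq> ?S" by auto
  then show "finite {P \<in> PD. a * f P + g P \<noteq> 0}" using S finite_subset by blast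
  have 1: "deg (mk f) = (\<Sum>P\<in>?S. f P * dg P)" by (rule deg_mk[OF S]) auto
  have 2: "deg (mk g) = (\<Sum>P\<in>?S. g P * dg P)" by (rule deg_mk[OF S]) auto
  have 3: "deg (mk (\<lambda>P. a * f P + g P)) = (\<Sum>P\<in>?S. (a * f P + g P) * dg P)" by (rule deg_mk[OF S sub])
  show "deg (mk (\<lambda>P. a * f P + g P)) = a * deg (mk f) + deg (mk g)"
    unfolding 1 2 3 by (simp add: distrib_right sum.distrib sum_distrib_left mult.assoc)
qed

lemma finite_scale: "finite {P \<in> PD. f P \<noteq> 0} \<Longrightarrow> finite {P \<in> PD. (a::int) * f P \<noteq> 0}"
  by (rule finite_subset[of _ "{P \<in> PD. f P \<noteq> 0}"]) auto

lemma deg_mk_scale: "finite {P \<in> PD. f P \<noteq> 0} \<Longrightarrow> deg (mk (\<lambda>P. a * f P)) = a * deg (mk f)"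
  using deg_mk_linear(1)[of f "\<lambda>_. 0" a] deg_mk[of "{}" "\<lambda>_. 0"] by simp

text \<open>Multiplicities of the pole divisor of z. The zero divisor appears as
  \<open>polef (inv z)\<close>.\<close>

definition polef :: "'a \<Rightarrow> 'a set \<Rightarrow> int" where "polef z P = max 0 (- ordP P z)"

lemma polef_finite:
  assumes "z \<in> carrier K" "z \<noteq> \<zero>" shows "finite {P \<in> PD. polef z P \<noteq> 0}"
  by (rule finite_subset[OF _ support_finite[OF assms]]) (auto simp: polef_def)

lemma polef_nonneg: "0 \<le> polef z P" unfolding polef_def by simp

lemma mk_eff: "finite {P \<in> PD. f P \<noteq> 0} \<Longrightarrow> (\<And>P. P \<in> PD \<Longrightarrow> 0 \<le> f P) \<Longrightarrow> mk f \<in> eff"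
  using mk_Div by (simp add: eff_iff lkp_mk)

text \<open>Let H be the ring of elements integral at the poles of z, u = 1/z, and d the degree of
  the pole divisor. Approximation gives q^d elements of H incongruent modulo uH; taken as digits,
  they make q^(d(m+1)) polynomials of degree m in z. These lie in the space of m times the pole
  divisor plus a fixed divisor c that bounds the poles of the digits. So l there is at least d(m +
  1), and phi is at most deg c for every m.\<close>

lemma pole_growth:
  assumes zk: "z \<in> carrier K" "z \<notin> k"
  shows "\<exists>c. \<forall>m::nat. phi (mk (\<lambda>P. int m * polef z P)) \<le> c"
proof -
  have z: "z \<in> carrier K" "z \<noteq> \<zero>" using zk k_ring(2) by auto
  define u where "u = inv z"
  have u: "u \<in> carrier K" "u \<noteq> \<zero>" "z \<otimes> u = \<one>" unfolding u_def using inv_mem[OF z] inv_nz[OF z] inv_r[OF z] by auto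
  let ?y = "polef z"
  note yfin = polef_finite[OF z]
  define T where "T = {P \<in> PD. ordP P z < 0}"
  have T: "finite T" "T \<subseteq> PD" unfolding T_def by (rule finite_subset[OF _ support_finite[OF z]]) auto
  define D where "D P = nat (- ordP P z)" for P
  let ?H = "{x \<in> carrier K. \<forall>P\<in>T. x \<in> fid K P 0}"
  obtain W where W: "W \<subseteq> ?H" "finite W" "card W = (\<Prod>P\<in>T. place_norm K P ^ D P)"
    "\<And>w w'. w \<in> W \<Longrightarrow> w' \<in> W \<Longrightarrow> (\<forall>P\<in>T. w \<ominus> w' \<in> fid K P (int (D P))) \<Longrightarrow> w = w'"
    using approximation_reps[OF T, of D] residue_finite T(2) by blast
  have f: "additive_subgroup (fid K P 0) K" if "P \<in> T" for P using fid_additive_subgroup T(2) that by blast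
  have H: "additive_subgroup ?H K"
  proof (rule additive_subgroupI')
    show "\<zero> \<in> ?H" using additive_subgroup.zero_closed[OF f] by auto
    show "a \<oplus> b \<in> ?H" if "a \<in> ?H" "b \<in> ?H" for a b using that additive_subgroup.a_closed[OF f] by auto
    show "\<ominus> a \<in> ?H" if "a \<in> ?H" for a using that additive_subgroup.a_inv_closed[OF f] by auto
  qed auto
  have uf: "u \<otimes> h \<in> fid K P (int (D P))" if "h \<in> ?H" "P \<in> T" for h P
  proof -
    have PP: "P \<in> PD" "ordP P z < 0" using that(2) unfolding T_def by auto
    have "u \<in> fid K P (int (D P))" using u(1) place_ord_inv[OF PP(1) z] PP(2) unfolding u_def D_def by (intro fidI) auto
    then show ?thesis using fid_mult[OF PP(1), of u "int (D P)" h 0] that by simp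
  qed
  have dil: "dilate u ?H \<subseteq> ?H"
  proof
    fix x assume "x \<in> dilate u ?H"
    then obtain h where h: "h \<in> ?H" "x = u \<otimes> h" unfolding dilate_def by blast
    have "x \<in> fid K P 0" if "P \<in> T" for P using uf[OF h(1) that] h(2) fid_antimono[of 0 "int (D P)" P] by auto
    then show "x \<in> ?H" using h u by auto
  qed
  note uHa = dilate_additive_subgroup[OF H u(1)]
  have inj: "inj_on (\<lambda>a. dilate u ?H +> a) W"
  proof (rule inj_onI)
    fix a b assume A: "a \<in> W" "b \<in> W" "dilate u ?H +> a = dilate u ?H +> b"
    have c: "a \<in> carrier K" "b \<in> carrier K" using A(1,2) W(1) by auto
    have "a \<ominus> b \<in> dilate u ?H" using A(3) coset_eq_iff[OF uHa c] by blast
    then obtain h where h: "h \<in> ?H" "a \<ominus> b = u \<otimes> h" unfolding dilate_def by blast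
    have "\<forall>P\<in>T. a \<ominus> b \<in> fid K P (int (D P))" unfolding h(2) using uf[OF h(1)] by blast
    then show "a = b" using W(4)[OF A(1,2)] by blast
  qed
  note ds = digit_sums_card[OF H u(1,2) dil W(1) inj W(2)]
  \<comment> \<open>The case distinction is needed because \<open>polef\<close> at zero rests on a
    meaningless order.\<close>
  define c where "c P = (\<Sum>w\<in>W. if w = \<zero> then 0 else polef w P)" for P
  have cfin: "finite {P \<in> PD. c P \<noteq> 0}"
  proof (rule finite_subset)
    show "{P \<in> PD. c P \<noteq> 0} \<subseteq> (\<Union>w\<in>W - {\<zero>}. {P \<in> PD. polef w P \<noteq> 0})"
    proof
      fix P assume "P \<in> {P \<in> PD. c P \<noteq> 0}"
      then have P: "P \<in> PD" "c P \<noteq> 0" by auto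
      obtain w where "w \<in> W" "(if w = \<zero> then 0 else polef w P) \<noteq> 0" using P(2) unfolding c_def by (rule sum.not_neutral_contains_not_neutral)
      then show "P \<in> (\<Union>w\<in>W - {\<zero>}. {P \<in> PD. polef w P \<noteq> 0})" using P(1) by (auto split: if_splits)
    qed
    show "finite (\<Union>w\<in>W - {\<zero>}. {P \<in> PD. polef w P \<noteq> 0})" using W(1,2) polef_finite by auto
  qed
  define E where "E m = mk (\<lambda>P. int m * ?y P + c P)" for m :: nat
  have Elk: "lkp (E m) P = int m * ?y P + c P" if "P \<in> PD" for m P
    unfolding E_def using lkp_mk[OF deg_mk_linear(2)[OF yfin cfin]] that by simp
  have EDiv: "E m \<in> Div" for m unfolding E_def by (rule mk_Div[OF deg_mk_linear(2)[OF yfin cfin]])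
  have Emono: "LL (E m) \<subseteq> LL (E (Suc m))" for m
    by (rule LL_mono) (use Elk polef_nonneg in \<open>simp add: algebra_simps\<close>)
  have wf: "w \<in> fid K P (- c P)" if w: "w \<in> W" and P: "P \<in> PD" for w P
  proof (rule fidI)
    show "w \<in> carrier K" using w W(1) by auto
    assume "w \<noteq> \<zero>"
    then have "polef w P \<le> c P" unfolding c_def
      using member_le_sum[of w W "\<lambda>w. if w = \<zero> then 0 else polef w P"] w W(2) polef_nonneg by auto
    then show "- c P \<le> ordP P w" unfolding polef_def by linarith
  qed
  have zw: "z [^] m \<otimes> w \<in> LL (E m)" if w: "w \<in> W" for m :: nat and w
    unfolding LL_iff
  proof (intro conjI ballI)
    show "z [^] m \<otimes> w \<in> carrier K" using w W(1) z by auto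
    fix P assume P: "P \<in> PD"
    have "z [^] m \<in> fid K P (- (int m * ?y P))"
    proof (rule fidI)
      have "int m * (- ?y P) \<le> int m * ordP P z" by (intro mult_left_mono) (auto simp: polef_def)
      then show "- (int m * ?y P) \<le> ordP P (z [^] m)" using place_ord_pow[OF P z, of m] by simp
    qed (use z in simp)
    then have "z [^] m \<otimes> w \<in> fid K P (- (int m * ?y P) + - c P)" using fid_mult[OF P _ wf[OF w P]] by blast
    moreover have "- lkp (E m) P = - (int m * ?y P) + - c P" using Elk[OF P] by simp
    ultimately show "z [^] m \<otimes> w \<in> fid K P (- lkp (E m) P)" by metis
  qed
  have sums: "z [^] m \<otimes> x \<in> LL (E m)" if "x \<in> digit_sums W u (Suc m)" for m :: nat and x
    using that
  proof (induction m arbitrary: x)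
    case 0
    then obtain w where w: "w \<in> W" "x = w \<oplus> u \<otimes> \<zero>" by auto
    then have "x = w" using u(1) W(1) by auto
    then show ?case using zw[OF w(1), of 0] by simp
  next
    case (Suc m)
    obtain w x' where x: "w \<in> W" "x' \<in> digit_sums W u (Suc m)" "x = w \<oplus> u \<otimes> x'"
      using Suc.prems digit_sums.simps(2)[of W u "Suc m"] by auto
    have c: "w \<in> carrier K" "x' \<in> carrier K" using x(1,2) W(1) ds[of "Suc m"] by blast+
    have "z [^] Suc m \<otimes> x = z [^] Suc m \<otimes> w \<oplus> (z \<otimes> u) \<otimes> (z [^] m \<otimes> x')"
      using x(3) c z u(1) by (simp add: r_distr m_ac)
    also have "\<dots> = z [^] Suc m \<otimes> w \<oplus> z [^] m \<otimes> x'" using u(3) c z by simp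
    finally have "z [^] Suc m \<otimes> x = z [^] Suc m \<otimes> w \<oplus> z [^] m \<otimes> x'" .
    moreover have "z [^] m \<otimes> x' \<in> LL (E (Suc m))" using Suc.IH[OF x(2)] Emono by blast
    ultimately show ?case using additive_subgroup.a_closed[OF LL_additive zw[OF x(1), of "Suc m"]] by metis
  qed
  define d where "d = (\<Sum>P\<in>T. place_degree K P * D P)"
  have cW: "card W = q ^ d"
  proof -
    have "card W = (\<Prod>P\<in>T. q ^ (place_degree K P * D P))"
      unfolding W(3) using T(2) place_norm_power(1) by (intro prod.cong) (auto simp: power_mult)
    then show ?thesis unfolding d_def by (simp add: power_sum)
  qed
  have dY: "deg (mk ?y) = int d"
  proof -
    have "deg (mk ?y) = (\<Sum>P\<in>T. ?y P * dg P)" by (rule deg_mk[OF T]) (auto simp: polef_def T_def)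
    also have "\<dots> = (\<Sum>P\<in>T. int (place_degree K P * D P))" by (intro sum.cong) (auto simp: polef_def T_def D_def)
    finally show ?thesis unfolding d_def by simp
  qed
  have "phi (mk (\<lambda>P. int m * ?y P)) \<le> deg (mk c)" for m :: nat
  proof -
    have "inj_on (\<lambda>x. z [^] m \<otimes> x) (digit_sums W u (Suc m))"
    proof (rule inj_onI)
      fix a b assume A: "a \<in> digit_sums W u (Suc m)" "b \<in> digit_sums W u (Suc m)" "z [^] m \<otimes> a = z [^] m \<otimes> b"
      have "a \<in> carrier K" "b \<in> carrier K" using A(1,2) ds[of "Suc m"] by blast+
      then show "a = b" using A(3) m_lcancel[OF pow_nonzero[OF z] nat_pow_closed[OF z(1)]] by blast
    qed
    moreover have "(\<lambda>x. z [^] m \<otimes> x) ` digit_sums W u (Suc m) \<subseteq> LL (E m)" using sums by blast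
    ultimately have "card (digit_sums W u (Suc m)) \<le> card (LL (E m))" using LL_finite[OF EDiv] by (rule card_inj_on_le)
    moreover have "q ^ (d * Suc m) = card (digit_sums W u (Suc m))" using ds[of "Suc m"] cW by (simp only: power_mult)
    ultimately have "q ^ (d * Suc m) \<le> q ^ riemann_roch_dim K (E m)" using card_LL[OF EDiv] by (simp only:)
    then have "d * Suc m \<le> riemann_roch_dim K (E m)" using q_ge_2 by (simp add: power_le_imp_le_exp)
    then have "int (d * Suc m) \<le> ll (E m)" by (simp only: of_nat_le_iff)
    moreover have "deg (E m) = int m * int d + deg (mk c)" unfolding E_def using deg_mk_linear(1)[OF yfin cfin] dY by simp
    ultimately have "phi (E m) \<le> deg (mk c)" by (simp add: algebra_simps)
    moreover have "phi (mk (\<lambda>P. int m * ?y P)) \<le> phi (E m)"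
    proof (rule phi_mono'[OF mk_Div[OF finite_scale[OF yfin]] EDiv])
      fix P assume P: "P \<in> PD"
      have "0 \<le> c P" unfolding c_def by (intro sum_nonneg) (auto simp: polef_def)
      then show "lkp (mk (\<lambda>P. int m * ?y P)) P \<le> lkp (E m) P" using lkp_mk[OF finite_scale[OF yfin]] Elk[OF P] P by simp
    qed
    ultimately show ?thesis by simp
  qed
  then show ?thesis by blast
qed

text \<open>The pole divisor of z plus its principal divisor is the zero divisor of z; everything is
  multiplied by m.\<close>

lemma prdiv_polef:
  assumes z: "z \<in> carrier K" "z \<noteq> \<zero>"
  shows "mk (\<lambda>P. int m * polef z P) + prdiv (z [^] m) = mk (\<lambda>P. int m * polef (inv z) P)"
proof (rule poly_mapping_eqI)
  fix P
  note f1 = lkp_mk[OF finite_scale[OF polef_finite[OF z]], of "int m"]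
    and f2 = lkp_mk[OF finite_scale[OF polef_finite[OF inv_mem[OF z] inv_nz[OF z]]], of "int m"]
  have zm: "z [^] m \<in> carrier K" "z [^] m \<noteq> \<zero>" using z pow_nonzero by auto
  have "max 0 (- a) + a = max 0 (a::int)" for a by simp
  then have "int m * max 0 (- a) + int m * a = int m * max 0 a" for a by (metis distrib_left)
  then show "lkp (mk (\<lambda>P. int m * polef z P) + prdiv (z [^] m)) P = lkp (mk (\<lambda>P. int m * polef (inv z) P)) P"
    unfolding lookup_add f1 f2 lkp_prdiv[OF zm]
    using place_ord_pow[OF _ z, of P m] place_ord_inv[OF _ z, of P] by (cases "P \<in> PD") (simp_all add: polef_def)
qed

text \<open>The m-fold pole and zero divisors are linearly equivalent, hence have the same l. It is
  at least m times the degree of the poles minus a constant, and at most m times the degree of the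
  zeros plus one; compare for large m. Applied to z and 1/z this yields degree zero of principal
  divisors.\<close>

lemma deg_pole_le:
  assumes zk: "z \<in> carrier K" "z \<notin> k" shows "deg (mk (polef z)) \<le> deg (mk (polef (inv z)))"
proof (rule ccontr)
  assume "\<not> ?thesis"
  then have lt: "deg (mk (polef (inv z))) + 1 \<le> deg (mk (polef z))" by simp
  have z: "z \<in> carrier K" "z \<noteq> \<zero>" using zk k_ring(2) by auto
  note fz = polef_finite[OF z] and fi = polef_finite[OF inv_mem[OF z] inv_nz[OF z]]
  obtain c where c: "\<And>m::nat. phi (mk (\<lambda>P. int m * polef z P)) \<le> c" using pole_growth[OF zk] by blast
  define m where "m = nat (c + 2)"
  let ?A = "mk (\<lambda>P. int m * polef z P)" and ?B = "mk (\<lambda>P. int m * polef (inv z) P)"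
  have zm: "z [^] m \<in> carrier K" "z [^] m \<noteq> \<zero>" using z pow_nonzero by auto
  have "?B \<in> eff" by (rule mk_eff[OF finite_scale[OF fi]]) (simp add: polef_nonneg)
  then have "ll ?B \<le> deg ?B + 1" by (rule ll_le)
  moreover have "ll ?B = ll ?A" using ll_shift[OF zm mk_Div[OF finite_scale[OF fz]], of "int m"] prdiv_polef[OF z, of m] by simp
  moreover have "deg ?A = int m * deg (mk (polef z))" "deg ?B = int m * deg (mk (polef (inv z)))"
    by (rule deg_mk_scale[OF fz], rule deg_mk_scale[OF fi])
  moreover have "phi ?A \<le> c" by (rule c)
  ultimately have "int m * deg (mk (polef z)) - c \<le> int m * deg (mk (polef (inv z))) + 1" by linarith
  moreover have "int m * (deg (mk (polef (inv z))) + 1) \<le> int m * deg (mk (polef z))" using lt by (intro mult_left_mono) auto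
  ultimately have "int m \<le> c + 1" by (simp add: distrib_left)
  moreover have "c + 2 \<le> int m" unfolding m_def by simp
  ultimately show False by simp
qed

lemma deg_prdiv:
  assumes z: "z \<in> carrier K" "z \<noteq> \<zero>" shows "deg (prdiv z) = 0"
proof (cases "z \<in> k")
  case True
  have "prdiv z = 0" by (rule poly_mapping_eqI) (use lkp_prdiv[OF z] ord_const[OF _ True z(2)] in auto)
  then show ?thesis by simp
next
  case False
  have ik: "inv z \<notin> k"
  proof
    assume "inv z \<in> k"
    then have "inv (inv z) \<in> k" using k_inv inv_nz[OF z] by blast
    then show False using inv_i[OF z] False by simp
  qed
  have e: "mk (polef z) + prdiv z = mk (polef (inv z))" using prdiv_polef[OF z, of 1] z by simp
  have "deg (mk (polef z)) = deg (mk (polef (inv z)))"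
    using deg_pole_le[OF z(1) False] deg_pole_le[OF inv_mem[OF z] ik] inv_i[OF z] by simp
  then show ?thesis using arg_cong[OF e, of deg] by (simp add: deg_add)
qed

lemma phi_shift: "x \<in> carrier K \<Longrightarrow> x \<noteq> \<zero> \<Longrightarrow> D \<in> Div \<Longrightarrow> phi (D + prdiv x) = phi D"
  using ll_shift deg_prdiv by (simp add: deg_add)

text \<open>A nonzero x in L(D - A) makes D + (x) dominate A; \<open>phi\<close> is monotone and
  invariant under linear equivalence.\<close>

lemma LL_nonzero_le:
  assumes x: "x \<in> LL (D - A)" "x \<noteq> \<zero>" and D: "D \<in> Div" and A: "A \<in> Div"
  shows "phi A \<le> phi D"
proof -
  have xc: "x \<in> carrier K" using x(1) by (simp add: LL_iff)
  have "phi A \<le> phi (D + prdiv x)"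
  proof (rule phi_mono'[OF A Div_closed(2)[OF D prdiv_Div[OF xc x(2)]]])
    fix P assume P: "P \<in> PD"
    have "- lkp (D - A) P \<le> ordP P x" using x P fidD[of x P] by (simp add: LL_iff)
    then show "lkp A P \<le> lkp (D + prdiv x) P" using lkp_prdiv[OF xc x(2), of P] P by (simp add: lookup_add lookup_minus)
  qed
  then show ?thesis using phi_shift[OF xc x(2) D] by simp
qed

text \<open>The bound is known for the multiples M of one pole divisor. Any D lies below an
  effective A, and for a large multiple l(M - A) is positive, so that a divisor equivalent to M
  dominates A. Then phi D <= phi A <= phi M.\<close>

lemma riemann_bound: "\<exists>c. \<forall>D\<in>Div. phi D \<le> c"
proof -
  obtain z where zk: "z \<in> carrier K" "z \<notin> k" using nonconst by blast
  have z: "z \<in> carrier K" "z \<noteq> \<zero>" using zk k_ring(2) by auto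
  note fz = polef_finite[OF z]
  obtain c where c: "\<And>m::nat. phi (mk (\<lambda>P. int m * polef z P)) \<le> c" using pole_growth[OF zk] by blast
  obtain P0 where P0: "P0 \<in> PD" "ordP P0 z < 0" using pole_exists[OF zk] by blast
  let ?y = "mk (polef z)"
  have "1 * 1 \<le> polef z P0 * dg P0" using P0 dg_pos[OF P0(1)] by (intro mult_mono) (auto simp: polef_def)
  also have "\<dots> \<le> (\<Sum>P\<in>{P \<in> PD. polef z P \<noteq> 0}. polef z P * dg P)"
    using P0 by (intro member_le_sum) (auto simp: polef_def fz[unfolded polef_def])
  also have "\<dots> = deg ?y" using deg_mk[OF fz, of "polef z"] by simp
  finally have dy: "1 \<le> deg ?y" by simp
  have "phi D \<le> c" if D: "D \<in> Div" for D
  proof -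
    obtain E where E: "E \<in> eff" "D + E \<in> eff" by (rule dominate[OF D])
    let ?A = "D + E"
    have A: "?A \<in> Div" using E(2) unfolding eff_iff by blast
    \<comment> \<open>The pole divisor has degree at least 1, so deg(M - A) >= c + 1; as phi(M - A)
      <= c, this forces l(M - A) to be positive.\<close>
    define m where "m = nat (deg ?A + c + 1)"
    let ?M = "mk (\<lambda>P. int m * polef z P)"
    have M: "?M \<in> Div" by (rule mk_Div[OF finite_scale[OF fz]])
    have "phi (?M - ?A) \<le> phi (?M - ?A + ?A)" by (rule phi_mono[OF E(2) Div_closed(4)[OF M A]])
    then have "phi (?M - ?A) \<le> c" using c[of m] by simp
    moreover have "deg (?M - ?A) = int m * deg ?y - deg ?A" using deg_mk_scale[OF fz, of "int m"] by (simp add: deg_diff)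
    moreover have "int m * 1 \<le> int m * deg ?y" using dy by (intro mult_left_mono) auto
    moreover have "deg ?A + c + 1 \<le> int m" unfolding m_def by simp
    ultimately have "0 < ll (?M - ?A)" by simp
    then obtain x where x: "x \<in> LL (?M - ?A)" "x \<noteq> \<zero>" using LL_nonzero[OF Div_closed(4)[OF M A]] by blast
    have "phi ?A \<le> phi ?M" by (rule LL_nonzero_le[OF x M A])
    moreover have "phi D \<le> phi ?A" by (rule phi_mono[OF E(1) D])
    ultimately show ?thesis using c[of m] by simp
  qed
  then show ?thesis by blast
qed

lemma genus_props: "\<And>D. D \<in> Div \<Longrightarrow> phi D \<le> genus K - 1" "\<exists>D\<in>Div. phi D = genus K - 1"
proof -
  obtain c where c: "\<And>D. D \<in> Div \<Longrightarrow> phi D \<le> c" using riemann_bound by blast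
  obtain A where A: "A \<in> Div" "\<And>D. D \<in> Div \<Longrightarrow> nat (c - phi A) \<le> nat (c - phi D)"
    using ex_has_least_nat[of "\<lambda>D. D \<in> Div" 0 "\<lambda>D. nat (c - phi D)"] Div_closed(1) by blast
  have max: "phi D \<le> phi A" if "D \<in> Div" for D using A(2)[OF that] c[OF that] c[OF A(1)] by linarith
  have "genus K = phi A + 1"
    unfolding genus_def
  proof (rule Greatest_equality)
    show "\<exists>D\<in>carrier (divisor_group K). phi A + 1 = deg D - ll D + 1" using A(1) by auto
    fix g assume "\<exists>D\<in>carrier (divisor_group K). g = deg D - ll D + 1"
    then show "g \<le> phi A + 1" using max by auto
  qed
  then show "\<And>D. D \<in> Div \<Longrightarrow> phi D \<le> genus K - 1" "\<exists>D\<in>Div. phi D = genus K - 1" using max A(1) by auto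
qed

text \<open>Fix A where \<open>phi\<close> attains its maximum g - 1. In degrees at least deg A + g
  the space L(D - A) is nonzero, so D is equivalent to a divisor above A and phi D cannot be smaller
  than the maximum.\<close>

lemma riemann_equality: "\<exists>c. \<forall>D\<in>Div. c \<le> deg D \<longrightarrow> ll D = deg D + 1 - genus K"
proof -
  obtain A where A: "A \<in> Div" "phi A = genus K - 1" using genus_props(2) by blast
  have "ll D = deg D + 1 - genus K" if D: "D \<in> Div" and d: "deg A + genus K \<le> deg D" for D
  proof -
    note DA = Div_closed(4)[OF D A(1)]
    have "phi (D - A) \<le> genus K - 1" by (rule genus_props(1)[OF DA])
    then have "0 < ll (D - A)" using d by (simp add: deg_diff)
    then obtain x where x: "x \<in> LL (D - A)" "x \<noteq> \<zero>" using LL_nonzero[OF DA] by blast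
    have "genus K - 1 \<le> phi D" using LL_nonzero_le[OF x D A(1)] A(2) by simp
    then show ?thesis using genus_props(1)[OF D] by simp
  qed
  then show ?thesis by blast
qed

end

section \<open>Counting effective divisors\<close>

lemma card_fibres:
  assumes "finite U" "\<And>b. b \<in> f ` U \<Longrightarrow> card {x \<in> U. f x = b} = m"
  shows "card U = m * card (f ` U)"
proof -
  have "card U = (\<Sum>b\<in>f ` U. card {x \<in> U. f x = b})" using sum.image_gen[OF assms(1), of "\<lambda>_. 1::nat" f] by simp
  also have "\<dots> = (\<Sum>b\<in>f ` U. m)" using assms(2) by (intro sum.cong) auto
  finally show ?thesis by simp
qed

lemma finite_field_pow_card:
  assumes F: "field F" and fin: "finite (carrier F)" and y: "y \<in> carrier F"
  shows "y [^]\<^bsub>F\<^esub> card (carrier F) = y"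
proof -
  interpret F: field F by fact
  show ?thesis
  proof (cases "y = \<zero>\<^bsub>F\<^esub>")
    case True
    have "card (carrier F) \<noteq> 0" using fin y by auto
    then show ?thesis using True F.nat_pow_zero by auto
  next
    case False
    interpret G: group "Multiplicative_Group.mult_of F" by (rule F.field_mult_group)
    have o: "order (Multiplicative_Group.mult_of F) = card (carrier F) - 1"
      using F.order_mult_of[OF fin] by (simp add: order_def)
    have yc: "y \<in> carrier (Multiplicative_Group.mult_of F)" using y False by simp
    have "y [^]\<^bsub>F\<^esub> (card (carrier F) - 1) = \<one>\<^bsub>F\<^esub>"
      using G.pow_order_eq_1[OF yc] unfolding o Multiplicative_Group.nat_pow_mult_of by simp
    moreover have "card (carrier F) = Suc (card (carrier F) - 1)" using fin y by (cases "card (carrier F)") auto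
    ultimately show ?thesis using y by (metis F.l_one F.nat_pow_Suc)
  qed
qed

section \<open>Fermat's congruence and the number of places of given degree\<close>

context ffield begin

lemma residue_fermat:
  assumes P: "P \<in> PD" and x: "x \<in> P" shows "x [^] place_norm K P \<ominus> x \<in> fid K P 1"
proof -
  let ?S = "K\<lparr>carrier := P\<rparr>" and ?I = "place_ideal K P"
  note sr = place_subring[OF P] and Pc = subringE(1)[OF place_subring[OF P]]
  interpret S: domain ?S using subring_domain(1)[OF sr] .
  interpret I: ideal ?I ?S by (rule place_ideal_props(5)[OF P])
  let ?F = "?S Quot ?I"
  have F: "field ?F" using maximalideal.quotient_is_field[OF place_ideal_maximal(1)[OF P] S.is_cring] .
  have nc: "card (carrier ?F) = place_norm K P" unfolding place_norm_def ..
  have fin: "finite (carrier ?F)"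
    by (rule card_ge_0_finite) (use nc place_norm_power(1)[OF P] q_ge_2 in simp)
  let ?h = "\<lambda>a. ?I +>\<^bsub>?S\<^esub> a"
  have hom: "?h \<in> ring_hom ?S ?F" by (rule I.rcos_ring_hom)
  interpret h: ring_hom_ring ?S ?F ?h by (rule I.rcos_ring_hom_ring)
  have xs: "x \<in> carrier ?S" using x by simp
  have pw: "x [^]\<^bsub>?S\<^esub> n = x [^] n" for n :: nat by (induction n) auto
  have "?h (x [^]\<^bsub>?S\<^esub> place_norm K P) = ?h x [^]\<^bsub>?F\<^esub> place_norm K P" using h.hom_nat_pow[OF xs] by simp
  also have "\<dots> = ?h x" using finite_field_pow_card[OF F fin h.hom_closed[OF xs]] unfolding nc .
  finally have e: "?h (x [^] place_norm K P) = ?h x" unfolding pw .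
  have "?h a = ?I +> a" for a unfolding a_r_coset_def' by simp
  then have "?I +> (x [^] place_norm K P) = ?I +> x" using e by simp
  moreover have "x \<in> carrier K" using x Pc by blast
  ultimately show ?thesis unfolding fid_1[OF P] using coset_eq_iff[OF place_ideal_props(1)[OF P], of "x [^] place_norm K P" x] by simp
qed

text \<open>Fix a nonconstant x. By Fermat's congruence w = x^(q^e) - x vanishes at all places of
  degree e that are not poles of x, and w is nonzero because x is not a root of unity. The poles of
  w are bounded by q^e times those of x, and zeros and poles of w have equal degree. The finitely
  many poles of x are counted separately, through the summand card T of the constant.\<close>

lemma prime_count_bound:
  "\<exists>c::nat. \<forall>e. finite {P \<in> PD. place_degree K P = e} \<and> e * card {P \<in> PD. place_degree K P = e} \<le> c * q ^ e"
proof -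
  obtain x where xk: "x \<in> carrier K" "x \<notin> k" using nonconst by blast
  have x: "x \<in> carrier K" "x \<noteq> \<zero>" using xk k_ring(2) by auto
  define T where "T = {P \<in> PD. ordP P x < 0}"
  have T: "finite T" unfolding T_def by (rule finite_subset[OF _ support_finite[OF x]]) auto
  define d where "d = nat (deg (mk (polef x)))"
  have "finite {P \<in> PD. place_degree K P = e} \<and> e * card {P \<in> PD. place_degree K P = e} \<le> (d + card T) * q ^ e" for e
  proof -
    let ?Z = "{P \<in> PD. place_degree K P = e} - T"
    define w where "w = x [^] (q ^ e) \<ominus> x"
    show ?thesis
    proof (cases "e = 0")
      case True
      then have em: "{P \<in> PD. place_degree K P = e} = {}" using place_norm_power(2) by auto
      show ?thesis unfolding em by simp
    next
      case e0: False
      have q1: "1 < q ^ e" using q_ge_2 e0 one_less_power[of q e] by simp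
      have wc: "w \<in> carrier K" unfolding w_def using x by simp
      have w0: "w \<noteq> \<zero>"
      proof
        assume "w = \<zero>"
        then have xx: "x [^] (q ^ e) = x" unfolding w_def using x by simp
        obtain r where r: "q ^ e = Suc r" using q1 by (cases "q ^ e") auto
        have "x [^] r \<otimes> x = \<one> \<otimes> x" using xx x unfolding r by simp
        then have "x [^] r = \<one>" using m_rcancel[OF x(2,1), of "x [^] r" \<one>] x by simp
        moreover have "0 < r" using q1 r by simp
        ultimately show False using xk k_torsion[of x] by blast
      qed
      have zero: "1 \<le> ordP P w" if P: "P \<in> ?Z" for P
      proof -
        have PP: "P \<in> PD" "place_degree K P = e" "0 \<le> ordP P x" using P unfolding T_def by auto
        have "x \<in> P" using place_ord_nonneg_iff(1)[OF PP(1) x] PP(3) by blast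
        then have "w \<in> fid K P 1" using residue_fermat[OF PP(1), of x] place_norm_power(1)[OF PP(1)] PP(2) unfolding w_def by simp
        then show ?thesis using fidD w0 by blast
      qed
      have "?Z \<subseteq> {P \<in> PD. 1 \<le> ordP P w}" using zero by blast
      then have finZ: "finite ?Z" using zeros_finite[OF wc w0] finite_subset by blast
      then have fin: "finite {P \<in> PD. place_degree K P = e}" using T finite_Diff2 by blast
      have iw: "inv w \<in> carrier K" "inv w \<noteq> \<zero>" using inv_mem[OF wc w0] inv_nz[OF wc w0] by auto
      have pw: "polef w P \<le> int (q ^ e) * polef x P" if P: "P \<in> PD" for P
      proof -
        let ?n = "- (int (q ^ e) * polef x P)"
        have "x [^] (q ^ e) \<in> fid K P ?n"
        proof (rule fidI)
          have "int (q ^ e) * (- polef x P) \<le> int (q ^ e) * ordP P x" by (intro mult_left_mono) (auto simp: polef_def)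
          then show "?n \<le> ordP P (x [^] (q ^ e))" using place_ord_pow[OF P x, of "q ^ e"] by simp
        qed (use x in simp)
        moreover have "x \<in> fid K P ?n"
        proof (rule fidI)
          have "1 \<le> int (q ^ e)" using q1 by linarith
          then have "1 * polef x P \<le> int (q ^ e) * polef x P" by (rule mult_right_mono[OF _ polef_nonneg])
          then show "?n \<le> ordP P x" unfolding polef_def by linarith
        qed (use x in simp)
        ultimately have "w \<in> fid K P ?n" unfolding w_def using additive_subgroup_minus[OF fid_additive_subgroup[OF P]] by blast
        then have "?n \<le> ordP P w" using fidD w0 by blast
        moreover have "0 \<le> int (q ^ e) * polef x P" using polef_nonneg by simp
        ultimately show ?thesis unfolding polef_def by linarith
      qed
      have pf: "finite {P \<in> PD. polef (inv w) P \<noteq> 0}" by (rule polef_finite[OF iw])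
      have one: "1 \<le> polef (inv w) P" if "P \<in> ?Z" for P
      proof -
        have "P \<in> PD" using that by blast
        then show ?thesis using zero[OF that] place_ord_inv[OF _ wc w0, of P] unfolding polef_def by simp
      qed
      have "int e * int (card ?Z) = (\<Sum>P\<in>?Z. 1 * dg P)" by simp
      also have "\<dots> \<le> (\<Sum>P\<in>?Z. polef (inv w) P * dg P)"
        using one by (intro sum_mono mult_right_mono) simp_all
      also have "\<dots> \<le> (\<Sum>P\<in>{P \<in> PD. polef (inv w) P \<noteq> 0}. polef (inv w) P * dg P)"
      proof (rule sum_mono2[OF pf])
        show "?Z \<subseteq> {P \<in> PD. polef (inv w) P \<noteq> 0}"
        proof
          fix P assume "P \<in> ?Z"
          then show "P \<in> {P \<in> PD. polef (inv w) P \<noteq> 0}" using one[of P] by simp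
        qed
      qed (simp add: polef_nonneg)
      also have "\<dots> = deg (mk (polef (inv w)))" using deg_mk[OF pf, of "polef (inv w)"] by simp
      also have "\<dots> = deg (mk (polef w))"
      proof -
        have "mk (polef w) + prdiv w = mk (polef (inv w))" using prdiv_polef[OF wc w0, of 1] wc by simp
        from arg_cong[OF this, of deg] show ?thesis using deg_prdiv[OF wc w0] by (simp add: deg_add)
      qed
      also have "\<dots> \<le> int (q ^ e) * deg (mk (polef x))"
      proof -
        let ?S = "{P \<in> PD. polef x P \<noteq> 0}"
        have S: "finite ?S" by (rule polef_finite[OF x])
        have sub: "{P \<in> PD. polef w P \<noteq> 0} \<subseteq> ?S"
        proof
          fix P assume "P \<in> {P \<in> PD. polef w P \<noteq> 0}"
          then have "P \<in> PD" "0 < polef w P" using polef_nonneg[of w P] by auto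
          then show "P \<in> ?S" using pw[of P] by auto
        qed
        have "deg (mk (polef w)) = (\<Sum>P\<in>?S. polef w P * dg P)" by (rule deg_mk[OF S _ sub]) auto
        also have "\<dots> \<le> (\<Sum>P\<in>?S. int (q ^ e) * polef x P * dg P)" using pw by (intro sum_mono mult_right_mono) auto
        also have "\<dots> = int (q ^ e) * deg (mk (polef x))"
          using deg_mk[OF S, of "polef x"] by (simp add: sum_distrib_left mult.assoc)
        finally show ?thesis .
      qed
      also have "\<dots> \<le> int (q ^ e) * int d" unfolding d_def by (intro mult_left_mono) auto
      finally have "int e * int (card ?Z) \<le> int (q ^ e) * int d" by simp
      then have Zb: "e * card ?Z \<le> q ^ e * d" unfolding of_nat_mult[symmetric] of_nat_le_iff .
      have "card {P \<in> PD. place_degree K P = e} \<le> card ?Z + card T"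
      proof -
        have "card {P \<in> PD. place_degree K P = e} \<le> card (?Z \<union> T)" by (rule card_mono) (use finZ T in blast)+
        also have "\<dots> \<le> card ?Z + card T" by (rule card_Un_le)
        finally show ?thesis by simp
      qed
      then have "e * card {P \<in> PD. place_degree K P = e} \<le> e * card ?Z + e * card T" unfolding add_mult_distrib2[symmetric] by (rule mult_le_mono2)
      also have "\<dots> \<le> q ^ e * d + q ^ e * card T"
      proof (rule add_mono[OF Zb])
        have "2 ^ e \<le> q ^ e" using q_ge_2 by (intro power_mono) auto
        then have "e \<le> q ^ e" using less_exp[of e] by linarith
        then show "e * card T \<le> q ^ e * card T" by simp
      qed
      finally show ?thesis using fin by (simp add: algebra_simps)
    qed
  qed
  then show ?thesis by blast
qed

definition Eff :: "nat \<Rightarrow> ('a set \<Rightarrow>\<^sub>0 int) set" where "Eff n = {A \<in> eff. deg A = int n}"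

lemma place_degree_finite: "finite {P \<in> PD. place_degree K P = e}"
  using prime_count_bound by blast

lemma place_degree_le_finite: "finite {P \<in> PD. place_degree K P \<le> n}"
proof -
  have "{P \<in> PD. place_degree K P \<le> n} = (\<Union>e\<le>n. {P \<in> PD. place_degree K P = e})" by auto
  then show ?thesis using place_degree_finite by simp
qed

lemma Eff_lkp:
  assumes A: "A \<in> Eff n"
  shows "lkp A P * dg P \<le> int n" "lkp A P \<noteq> 0 \<Longrightarrow> P \<in> PD \<and> place_degree K P \<le> n" "0 \<le> lkp A P" "lkp A P \<le> int n"
proof -
  have AE: "A \<in> Div" "\<And>P. 0 \<le> lkp A P" "deg A = int n" using A unfolding Eff_def eff_iff by auto
  show 0: "0 \<le> lkp A P" by (rule AE(2))
  have "lkp A P * dg P \<le> deg A"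
  proof (cases "P \<in> Poly_Mapping.keys A")
    case True
    then show ?thesis unfolding divisor_degree_def using AE(2) by (intro member_le_sum) auto
  next
    case False
    then show ?thesis using deg_eff[of A] A unfolding Eff_def by (simp add: in_keys_iff)
  qed
  then show 1: "lkp A P * dg P \<le> int n" using AE(3) by simp
  show 2: "P \<in> PD \<and> place_degree K P \<le> n" if nz: "lkp A P \<noteq> 0"
  proof -
    have "P \<in> PD" using nz lkp_zero[OF AE(1)] by blast
    moreover have "1 * dg P \<le> lkp A P * dg P" using nz 0 by (intro mult_right_mono) auto
    ultimately show ?thesis using 1 by simp
  qed
  show "lkp A P \<le> int n"
  proof (cases "lkp A P = 0")
    case False
    then have "lkp A P * 1 \<le> lkp A P * dg P" using 2 dg_pos[of P] 0 by (intro mult_left_mono) auto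
    then show ?thesis using 1 by simp
  qed simp
qed

lemma Eff_finite: "finite (Eff n)"
proof -
  let ?S = "{P \<in> PD. place_degree K P \<le> n}"
  have "lkp ` Eff n \<subseteq> {f. \<forall>P. (P \<in> ?S \<longrightarrow> f P \<in> {0..int n}) \<and> (P \<notin> ?S \<longrightarrow> f P = 0)}"
  proof (rule image_subsetI, rule CollectI, rule allI)
    fix A P assume A: "A \<in> Eff n"
    show "(P \<in> ?S \<longrightarrow> lkp A P \<in> {0..int n}) \<and> (P \<notin> ?S \<longrightarrow> lkp A P = 0)" using Eff_lkp(2,3,4)[OF A, of P] by auto
  qed
  then have "finite (lkp ` Eff n)" using finite_set_of_finite_funs[OF place_degree_le_finite, of "{0..int n}" n 0] finite_subset by blast
  moreover have "inj_on lkp (Eff n)" by (auto intro!: inj_onI poly_mapping_eqI)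
  ultimately show ?thesis using finite_imageD by blast
qed

lemma prdiv_eq_iff:
  assumes x: "x \<in> carrier K" "x \<noteq> \<zero>" and y: "y \<in> carrier K" "y \<noteq> \<zero>"
  shows "prdiv x = prdiv y \<longleftrightarrow> (\<exists>c\<in>k - {\<zero>}. x = c \<otimes> y)"
proof
  assume e: "prdiv x = prdiv y"
  let ?c = "x \<otimes> inv y"
  note iy = inv_mem[OF y] inv_nz[OF y]
  have c: "?c \<in> carrier K" "?c \<noteq> \<zero>" using x iy by (auto simp: integral_iff)
  have "ordP P ?c = 0" if P: "P \<in> PD" for P
    using arg_cong[OF e, of "\<lambda>D. lkp D P"] lkp_prdiv[OF x] lkp_prdiv[OF y] P place_ord_mult[OF P x iy] place_ord_inv[OF P y] by simp
  then have "?c \<in> k" using no_poles_imp_const[OF c] by simp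
  moreover have "x = ?c \<otimes> y" using x y iy inv_l[OF y] by (simp add: m_assoc)
  ultimately show "\<exists>c\<in>k - {\<zero>}. x = c \<otimes> y" using c(2) by blast
next
  assume "\<exists>c\<in>k - {\<zero>}. x = c \<otimes> y"
  then obtain c where c: "c \<in> k" "c \<noteq> \<zero>" "x = c \<otimes> y" by blast
  have cc: "c \<in> carrier K" using c k_ring(1) by blast
  have "prdiv c = 0" by (rule poly_mapping_eqI) (use lkp_prdiv[OF cc c(2)] ord_const[OF _ c(1,2)] in auto)
  then show "prdiv x = prdiv y" using prdiv_mult[OF cc c(2) y] c(3) by simp
qed

text \<open>The nonzero x in L(D) yield the effective divisors D + (x) equivalent to D, and two of
  them yield the same divisor exactly when they differ by a nonzero constant.\<close>

lemma linear_system_card: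
  assumes D: "D \<in> Div"
  shows "card (LL D) - 1 = (q - 1) * card {A \<in> eff. A - D \<in> principal_divisors K}"
proof -
  let ?U = "LL D - {\<zero>}" and ?f = "\<lambda>x. D + prdiv x"
  have Uc: "x \<in> carrier K" "x \<noteq> \<zero>" if "x \<in> ?U" for x using that by (auto simp: LL_iff)
  have fin: "finite ?U" using LL_finite[OF D] by simp
  have img: "?f ` ?U = {A \<in> eff. A - D \<in> principal_divisors K}"
  proof
    show "?f ` ?U \<subseteq> {A \<in> eff. A - D \<in> principal_divisors K}"
    proof
      fix A assume "A \<in> ?f ` ?U"
      then obtain x where xU: "x \<in> ?U" "A = D + prdiv x" by blast
      note x = Uc[OF xU(1)]
      have "0 \<le> lkp A P" for P
      proof (cases "P \<in> PD")
        case True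
        then have "- lkp D P \<le> ordP P x" using xU(1) fidD[of x P] by (auto simp: LL_iff)
        then show ?thesis using xU(2) lkp_prdiv[OF x, of P] True by (simp add: lookup_add)
      next
        case False then show ?thesis using xU(2) lkp_prdiv[OF x, of P] lkp_zero[OF D] by (simp add: lookup_add)
      qed
      then have "A \<in> eff" unfolding eff_iff using Div_closed(2)[OF D prdiv_Div[OF x]] xU(2) by blast
      moreover have "A - D = prdiv x" using xU(2) by simp
      ultimately show "A \<in> {A \<in> eff. A - D \<in> principal_divisors K}" using principal_iff x by auto
    qed
    show "{A \<in> eff. A - D \<in> principal_divisors K} \<subseteq> ?f ` ?U"
    proof
      fix A assume "A \<in> {A \<in> eff. A - D \<in> principal_divisors K}"
      then obtain x where A: "A \<in> eff" and x: "x \<in> carrier K" "x \<noteq> \<zero>" "A - D = prdiv x" unfolding principal_iff by blast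
      have AD: "A = D + prdiv x" using x(3) by (metis add.commute diff_add_cancel)
      have "x \<in> fid K P (- lkp D P)" if P: "P \<in> PD" for P
      proof (rule fidI[OF x(1)])
        have "0 \<le> lkp A P" using A unfolding eff_iff by blast
        then show "- lkp D P \<le> ordP P x" using AD lkp_prdiv[OF x(1,2), of P] P by (simp add: lookup_add)
      qed
      then have "x \<in> ?U" using x by (simp add: LL_iff)
      then show "A \<in> ?f ` ?U" using AD by blast
    qed
  qed
  have fib: "card {x \<in> ?U. ?f x = b} = q - 1" if b: "b \<in> ?f ` ?U" for b
  proof -
    obtain y where yU: "y \<in> ?U" "b = ?f y" using b by blast
    note y = Uc[OF yU(1)]
    have "{x \<in> ?U. ?f x = b} = (\<lambda>c. c \<otimes> y) ` (k - {\<zero>})"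
    proof
      show "{x \<in> ?U. ?f x = b} \<subseteq> (\<lambda>c. c \<otimes> y) ` (k - {\<zero>})"
      proof
        fix x assume x: "x \<in> {x \<in> ?U. ?f x = b}"
        then have "prdiv x = prdiv y" using yU(2) by auto
        then show "x \<in> (\<lambda>c. c \<otimes> y) ` (k - {\<zero>})" using prdiv_eq_iff[OF _ _ y] Uc[of x] x by blast
      qed
      show "(\<lambda>c. c \<otimes> y) ` (k - {\<zero>}) \<subseteq> {x \<in> ?U. ?f x = b}"
      proof
        fix x assume "x \<in> (\<lambda>c. c \<otimes> y) ` (k - {\<zero>})"
        then obtain c where c: "c \<in> k" "c \<noteq> \<zero>" "x = c \<otimes> y" by blast
        have cc: "c \<in> carrier K" using c k_ring(1) by blast
        have x: "x \<in> carrier K" "x \<noteq> \<zero>" using c(2,3) cc y by (auto simp: integral_iff)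
        have "prdiv x = prdiv y" using prdiv_eq_iff[OF x y] c by blast
        moreover have "x \<in> LL D" using LL_smult[OF c(1)] yU(1) c(3) by blast
        ultimately show "x \<in> {x \<in> ?U. ?f x = b}" using x yU(2) by simp
      qed
    qed
    moreover have "inj_on (\<lambda>c. c \<otimes> y) (k - {\<zero>})"
    proof (rule inj_onI)
      fix a b assume "a \<in> k - {\<zero>}" "b \<in> k - {\<zero>}" "a \<otimes> y = b \<otimes> y"
      then show "a = b" using m_rcancel[OF y(2,1)] k_ring(1) by blast
    qed
    ultimately have "card {x \<in> ?U. ?f x = b} = card (k - {\<zero>})" by (simp add: card_image)
    also have "\<dots> = q - 1" using k_finite k_ring(2) q by simp
    finally show ?thesis .
  qed
  have "card ?U = (q - 1) * card (?f ` ?U)" by (rule card_fibres[OF fin fib])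
  moreover have "card ?U = card (LL D) - 1" using LL_finite[OF D] additive_subgroup.zero_closed[OF LL_additive] by simp
  ultimately show ?thesis unfolding img by simp
qed

end

section \<open>Divisor classes and the number of effective divisors\<close>

context ffield begin

abbreviation PRD where "PRD \<equiv> principal_divisors K"
abbreviation Div0 where "Div0 \<equiv> {D \<in> Div. deg D = 0}"

text \<open>Divisor classes as cosets of the principal divisors, written as in the quotient group
  behind \<open>class_number\<close>.\<close>

definition cls :: "('a set \<Rightarrow>\<^sub>0 int) \<Rightarrow> ('a set \<Rightarrow>\<^sub>0 int) set" where "cls D = (\<lambda>h. h + D) ` PRD"

lemma PRD_zero: "0 \<in> PRD"
proof -
  have "prdiv \<one> = 0" by (rule poly_mapping_eqI) (simp add: lkp_prdiv place_ord_one)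
  then show ?thesis unfolding principal_iff by (intro bexI[of _ \<one>]) auto
qed

lemma PRD_diff: assumes "D \<in> PRD" "E \<in> PRD" shows "D - E \<in> PRD"
proof -
  obtain x y where x: "x \<in> carrier K" "x \<noteq> \<zero>" "D = prdiv x" and y: "y \<in> carrier K" "y \<noteq> \<zero>" "E = prdiv y"
    using assms unfolding principal_iff by blast
  note iy = inv_mem[OF y(1,2)] inv_nz[OF y(1,2)]
  have "prdiv (x \<otimes> inv y) = D - E" using prdiv_mult[OF x(1,2) iy] prdiv_inv[OF y(1,2)] x(3) y(3) by simp
  moreover have "x \<otimes> inv y \<in> carrier K - {\<zero>}" using x iy by (auto simp: integral_iff)
  ultimately show ?thesis unfolding principal_iff by metis
qed

lemma PRD_add: assumes "D \<in> PRD" "E \<in> PRD" shows "D + E \<in> PRD"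
  using PRD_diff[OF assms(1) PRD_diff[OF PRD_zero assms(2)]] by simp

lemma PRD_deg: "D \<in> PRD \<Longrightarrow> deg D = 0" "D \<in> PRD \<Longrightarrow> D \<in> Div"
proof -
  assume "D \<in> PRD"
  then obtain x where "x \<in> carrier K" "x \<noteq> \<zero>" "D = prdiv x" unfolding principal_iff by blast
  then show "deg D = 0" "D \<in> Div" using deg_prdiv prdiv_Div by blast+
qed

lemma cls_eq_iff: "cls D = cls E \<longleftrightarrow> D - E \<in> PRD"
proof
  assume "cls D = cls E"
  moreover have "0 + D \<in> cls D" unfolding cls_def using PRD_zero by blast
  ultimately obtain h where "h \<in> PRD" "0 + D = h + E" unfolding cls_def by blast
  then show "D - E \<in> PRD" by simp
next
  have *: "cls D \<subseteq> cls E" if "D - E \<in> PRD" for D E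
  proof
    fix A assume "A \<in> cls D"
    then obtain h where h: "h \<in> PRD" "A = h + D" unfolding cls_def by blast
    have "A = (h + (D - E)) + E" using h(2) by simp
    then show "A \<in> cls E" unfolding cls_def using PRD_add[OF h(1) that] by blast
  qed
  assume d: "D - E \<in> PRD"
  then have "E - D \<in> PRD" using PRD_diff[OF PRD_zero d] by simp
  then show "cls D = cls E" using * d by blast
qed

lemma class_number_eq: "class_number K = card (cls ` Div0)"
proof -
  let ?G = "(divisor_group K)\<lparr>carrier := {D \<in> carrier (divisor_group K). deg D = 0}\<rparr>"
  have e: "{D \<in> carrier (divisor_group K). deg D = 0} = Div0" by auto
  have "carrier (?G Mod PRD) = cls ` Div0"
    unfolding FactGroup_def RCOSETS_def r_coset_def cls_def by (auto simp: e image_def)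
  then show ?thesis unfolding class_number_def order_def by simp
qed

text \<open>The divisor D0 shifts classes of degree n to classes of degree zero. Each class then
  holds (q^l - 1)/(q - 1) effective divisors with l = n + 1 - g, in particular at least one; since
  there are finitely many effective divisors of degree n, the class group is finite as well.\<close>

lemma eff_count:
  "\<exists>n0. \<forall>n. \<forall>D0\<in>Div. deg D0 = int n \<longrightarrow> n0 \<le> int n \<longrightarrow>
     genus K \<le> int n \<and> (q - 1) * card (Eff n) = class_number K * (q ^ nat (int n + 1 - genus K) - 1) \<and> 0 < class_number K"
proof -
  obtain c where c: "\<And>D. D \<in> Div \<Longrightarrow> c \<le> deg D \<Longrightarrow> ll D = deg D + 1 - genus K" using riemann_equality by blast
  have "genus K \<le> int n \<and> (q - 1) * card (Eff n) = class_number K * (q ^ nat (int n + 1 - genus K) - 1) \<and> 0 < class_number K"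
    if D0: "D0 \<in> Div" "deg D0 = int n" and n: "max c (genus K) \<le> int n" for n D0
  proof -
    let ?l = "nat (int n + 1 - genus K)"
    let ?f = "\<lambda>A. cls (A - D0)"
    have l1: "1 \<le> ?l" using n by (simp add: Suc_le_eq)
    have EffD: "A \<in> Div" "deg A = int n" if "A \<in> Eff n" for A using that unfolding Eff_def eff_iff by auto
    have fib: "(q - 1) * card {A \<in> Eff n. ?f A = cls E} = q ^ ?l - 1" if E: "E \<in> Div0" for E
    proof -
      have DE: "D0 + E \<in> Div" "deg (D0 + E) = int n" using Div_closed(2)[OF D0(1)] E D0(2) by (auto simp: deg_add)
      have "{A \<in> Eff n. ?f A = cls E} = {A \<in> eff. A - (D0 + E) \<in> PRD}"
      proof (rule Set.set_eqI)
        fix A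
        have "deg A = int n" if "A - (D0 + E) \<in> PRD"
          using PRD_deg(1)[OF that] DE(2) by (simp add: deg_diff)
        then show "A \<in> {A \<in> Eff n. ?f A = cls E} \<longleftrightarrow> A \<in> {A \<in> eff. A - (D0 + E) \<in> PRD}"
          unfolding cls_eq_iff Eff_def diff_diff_eq by blast
      qed
      then have "(q - 1) * card {A \<in> Eff n. ?f A = cls E} = card (LL (D0 + E)) - 1" using linear_system_card[OF DE(1)] by simp
      also have "card (LL (D0 + E)) = q ^ riemann_roch_dim K (D0 + E)" by (rule card_LL[OF DE(1)])
      also have "riemann_roch_dim K (D0 + E) = ?l" using c[OF DE(1)] DE(2) n by simp
      finally show ?thesis .
    qed
    have pos: "0 < q ^ ?l - 1"
    proof -
      have "1 < q ^ ?l" using one_less_power[of q ?l] q_ge_2 l1 by simp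
      then show ?thesis by simp
    qed
    have img: "?f ` Eff n = cls ` Div0"
    proof
      show "?f ` Eff n \<subseteq> cls ` Div0"
      proof
        fix x assume "x \<in> ?f ` Eff n"
        then obtain A where A: "A \<in> Eff n" "x = cls (A - D0)" by blast
        have "A - D0 \<in> Div0" using Div_closed(4)[OF EffD(1)[OF A(1)] D0(1)] EffD(2)[OF A(1)] D0(2) by (simp add: deg_diff)
        then show "x \<in> cls ` Div0" using A(2) by blast
      qed
      show "cls ` Div0 \<subseteq> ?f ` Eff n"
      proof
        fix x assume "x \<in> cls ` Div0"
        then obtain E where E: "E \<in> Div0" "x = cls E" by blast
        have "card {A \<in> Eff n. ?f A = cls E} \<noteq> 0" using fib[OF E(1)] pos by (metis mult_0_right less_not_refl)
        then have "{A \<in> Eff n. ?f A = cls E} \<noteq> {}" by (metis card.empty)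
        then show "x \<in> ?f ` Eff n" using E(2) by blast
      qed
    qed
    define m where "m = (q ^ ?l - 1) div (q - 1)"
    have q1: "0 < q - 1" using q_ge_2 by simp
    have "card {A \<in> Eff n. ?f A = b} = m" if b: "b \<in> ?f ` Eff n" for b
    proof -
      have "b \<in> cls ` Div0" using b unfolding img .
      then obtain E where E: "E \<in> Div0" "b = cls E" by blast
      show ?thesis unfolding m_def fib[OF E(1), symmetric] E(2) using q1 by simp
    qed
    then have "card (Eff n) = m * card (?f ` Eff n)" by (rule card_fibres[OF Eff_finite])
    then have 1: "card (Eff n) = m * class_number K" unfolding img class_number_eq .
    have z0: "0 \<in> Div0" using Div_closed(1) by simp
    have "(q - 1) * m = q ^ ?l - 1" unfolding m_def fib[OF z0, symmetric] using q1 by simp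
    then have 2: "(q - 1) * card (Eff n) = class_number K * (q ^ ?l - 1)" unfolding 1 by (metis mult.assoc mult.commute)
    have "finite (cls ` Div0)" unfolding img[symmetric] using Eff_finite by simp
    then have "0 < class_number K" unfolding class_number_eq using z0 by (auto simp: card_gt_0_iff)
    then show ?thesis using 2 n by simp
  qed
  then show ?thesis by blast
qed

text \<open>This holds for every n: a degree that no divisor has contributes nothing, and the
  finitely many small degrees are absorbed by the constant.\<close>

lemma eff_upper: "\<exists>a::nat. \<forall>n. card (Eff n) \<le> a * q ^ n"
proof -
  obtain n0 where n0: "\<And>n D0. D0 \<in> Div \<Longrightarrow> deg D0 = int n \<Longrightarrow> n0 \<le> int n \<Longrightarrow>
     genus K \<le> int n \<and> (q - 1) * card (Eff n) = class_number K * (q ^ nat (int n + 1 - genus K) - 1) \<and> 0 < class_number K"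
    using eff_count by blast
  let ?s = "\<Sum>i<nat n0. card (Eff i)" and ?b = "class_number K * q ^ (1 + nat (- genus K))"
  have "card (Eff n) \<le> (?s + ?b) * q ^ n" for n
  proof (cases "n0 \<le> int n")
    case False
    then have "card (Eff n) \<le> ?s" by (intro member_le_sum) auto
    also have "\<dots> \<le> ?s * q ^ n" using q_ge_2 by simp
    finally show ?thesis by (simp add: add_mult_distrib)
  next
    case True
    show ?thesis
    proof (cases "Eff n = {}")
      case False
      then obtain D0 where "D0 \<in> Eff n" by blast
      then have D0: "D0 \<in> Div" "deg D0 = int n" unfolding Eff_def eff_iff by auto
      have "1 * card (Eff n) \<le> (q - 1) * card (Eff n)" using q_ge_2 by (intro mult_le_mono1) simp
      also have "\<dots> = class_number K * (q ^ nat (int n + 1 - genus K) - 1)" using n0[OF D0 True] by blast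
      also have "\<dots> \<le> class_number K * q ^ (1 + nat (- genus K) + n)"
      proof (rule mult_le_mono2)
        have "q ^ nat (int n + 1 - genus K) \<le> q ^ (1 + nat (- genus K) + n)" using q_ge_2 by (intro power_increasing) auto
        then show "q ^ nat (int n + 1 - genus K) - 1 \<le> q ^ (1 + nat (- genus K) + n)" by simp
      qed
      also have "\<dots> = ?b * q ^ n" by (simp add: power_add)
      finally have "card (Eff n) \<le> ?b * q ^ n" by simp
      then show ?thesis unfolding add_mult_distrib by (rule trans_le_add2)
    qed simp
  qed
  then show ?thesis by blast
qed

lemma eff_lower:
  "\<exists>n0 b::nat. \<forall>n\<ge>n0. \<forall>D0\<in>Div. deg D0 = int n \<longrightarrow> q ^ n \<le> b * card (Eff n)"
proof -
  obtain n0 where n0: "\<And>n D0. D0 \<in> Div \<Longrightarrow> deg D0 = int n \<Longrightarrow> n0 \<le> int n \<Longrightarrow>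
     genus K \<le> int n \<and> (q - 1) * card (Eff n) = class_number K * (q ^ nat (int n + 1 - genus K) - 1) \<and> 0 < class_number K"
    using eff_count by blast
  have "q ^ n \<le> (2 * q ^ nat (genus K) * (q - 1)) * card (Eff n)"
    if n: "nat n0 \<le> n" and D0: "D0 \<in> Div" "deg D0 = int n" for n D0
  proof -
    let ?l = "nat (int n + 1 - genus K)"
    have f: "genus K \<le> int n" "(q - 1) * card (Eff n) = class_number K * (q ^ ?l - 1)" "0 < class_number K"
      using n0[OF D0] n by auto
    have "q ^ 1 \<le> q ^ ?l" by (rule power_increasing) (use f(1) q_ge_2 in \<open>simp_all add: Suc_le_eq\<close>)
    then have "q \<le> q ^ ?l" by (simp only: power_one_right)
    then have "2 \<le> q ^ ?l" by (rule le_trans[OF q_ge_2])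
    then have 2: "q ^ ?l \<le> 2 * (q ^ ?l - 1)" by simp
    have "q ^ n \<le> q ^ (nat (genus K) + ?l)" using q_ge_2 f(1) by (intro power_increasing) auto
    also have "\<dots> = q ^ nat (genus K) * q ^ ?l" by (simp add: power_add)
    also have "\<dots> \<le> q ^ nat (genus K) * (2 * (q ^ ?l - 1))" using 2 by (rule mult_le_mono2)
    also have "\<dots> \<le> q ^ nat (genus K) * (2 * (class_number K * (q ^ ?l - 1)))" using f(3) by simp
    also have "\<dots> = (2 * q ^ nat (genus K) * (q - 1)) * card (Eff n)" unfolding f(2)[symmetric] by simp
    finally show ?thesis by simp
  qed
  then show ?thesis by blast
qed

lemma place_exists: "PD \<noteq> {}"
proof -
  obtain y where "y \<in> carrier K" "y \<notin> k" using nonconst by blast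
  then obtain P where "P \<in> PD" by (rule pole_exists)
  then show ?thesis by blast
qed

lemma degree_gcd:
  "\<exists>d::nat. 0 < d \<and> (\<forall>D\<in>Div. int d dvd deg D) \<and> (\<forall>m::int. \<exists>D\<in>Div. deg D = m * int d)"
proof -
  have scale: "\<exists>E\<in>Div. deg E = m * deg D" if D: "D \<in> Div" for D and m :: int
  proof -
    have f: "finite {P \<in> PD. lkp D P \<noteq> 0}" by (rule finite_subset[of _ "Poly_Mapping.keys D"]) (auto simp: in_keys_iff)
    have "mk (lkp D) = D" by (rule poly_mapping_eqI) (use lkp_mk[OF f] lkp_zero[OF D] in auto)
    then show ?thesis using deg_mk_scale[OF f, of m] mk_Div[OF finite_scale[OF f, of m]] by metis
  qed
  let ?Q = "\<lambda>d::nat. 0 < d \<and> (\<exists>D\<in>Div. deg D = int d)"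
  obtain P where P: "P \<in> PD" using place_exists by blast
  have Q: "?Q (place_degree K P)"
  proof
    show "0 < place_degree K P" using dg_pos[OF P] by simp
    show "\<exists>D\<in>Div. deg D = dg P" by (rule bexI[OF _ Div_closed(5)[OF P, of 1]]) simp
  qed
  define d where "d = (LEAST d. ?Q d)"
  have d: "?Q d" "\<And>e. ?Q e \<Longrightarrow> d \<le> e" unfolding d_def by (rule LeastI[of ?Q, OF Q], rule Least_le)
  obtain D1 where D1: "D1 \<in> Div" "deg D1 = int d" using d(1) by blast
  have "int d dvd deg D" if D: "D \<in> Div" for D
  proof (rule ccontr)
    assume nd: "\<not> int d dvd deg D"
    obtain E where E: "E \<in> Div" "deg E = (deg D div int d) * deg D1" using scale[OF D1(1)] by blast
    have "deg (D - E) = deg D mod int d" using E(2) D1(2) by (simp add: deg_diff minus_div_mult_eq_mod)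
    then have r: "deg (D - E) = int (nat (deg D mod int d))" using d(1) by simp
    have "deg D mod int d \<noteq> 0" using nd by (simp add: dvd_eq_mod_eq_0)
    moreover have "0 \<le> deg D mod int d" "deg D mod int d < int d" using d(1) by auto
    ultimately have "0 < nat (deg D mod int d)" and lt: "nat (deg D mod int d) < d" by auto
    moreover have "\<exists>D'\<in>Div. deg D' = int (nat (deg D mod int d))" by (rule bexI[OF _ Div_closed(4)[OF D E(1)]]) (rule r)
    ultimately have "d \<le> nat (deg D mod int d)" using d(2) by blast
    then show False using lt by simp
  qed
  moreover have "\<exists>D\<in>Div. deg D = m * int d" for m :: int using scale[OF D1(1), of m] D1(2) by simp
  ultimately show ?thesis using d(1) by blast
qed

end

text \<open>Pairs of effective divisors of \<open>K\<close> inject into those of \<open>M\<close>, so the number of effective divisors of \<open>M\<close> of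
  norm \<open>q ^ n\<close> would be of order \<open>n q ^ n\<close>.\<close>

lemma doubled_places_degree:
  fixes K :: "('a, 'b) ring_scheme" and M :: "('c, 'd) ring_scheme"
  assumes K: "ffield K k q B C" and M: "ffield M k' q' B' C'"
    and s1: "\<sigma>1 ` prime_divisors K \<subseteq> prime_divisors M" "inj_on \<sigma>1 (prime_divisors K)"
    and s2: "\<sigma>2 ` prime_divisors K \<subseteq> prime_divisors M" "inj_on \<sigma>2 (prime_divisors K)"
    and dis: "\<sigma>1 ` prime_divisors K \<inter> \<sigma>2 ` prime_divisors K = {}"
    and nrm: "\<And>P. P \<in> prime_divisors K \<Longrightarrow> place_norm M (\<sigma>1 P) = place_norm K P"
      "\<And>P. P \<in> prime_divisors K \<Longrightarrow> place_norm M (\<sigma>2 P) = place_norm K P"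
  shows False
proof -
  interpret K: ffield K k q B C by fact
  interpret M: ffield M k' q' B' C' by fact
  let ?P = "prime_divisors K"
  \<comment> \<open>The multiplicities on M of the pair: D1 is transported along
    \<open>\<sigma>1\<close>, D2 along \<open>\<sigma>2\<close>. Disjoint images make the pair
    recoverable.\<close>
  define \<tau> where "\<tau> = (\<lambda>(D1, D2). \<lambda>Q. if Q \<in> \<sigma>1 ` ?P then lkp D1 (inv_into ?P \<sigma>1 Q)
      else if Q \<in> \<sigma>2 ` ?P then lkp D2 (inv_into ?P \<sigma>2 Q) else (0::int))"
  have t1: "\<tau> (D1, D2) (\<sigma>1 P) = lkp D1 P" if "P \<in> ?P" for D1 D2 P
    unfolding \<tau>_def using that s1(2) by simp
  have t2: "\<tau> (D1, D2) (\<sigma>2 P) = lkp D2 P" if "P \<in> ?P" for D1 D2 P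
  proof -
    have "\<sigma>2 P \<in> \<sigma>2 ` ?P" using that by blast
    moreover then have "\<sigma>2 P \<notin> \<sigma>1 ` ?P" using dis by blast
    ultimately show ?thesis unfolding \<tau>_def using that s2(2) by simp
  qed
  have supp: "{Q \<in> prime_divisors M. \<tau> (D1, D2) Q \<noteq> 0} \<subseteq> \<sigma>1 ` Poly_Mapping.keys D1 \<union> \<sigma>2 ` Poly_Mapping.keys D2"
    if "D1 \<in> K.Div" "D2 \<in> K.Div" for D1 D2
  proof
    fix Q assume "Q \<in> {Q \<in> prime_divisors M. \<tau> (D1, D2) Q \<noteq> 0}"
    then have Q: "\<tau> (D1, D2) Q \<noteq> 0" by blast
    then consider "Q \<in> \<sigma>1 ` ?P" | "Q \<in> \<sigma>2 ` ?P" unfolding \<tau>_def by (auto split: if_splits)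
    then show "Q \<in> \<sigma>1 ` Poly_Mapping.keys D1 \<union> \<sigma>2 ` Poly_Mapping.keys D2"
    proof cases
      case 1
      then obtain P where "P \<in> ?P" "Q = \<sigma>1 P" by blast
      then show ?thesis using Q t1 by (auto simp: in_keys_iff)
    next
      case 2
      then obtain P where "P \<in> ?P" "Q = \<sigma>2 P" by blast
      then show ?thesis using Q t2 by (auto simp: in_keys_iff)
    qed
  qed
  have fin: "finite {Q \<in> prime_divisors M. \<tau> (D1, D2) Q \<noteq> 0}" if "D1 \<in> K.Div" "D2 \<in> K.Div" for D1 D2
    by (rule finite_subset[OF supp[OF that]]) simp
  \<comment> \<open>The two fields may have constant fields of different sizes, so degrees are
    compared through the logarithms of the norms.\<close>
  have lq: "0 < ln (real q)" "0 < ln (real q')" using K.q_ge_2 M.q_ge_2 by auto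
  have dgs: "real (place_degree M (\<sigma> P)) * ln (real q') = real (place_degree K P) * ln (real q)"
    if "P \<in> ?P" "\<sigma> P \<in> prime_divisors M" "place_norm M (\<sigma> P) = place_norm K P" for P \<sigma>
  proof -
    have "real (q' ^ place_degree M (\<sigma> P)) = real (q ^ place_degree K P)"
      using M.place_norm_power(1)[OF that(2)] K.place_norm_power(1)[OF that(1)] that(3) by simp
    then have "ln (real (q' ^ place_degree M (\<sigma> P))) = ln (real (q ^ place_degree K P))" by simp
    then show ?thesis using K.q_ge_2 M.q_ge_2 by (simp add: ln_realpow)
  qed
  have dgt: "real_of_int (M.deg (M.mk (\<tau> (D1, D2)))) * ln (real q') = real_of_int (K.deg D1 + K.deg D2) * ln (real q)"
    if D: "D1 \<in> K.Div" "D2 \<in> K.Div" for D1 D2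
  proof -
    let ?A = "Poly_Mapping.keys D1" and ?B = "Poly_Mapping.keys D2"
    have sub: "?A \<subseteq> ?P" "?B \<subseteq> ?P" using D by auto
    have S: "finite (\<sigma>1 ` ?A \<union> \<sigma>2 ` ?B)" "\<sigma>1 ` ?A \<union> \<sigma>2 ` ?B \<subseteq> prime_divisors M" using sub s1(1) s2(1) by (simp, blast)
    have "M.deg (M.mk (\<tau> (D1, D2))) = (\<Sum>Q\<in>\<sigma>1 ` ?A \<union> \<sigma>2 ` ?B. \<tau> (D1, D2) Q * int (place_degree M Q))"
      by (rule M.deg_mk[OF S supp[OF D]])
    also have "\<dots> = (\<Sum>Q\<in>\<sigma>1 ` ?A. \<tau> (D1, D2) Q * int (place_degree M Q)) + (\<Sum>Q\<in>\<sigma>2 ` ?B. \<tau> (D1, D2) Q * int (place_degree M Q))"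
      by (rule sum.union_disjoint) (use dis sub in auto)
    also have "(\<Sum>Q\<in>\<sigma>1 ` ?A. \<tau> (D1, D2) Q * int (place_degree M Q)) = (\<Sum>P\<in>?A. lkp D1 P * int (place_degree M (\<sigma>1 P)))"
      unfolding sum.reindex[OF inj_on_subset[OF s1(2) sub(1)]] comp_def by (rule sum.cong) (use t1 sub(1) in auto)
    also have "(\<Sum>Q\<in>\<sigma>2 ` ?B. \<tau> (D1, D2) Q * int (place_degree M Q)) = (\<Sum>P\<in>?B. lkp D2 P * int (place_degree M (\<sigma>2 P)))"
      unfolding sum.reindex[OF inj_on_subset[OF s2(2) sub(2)]] comp_def by (rule sum.cong) (use t2 sub(2) in auto)
    finally have e: "M.deg (M.mk (\<tau> (D1, D2))) = (\<Sum>P\<in>?A. lkp D1 P * int (place_degree M (\<sigma>1 P))) + (\<Sum>P\<in>?B. lkp D2 P * int (place_degree M (\<sigma>2 P)))" by simp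
    have 1: "real_of_int (\<Sum>P\<in>?A. lkp D1 P * int (place_degree M (\<sigma>1 P))) * ln (real q') = real_of_int (K.deg D1) * ln (real q)"
    proof -
      have "real_of_int (\<Sum>P\<in>?A. lkp D1 P * int (place_degree M (\<sigma>1 P))) * ln (real q')
          = (\<Sum>P\<in>?A. real_of_int (lkp D1 P) * (real (place_degree M (\<sigma>1 P)) * ln (real q')))"
        by (simp add: sum_distrib_right mult.assoc)
      also have "\<dots> = (\<Sum>P\<in>?A. real_of_int (lkp D1 P) * (real (place_degree K P) * ln (real q)))"
        using dgs[of _ \<sigma>1] sub(1) s1(1) nrm(1) by (intro sum.cong) (auto simp: image_subset_iff subset_iff)
      finally show ?thesis unfolding divisor_degree_def by (simp add: sum_distrib_right mult.assoc)
    qed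
    have 2: "real_of_int (\<Sum>P\<in>?B. lkp D2 P * int (place_degree M (\<sigma>2 P))) * ln (real q') = real_of_int (K.deg D2) * ln (real q)"
    proof -
      have "real_of_int (\<Sum>P\<in>?B. lkp D2 P * int (place_degree M (\<sigma>2 P))) * ln (real q')
          = (\<Sum>P\<in>?B. real_of_int (lkp D2 P) * (real (place_degree M (\<sigma>2 P)) * ln (real q')))"
        by (simp add: sum_distrib_right mult.assoc)
      also have "\<dots> = (\<Sum>P\<in>?B. real_of_int (lkp D2 P) * (real (place_degree K P) * ln (real q)))"
        using dgs[of _ \<sigma>2] sub(2) s2(1) nrm(2) by (intro sum.cong) (auto simp: image_subset_iff subset_iff)
      finally show ?thesis unfolding divisor_degree_def by (simp add: sum_distrib_right mult.assoc)
    qed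
    show ?thesis unfolding e of_int_add distrib_right 1 2 by simp
  qed
  obtain d :: nat where d: "0 < d" and d2: "\<forall>m::int. \<exists>D\<in>K.Div. K.deg D = m * int d" using K.degree_gcd by auto
  obtain n0 b where b: "\<And>n D0. n0 \<le> n \<Longrightarrow> D0 \<in> K.Div \<Longrightarrow> K.deg D0 = int n \<Longrightarrow> q ^ n \<le> b * card (K.Eff n)" using K.eff_lower by blast
  obtain a where a: "\<And>n. card (M.Eff n) \<le> a * q' ^ n" using M.eff_upper by blast
  \<comment> \<open>Leaves a b b + 1 splittings of m into two parts of size at least n0, one more
    than the constants a, b, b of the upper and lower bounds permit.\<close>
  define m where "m = 2 * n0 + a * b * b"
  let ?I = "{n0..m - n0}"
  define U where "U = (\<Union>i\<in>?I. K.Eff (d * i) \<times> K.Eff (d * (m - i)))"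
  have UD: "D1 \<in> K.eff" "D2 \<in> K.eff" "K.deg D1 + K.deg D2 = int (d * m)" if U: "(D1, D2) \<in> U" for D1 D2
  proof -
    obtain i where i: "i \<in> ?I" "D1 \<in> K.Eff (d * i)" "D2 \<in> K.Eff (d * (m - i))" using U unfolding U_def by blast
    then show "D1 \<in> K.eff" "D2 \<in> K.eff" unfolding K.Eff_def by auto
    have "K.deg D1 + K.deg D2 = int (d * i + d * (m - i))" using i(2,3) unfolding K.Eff_def by simp
    moreover have "i \<le> m" using i(1) by (metis atLeastAtMost_iff diff_le_self le_trans)
    then have "d * i + d * (m - i) = d * m" by (metis add_mult_distrib2 le_add_diff_inverse)
    ultimately show "K.deg D1 + K.deg D2 = int (d * m)" by simp
  qed
  have UDiv: "D1 \<in> K.Div" "D2 \<in> K.Div" if U: "(D1, D2) \<in> U" for D1 D2 using UD(1,2)[OF U] unfolding K.eff_iff by auto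
  let ?g = "\<lambda>p. M.mk (\<tau> p)"
  have inj: "inj_on ?g U"
  proof (rule inj_onI, clarify)
    fix D1 D2 E1 E2 assume A: "(D1, D2) \<in> U" "(E1, E2) \<in> U" and e: "M.mk (\<tau> (D1, D2)) = M.mk (\<tau> (E1, E2))"
    have eq: "\<tau> (D1, D2) Q = \<tau> (E1, E2) Q" if "Q \<in> prime_divisors M" for Q
      using arg_cong[OF e, of "\<lambda>D. lkp D Q"] M.lkp_mk[OF fin[OF UDiv[OF A(1)]]] M.lkp_mk[OF fin[OF UDiv[OF A(2)]]] that by simp
    have "lkp D1 P = lkp E1 P \<and> lkp D2 P = lkp E2 P" for P
    proof (cases "P \<in> ?P")
      case True
      then show ?thesis using eq[of "\<sigma>1 P"] eq[of "\<sigma>2 P"] t1[OF True] t2[OF True] s1(1) s2(1) by auto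
    next
      case False
      then show ?thesis using K.lkp_zero[OF UDiv(1)[OF A(1)]] K.lkp_zero[OF UDiv(2)[OF A(1)]] K.lkp_zero[OF UDiv(1)[OF A(2)]] K.lkp_zero[OF UDiv(2)[OF A(2)]] by simp
    qed
    then show "D1 = E1 \<and> D2 = E2" by (auto intro: poly_mapping_eqI)
  qed
  have geff: "?g p \<in> M.eff" if "p \<in> U" for p
  proof -
    obtain D1 D2 where p: "p = (D1, D2)" by (cases p)
    have U: "(D1, D2) \<in> U" using that p by simp
    have nn: "0 \<le> lkp D1 P" "0 \<le> lkp D2 P" for P using UD(1,2)[OF U] unfolding K.eff_iff by auto
    show ?thesis unfolding p by (rule M.mk_eff[OF fin[OF UDiv[OF U]]]) (simp add: \<tau>_def nn)
  qed
  have gdeg: "real_of_int (M.deg (?g p)) * ln (real q') = real (d * m) * ln (real q)" if "p \<in> U" for p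
  proof -
    obtain D1 D2 where p: "p = (D1, D2)" by (cases p)
    have U: "(D1, D2) \<in> U" using that p by simp
    have "real_of_int (K.deg D1 + K.deg D2) = real (d * m)" using UD(3)[OF U] by (simp del: of_nat_mult)
    then show ?thesis using dgt[OF UDiv[OF U]] unfolding p by simp
  qed
  have mn: "n0 \<le> m - n0" "card ?I = Suc (a * b * b)" unfolding m_def by auto
  have low: "q ^ (d * i) \<le> b * card (K.Eff (d * i))" if n0i: "n0 \<le> i" for i
  proof -
    obtain D where D: "D \<in> K.Div" "K.deg D = int i * int d" using d2 by blast
    have "n0 \<le> d * i"
    proof -
      have "1 * i \<le> d * i" using d by (intro mult_le_mono1) simp
      then have "i \<le> d * i" by (simp only: mult_1)
      then show ?thesis using n0i le_trans by blast
    qed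
    then show ?thesis using b[of "d * i" D] D by (simp add: mult.commute)
  qed
  have finU: "finite U" unfolding U_def using K.Eff_finite by simp
  have cU: "card U = (\<Sum>i\<in>?I. card (K.Eff (d * i)) * card (K.Eff (d * (m - i))))"
    unfolding U_def
  proof (subst card_UN_disjoint)
    show "\<forall>i\<in>?I. \<forall>j\<in>?I. i \<noteq> j \<longrightarrow> K.Eff (d * i) \<times> K.Eff (d * (m - i)) \<inter> K.Eff (d * j) \<times> K.Eff (d * (m - j)) = {}"
      using d unfolding K.Eff_def by auto
  qed (use K.Eff_finite in \<open>auto simp: card_cartesian_product\<close>)
  have "Suc (a * b * b) * q ^ (d * m) = (\<Sum>i\<in>?I. q ^ (d * m))" using mn by simp
  also have "\<dots> \<le> (\<Sum>i\<in>?I. (b * card (K.Eff (d * i))) * (b * card (K.Eff (d * (m - i)))))"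
  proof (rule sum_mono)
    fix i assume i: "i \<in> ?I"
    have "n0 \<le> m - i" using i mn(1) by auto
    have "i \<le> m" using i by (metis atLeastAtMost_iff diff_le_self le_trans)
    then have "d * m = d * i + d * (m - i)" by (metis add_mult_distrib2 le_add_diff_inverse)
    then have "q ^ (d * m) = q ^ (d * i) * q ^ (d * (m - i))" by (simp add: power_add)
    also have "\<dots> \<le> (b * card (K.Eff (d * i))) * (b * card (K.Eff (d * (m - i))))"
      using low[of i] low[of "m - i"] i \<open>n0 \<le> m - i\<close> by (intro mult_le_mono) auto
    finally show "q ^ (d * m) \<le> (b * card (K.Eff (d * i))) * (b * card (K.Eff (d * (m - i))))" .
  qed
  also have "\<dots> = b * b * card U" unfolding cU by (simp add: sum_distrib_left algebra_simps)
  also have "\<dots> \<le> b * b * (a * q ^ (d * m))"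
  proof (rule mult_le_mono2)
    show "card U \<le> a * q ^ (d * m)"
    proof (cases "U = {}")
      case False
      then obtain p where p: "p \<in> U" by blast
      define n where "n = nat (M.deg (?g p))"
      have dn: "M.deg (?g p) = int n" unfolding n_def using M.deg_eff[OF geff[OF p]] by simp
      have "?g ` U \<subseteq> M.Eff n"
      proof
        fix A assume "A \<in> ?g ` U"
        then obtain p' where p': "p' \<in> U" "A = ?g p'" by blast
        have "real_of_int (M.deg A) * ln (real q') = real_of_int (M.deg (?g p)) * ln (real q')" using gdeg[OF p] gdeg[OF p'(1)] p'(2) by simp
        then have "M.deg A = int n" using lq dn by simp
        then show "A \<in> M.Eff n" unfolding M.Eff_def using geff[OF p'(1)] p'(2) by simp
      qed
      then have "card U \<le> card (M.Eff n)" using card_inj_on_le[OF inj _ M.Eff_finite] by blast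
      also have "\<dots> \<le> a * q' ^ n" by (rule a)
      also have "q' ^ n = q ^ (d * m)"
      proof -
        have "ln (real (q' ^ n)) = ln (real (q ^ (d * m)))" using gdeg[OF p] dn K.q_ge_2 M.q_ge_2 by (simp add: ln_realpow)
        moreover have "0 < real (q' ^ n)" "0 < real (q ^ (d * m))" using K.q_ge_2 M.q_ge_2 by simp_all
        ultimately have "real (q' ^ n) = real (q ^ (d * m))" by (metis ln_inj_iff)
        then show ?thesis by (simp only: of_nat_eq_iff)
      qed
      finally show ?thesis .
    qed simp
  qed
  finally have "Suc (a * b * b) * q ^ (d * m) \<le> (a * b * b) * q ^ (d * m)" by (simp add: algebra_simps)
  then show False using K.q_ge_2 by simp
qed

section \<open>Global function fields\<close>

context field begin

lemma finite_Span:
  assumes F: "subfield F R" "finite F" and Us: "set Us \<subseteq> carrier R" shows "finite (Span F Us)"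
  using Us
proof (induction Us rule: list.induct)
  case (Cons u Us)
  have "Span F (u # Us) = (\<lambda>(a, v). a \<otimes> u \<oplus> v) ` (F \<times> Span F Us)" using line_extension_mem_iff[of _ F u "Span F Us"] by force
  then show ?case using Cons F(2) by simp
qed simp

text \<open>An algebraic element generates a finite field, so its powers repeat. Conversely, if c^m
  = 1 the distinct polynomials X^m and 1 take the same value at c.\<close>

lemma algebraic_over_finite_iff:
  assumes F: "subfield F R" "finite F" and c: "c \<in> carrier R"
  shows "(algebraic over F) c \<longleftrightarrow> torsion c"
proof
  assume alg: "(algebraic over F) c"
  let ?E = "simple_extension F c"
  have sf: "subfield ?E R" using simple_extension_is_subfield[OF F(1) c] alg by blast
  have "finite_dimension F ?E" using finite_dimension_simple_extension[OF F(1) c] alg by blast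
  then have "dimension ((dim over F) ?E) F ?E" using finite_dimensionE[OF F(1)] by blast
  then obtain Vs where Vs: "set Vs \<subseteq> carrier R" "Span F Vs = ?E" using exists_base[OF F(1)] by blast
  have fin: "finite ?E" using finite_Span[OF F Vs(1)] Vs(2) by simp
  note Er = subringE[OF subfieldE(1)[OF sf]]
  have "c [^] m \<in> ?E" for m :: nat
    by (induction m) (use Er simple_extension_mem[OF subfieldE(1)[OF F(1)] c] in auto)
  then have "finite (range (\<lambda>m::nat. c [^] m))" using finite_subset[OF _ fin] by blast
  then show "torsion c" by (rule torsion_of_finite_powers[OF c])
next
  assume t: "torsion c"
  note Fs = subfieldE(1)[OF F(1)]
  show "(algebraic over F) c"
  proof (cases "c = \<zero>")
    case True then show ?thesis using zero_is_algebraic[OF Fs] by simp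
  next
    case False
    then obtain m :: nat where m: "0 < m" "c [^] m = \<one>" using t unfolding torsion_def by blast
    show ?thesis
    proof (rule ccontr)
      assume "\<not> (algebraic over F) c"
      then have inj: "inj_on (\<lambda>p. eval p c) (carrier (F[X]))" unfolding over_def transcendental_def by simp
      have o: "\<one> \<in> F - {\<zero>}" using subringE(3)[OF Fs] by simp
      have in1: "monom \<one> m \<in> carrier (F[X])" "monom \<one> 0 \<in> carrier (F[X])"
        using monom_is_polynomial[OF Fs o] univ_poly_carrier by blast+
      have ev: "eval (monom \<one> n) c = c [^] n" for n
      proof -
        have "eval (replicate n \<zero>) c = \<zero>" using eval_replicate[of "[]" c n] c by simp
        then show ?thesis unfolding monom_def using c by simp
      qed
      have "monom \<one> m = monom \<one> 0" using inj_onD[OF inj _ in1] ev m(2) by simp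
      then show False using m(1) unfolding monom_def by simp
    qed
  qed
qed

text \<open>The main point is that the constant field is finite. Take a valuation ring V in which z
  = 1/y is a nonunit. The constants are torsion, so they lie in V, and a nonzero difference of
  constants is a unit; hence they inject into V/zV, which is finite by the index bound.\<close>

lemma ffieldI:
  assumes fin: "finite (prime_subfield R)" and g: "growth R B C" and y: "y \<in> carrier R" "\<not> torsion y"
  shows "ffield R (constant_field R) (card (constant_field R)) B C"
proof -
  let ?F = "prime_subfield R" and ?k = "constant_field R"
  have F: "subfield ?F R" unfolding prime_subfield_def by (rule generate_field_is_subfield) simp
  have ksub: "subfield ?k R" unfolding constant_field_def by (rule subfield_of_algebraics[OF F])
  have kt: "c \<in> ?k \<longleftrightarrow> c \<in> carrier R \<and> torsion c" for c
    unfolding constant_field_def using algebraic_over_finite_iff[OF F fin] by auto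
  note kr = subringE[OF subfieldE(1)[OF ksub]]
  note Fs = subfieldE(1)[OF F]
  have y0: "y \<noteq> \<zero>" using y(2) unfolding torsion_def by blast
  define z where "z = inv y"
  have z: "z \<in> carrier R" "z \<noteq> \<zero>" unfolding z_def using inv_mem[OF y(1) y0] inv_nz[OF y(1) y0] by auto
  note tp = transcendental_pair[OF Fs fin y]
  have kfin: "finite ?k"
  proof (rule chevalley_extension[OF tp(1)])
    fix V J assume V: "(\<Union>n. pols ?F (inv y) n) \<subseteq> V" "dilate (inv y) (\<Union>n. pols ?F (inv y) n) \<subseteq> J" "ring_ideal_pair V J"
      "\<And>z. z \<in> carrier R \<Longrightarrow> z \<noteq> \<zero> \<Longrightarrow> z \<in> V \<or> inv z \<in> V"
    have Vr: "subring V R" and J: "J \<subseteq> V" "\<And>a j. a \<in> V \<Longrightarrow> j \<in> J \<Longrightarrow> a \<otimes> j \<in> J" "\<one> \<notin> J"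
      using V(3) unfolding ring_ideal_pair_def by auto
    note Vs = subringE[OF Vr]
    have zJ: "z \<in> J" "z \<in> V" using tp(2) V(2) J(1) unfolding z_def by auto
    have kV: "?k \<subseteq> V"
    proof
      fix c assume "c \<in> ?k"
      then have c: "c \<in> carrier R" "torsion c" using kt by auto
      show "c \<in> V" by (rule torsion_in_valuation_ring[OF Vr V(4) c])
    qed
    have zV: "dilate z V \<subseteq> J" unfolding dilate_def using J(2)[OF _ zJ(1)] m_comm z Vs(1) by (auto simp: subset_iff)
    have zVV: "dilate z V \<subseteq> V" using dilate_sub_ideal(2)[OF Vr zJ(2)] .
    note Va = subring_additive_subgroup[OF Vr]
    note zVa = dilate_additive_subgroup[OF Va z(1)]
    obtain N where "\<And>H. additive_subgroup H R \<Longrightarrow> dilate z H \<subseteq> H \<Longrightarrow> finite (cosets H (dilate z H)) \<and> card (cosets H (dilate z H)) \<le> N"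
      using index_bound[OF g z] by blast
    then have fc: "finite (cosets V (dilate z V))" using Va zVV by blast
    have "inj_on (\<lambda>a. dilate z V +> a) ?k"
    proof (rule inj_onI)
      fix a b assume A: "a \<in> ?k" "b \<in> ?k" "dilate z V +> a = dilate z V +> b"
      have c: "a \<in> carrier R" "b \<in> carrier R" using A(1,2) kr(1) by auto
      have "a \<ominus> b \<in> J" using A(3) coset_eq_iff[OF zVa c] zV by blast
      moreover have abk: "a \<ominus> b \<in> ?k" using additive_subgroup_minus[OF subring_additive_subgroup[OF subfieldE(1)[OF ksub]] A(1,2)] .
      moreover have "a \<ominus> b = \<zero>"
      proof (rule ccontr)
        assume nz: "a \<ominus> b \<noteq> \<zero>"
        then have "inv (a \<ominus> b) \<in> V" using subfield_m_inv(1)[OF ksub, of "a \<ominus> b"] abk kV by blast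
        then have "inv (a \<ominus> b) \<otimes> (a \<ominus> b) \<in> J" using J(2) calculation(1) by blast
        then show False using J(3) inv_l[OF _ nz] c by simp
      qed
      then show "a = b" using c by simp
    qed
    moreover have "(\<lambda>a. dilate z V +> a) ` ?k \<subseteq> cosets V (dilate z V)" unfolding cosets_def using kV by blast
    ultimately show "finite ?k" using fc inj_on_finite by blast
  qed
  have "\<exists>y\<in>carrier R. y \<notin> ?k" using y kt by blast
  then show ?thesis
    using field_axioms kfin ksub g kt unfolding torsion_def by (intro ffield.intro ffield_axioms.intro) simp_all
qed

section \<open>Growth for finite extensions of F(x)\<close>

fun lspan :: "'a set \<Rightarrow> 'a \<Rightarrow> 'a list \<Rightarrow> nat \<Rightarrow> 'a set" where
  "lspan F x [] e = {\<zero>}"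
| "lspan F x (u # us) e = {f \<otimes> u \<oplus> v |f v. f \<in> pols F x e \<and> v \<in> lspan F x us e}"

context
  fixes F x assumes F: "subring F R" "finite F" and x: "x \<in> carrier R"
begin

lemmas Fadd = subring_additive_subgroup[OF F(1)]

lemma lspan_closed:
  assumes "set us \<subseteq> carrier R"
  shows "lspan F x us e \<subseteq> carrier R \<and> \<zero> \<in> lspan F x us e \<and> finite (lspan F x us e) \<and>
    card (lspan F x us e) \<le> (card F ^ length us) ^ Suc e \<and> (\<forall>a\<in>lspan F x us e. \<forall>b\<in>lspan F x us e. a \<oplus> b \<in> lspan F x us e)"
  using assms
proof (induction us rule: list.induct)
  case Nil then show ?case by simp
next
  case (Cons u us)
  note pc = pols_in_carrier[OF Fadd x, of e] and pa = pols_additive_subgroup[OF Fadd x, of e]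
  have u: "u \<in> carrier R" "set us \<subseteq> carrier R" using Cons.prems by auto
  have IH: "lspan F x us e \<subseteq> carrier R" "\<zero> \<in> lspan F x us e" "finite (lspan F x us e)"
    "card (lspan F x us e) \<le> (card F ^ length us) ^ Suc e" "\<And>a b. a \<in> lspan F x us e \<Longrightarrow> b \<in> lspan F x us e \<Longrightarrow> a \<oplus> b \<in> lspan F x us e"
    using Cons.IH[OF u(2)] by auto
  have e: "lspan F x (u # us) e = (\<lambda>(f, v). f \<otimes> u \<oplus> v) ` (pols F x e \<times> lspan F x us e)" by force
  have 1: "lspan F x (u # us) e \<subseteq> carrier R" using pc IH(1) u by auto
  have "\<zero> = \<zero> \<otimes> u \<oplus> \<zero>" using u by simp
  then have 2: "\<zero> \<in> lspan F x (u # us) e" using IH(2) additive_subgroup.zero_closed[OF pa] by auto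
  have fp: "finite (pols F x e \<times> lspan F x us e)" using IH(3) finite_pols_card(1)[OF F(2)] by blast
  have "card (lspan F x (u # us) e) \<le> card (pols F x e) * card (lspan F x us e)"
    unfolding e using card_image_le[OF fp] by (simp add: card_cartesian_product)
  also have "\<dots> \<le> card F ^ Suc e * (card F ^ length us) ^ Suc e" by (rule mult_le_mono[OF finite_pols_card(2)[OF F(2)] IH(4)])
  also have "\<dots> = (card F ^ length (u # us)) ^ Suc e" by (simp add: power_mult_distrib)
  finally have 4: "card (lspan F x (u # us) e) \<le> (card F ^ length (u # us)) ^ Suc e" .
  have 5: "a \<oplus> b \<in> lspan F x (u # us) e" if ab: "a \<in> lspan F x (u # us) e" "b \<in> lspan F x (u # us) e" for a b
  proof -
    obtain f v g w where d: "f \<in> pols F x e" "v \<in> lspan F x us e" "a = f \<otimes> u \<oplus> v" "g \<in> pols F x e" "w \<in> lspan F x us e" "b = g \<otimes> u \<oplus> w"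
      using ab by auto
    have c: "f \<in> carrier R" "g \<in> carrier R" "v \<in> carrier R" "w \<in> carrier R" using d pc IH(1) by auto
    have "a \<oplus> b = (f \<oplus> g) \<otimes> u \<oplus> (v \<oplus> w)" using c u d(3,6) by (simp add: l_distr a_ac)
    moreover have "f \<oplus> g \<in> pols F x e" by (rule additive_subgroup.a_closed[OF pa d(1,4)])
    ultimately show ?thesis using IH(5)[OF d(2,5)] by auto
  qed
  show ?case using 1 2 4 5 fp unfolding e by blast
qed

lemma lspan_mono: "e \<le> e' \<Longrightarrow> lspan F x us e \<subseteq> lspan F x us e'"
proof (induction us)
  case (Cons u us)
  then show ?case using pols_mono[OF Fadd x, of e e'] by auto
qed simp

lemma lspan_mult:
  assumes "set us \<subseteq> carrier R" "f \<in> pols F x m" "v \<in> lspan F x us e" shows "f \<otimes> v \<in> lspan F x us (m + e)"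
  using assms(1,3)
proof (induction us arbitrary: v)
  case Nil
  have "f \<in> carrier R" using assms(2) pols_in_carrier[OF Fadd x] by blast
  then show ?case using Nil by simp
next
  case (Cons u us)
  have fc: "f \<in> carrier R" using assms(2) pols_in_carrier[OF Fadd x] by blast
  have u: "u \<in> carrier R" "set us \<subseteq> carrier R" using Cons.prems by auto
  obtain g w where d: "g \<in> pols F x e" "w \<in> lspan F x us e" "v = g \<otimes> u \<oplus> w" using Cons.prems by auto
  have c: "g \<in> carrier R" "w \<in> carrier R" using d pols_in_carrier[OF Fadd x] lspan_closed[OF u(2)] by blast+
  have "f \<otimes> v = (f \<otimes> g) \<otimes> u \<oplus> f \<otimes> w" using d(3) c fc u by (simp add: r_distr m_assoc)
  moreover have "f \<otimes> g \<in> pols F x (m + e)" by (rule pols_mult[OF Fadd Fadd x subringE(6)[OF F(1)] assms(2) d(1)])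
  ultimately show ?case using Cons.IH[OF u(2) d(2)] by auto
qed

lemma lspan_lift:
  assumes us: "set us \<subseteq> carrier R" and z: "z \<in> carrier R"
    and vs: "set vs \<subseteq> carrier R" "\<And>v. v \<in> set vs \<Longrightarrow> z \<otimes> v \<in> lspan F x us e" and b: "b \<in> lspan F x vs m"
  shows "z \<otimes> b \<in> lspan F x us (m + e)"
  using vs b
proof (induction vs arbitrary: b)
  case Nil
  then show ?case using lspan_closed[OF us] z by simp
next
  case (Cons v vs)
  obtain f w where d: "f \<in> pols F x m" "w \<in> lspan F x vs m" "b = f \<otimes> v \<oplus> w" using Cons.prems(3) by auto
  have v: "v \<in> carrier R" "set vs \<subseteq> carrier R" using Cons.prems(1) by auto
  have c: "f \<in> carrier R" "w \<in> carrier R" using d pols_in_carrier[OF Fadd x] lspan_closed[OF v(2)] by blast+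
  have "z \<otimes> b = f \<otimes> (z \<otimes> v) \<oplus> z \<otimes> w" using d(3) c v z by (simp add: r_distr m_ac)
  moreover have "f \<otimes> (z \<otimes> v) \<in> lspan F x us (m + e)" by (rule lspan_mult[OF us d(1)]) (use Cons.prems(2) in simp)
  moreover have "z \<otimes> w \<in> lspan F x us (m + e)" by (rule Cons.IH[OF v(2) _ d(2)]) (use Cons.prems(2) in simp)
  ultimately show ?case using lspan_closed[OF us] by simp
qed

abbreviation Fx where "Fx \<equiv> (\<Union>n. pols F x n)"

text \<open>Elements of the generated field are fractions of polynomials, by induction on
  generation; for an inverse, numerator and denominator change places.\<close>

lemma fraction_denominator:
  assumes "g \<in> generate_field R {x}" "F = generate_field R {}" shows "\<exists>b\<in>Fx - {\<zero>}. b \<otimes> g \<in> Fx"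
proof -
  note A = subringE[OF pols_subring(1)[OF F(1) x]] and xA = pols_subring(3)[OF F(1) x]
  have car: "h \<in> carrier R" if "h \<in> generate_field R {x}" for h using generate_field_in_carrier[of "{x}"] that x by auto
  show ?thesis using assms(1)
  proof (induction rule: generate_field.induct)
    case one then show ?case using A(3) by (intro bexI[of _ \<one>]) auto
  next
    case (incl h) then show ?case using A(3) xA x by (intro bexI[of _ \<one>]) auto
  next
    case (a_inv h)
    then obtain b where b: "b \<in> Fx" "b \<noteq> \<zero>" "b \<otimes> h \<in> Fx" by blast
    have "b \<otimes> (\<ominus> h) = \<ominus> (b \<otimes> h)" using b A(1) car[OF a_inv.hyps] by (simp add: r_minus subset_iff)
    then show ?case using A(5)[OF b(3)] b(1,2) by (metis DiffI singletonD)
  next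
    case (m_inv h)
    then obtain b where b: "b \<in> Fx" "b \<noteq> \<zero>" "b \<otimes> h \<in> Fx" by blast
    have c: "b \<in> carrier R" "h \<in> carrier R" using b A(1) car[OF m_inv.hyps(1)] by auto
    have nz: "b \<otimes> h \<noteq> \<zero>" using b(2) m_inv.hyps(2) c by (simp add: integral_iff)
    have "(b \<otimes> h) \<otimes> inv h = b" using c inv_mem[OF c(2) m_inv.hyps(2)] inv_r[OF c(2) m_inv.hyps(2)] by (simp add: m_assoc)
    then show ?case using b nz by (metis DiffI singletonD)
  next
    case (eng_add h1 h2)
    then obtain b b' where b: "b \<in> Fx" "b \<noteq> \<zero>" "b \<otimes> h1 \<in> Fx" "b' \<in> Fx" "b' \<noteq> \<zero>" "b' \<otimes> h2 \<in> Fx" by blast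
    have c: "b \<in> carrier R" "b' \<in> carrier R" "h1 \<in> carrier R" "h2 \<in> carrier R" using b(1,4) A(1) car eng_add.hyps by auto
    have "(b \<otimes> b') \<otimes> (h1 \<oplus> h2) = b' \<otimes> (b \<otimes> h1) \<oplus> b \<otimes> (b' \<otimes> h2)" using c by (simp add: r_distr m_ac)
    then have "(b \<otimes> b') \<otimes> (h1 \<oplus> h2) \<in> Fx" using A(7)[OF A(6)[OF b(4,3)] A(6)[OF b(1,6)]] by metis
    moreover have "b \<otimes> b' \<in> Fx - {\<zero>}" using A(6)[OF b(1,4)] b(2,5) c by (simp add: integral_iff)
    ultimately show ?case by blast
  next
    case (eng_mult h1 h2)
    then obtain b b' where b: "b \<in> Fx" "b \<noteq> \<zero>" "b \<otimes> h1 \<in> Fx" "b' \<in> Fx" "b' \<noteq> \<zero>" "b' \<otimes> h2 \<in> Fx" by blast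
    have c: "b \<in> carrier R" "b' \<in> carrier R" "h1 \<in> carrier R" "h2 \<in> carrier R" using b(1,4) A(1) car eng_mult.hyps by auto
    have "(b \<otimes> b') \<otimes> (h1 \<otimes> h2) = (b \<otimes> h1) \<otimes> (b' \<otimes> h2)" using c by (simp add: m_ac)
    then have "(b \<otimes> b') \<otimes> (h1 \<otimes> h2) \<in> Fx" using A(6)[OF b(3,6)] by metis
    moreover have "b \<otimes> b' \<in> Fx - {\<zero>}" using A(6)[OF b(1,4)] b(2,5) c by (simp add: integral_iff)
    ultimately show ?case by blast
  qed
qed

text \<open>Level e consists of the combinations of a spanning list whose coefficients are
  polynomials in x of degree at most e. The list is extended by 1, so that 1 has level zero. Given
  Y, one clears the denominators in all products of members of Y with list elements at once;
  linearity then carries the bounded shift of levels to every element.\<close>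

lemma growth_of_finite_dimension:
  assumes FG: "F = generate_field R {}" and us: "set us \<subseteq> carrier R" and sp: "Span (generate_field R {x}) us = carrier R"
  shows "growth R (lspan F x (\<one> # us)) (card F ^ Suc (length us))"
proof -
  let ?us = "\<one> # us"
  have us1: "set ?us \<subseteq> carrier R" using us by simp
  note A = subringE[OF pols_subring(1)[OF F(1) x]]
  have den1: "\<exists>c\<in>Fx - {\<zero>}. \<exists>e. c \<otimes> w \<in> lspan F x vs e" if vs: "set vs \<subseteq> carrier R" and w: "w \<in> Span (generate_field R {x}) vs" for w vs
    using vs w
  proof (induction vs arbitrary: w)
    case Nil
    then show ?case using A(3) by (intro bexI[of _ \<one>]) auto
  next
    case (Cons v vs)
    have v: "v \<in> carrier R" "set vs \<subseteq> carrier R" using Cons.prems by auto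
    have "w \<in> line_extension (generate_field R {x}) v (Span (generate_field R {x}) vs)" using Cons.prems(2) by simp
    then obtain g w' where d: "g \<in> generate_field R {x}" "w' \<in> Span (generate_field R {x}) vs" "w = g \<otimes> v \<oplus> w'"
      unfolding line_extension_mem_iff by blast
    obtain b where b: "b \<in> Fx" "b \<noteq> \<zero>" "b \<otimes> g \<in> Fx" using fraction_denominator[OF d(1) FG] by blast
    obtain c e where c: "c \<in> Fx" "c \<noteq> \<zero>" "c \<otimes> w' \<in> lspan F x vs e" using Cons.IH[OF v(2) d(2)] by blast
    have gc: "g \<in> carrier R" using generate_field_in_carrier[of "{x}"] d(1) x by auto
    have sx: "subfield (generate_field R {x}) R" by (rule generate_field_is_subfield) (use x in simp)
    have wc: "w' \<in> carrier R" using Span_subgroup_props(1)[OF sx v(2)] d(2) by blast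
    have cc: "b \<in> carrier R" "c \<in> carrier R" using b c A(1) by auto
    obtain n where n: "c \<otimes> (b \<otimes> g) \<in> pols F x n" using A(6)[OF c(1) b(3)] by blast
    obtain m where m: "b \<in> pols F x m" using b(1) by blast
    let ?e = "n + (m + e)"
    have "(b \<otimes> c) \<otimes> w = (c \<otimes> (b \<otimes> g)) \<otimes> v \<oplus> b \<otimes> (c \<otimes> w')" using d(3) gc wc cc v by (simp add: r_distr m_ac)
    moreover have "c \<otimes> (b \<otimes> g) \<in> pols F x ?e" using n pols_mono[OF Fadd x, of n ?e] by auto
    moreover have "b \<otimes> (c \<otimes> w') \<in> lspan F x vs ?e" using lspan_mult[OF v(2) m c(3)] lspan_mono[of "m + e" ?e vs] by auto
    ultimately have "(b \<otimes> c) \<otimes> w \<in> lspan F x (v # vs) ?e" by auto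
    moreover have "b \<otimes> c \<in> Fx - {\<zero>}" using A(6)[OF b(1) c(1)] b(2) c(2) cc by (simp add: integral_iff)
    ultimately show ?case by blast
  qed
  have den: "\<exists>c\<in>Fx - {\<zero>}. \<exists>e. c \<otimes> w \<in> lspan F x ?us e" if w: "w \<in> carrier R" for w
  proof -
    obtain c e where c: "c \<in> Fx - {\<zero>}" "c \<otimes> w \<in> lspan F x us e" using den1[OF us, of w] w sp by blast
    have "c \<otimes> w \<in> carrier R" using c A(1) w by auto
    then have "c \<otimes> w = \<zero> \<otimes> \<one> \<oplus> c \<otimes> w" by simp
    then have "c \<otimes> w \<in> lspan F x ?us e" unfolding lspan.simps mem_Collect_eq
      using c(2) additive_subgroup.zero_closed[OF pols_additive_subgroup[OF Fadd x]] by blast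
    then show ?thesis using c(1) by blast
  qed
  have common: "\<exists>c\<in>Fx - {\<zero>}. \<exists>e. \<forall>y\<in>Y. c \<otimes> y \<in> lspan F x ?us e" if "finite Y" "Y \<subseteq> carrier R" for Y
    using that
  proof (induction Y rule: finite_induct)
    case empty then show ?case using A(3) by (intro bexI[of _ \<one>]) auto
  next
    case (insert y Y)
    obtain c e where c: "c \<in> Fx" "c \<noteq> \<zero>" "\<forall>y\<in>Y. c \<otimes> y \<in> lspan F x ?us e" using insert by blast
    have y: "y \<in> carrier R" "Y \<subseteq> carrier R" using insert.prems by auto
    obtain b f where b: "b \<in> Fx" "b \<noteq> \<zero>" "b \<otimes> y \<in> lspan F x ?us f" using den[OF y(1)] by blast
    obtain m n where mn: "b \<in> pols F x m" "c \<in> pols F x n" using b(1) c(1) by blast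
    have cc: "b \<in> carrier R" "c \<in> carrier R" using b c A(1) by auto
    let ?e = "m + e + (n + f)"
    have "(b \<otimes> c) \<otimes> y' \<in> lspan F x ?us ?e" if y': "y' \<in> insert y Y" for y'
    proof (cases "y' = y")
      case True
      have "(b \<otimes> c) \<otimes> y = c \<otimes> (b \<otimes> y)" using cc y by (simp add: m_ac)
      then show ?thesis using True lspan_mult[OF us1 mn(2) b(3)] lspan_mono[of "n + f" ?e ?us] by (metis le_add2 subsetD)
    next
      case False
      then have y'Y: "y' \<in> Y" using y' by blast
      have "(b \<otimes> c) \<otimes> y' = b \<otimes> (c \<otimes> y')" using cc y y'Y by (simp add: m_assoc subset_iff)
      then show ?thesis using lspan_mult[OF us1 mn(1) c(3)[rule_format, OF y'Y]] lspan_mono[of "m + e" ?e ?us] by (metis le_add1 subsetD)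
    qed
    moreover have "b \<otimes> c \<in> Fx - {\<zero>}" using A(6)[OF b(1) c(1)] b(2) c(2) cc by (simp add: integral_iff)
    ultimately show ?case by blast
  qed
  have mul: "\<exists>c\<in>carrier R - {\<zero>}. \<exists>d. \<forall>y\<in>Y. \<forall>m. \<forall>b\<in>lspan F x ?us m. (c \<otimes> y) \<otimes> b \<in> lspan F x ?us (m + d)"
    if Y: "finite Y" "Y \<subseteq> carrier R" for Y
  proof -
    let ?Y = "(\<lambda>(y, u). y \<otimes> u) ` (Y \<times> set ?us)"
    have Y': "finite ?Y" "?Y \<subseteq> carrier R" using Y us1 by auto
    obtain c d where c: "c \<in> Fx - {\<zero>}" "\<forall>y\<in>?Y. c \<otimes> y \<in> lspan F x ?us d" using common[OF Y'] by blast
    have cc: "c \<in> carrier R" using c(1) A(1) by blast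
    have "(c \<otimes> y) \<otimes> b \<in> lspan F x ?us (m + d)" if yb: "y \<in> Y" "b \<in> lspan F x ?us m" for y m b
    proof (rule lspan_lift[OF us1 _ us1 _ yb(2)])
      have yc: "y \<in> carrier R" using yb Y by blast
      then show "c \<otimes> y \<in> carrier R" using cc by simp
      fix v assume v: "v \<in> set ?us"
      then have "v \<in> carrier R" using us1 by blast
      then have "(c \<otimes> y) \<otimes> v = c \<otimes> (y \<otimes> v)" using cc yc by (simp add: m_assoc)
      moreover have "y \<otimes> v \<in> ?Y" using yb(1) v by force
      ultimately show "(c \<otimes> y) \<otimes> v \<in> lspan F x ?us d" using c(2) by metis
    qed
    then show ?thesis using c(1) cc by blast
  qed
  have "\<one> = \<one> \<otimes> \<one> \<oplus> \<zero>" by simp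
  moreover have "\<one> \<in> pols F x 0" "\<zero> \<in> lspan F x us 0" using subringE(3)[OF F(1)] lspan_closed[OF us] by auto
  ultimately have one: "\<one> \<in> lspan F x ?us 0" unfolding lspan.simps mem_Collect_eq by blast
  have len: "length ?us = Suc (length us)" by simp
  show ?thesis unfolding growth_def using lspan_closed[OF us1, unfolded len] one mul by blast
qed

end

end

lemma (in global_function_field) ffield:
  "\<exists>B C. ffield K (constant_field K) (card (constant_field K)) B C"
proof -
  let ?F = "prime_subfield K"
  have fin: "finite ?F" using prime_subfield_card card_ge_0_finite prime_gt_0_nat by blast
  have F: "subfield ?F K" unfolding prime_subfield_def by (rule generate_field_is_subfield) simp
  obtain x where x: "x \<in> carrier K" "(transcendental over ?F) x" "finite_dimension (generate_field K {x}) (carrier K)"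
    using finite_over_rational by blast
  have sx: "subfield (generate_field K {x}) K" by (rule generate_field_is_subfield) (use x in simp)
  have "dimension ((dim over (generate_field K {x})) (carrier K)) (generate_field K {x}) (carrier K)" using finite_dimensionE[OF sx x(3)] .
  then obtain us where us: "set us \<subseteq> carrier K" "Span (generate_field K {x}) us = carrier K" using exists_base[OF sx] by blast
  have "growth K (lspan ?F x (\<one> # us)) (card ?F ^ Suc (length us))"
    by (rule growth_of_finite_dimension[OF subfieldE(1)[OF F] fin x(1) prime_subfield_def us])
  moreover have "\<not> torsion x" using algebraic_over_finite_iff[OF F fin x(1)] x(2) unfolding over_def by simp
  ultimately show ?thesis using ffieldI[OF fin _ x(1)] by blast
qed

section \<open>Splitting of places in a constant field extension\<close>

lemma card_image_same_kernel:
  assumes "\<And>a b. a \<in> S \<Longrightarrow> b \<in> S \<Longrightarrow> g a = g b \<longleftrightarrow> h a = h b" shows "card (g ` S) = card (h ` S)"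
proof -
  let ?f = "\<lambda>y. g (inv_into S h y)"
  have f: "?f (h a) = g a" if "a \<in> S" for a
    using assms[of "inv_into S h (h a)" a] that f_inv_into_f[of "h a" h S] inv_into_into[of "h a" h S] by auto
  have "inj_on ?f (h ` S)" by (rule inj_onI) (use f assms in auto)
  moreover have "?f ` h ` S = g ` S" unfolding image_image using f by auto
  ultimately show ?thesis by (metis card_image)
qed

text \<open>The expansion of X^(n+1) at y to first order. That the coefficient of the square stays
  in the subring is what makes it usable for integral approximation.\<close>

lemma (in cring) taylor:
  assumes A: "subring A R" and x: "x \<in> A" and y: "y \<in> A"
  shows "\<exists>c\<in>A. x [^] Suc n = (y [^] Suc n \<oplus> add_pow R (Suc n) ((x \<ominus> y) \<otimes> y [^] n)) \<oplus> ((x \<ominus> y) \<otimes> (x \<ominus> y)) \<otimes> c"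
proof (induction n)
  note Ar = subringE[OF A]
  have c: "x \<in> carrier R" "y \<in> carrier R" using x y Ar(1) by auto
  case 0
  have "x [^] Suc 0 = (y [^] Suc 0 \<oplus> add_pow R (Suc 0) ((x \<ominus> y) \<otimes> y [^] (0::nat))) \<oplus> ((x \<ominus> y) \<otimes> (x \<ominus> y)) \<otimes> \<zero>"
    using c minus_minus_cancel(5)[OF c c(1)] by simp
  then show ?case using Ar(2) by blast
next
  note Ar = subringE[OF A]
  have c: "x \<in> carrier R" "y \<in> carrier R" using x y Ar(1) by auto
  case (Suc n)
  then obtain e where e: "e \<in> A" "x [^] Suc n = (y [^] Suc n \<oplus> add_pow R (Suc n) ((x \<ominus> y) \<otimes> y [^] n)) \<oplus> ((x \<ominus> y) \<otimes> (x \<ominus> y)) \<otimes> e" by blast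
  define D where "D = x \<ominus> y"
  define s where "s = add_pow R (Suc n) (y [^] n)"
  have D: "D \<in> carrier R" "x = y \<oplus> D" unfolding D_def using c minus_minus_cancel(5)[OF c c(1)] by auto
  have yA: "y [^] m \<in> A" for m :: nat by (induction m) (use y Ar in auto)
  have sA: "add_pow R m z \<in> A" if "z \<in> A" for m :: nat and z by (induction m) (use that Ar in auto)
  have s: "s \<in> A" unfolding s_def by (rule sA[OF yA])
  have ec: "e \<in> carrier R" "s \<in> carrier R" using e(1) s Ar(1) by auto
  have y1: "y [^] Suc n \<in> carrier R" using c by simp
  have Ds: "add_pow R (Suc n) (D \<otimes> y [^] n) = D \<otimes> s" unfolding s_def using add_pow_rdistr[of D "y [^] n" "Suc n"] D(1) c by simp
  have ys: "add_pow R (Suc (Suc n)) (D \<otimes> y [^] Suc n) = y \<otimes> (D \<otimes> s) \<oplus> D \<otimes> y [^] Suc n"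
  proof -
    have "add_pow R (Suc n) (D \<otimes> y [^] Suc n) = add_pow R (Suc n) ((y \<otimes> D) \<otimes> y [^] n)" using c D(1) by (simp add: m_ac)
    also have "\<dots> = (y \<otimes> D) \<otimes> s" unfolding s_def using add_pow_rdistr[of "y \<otimes> D" "y [^] n" "Suc n"] D(1) c by simp
    also have "\<dots> = y \<otimes> (D \<otimes> s)" using c D(1) ec by (simp add: m_assoc)
    finally show ?thesis using c D(1) by simp
  qed
  have "x [^] Suc (Suc n) = x [^] Suc n \<otimes> x" by simp
  also have "\<dots> = ((y [^] Suc n \<oplus> D \<otimes> s) \<oplus> (D \<otimes> D) \<otimes> e) \<otimes> (y \<oplus> D)"
    using e(2) Ds D(2) unfolding D_def[symmetric] by simp
  also have "\<dots> = (y [^] Suc n \<otimes> y \<oplus> (y \<otimes> (D \<otimes> s) \<oplus> D \<otimes> y [^] Suc n)) \<oplus> (D \<otimes> D) \<otimes> (s \<oplus> e \<otimes> x)"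
  proof -
    define Y where "Y = y [^] Suc n"
    have Y: "Y \<in> carrier R" using y1 Y_def by simp
    show ?thesis unfolding Y_def[symmetric] D(2) using Y D(1) c(2) ec
      by (simp add: l_distr r_distr m_ac a_ac)
  qed
  also have "y [^] Suc n \<otimes> y = y [^] Suc (Suc n)" by simp
  finally have "x [^] Suc (Suc n) = (y [^] Suc (Suc n) \<oplus> add_pow R (Suc (Suc n)) (D \<otimes> y [^] Suc n)) \<oplus> (D \<otimes> D) \<otimes> (s \<oplus> e \<otimes> x)"
    unfolding ys .
  moreover have "s \<oplus> e \<otimes> x \<in> A" using Ar(7)[OF s Ar(6)[OF e(1) x]] .
  ultimately show ?case unfolding D_def by blast
qed

text \<open>When m is zero in the ring, the linear term of the expansion drops out.\<close>

lemma (in cring) taylor_char: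
  assumes A: "subring A R" "x \<in> A" "y \<in> A" and m: "0 < m" "add_pow R (m::nat) \<one> = \<zero>"
  shows "\<exists>c\<in>A. x [^] m \<ominus> y [^] m = ((x \<ominus> y) \<otimes> (x \<ominus> y)) \<otimes> c"
proof -
  note Ar = subringE[OF A(1)]
  have c: "x \<in> carrier R" "y \<in> carrier R" using A Ar(1) by auto
  obtain n where n: "m = Suc n" using m(1) by (cases m) auto
  have z: "add_pow R m u = \<zero>" if "u \<in> carrier R" for u
    using add_pow_ldistr[of \<one> u m] that m(2) by simp
  obtain e where e: "e \<in> A" "x [^] m = (y [^] m \<oplus> add_pow R m ((x \<ominus> y) \<otimes> y [^] n)) \<oplus> ((x \<ominus> y) \<otimes> (x \<ominus> y)) \<otimes> e"
    using taylor[OF A, of n] unfolding n by blast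
  have ec: "e \<in> carrier R" using e(1) Ar(1) by blast
  let ?d = "((x \<ominus> y) \<otimes> (x \<ominus> y)) \<otimes> e"
  have dc: "?d \<in> carrier R" using c ec by simp
  have "x [^] m = ?d \<oplus> y [^] m" using e(2) z[of "(x \<ominus> y) \<otimes> y [^] n"] c dc by (simp add: a_comm)
  then have "x [^] m \<ominus> y [^] m = ?d" using minus_minus_cancel(4)[of ?d "y [^] m" \<zero>] dc c by simp
  then show ?thesis using e(1) by blast
qed

lemma (in ffield) char_q: "add_pow K q \<one> = \<zero>"
proof -
  let ?G = "(add_monoid K)\<lparr>carrier := k\<rparr>"
  have G: "group ?G"
    by (rule add.subgroup_imp_group[OF additive_subgroup.a_subgroup[OF k_additive]])
  have "\<one> [^]\<^bsub>?G\<^esub> order ?G = \<one>\<^bsub>?G\<^esub>"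
    by (rule group.pow_order_eq_1[OF G]) (use k_ring(3) in simp)
  then show ?thesis
    unfolding add_pow_def order_def add.nat_pow_consistent[symmetric] using q by simp
qed

text \<open>The elements of \<open>Z\<close> become distinct roots of X^n - X in the residue field:
  zero and at most n - 1 solutions of X^(n-1) = 1.\<close>

lemma (in ffield) residue_frobenius_fixed:
  assumes Q: "Q \<in> PD" and n: "1 < n" and Z: "Z \<subseteq> Q" "finite Z" "\<And>z. z \<in> Z \<Longrightarrow> z [^] (n::nat) \<ominus> z \<in> fid K Q 1"
    and inj: "\<And>z z'. z \<in> Z \<Longrightarrow> z' \<in> Z \<Longrightarrow> z \<ominus> z' \<in> fid K Q 1 \<Longrightarrow> z = z'"
  shows "card Z \<le> n"
proof -
  let ?S = "K\<lparr>carrier := Q\<rparr>" and ?I = "place_ideal K Q"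
  note sr = place_subring[OF Q] and Qc = subringE(1)[OF place_subring[OF Q]]
  interpret S: domain ?S using subring_domain(1)[OF sr] .
  interpret I: ideal ?I ?S by (rule place_ideal_props(5)[OF Q])
  let ?F = "?S Quot ?I"
  interpret F: field ?F using maximalideal.quotient_is_field[OF place_ideal_maximal(1)[OF Q] S.is_cring] .
  have fin: "finite (carrier ?F)"
    by (rule card_ge_0_finite) (use place_norm_power(1)[OF Q] q_ge_2 in \<open>simp add: place_norm_def\<close>)
  let ?h = "\<lambda>a. ?I +>\<^bsub>?S\<^esub> a"
  interpret h: ring_hom_ring ?S ?F ?h by (rule I.rcos_ring_hom_ring)
  have pw: "x [^]\<^bsub>?S\<^esub> m = x [^] m" for x and m :: nat by (induction m) auto
  have hI: "?h a = ?I +> a" for a unfolding a_r_coset_def' by simp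
  have heq: "?h a = ?h b \<longleftrightarrow> a \<ominus> b \<in> fid K Q 1" if ab: "a \<in> Q" "b \<in> Q" for a b
    unfolding hI fid_1[OF Q] by (rule coset_eq_iff[OF place_ideal_props(1)[OF Q]]) (use ab Qc in auto)
  obtain d where d: "n = Suc d" "1 \<le> d" using n by (cases n) auto
  have "?h ` Z \<subseteq> insert \<zero>\<^bsub>?F\<^esub> {y \<in> carrier ?F. y [^]\<^bsub>?F\<^esub> d = \<one>\<^bsub>?F\<^esub>}"
  proof
    fix y assume "y \<in> ?h ` Z"
    then obtain z where z: "z \<in> Z" "y = ?h z" by blast
    have zQ: "z \<in> Q" using z(1) Z(1) by blast
    have yc: "y \<in> carrier ?F" unfolding z(2) using zQ by (intro h.hom_closed) simp
    have pQ: "z [^] m \<in> Q" for m :: nat by (induction m) (use zQ subringE[OF sr] in auto)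
    have "?h (z [^] n) = y" unfolding z(2) using heq[OF pQ zQ] Z(3)[OF z(1)] by blast
    then have yn: "y [^]\<^bsub>?F\<^esub> n = y" using h.hom_nat_pow[of z n] zQ unfolding pw z(2) by simp
    show "y \<in> insert \<zero>\<^bsub>?F\<^esub> {y \<in> carrier ?F. y [^]\<^bsub>?F\<^esub> d = \<one>\<^bsub>?F\<^esub>}"
    proof (cases "y = \<zero>\<^bsub>?F\<^esub>")
      case False
      have "y [^]\<^bsub>?F\<^esub> d \<otimes>\<^bsub>?F\<^esub> y = \<one>\<^bsub>?F\<^esub> \<otimes>\<^bsub>?F\<^esub> y" using yn yc d(1) F.nat_pow_Suc F.l_one by metis
      then have "y [^]\<^bsub>?F\<^esub> d = \<one>\<^bsub>?F\<^esub>" using F.m_rcancel[OF False yc F.nat_pow_closed[OF yc] F.one_closed] by blast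
      then show ?thesis using yc by blast
    qed blast
  qed
  then have "card (?h ` Z) \<le> card (insert \<zero>\<^bsub>?F\<^esub> {y \<in> carrier ?F. y [^]\<^bsub>?F\<^esub> d = \<one>\<^bsub>?F\<^esub>})"
    using fin by (intro card_mono) auto
  also have "\<dots> \<le> Suc d"
  proof -
    let ?S = "{y \<in> carrier ?F. y [^]\<^bsub>?F\<^esub> d = \<one>\<^bsub>?F\<^esub>}"
    have "finite ?S" using fin by simp
    moreover have "card ?S \<le> d" using F.num_roots_le_deg[OF fin] d(2) by simp
    ultimately show ?thesis by (simp only: card_insert_if split: if_split) simp
  qed
  finally have "card (?h ` Z) \<le> n" using d(1) by simp
  moreover have "inj_on ?h Z"
  proof (rule inj_onI)
    fix z z' assume z: "z \<in> Z" "z' \<in> Z" "?h z = ?h z'"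
    then have "z \<ominus> z' \<in> fid K Q 1" using heq[of z z'] Z(1) by blast
    then show "z = z'" using inj z by blast
  qed
  ultimately show ?thesis using card_image by metis
qed

text \<open>Since \<open>\<theta>\<close> is fixed by \<open>x \<mapsto> x ^ |P|\<close>, and this map has derivative zero, iterating it improves an approximation of
  \<open>\<theta>\<close> by elements of \<open>K\<close> quadratically, as in Newton's method.\<close>

locale const_ext = ffield M kM qM BM CM + K: ffield K k q B C
  for M (structure) and kM qM BM CM and K :: "('a, 'b) ring_scheme" and k q B C +
  fixes \<iota> \<theta> and N :: nat
  assumes hom: "\<iota> \<in> ring_hom K M" and th: "\<theta> \<in> carrier M" "\<theta> \<notin> \<iota> ` carrier K" and N: "0 < N" "\<theta> [^] N = \<one>"
    and gen: "carrier M = (\<Union>n. pols (\<iota> ` carrier K) \<theta> n)"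
    and frob: "\<And>P. P \<in> prime_divisors K \<Longrightarrow> \<theta> [^] place_norm K P = \<theta>"
begin

sublocale h: ring_hom_ring K M \<iota>
  using ring_hom_ringI2[OF K.ring_axioms ring_axioms hom] .

abbreviation KK where "KK \<equiv> \<iota> ` carrier K"

lemma hinj: assumes "x \<in> carrier K" "y \<in> carrier K" "\<iota> x = \<iota> y" shows "x = y"
  using inj_onD[OF non_trivial_field_hom_is_inj[OF hom K.field_axioms field_axioms] assms(3,1,2)] .

lemma hz: assumes "x \<in> carrier K" "x \<noteq> \<zero>\<^bsub>K\<^esub>" shows "\<iota> x \<noteq> \<zero>"
  using hinj[OF assms(1) K.zero_closed] assms(2) h.hom_zero by metis

lemma hminus: assumes "x \<in> carrier K" "y \<in> carrier K" shows "\<iota> (x \<ominus>\<^bsub>K\<^esub> y) = \<iota> x \<ominus> \<iota> y"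
  using assms by (simp add: a_minus_def)

lemma hinv: assumes "x \<in> carrier K" "x \<noteq> \<zero>\<^bsub>K\<^esub>" shows "\<iota> (inv\<^bsub>K\<^esub> x) = inv (\<iota> x)"
proof -
  have "\<iota> x \<otimes> \<iota> (inv\<^bsub>K\<^esub> x) = \<one>" using assms K.inv_mem K.inv_r by (metis h.hom_mult h.hom_one)
  then show ?thesis using inv_eqI[of "\<iota> x" "\<iota> (inv\<^bsub>K\<^esub> x)"] assms K.inv_mem by simp
qed

lemma KK_subring: "subring KK M" by (rule h.img_is_subring[OF K.carrier_is_subring])

lemma KK_inv: "f \<in> KK \<Longrightarrow> f \<noteq> \<zero> \<Longrightarrow> inv f \<in> KK"
proof -
  assume "f \<in> KK" "f \<noteq> \<zero>"
  then obtain x where x: "x \<in> carrier K" "f = \<iota> x" by blast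
  then have "x \<noteq> \<zero>\<^bsub>K\<^esub>" using \<open>f \<noteq> \<zero>\<close> by auto
  then show "inv f \<in> KK" using hinv[OF x(1)] x K.inv_mem[OF x(1)] by (metis imageI)
qed

definition subspace :: "'c set \<Rightarrow> bool" where
  "subspace H \<longleftrightarrow> additive_subgroup H M \<and> (\<forall>f\<in>KK. \<forall>h\<in>H. f \<otimes> h \<in> H)"

text \<open>\<open>H\<close> is the kernel of a \<open>K\<close>-linear functional that vanishes on \<open>H0\<close> and not at \<open>v\<close>.\<close>

lemma hyperplane:
  assumes H0: "subspace H0" "v \<notin> H0" and v: "v \<in> carrier M" and gs: "set gs \<subseteq> carrier M"
  shows "\<exists>H. subspace H \<and> H0 \<subseteq> H \<and> v \<notin> H \<and> (\<forall>g\<in>set gs. \<exists>h\<in>H. \<exists>f\<in>KK. g = h \<oplus> f \<otimes> v)"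
  using gs
proof (induction gs)
  case Nil then show ?case using H0 by auto
next
  case (Cons g gs)
  note Kr = subringE[OF KK_subring]
  have g: "g \<in> carrier M" "set gs \<subseteq> carrier M" using Cons.prems by auto
  obtain H where H: "subspace H" "H0 \<subseteq> H" "v \<notin> H" "\<forall>g\<in>set gs. \<exists>h\<in>H. \<exists>f\<in>KK. g = h \<oplus> f \<otimes> v" using Cons.IH[OF g(2)] by blast
  have Ha: "additive_subgroup H M" and Hs: "\<And>f h. f \<in> KK \<Longrightarrow> h \<in> H \<Longrightarrow> f \<otimes> h \<in> H" using H(1) unfolding subspace_def by auto
  note Hc = additive_subgroup.a_subset[OF Ha]
  show ?case
  proof (cases "\<exists>h\<in>H. \<exists>f\<in>KK. g = h \<oplus> f \<otimes> v")
    case True then show ?thesis using H by (intro exI[of _ H]) auto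
  next
    case False
    let ?H = "{h \<oplus> f \<otimes> g |h f. h \<in> H \<and> f \<in> KK}"
    have inH: "h \<oplus> f \<otimes> g \<in> ?H" if "h \<in> H" "f \<in> KK" for h f using that by blast
    have HH: "H \<subseteq> ?H"
    proof
      fix h assume h: "h \<in> H"
      then have "h = h \<oplus> \<zero> \<otimes> g" using Hc g by auto
      then show "h \<in> ?H" using h Kr(2) by blast
    qed
    have gH: "g = \<zero> \<oplus> \<one> \<otimes> g" using g by simp
    have sub: "subspace ?H" unfolding subspace_def
    proof (intro conjI ballI)
      show "additive_subgroup ?H M"
      proof (rule additive_subgroupI')
        show "?H \<subseteq> carrier M" using Hc Kr(1) g by blast
        show "\<zero> \<in> ?H" using HH additive_subgroup.zero_closed[OF Ha] by blast
        show "a \<oplus> b \<in> ?H" if ab: "a \<in> ?H" "b \<in> ?H" for a b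
        proof -
          obtain h f h' f' where d: "h \<in> H" "f \<in> KK" "a = h \<oplus> f \<otimes> g" "h' \<in> H" "f' \<in> KK" "b = h' \<oplus> f' \<otimes> g" using ab by blast
          have c: "h \<in> carrier M" "f \<in> carrier M" "h' \<in> carrier M" "f' \<in> carrier M" using d Hc Kr(1) by blast+
          have "a \<oplus> b = (h \<oplus> h') \<oplus> (f \<oplus> f') \<otimes> g" unfolding d(3,6) using c g(1) by (simp add: l_distr a_ac)
          then show ?thesis using inH[OF additive_subgroup.a_closed[OF Ha d(1,4)] Kr(7)[OF d(2,5)]] by metis
        qed
        show "\<ominus> a \<in> ?H" if ab: "a \<in> ?H" for a
        proof -
          obtain h f where d: "h \<in> H" "f \<in> KK" "a = h \<oplus> f \<otimes> g" using ab by blast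
          have c: "h \<in> carrier M" "f \<in> carrier M" using d Hc Kr(1) by blast+
          have "\<ominus> a = (\<ominus> h) \<oplus> (\<ominus> f) \<otimes> g" unfolding d(3) using c g(1) by (simp add: l_minus minus_add)
          then show ?thesis using inH[OF additive_subgroup.a_inv_closed[OF Ha d(1)] Kr(5)[OF d(2)]] by metis
        qed
      qed
      fix f' a assume f': "f' \<in> KK" and "a \<in> ?H"
      then obtain h f where d: "h \<in> H" "f \<in> KK" "a = h \<oplus> f \<otimes> g" by blast
      have c: "h \<in> carrier M" "f \<in> carrier M" "f' \<in> carrier M" using d f' Hc Kr(1) by blast+
      have "f' \<otimes> a = (f' \<otimes> h) \<oplus> (f' \<otimes> f) \<otimes> g" unfolding d(3) using c g(1) by (simp add: r_distr m_assoc)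
      then show "f' \<otimes> a \<in> ?H" using inH[OF Hs[OF f' d(1)] Kr(6)[OF f' d(2)]] by metis
    qed
    \<comment> \<open>If v were h + f g with f nonzero, then g would be a multiple of v modulo the
      old H, which the present case excludes; with f = 0, v would lie in H itself.\<close>
    have vn: "v \<notin> ?H"
    proof
      assume "v \<in> ?H"
      then obtain h f where d: "h \<in> H" "f \<in> KK" "v = h \<oplus> f \<otimes> g" by blast
      have c: "h \<in> carrier M" "f \<in> carrier M" using d Hc Kr(1) by blast+
      have f0: "f \<noteq> \<zero>" using d(3) H(3) d(1) c g by auto
      note ic = inv_mem[OF c(2) f0]
      have "f \<otimes> g = v \<ominus> h" unfolding d(3) using c g minus_minus_cancel(4)[of "f \<otimes> g" h h] by (simp add: a_comm)
      then have "inv f \<otimes> (f \<otimes> g) = inv f \<otimes> v \<ominus> inv f \<otimes> h" using minus_identities(5)[OF v c(1) ic ic] by simp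
      moreover have "inv f \<otimes> (f \<otimes> g) = g" using ic c g inv_l[OF c(2) f0] by (simp add: m_assoc[symmetric])
      ultimately have "g = (\<ominus> (inv f \<otimes> h)) \<oplus> inv f \<otimes> v" using ic c v by (simp add: a_minus_def a_comm)
      moreover have "\<ominus> (inv f \<otimes> h) \<in> H" using additive_subgroup.a_inv_closed[OF Ha Hs[OF KK_inv[OF d(2) f0] d(1)]] .
      ultimately show False using False KK_inv[OF d(2) f0] by blast
    qed
    have gg: "\<exists>h\<in>?H. \<exists>f\<in>KK. g' = h \<oplus> f \<otimes> v" if g': "g' \<in> set (g # gs)" for g'
    proof (cases "g' = g")
      case True
      have "g \<in> ?H" using inH[OF additive_subgroup.zero_closed[OF Ha] Kr(3)] gH by metis
      moreover have "g' = g \<oplus> \<zero> \<otimes> v" using True g v by simp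
      ultimately show ?thesis using Kr(2) by blast
    next
      case False
      then have "g' \<in> set gs" using g' by auto
      then obtain h f where "h \<in> H" "f \<in> KK" "g' = h \<oplus> f \<otimes> v" using H(4) by metis
      then show ?thesis using HH by blast
    qed
    show ?thesis by (rule exI[of _ ?H], intro conjI sub vn order.trans[OF H(2) HH] ballI gg)
  qed
qed

section \<open>The places above one place P\<close>

context
  fixes P t assumes P: "P \<in> prime_divisors K" and t: "t \<in> carrier K" "t \<noteq> \<zero>\<^bsub>K\<^esub>" "place_ord K P t = 1"
begin

abbreviation OP where "OP \<equiv> \<iota> ` P"
definition AP where "AP = (\<Union>n. pols OP \<theta> n)"

lemmas PK = subringE[OF K.place_subring[OF P]]

lemma OP_subring: "subring OP M" by (rule h.img_is_subring[OF K.place_subring[OF P]])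

lemma AP_subring: "subring AP M" "OP \<subseteq> AP" "\<theta> \<in> AP" unfolding AP_def using pols_subring[OF OP_subring th(1)] by auto

lemmas AR = subringE[OF AP_subring(1)]

lemma tP: "t \<in> P" "t \<in> fid K P 1" "\<iota> t \<in> OP" "\<iota> t \<in> carrier M" "\<iota> t \<noteq> \<zero>" "\<iota> t \<in> AP"
proof -
  show "t \<in> P" using K.place_ord_nonneg_iff(1)[OF P t(1,2)] t(3) by simp
  then show "\<iota> t \<in> OP" by blast
  then show "\<iota> t \<in> AP" using AP_subring(2) by blast
  show "t \<in> fid K P 1" using t by (intro K.fidI) auto
  show "\<iota> t \<in> carrier M" "\<iota> t \<noteq> \<zero>" using t hz by auto
qed

lemma ideal_div: assumes "x \<in> fid K P 1" shows "\<exists>p\<in>P. x = t \<otimes>\<^bsub>K\<^esub> p"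
proof -
  have xc: "x \<in> carrier K" using assms K.fid_carrier by blast
  have it: "inv\<^bsub>K\<^esub> t \<in> carrier K" "inv\<^bsub>K\<^esub> t \<noteq> \<zero>\<^bsub>K\<^esub>" using K.inv_mem[OF t(1,2)] K.inv_nz[OF t(1,2)] by auto
  have "inv\<^bsub>K\<^esub> t \<in> fid K P (-1)" using it K.place_ord_inv[OF P t(1,2)] t(3) by (intro K.fidI) auto
  then have "inv\<^bsub>K\<^esub> t \<otimes>\<^bsub>K\<^esub> x \<in> P" using K.fid_mult[OF P _ assms, of "inv\<^bsub>K\<^esub> t" "-1"] K.fid_0[OF P] by simp
  moreover have "x = t \<otimes>\<^bsub>K\<^esub> (inv\<^bsub>K\<^esub> t \<otimes>\<^bsub>K\<^esub> x)" using t it xc K.inv_r[OF t(1,2)] by (simp add: K.m_assoc[symmetric])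
  ultimately show ?thesis by blast
qed

text \<open>The ring \<open>AP\<close> is a finitely generated module over the image of \<open>P\<close>, so a functional that is nonzero at \<open>v\<close>
  has bounded denominators on it.\<close>

lemma bounded:
  assumes H0: "subspace H0" "v \<notin> H0" and v: "v \<in> carrier M"
  shows "\<exists>C::int. \<forall>j::nat. \<forall>a\<in>AP. \<forall>b\<in>H0. v = b \<oplus> \<iota> t [^] j \<otimes> a \<longrightarrow> int j \<le> C"
proof -
  note Kr = subringE[OF KK_subring]
  let ?gs = "map (\<lambda>i. \<theta> [^] (i::nat)) [0..<N]"
  have "set ?gs \<subseteq> carrier M" using th by auto
  from hyperplane[OF H0 v this] obtain H where H: "subspace H" "H0 \<subseteq> H" "v \<notin> H"
    "\<forall>g\<in>set ?gs. \<exists>h\<in>H. \<exists>f\<in>KK. g = h \<oplus> f \<otimes> v" by blast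
  have Ha: "additive_subgroup H M" and Hs: "\<And>f h. f \<in> KK \<Longrightarrow> h \<in> H \<Longrightarrow> f \<otimes> h \<in> H" using H(1) unfolding subspace_def by auto
  note Hc = additive_subgroup.a_subset[OF Ha]
  have "\<forall>i\<in>{..<N}. \<exists>f. f \<in> carrier K \<and> (\<exists>h\<in>H. \<theta> [^] i = h \<oplus> \<iota> f \<otimes> v)"
  proof
    fix i assume "i \<in> {..<N}"
    then have "\<theta> [^] i \<in> set ?gs" by auto
    then show "\<exists>f. f \<in> carrier K \<and> (\<exists>h\<in>H. \<theta> [^] i = h \<oplus> \<iota> f \<otimes> v)" using H(4) by blast
  qed
  then obtain f where f: "\<forall>i\<in>{..<N}. f i \<in> carrier K \<and> (\<exists>h\<in>H. \<theta> [^] i = h \<oplus> \<iota> (f i) \<otimes> v)" by (rule bchoice[THEN exE])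
  \<comment> \<open>Bounds the denominators at P of the functional on the powers of \<theta>. Only N
    powers matter, because \<theta>^N = 1.\<close>
  define C where "C = (\<Sum>i<N. \<bar>place_ord K P (f i)\<bar>)"
  have fC: "f i \<in> fid K P (- C)" if "i < N" for i
  proof (rule K.fidI)
    show "f i \<in> carrier K" using f that by blast
    have "\<bar>place_ord K P (f i)\<bar> \<le> C" unfolding C_def using member_le_sum[of i "{..<N}" "\<lambda>i. \<bar>place_ord K P (f i)\<bar>"] that by simp
    then show "- C \<le> place_ord K P (f i)" by simp
  qed
  \<comment> \<open>The elements on which the functional takes values of order at least -C at P.
    This is a module over the image of P containing all powers of \<theta>, hence it contains
    \<open>AP\<close>.\<close>
  define S where "S = {h \<oplus> \<iota> g \<otimes> v |h g. h \<in> H \<and> g \<in> fid K P (- C)}"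
  note fa = K.fid_additive_subgroup[OF P, of "- C"]
  have Sth: "\<theta> [^] i \<in> S" for i :: nat
  proof -
    have "\<theta> [^] i = \<theta> [^] (N * (i div N) + i mod N)" by simp
    also have "\<dots> = (\<theta> [^] N) [^] (i div N) \<otimes> \<theta> [^] (i mod N)" using th(1) by (simp only: nat_pow_mult[symmetric] nat_pow_pow)
    also have "\<dots> = \<theta> [^] (i mod N)" using N th(1) by simp
    finally have e: "\<theta> [^] i = \<theta> [^] (i mod N)" .
    have "i mod N < N" using N(1) by simp
    then show ?thesis unfolding e S_def using f fC by blast
  qed
  have Sadd: "a \<oplus> b \<in> S" if ab: "a \<in> S" "b \<in> S" for a b
  proof -
    obtain h g h' g' where d: "h \<in> H" "g \<in> fid K P (- C)" "a = h \<oplus> \<iota> g \<otimes> v" "h' \<in> H" "g' \<in> fid K P (- C)" "b = h' \<oplus> \<iota> g' \<otimes> v"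
      using ab unfolding S_def by blast
    have c: "h \<in> carrier M" "h' \<in> carrier M" "g \<in> carrier K" "g' \<in> carrier K" using d Hc K.fid_carrier by blast+
    have "a \<oplus> b = (h \<oplus> h') \<oplus> \<iota> (g \<oplus>\<^bsub>K\<^esub> g') \<otimes> v" unfolding d(3,6) using c v by (simp add: l_distr a_ac)
    then show ?thesis unfolding S_def using additive_subgroup.a_closed[OF Ha d(1,4)] additive_subgroup.a_closed[OF fa d(2,5)] by blast
  qed
  have Smul: "\<iota> p \<otimes> a \<in> S" if p: "p \<in> P" and a: "a \<in> S" for p a
  proof -
    obtain h g where d: "h \<in> H" "g \<in> fid K P (- C)" "a = h \<oplus> \<iota> g \<otimes> v" using a unfolding S_def by blast
    have c: "h \<in> carrier M" "g \<in> carrier K" "p \<in> carrier K" using d p Hc K.fid_carrier PK(1) by blast+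
    have "\<iota> p \<otimes> a = \<iota> p \<otimes> h \<oplus> \<iota> (p \<otimes>\<^bsub>K\<^esub> g) \<otimes> v" unfolding d(3) using c v by (simp add: r_distr m_assoc)
    moreover have "p \<otimes>\<^bsub>K\<^esub> g \<in> fid K P (- C)" using K.fid_mult[OF P, of p 0 g "- C"] p d(2) K.fid_0[OF P] by simp
    moreover have "\<iota> p \<otimes> h \<in> H" using Hs d(1) c(3) by blast
    ultimately show ?thesis unfolding S_def by blast
  qed
  note Oa = subring_additive_subgroup[OF OP_subring]
  have AS: "a \<in> S" if "a \<in> pols OP \<theta> n" for a n using that
  proof (induction n arbitrary: a)
    case 0
    then obtain p where p: "p \<in> P" "a = \<iota> p" by auto
    have "a = \<iota> p \<otimes> \<theta> [^] (0::nat)" using p PK(1) by auto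
    then show ?case using Smul[OF p(1) Sth] by metis
  next
    case (Suc n)
    obtain s o' where s: "s \<in> pols OP \<theta> n" "o' \<in> OP" "a = s \<oplus> o' \<otimes> \<theta> [^] Suc n" using pols_top[OF Oa th(1) Suc.prems] by blast
    then show ?case using Sadd[OF Suc.IH[OF s(1)]] Smul Sth by blast
  qed
  have "int j \<le> C" if ja: "a \<in> AP" "b \<in> H0" "v = b \<oplus> \<iota> t [^] j \<otimes> a" for j :: nat and a b
  proof -
    obtain h g where d: "h \<in> H" "g \<in> fid K P (- C)" "a = h \<oplus> \<iota> g \<otimes> v" using ja(1) AS unfolding AP_def S_def by blast
    have bH: "b \<in> H" using ja(2) H(2) by blast
    define T where "T = t [^]\<^bsub>K\<^esub> j"
    have T: "T \<in> carrier K" "T \<noteq> \<zero>\<^bsub>K\<^esub>" "\<iota> T = \<iota> t [^] j" "place_ord K P T = int j"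
      unfolding T_def using t K.pow_nonzero h.hom_nat_pow K.place_ord_pow[OF P t(1,2), of j] by auto
    have c: "h \<in> carrier M" "b \<in> carrier M" "g \<in> carrier K" using d bH Hc K.fid_carrier by blast+
    \<comment> \<open>Applying the functional to v = b + t^j a gives 1 = T g, that is w = 0; hence
      the order of g is -j, while it is at least -C.\<close>
    define w where "w = \<one>\<^bsub>K\<^esub> \<ominus>\<^bsub>K\<^esub> T \<otimes>\<^bsub>K\<^esub> g"
    have wc: "w \<in> carrier K" unfolding w_def using T c by simp
    have Tc: "\<iota> T \<in> carrier M" "\<iota> g \<in> carrier M" "\<iota> (T \<otimes>\<^bsub>K\<^esub> g) = \<iota> T \<otimes> \<iota> g" using T(1) c(3) by auto
    let ?r = "\<iota> (T \<otimes>\<^bsub>K\<^esub> g) \<otimes> v"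
    have rc: "?r \<in> carrier M" "b \<oplus> \<iota> T \<otimes> h \<in> carrier M" using Tc c v by auto
    have "b \<oplus> \<iota> T \<otimes> a = (b \<oplus> \<iota> T \<otimes> h) \<oplus> ?r"
      unfolding d(3) Tc(3) using c(1,2) v Tc(1,2) by (simp add: r_distr m_assoc a_assoc)
    then have "v = (b \<oplus> \<iota> T \<otimes> h) \<oplus> ?r" using ja(3) T(3) by metis
    then have "v \<ominus> ?r = b \<oplus> \<iota> T \<otimes> h"
      using minus_minus_cancel(4)[OF rc(2,1) zero_closed] by metis
    moreover have "\<iota> w \<otimes> v = v \<ominus> ?r"
    proof -
      have "\<iota> w = \<one> \<ominus> \<iota> (T \<otimes>\<^bsub>K\<^esub> g)" unfolding w_def using hminus[of "\<one>\<^bsub>K\<^esub>" "T \<otimes>\<^bsub>K\<^esub> g"] T(1) c(3) by simp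
      then show ?thesis using Tc v by (simp add: a_minus_def l_distr l_minus)
    qed
    moreover have "\<iota> T \<otimes> h \<in> H" using Hs[OF _ d(1)] T(1) by blast
    ultimately have wv: "\<iota> w \<otimes> v \<in> H" using additive_subgroup.a_closed[OF Ha bH, of "\<iota> T \<otimes> h"] by simp
    have "w = \<zero>\<^bsub>K\<^esub>"
    proof (rule ccontr)
      assume nz: "w \<noteq> \<zero>\<^bsub>K\<^esub>"
      have "inv (\<iota> w) \<in> KK" using KK_inv[of "\<iota> w"] wc hz[OF wc nz] by blast
      then have "inv (\<iota> w) \<otimes> (\<iota> w \<otimes> v) \<in> H" using Hs wv by blast
      moreover have "inv (\<iota> w) \<otimes> (\<iota> w \<otimes> v) = v"
        using inv_mem[OF _ hz[OF wc nz]] inv_l[OF _ hz[OF wc nz]] wc v by (simp add: m_assoc[symmetric])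
      ultimately show False using H(3) by simp
    qed
    then have Tg: "T \<otimes>\<^bsub>K\<^esub> g = \<one>\<^bsub>K\<^esub>" unfolding w_def using T c by (simp add: K.r_right_minus_eq)
    have g0: "g \<noteq> \<zero>\<^bsub>K\<^esub>" using Tg T by auto
    have "int j + place_ord K P g = 0" using K.place_ord_mult[OF P T(1,2) c(3) g0] Tg K.place_ord_one[OF P] T(4) by simp
    moreover have "- C \<le> place_ord K P g" using K.fidD[OF d(2) g0] .
    ultimately show ?thesis by simp
  qed
  then show ?thesis by blast
qed

text \<open>If t a = 1 in \<open>AP\<close>, then 1 = t^j a^j for every j, against boundedness for v
  = 1 and the zero subspace.\<close>

lemma tA_pair: "ring_ideal_pair AP (dilate (\<iota> t) AP)"
proof -
  have n1: "\<one> \<notin> dilate (\<iota> t) AP"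
  proof
    assume "\<one> \<in> dilate (\<iota> t) AP"
    then obtain a where a: "a \<in> AP" "\<one> = \<iota> t \<otimes> a" unfolding dilate_def by blast
    have ac: "a \<in> carrier M" using a(1) AR(1) by blast
    have aj: "a [^] j \<in> AP" for j :: nat by (induction j) (use a(1) AR(3,6) in auto)
    have "subspace {\<zero>}" unfolding subspace_def using subringE(1)[OF KK_subring] by (auto intro!: additive_subgroupI')
    moreover have "\<one> \<notin> {\<zero>}" by simp
    ultimately obtain C :: int where C: "\<forall>j::nat. \<forall>a\<in>AP. \<forall>b\<in>{\<zero>}. \<one> = b \<oplus> \<iota> t [^] j \<otimes> a \<longrightarrow> int j \<le> C" using bounded[OF _ _ one_closed] by blast
    have "\<one> = \<zero> \<oplus> \<iota> t [^] j \<otimes> a [^] j" for j :: nat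
    proof -
      have "\<iota> t [^] j \<otimes> a [^] j = (\<iota> t \<otimes> a) [^] j" using nat_pow_distrib[OF tP(4) ac] by simp
      also have "\<dots> = \<one>" unfolding a(2)[symmetric] by (rule nat_pow_one)
      finally show ?thesis by simp
    qed
    then have "int j \<le> C" for j :: nat using bspec[OF bspec[OF spec[OF C] aj], of \<zero>] by blast
    from this[of "nat (C + 1)"] show False by linarith
  qed
  show ?thesis unfolding ring_ideal_pair_def
    using AP_subring(1) n1 dilate_sub_ideal(1)[OF AP_subring(1) tP(6)] unfolding sub_ideal_iff[OF AP_subring(1)] by blast
qed

lemma char_zero: "add_pow M (place_norm K P) \<one> = \<zero>"
proof -
  note q0 = K.char_q
  obtain r where r: "place_degree K P = Suc r" using K.place_norm_power(2)[OF P] by (cases "place_degree K P") auto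
  have "add_pow K (place_norm K P) \<one>\<^bsub>K\<^esub> = add_pow K (q ^ r * q) \<one>\<^bsub>K\<^esub>" using K.place_norm_power(1)[OF P] r by (simp add: mult.commute)
  also have "\<dots> = add_pow K (q ^ r) (add_pow K q \<one>\<^bsub>K\<^esub>)" using K.add.nat_pow_pow[of "\<one>\<^bsub>K\<^esub>" "q ^ r" q] unfolding add_pow_def by (simp add: mult.commute)
  also have "\<dots> = \<zero>\<^bsub>K\<^esub>" unfolding q0 using K.add.nat_pow_one unfolding add_pow_def by simp
  finally have z: "add_pow K (place_norm K P) \<one>\<^bsub>K\<^esub> = \<zero>\<^bsub>K\<^esub>" .
  have "\<iota> (add_pow K n \<one>\<^bsub>K\<^esub>) = add_pow M n \<one>" for n :: nat by (induction n) auto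
  then show ?thesis using z by (metis h.hom_zero)
qed

lemma norm_gt_1: "1 < place_norm K P"
  using K.place_norm_power[OF P] K.q_ge_2 one_less_power[of q "place_degree K P"] by simp

text \<open>\<theta> equals its own power with exponent |P|, and |P| is zero in M, so the expansion
  leaves the square of the error times an integral factor.\<close>

lemma newton_step:
  assumes A: "subring A' M" "\<theta> \<in> A'" "OP \<subseteq> A'" and b: "b \<in> P"
  shows "b [^]\<^bsub>K\<^esub> place_norm K P \<in> P" "\<exists>c\<in>A'. \<theta> \<ominus> \<iota> (b [^]\<^bsub>K\<^esub> place_norm K P) = ((\<theta> \<ominus> \<iota> b) \<otimes> (\<theta> \<ominus> \<iota> b)) \<otimes> c"
proof -
  have bc: "b \<in> carrier K" using b PK(1) by blast
  show "b [^]\<^bsub>K\<^esub> place_norm K P \<in> P"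
  proof -
    have "b [^]\<^bsub>K\<^esub> n \<in> P" for n :: nat by (induction n) (use b PK in auto)
    then show ?thesis by blast
  qed
  have "\<iota> b \<in> A'" using b A(3) by blast
  from taylor_char[OF A(1,2) this _ char_zero] norm_gt_1
  show "\<exists>c\<in>A'. \<theta> \<ominus> \<iota> (b [^]\<^bsub>K\<^esub> place_norm K P) = ((\<theta> \<ominus> \<iota> b) \<otimes> (\<theta> \<ominus> \<iota> b)) \<otimes> c"
    using frob[OF P] h.hom_nat_pow[OF bc] by simp
qed

text \<open>Otherwise Newton's iteration, started at b, would approximate \<theta> by elements of P
  to every power of t within \<open>AP\<close>. This contradicts boundedness for the subspace K and
  v = \<theta>, and it is here that \<theta> outside K enters.\<close>

lemma residue_not_tA: assumes b: "b \<in> P" shows "\<theta> \<ominus> \<iota> b \<notin> dilate (\<iota> t) AP"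
proof
  assume A: "\<theta> \<ominus> \<iota> b \<in> dilate (\<iota> t) AP"
  have st: "\<exists>b\<in>P. \<exists>a\<in>AP. \<theta> \<ominus> \<iota> b = \<iota> t [^] Suc j \<otimes> a" for j
  proof (induction j)
    case 0
    obtain a where "a \<in> AP" "\<theta> \<ominus> \<iota> b = \<iota> t \<otimes> a" using A unfolding dilate_def by blast
    then show ?case using b tP(4) by auto
  next
    case (Suc j)
    then obtain b a where ba: "b \<in> P" "a \<in> AP" "\<theta> \<ominus> \<iota> b = \<iota> t [^] Suc j \<otimes> a" by blast
    obtain c where c: "c \<in> AP" "\<theta> \<ominus> \<iota> (b [^]\<^bsub>K\<^esub> place_norm K P) = ((\<theta> \<ominus> \<iota> b) \<otimes> (\<theta> \<ominus> \<iota> b)) \<otimes> c"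
      using newton_step(2)[OF AP_subring(1,3,2) ba(1)] by blast
    have cc: "a \<in> carrier M" "c \<in> carrier M" using ba(2) c(1) AR(1) by blast+
    have tj: "\<iota> t [^] j \<in> AP" for j :: nat by (induction j) (use tP(6) AR(3,6) in auto)
    have "\<theta> \<ominus> \<iota> (b [^]\<^bsub>K\<^esub> place_norm K P) = \<iota> t [^] Suc (Suc j) \<otimes> (\<iota> t [^] j \<otimes> (a \<otimes> (a \<otimes> c)))"
      unfolding c(2) ba(3) using cc tP(4) by (simp add: m_ac)
    moreover have "\<iota> t [^] j \<otimes> (a \<otimes> (a \<otimes> c)) \<in> AP" using AR(6)[OF tj AR(6)[OF ba(2) AR(6)[OF ba(2) c(1)]]] .
    ultimately show ?case using newton_step(1)[OF AP_subring(1,3,2) ba(1)] by blast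
  qed
  have "subspace KK" unfolding subspace_def using subring_additive_subgroup[OF KK_subring] subringE(6)[OF KK_subring] by blast
  then obtain C :: int where C: "\<forall>j::nat. \<forall>a\<in>AP. \<forall>b\<in>KK. \<theta> = b \<oplus> \<iota> t [^] j \<otimes> a \<longrightarrow> int j \<le> C" using bounded[OF _ th(2,1)] by blast
  obtain b a where ba: "b \<in> P" "a \<in> AP" "\<theta> \<ominus> \<iota> b = \<iota> t [^] Suc (nat C) \<otimes> a" using st by blast
  have bK: "\<iota> b \<in> KK" "\<iota> b \<in> carrier M" using ba(1) PK(1) by auto
  have "\<theta> = \<iota> b \<oplus> \<iota> t [^] Suc (nat C) \<otimes> a" using ba(3) minus_minus_cancel(5)[OF th(1) bK(2) bK(2)] by metis
  then have "int (Suc (nat C)) \<le> C" using bspec[OF bspec[OF spec[OF C] ba(2)] bK(1)] by blast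
  then show False by linarith
qed

section \<open>A single place Q above P: density of K and equality of norms\<close>

context
  fixes Q assumes Q: "Q \<in> PD" and AQ: "AP \<subseteq> Q" and tQ: "\<iota> t \<in> place_ideal M Q"
begin

lemmas QK = subringE[OF place_subring[OF Q]]

lemma PQ: "x \<in> P \<Longrightarrow> \<iota> x \<in> Q" using AP_subring(2) AQ by blast

lemma thQ: "\<theta> \<in> Q" using AP_subring(3) AQ by blast

lemma fid1_iff: assumes x: "x \<in> P" shows "\<iota> x \<in> fid M Q 1 \<longleftrightarrow> x \<in> fid K P 1"
proof
  assume "x \<in> fid K P 1"
  then obtain p where p: "p \<in> P" "x = t \<otimes>\<^bsub>K\<^esub> p" using ideal_div by blast
  have "\<iota> x = \<iota> p \<otimes> \<iota> t" unfolding p(2) using p(1) PK(1) t(1) by (auto simp: m_comm)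
  then show "\<iota> x \<in> fid M Q 1" unfolding fid_1[OF Q] using place_ideal_props(3)[OF Q PQ[OF p(1)] tQ] by simp
next
  have xc: "x \<in> carrier K" using x PK(1) by blast
  assume "\<iota> x \<in> fid M Q 1"
  then have "\<iota> x = \<zero> \<or> inv (\<iota> x) \<notin> Q" unfolding fid_1[OF Q] place_ideal_iff[OF Q] by blast
  then have "x = \<zero>\<^bsub>K\<^esub> \<or> inv\<^bsub>K\<^esub> x \<notin> P" using hz[OF xc] hinv[OF xc] PQ by metis
  then show "x \<in> fid K P 1" unfolding K.fid_1[OF P] K.place_ideal_iff[OF P] using x by blast
qed

lemma over_iff: assumes x: "x \<in> carrier K" shows "\<iota> x \<in> Q \<longleftrightarrow> x \<in> P"
proof
  assume xQ: "\<iota> x \<in> Q"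
  show "x \<in> P"
  proof (rule ccontr)
    assume nx: "x \<notin> P"
    have x0: "x \<noteq> \<zero>\<^bsub>K\<^esub>" using nx PK(2) by auto
    have ixP: "inv\<^bsub>K\<^esub> x \<in> P" using K.place_valuation[OF P x x0] nx by blast
    then have "inv\<^bsub>K\<^esub> x \<in> fid K P 1"
      unfolding K.fid_1[OF P] K.place_ideal_iff[OF P] using nx K.inv_i[OF x x0] by simp
    then have "\<iota> (inv\<^bsub>K\<^esub> x) \<in> place_ideal M Q" using fid1_iff[OF ixP] unfolding fid_1[OF Q] by blast
    then have "inv (\<iota> x) \<in> place_ideal M Q" using hinv[OF x x0] by simp
    moreover have "\<iota> x \<in> carrier M" "\<iota> x \<noteq> \<zero>" using x hz[OF x x0] by auto
    ultimately show False unfolding place_ideal_iff[OF Q] using xQ inv_i inv_nz by simp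
  qed
qed (rule PQ)

text \<open>The residue class of \<theta> is fixed by the power map with exponent |P|. The residue
  field of P already supplies |P| fixed points in the residue field of Q, which is all there can
  be.\<close>

lemma residue_approx: "\<exists>b\<in>P. \<theta> \<ominus> \<iota> b \<in> fid M Q 1"
proof (rule ccontr)
  assume n: "\<not> (\<exists>b\<in>P. \<theta> \<ominus> \<iota> b \<in> fid M Q 1)"
  note f1 = K.fid_additive_subgroup[OF P, of 1] and g1 = fid_additive_subgroup[OF Q, of 1]
  obtain W where W: "W \<subseteq> fid K P 0" "inj_on (\<lambda>a. fid K P 1 +>\<^bsub>K\<^esub> a) W" "(\<lambda>a. fid K P 1 +>\<^bsub>K\<^esub> a) ` W = K.cosets (fid K P 0) (fid K P 1)"
    by (rule K.cosets_incongruent[OF f1 K.fid_carrier order_refl, of P 0])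
  have WP: "W \<subseteq> P" using W(1) K.fid_0[OF P] by simp
  have Wc: "W \<subseteq> carrier K" using WP PK(1) by blast
  have fW: "finite W" using W(2,3) K.residue_finite[OF P] finite_imageD by metis
  have cW: "card W = place_norm K P" using card_image[OF W(2)] W(3) K.place_norm_cosets[OF P] by simp
  have Wsep: "w = w'" if w: "w \<in> W" "w' \<in> W" "w \<ominus>\<^bsub>K\<^esub> w' \<in> fid K P 1" for w w'
  proof -
    have "w \<in> carrier K" "w' \<in> carrier K" using w Wc by auto
    then have "fid K P 1 +>\<^bsub>K\<^esub> w = fid K P 1 +>\<^bsub>K\<^esub> w'" using K.coset_eq_iff[OF f1] w(3) by blast
    then show ?thesis using inj_onD[OF W(2)] w by blast
  qed
  have nW: "\<theta> \<notin> \<iota> ` W" using th(2) Wc by blast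
  have ii: "inj_on \<iota> W" using hinj Wc by (intro inj_onI) blast
  let ?Z = "insert \<theta> (\<iota> ` W)"
  have cZ: "card ?Z = Suc (place_norm K P)" using nW fW card_image[OF ii] cW by simp
  have zero: "\<zero> \<in> fid M Q 1" using additive_subgroup.zero_closed[OF g1] .
  have "card ?Z \<le> place_norm K P"
  proof (rule residue_frobenius_fixed[OF Q norm_gt_1])
    show "?Z \<subseteq> Q" using thQ PQ WP by blast
    show "finite ?Z" using fW by simp
    show "z [^] place_norm K P \<ominus> z \<in> fid M Q 1" if z: "z \<in> ?Z" for z
    proof (cases "z = \<theta>")
      case True then show ?thesis using frob[OF P] zero th(1) by (simp add: a_minus_def r_neg)
    next
      case False
      then obtain w where w: "w \<in> W" "z = \<iota> w" using z by blast
      have wP: "w \<in> P" "w \<in> carrier K" using w WP Wc by auto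
      have "w [^]\<^bsub>K\<^esub> place_norm K P \<in> P" using newton_step(1)[OF AP_subring(1,3,2) wP(1)] .
      then have "w [^]\<^bsub>K\<^esub> place_norm K P \<ominus>\<^bsub>K\<^esub> w \<in> P"
        using K.additive_subgroup_minus[OF K.subring_additive_subgroup[OF K.place_subring[OF P]]] wP by blast
      from fid1_iff[OF this] K.residue_fermat[OF P wP(1)] show ?thesis
        unfolding w(2) using hminus[of "w [^]\<^bsub>K\<^esub> place_norm K P" w] wP h.hom_nat_pow[OF wP(2)] by simp
    qed
    have a: "\<theta> \<ominus> z \<notin> fid M Q 1" if "z \<in> \<iota> ` W" for z using n that WP by blast
    fix z z' assume z: "z \<in> ?Z" "z' \<in> ?Z" "z \<ominus> z' \<in> fid M Q 1"
    have Zc: "z \<in> carrier M" "z' \<in> carrier M" using z(1,2) th(1) Wc by auto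
    have z3: "z' \<ominus> z \<in> fid M Q 1"
      using additive_subgroup.a_inv_closed[OF g1 z(3)] minus_minus_cancel(6)[OF Zc Zc(1)] by simp
    show "z = z'"
    proof (cases "z = \<theta> \<or> z' = \<theta>")
      case True then show ?thesis using z z3 a by blast
    next
      case False
      then obtain w w' where w: "w \<in> W" "w' \<in> W" "z = \<iota> w" "z' = \<iota> w'" using z by blast
      have wP: "w \<in> P" "w' \<in> P" "w \<in> carrier K" "w' \<in> carrier K" using w WP Wc by auto
      have "w \<ominus>\<^bsub>K\<^esub> w' \<in> P"
        using K.additive_subgroup_minus[OF K.subring_additive_subgroup[OF K.place_subring[OF P]] wP(1,2)] .
      from fid1_iff[OF this] have "w \<ominus>\<^bsub>K\<^esub> w' \<in> fid K P 1" using z(3) hminus[OF wP(3,4)] unfolding w(3,4) by simp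
      then show ?thesis using Wsep w by blast
    qed
  qed
  then show False using cZ by simp
qed

lemma theta_approx: "\<exists>b\<in>P. \<theta> \<ominus> \<iota> b \<in> fid M Q (int j + 1)"
proof (induction j)
  case 0 then show ?case using residue_approx by simp
next
  case (Suc j)
  then obtain b where b: "b \<in> P" "\<theta> \<ominus> \<iota> b \<in> fid M Q (int j + 1)" by blast
  have OQ: "OP \<subseteq> Q" using PQ by blast
  obtain c where c: "c \<in> Q" "\<theta> \<ominus> \<iota> (b [^]\<^bsub>K\<^esub> place_norm K P) = ((\<theta> \<ominus> \<iota> b) \<otimes> (\<theta> \<ominus> \<iota> b)) \<otimes> c"
    using newton_step(2)[OF place_subring[OF Q] thQ OQ b(1)] by blast
  have "c \<in> fid M Q 0" using c(1) fid_0[OF Q] by simp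
  then have "\<theta> \<ominus> \<iota> (b [^]\<^bsub>K\<^esub> place_norm K P) \<in> fid M Q (((int j + 1) + (int j + 1)) + 0)"
    unfolding c(2) using fid_mult[OF Q fid_mult[OF Q b(2,2)]] by blast
  then have "\<theta> \<ominus> \<iota> (b [^]\<^bsub>K\<^esub> place_norm K P) \<in> fid M Q (int (Suc j) + 1)"
    using fid_antimono[of "int (Suc j) + 1" "((int j + 1) + (int j + 1)) + 0" Q] by auto
  then show ?case using newton_step(1)[OF place_subring[OF Q] thQ OQ b(1)] by blast
qed

lemma power_diff:
  assumes x: "x \<in> Q" and y: "y \<in> Q" and d: "x \<ominus> y \<in> fid M Q m"
  shows "x [^] (i::nat) \<ominus> y [^] i \<in> fid M Q m"
proof (induction i)
  note f = fid_additive_subgroup[OF Q, of m]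
  case 0 then show ?case using additive_subgroup.zero_closed[OF f] by (simp add: a_minus_def r_neg)
next
  note f = fid_additive_subgroup[OF Q, of m]
  case (Suc i)
  have c: "x \<in> carrier M" "y \<in> carrier M" using x y QK(1) by auto
  have xi: "y [^] i \<in> Q" by (induction i) (use y QK in auto)
  have f0: "x \<in> fid M Q 0" "y [^] i \<in> fid M Q 0" using x xi fid_0[OF Q] by auto
  have "x [^] Suc i \<ominus> y [^] Suc i = (x [^] i \<ominus> y [^] i) \<otimes> x \<oplus> y [^] i \<otimes> (x \<ominus> y)"
  proof -
    define u v where "u = x [^] i" and "v = y [^] i"
    have "u \<in> carrier M" "v \<in> carrier M" unfolding u_def v_def using c by auto
    then show ?thesis using c unfolding nat_pow_Suc u_def[symmetric] v_def[symmetric] by algebra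
  qed
  moreover have "(x [^] i \<ominus> y [^] i) \<otimes> x \<in> fid M Q m" using fid_mult[OF Q Suc.IH f0(1)] by simp
  moreover have "y [^] i \<otimes> (x \<ominus> y) \<in> fid M Q m" using fid_mult[OF Q f0(2) d] by simp
  ultimately show ?case using additive_subgroup.a_closed[OF f] by simp
qed

text \<open>M is K[\<theta>], and in a polynomial expression \<theta> may be replaced by a
  sufficiently close b in P.\<close>

lemma dense: assumes "c \<in> carrier M" shows "\<exists>c'\<in>carrier K. c \<ominus> \<iota> c' \<in> fid M Q m"
proof -
  note f = fid_additive_subgroup[OF Q, of m] and Ka = subring_additive_subgroup[OF KK_subring]
  have "\<exists>c'\<in>carrier K. c \<ominus> \<iota> c' \<in> fid M Q m" if "c \<in> pols KK \<theta> n" for c n using that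
  proof (induction n arbitrary: c)
    case 0
    then obtain c' where c': "c' \<in> carrier K" "c = \<iota> c'" by auto
    then have "c \<ominus> \<iota> c' = \<zero>" by (simp add: a_minus_def r_neg)
    then show ?case using c' additive_subgroup.zero_closed[OF f] by metis
  next
    case (Suc n)
    obtain s u where s: "s \<in> pols KK \<theta> n" "u \<in> KK" "c = s \<oplus> u \<otimes> \<theta> [^] Suc n" using pols_top[OF Ka th(1) Suc.prems] by blast
    obtain a where a: "a \<in> carrier K" "u = \<iota> a" using s(2) by blast
    obtain s' where s': "s' \<in> carrier K" "s \<ominus> \<iota> s' \<in> fid M Q m" using Suc.IH[OF s(1)] by blast
    define e where "e = place_ord M Q u"
    have ue: "u \<in> fid M Q e" unfolding e_def using a by (intro fidI) auto
    \<comment> \<open>The precision m - e compensates for a possible pole of the coefficient u at Q.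
      For u = 0 any value of e will do, as \<open>fid\<close> contains zero.\<close>
    obtain b where b: "b \<in> P" "\<theta> \<ominus> \<iota> b \<in> fid M Q (int (nat (m - e)) + 1)" using theta_approx by blast
    have "\<theta> \<ominus> \<iota> b \<in> fid M Q (m - e)" by (rule subsetD[OF fid_antimono b(2)]) simp
    from power_diff[OF thQ PQ[OF b(1)] this] have "\<theta> [^] Suc n \<ominus> \<iota> b [^] Suc n \<in> fid M Q (m - e)" .
    from fid_mult[OF Q ue this] have d: "u \<otimes> (\<theta> [^] Suc n \<ominus> \<iota> b [^] Suc n) \<in> fid M Q m" by simp
    have bc: "b \<in> carrier K" using b(1) PK(1) by blast
    define z where "z = s' \<oplus>\<^bsub>K\<^esub> a \<otimes>\<^bsub>K\<^esub> b [^]\<^bsub>K\<^esub> Suc n"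
    have zc: "z \<in> carrier K" unfolding z_def using s'(1) a(1) bc by simp
    have sc: "s \<in> carrier M" using s(1) pols_in_carrier[OF Ka th(1)] by blast
    have iz: "\<iota> z = \<iota> s' \<oplus> u \<otimes> \<iota> b [^] Suc n"
      unfolding z_def a(2) using s'(1) a(1) bc h.hom_nat_pow[OF bc, of "Suc n"] by (simp del: nat_pow_Suc)
    have "c \<ominus> \<iota> z = (s \<ominus> \<iota> s') \<oplus> u \<otimes> (\<theta> [^] Suc n \<ominus> \<iota> b [^] Suc n)"
    proof -
      define T B where "T = \<theta> [^] Suc n" and "B = \<iota> b [^] Suc n"
      have "T \<in> carrier M" "B \<in> carrier M" "u \<in> carrier M" "\<iota> s' \<in> carrier M" unfolding T_def B_def using th(1) bc a s'(1) by auto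
      then show ?thesis unfolding s(3) iz T_def[symmetric] B_def[symmetric] using sc by algebra
    qed
    then have "c \<ominus> \<iota> z \<in> fid M Q m" using additive_subgroup.a_closed[OF f s'(2) d] by simp
    then show ?case using zc by blast
  qed
  then show ?thesis using assms gen by blast
qed

text \<open>By density every residue class at Q contains an element of K, which lies in P by
  \<open>over_iff\<close>; congruence at Q and at P agree by \<open>fid1_iff\<close>.\<close>

lemma norm_eq: "place_norm M Q = place_norm K P"
proof -
  note f1 = K.fid_additive_subgroup[OF P, of 1] and g1 = fid_additive_subgroup[OF Q, of 1]
  have "cosets (fid M Q 0) (fid M Q 1) = (\<lambda>x. fid M Q 1 +> \<iota> x) ` P" unfolding cosets_def fid_0[OF Q]
  proof
    show "(\<lambda>x. fid M Q 1 +> \<iota> x) ` P \<subseteq> (\<lambda>a. fid M Q 1 +> a) ` Q" using PQ by blast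
    show "(\<lambda>a. fid M Q 1 +> a) ` Q \<subseteq> (\<lambda>x. fid M Q 1 +> \<iota> x) ` P"
    proof
      fix y assume "y \<in> (\<lambda>a. fid M Q 1 +> a) ` Q"
      then obtain c where c: "c \<in> Q" "y = fid M Q 1 +> c" by blast
      have cc: "c \<in> carrier M" using c(1) QK(1) by blast
      obtain c' where c': "c' \<in> carrier K" "c \<ominus> \<iota> c' \<in> fid M Q 1" using dense[OF cc] by blast
      have ic: "\<iota> c' \<in> carrier M" using c'(1) by simp
      have "c \<ominus> \<iota> c' \<in> Q" using c'(2) fid_antimono[of 0 1 Q] fid_0[OF Q] by auto
      then have "c \<ominus> (c \<ominus> \<iota> c') \<in> Q" using additive_subgroup_minus[OF subring_additive_subgroup[OF place_subring[OF Q]] c(1)] by blast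
      moreover have "c \<ominus> (c \<ominus> \<iota> c') = \<iota> c'" using cc ic by algebra
      ultimately have "c' \<in> P" using over_iff[OF c'(1)] by simp
      moreover have "y = fid M Q 1 +> \<iota> c'" unfolding c(2) using coset_eq_iff[OF g1 cc ic] c'(2) by blast
      ultimately show "y \<in> (\<lambda>x. fid M Q 1 +> \<iota> x) ` P" by blast
    qed
  qed
  moreover have "card ((\<lambda>x. fid M Q 1 +> \<iota> x) ` P) = card ((\<lambda>x. fid K P 1 +>\<^bsub>K\<^esub> x) ` P)"
  proof (rule card_image_same_kernel)
    fix a b assume ab: "a \<in> P" "b \<in> P"
    have c: "a \<in> carrier K" "b \<in> carrier K" using ab PK(1) by auto
    have ic: "\<iota> a \<in> carrier M" "\<iota> b \<in> carrier M" using c by auto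
    have "a \<ominus>\<^bsub>K\<^esub> b \<in> P"
      using K.additive_subgroup_minus[OF K.subring_additive_subgroup[OF K.place_subring[OF P]] ab] .
    from fid1_iff[OF this] show "fid M Q 1 +> \<iota> a = fid M Q 1 +> \<iota> b \<longleftrightarrow> fid K P 1 +>\<^bsub>K\<^esub> a = fid K P 1 +>\<^bsub>K\<^esub> b"
      unfolding coset_eq_iff[OF g1 ic] K.coset_eq_iff[OF f1 c] hminus[OF c] .
  qed
  ultimately show ?thesis unfolding place_norm_cosets[OF Q] K.place_norm_cosets[OF P] K.cosets_def K.fid_0[OF P] by simp
qed

end

text \<open>Modulo \<open>t\<close> the residue \<open>\<delta> = \<theta> - b\<close> satisfies \<open>\<delta> (1 - \<delta> c) = 0\<close> with neither factor a unit; each factor yields a place.\<close>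

lemma two_places:
  "\<exists>Q1\<in>PD. \<exists>Q2\<in>PD. Q1 \<noteq> Q2 \<and> (\<forall>Q\<in>{Q1, Q2}. AP \<subseteq> Q \<and> \<iota> t \<in> place_ideal M Q)"
proof -
  have tt: "\<iota> t \<in> dilate (\<iota> t) AP" unfolding dilate_def using AR(3) tP(4) by (intro image_eqI[of _ _ \<one>]) auto
  obtain Q1 where Q1: "Q1 \<in> PD" "AP \<subseteq> Q1" "dilate (\<iota> t) AP \<subseteq> place_ideal M Q1"
    using place_over_pair[OF tA_pair tt tP(5)] by blast
  have t1: "\<iota> t \<in> place_ideal M Q1" using Q1(3) tt by blast
  obtain b where b: "b \<in> P" "\<theta> \<ominus> \<iota> b \<in> fid M Q1 1" using residue_approx[OF Q1(1,2) t1] by blast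
  define \<delta> where "\<delta> = \<theta> \<ominus> \<iota> b"
  obtain c where c: "c \<in> AP" "\<theta> \<ominus> \<iota> (b [^]\<^bsub>K\<^esub> place_norm K P) = (\<delta> \<otimes> \<delta>) \<otimes> c"
    using newton_step(2)[OF AP_subring(1,3,2) b(1)] unfolding \<delta>_def by blast
  obtain p where p: "p \<in> P" "b [^]\<^bsub>K\<^esub> place_norm K P \<ominus>\<^bsub>K\<^esub> b = t \<otimes>\<^bsub>K\<^esub> p" using ideal_div[OF K.residue_fermat[OF P b(1)]] by blast
  have bc: "b \<in> carrier K" "p \<in> carrier K" using b(1) p(1) PK(1) by auto
  have ibA: "\<iota> b \<in> AP" "\<iota> p \<in> AP" using b(1) p(1) AP_subring(2) by auto
  have dA: "\<delta> \<in> AP" unfolding \<delta>_def using additive_subgroup_minus[OF subring_additive_subgroup[OF AP_subring(1)] AP_subring(3) ibA(1)] .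
  have cc: "\<delta> \<in> carrier M" "c \<in> carrier M" "\<iota> p \<in> carrier M" using dA c(1) ibA(2) AR(1) by auto
  \<comment> \<open>Newton's step gives \<theta> - b^|P| = \<delta>^2 c, and Fermat's congruence
    gives b^|P| - b = t p; add the two.\<close>
  have de: "\<delta> = (\<delta> \<otimes> \<delta>) \<otimes> c \<oplus> \<iota> t \<otimes> \<iota> p"
  proof -
    define B where "B = \<iota> (b [^]\<^bsub>K\<^esub> place_norm K P)"
    have B: "B \<in> carrier M" "\<iota> b \<in> carrier M" unfolding B_def using bc by auto
    have "\<iota> t \<otimes> \<iota> p = B \<ominus> \<iota> b" unfolding B_def using hminus[of "b [^]\<^bsub>K\<^esub> place_norm K P" b] bc p(2) t(1) by (metis K.nat_pow_closed h.hom_mult)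
    moreover have "(\<theta> \<ominus> B) \<oplus> (B \<ominus> \<iota> b) = \<theta> \<ominus> \<iota> b" using minus_minus_cancel(2)[OF th(1) B] .
    ultimately show ?thesis using c(2) unfolding \<delta>_def[symmetric] B_def[symmetric] by simp
  qed
  define e where "e = \<one> \<ominus> \<delta> \<otimes> c"
  have eA: "e \<in> AP" unfolding e_def
    using additive_subgroup_minus[OF subring_additive_subgroup[OF AP_subring(1)] AR(3) AR(6)[OF dA c(1)]] .
  have ec: "e \<in> carrier M" using eA AR(1) by blast
  have ed: "e \<otimes> \<delta> = \<iota> t \<otimes> \<iota> p"
  proof -
    have "e \<otimes> \<delta> = \<delta> \<ominus> (\<delta> \<otimes> \<delta>) \<otimes> c" unfolding e_def using cc by algebra
    moreover have "((\<delta> \<otimes> \<delta>) \<otimes> c \<oplus> \<iota> t \<otimes> \<iota> p) \<ominus> (\<delta> \<otimes> \<delta>) \<otimes> c = \<iota> t \<otimes> \<iota> p" using cc tP(4) by algebra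
    ultimately show ?thesis using de by metis
  qed
  \<comment> \<open>The ideal generated by t and e. It is proper: if 1 were in it, multiplying by
    \<delta> and using e \<delta> = t p would put \<delta> into t \<open>AP\<close>.\<close>
  define J where "J = {\<iota> t \<otimes> a \<oplus> e \<otimes> a' |a a'. a \<in> AP \<and> a' \<in> AP}"
  have inJ: "\<iota> t \<otimes> a \<oplus> e \<otimes> a' \<in> J" if "a \<in> AP" "a' \<in> AP" for a a' unfolding J_def using that by blast
  have JE: "\<exists>a\<in>AP. \<exists>a'\<in>AP. x = \<iota> t \<otimes> a \<oplus> e \<otimes> a'" if "x \<in> J" for x using that unfolding J_def by blast
  have Ac: "a \<in> carrier M" if "a \<in> AP" for a using that AR(1) by blast
  have pr: "ring_ideal_pair AP J" unfolding ring_ideal_pair_def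
  proof (intro conjI ballI AP_subring(1))
    show "additive_subgroup J M"
    proof (rule additive_subgroupI')
      show "J \<subseteq> carrier M" using JE Ac tP(4) ec by (metis a_closed m_closed subsetI)
      have "\<zero> = \<iota> t \<otimes> \<zero> \<oplus> e \<otimes> \<zero>" using tP(4) ec by simp
      then show "\<zero> \<in> J" using inJ[OF AR(2,2)] by metis
      fix x assume "x \<in> J"
      then obtain a a' where a: "a \<in> AP" "a' \<in> AP" "x = \<iota> t \<otimes> a \<oplus> e \<otimes> a'" using JE by blast
      have "\<ominus> x = \<iota> t \<otimes> (\<ominus> a) \<oplus> e \<otimes> (\<ominus> a')" unfolding a(3) using Ac[OF a(1)] Ac[OF a(2)] tP(4) ec by algebra
      then show "\<ominus> x \<in> J" using inJ[OF AR(5)[OF a(1)] AR(5)[OF a(2)]] by simp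
      fix y assume "y \<in> J"
      then obtain d d' where d: "d \<in> AP" "d' \<in> AP" "y = \<iota> t \<otimes> d \<oplus> e \<otimes> d'" using JE by blast
      have "x \<oplus> y = \<iota> t \<otimes> (a \<oplus> d) \<oplus> e \<otimes> (a' \<oplus> d')" unfolding a(3) d(3)
        using Ac[OF a(1)] Ac[OF a(2)] Ac[OF d(1)] Ac[OF d(2)] tP(4) ec by algebra
      then show "x \<oplus> y \<in> J" using inJ[OF AR(7)[OF a(1) d(1)] AR(7)[OF a(2) d(2)]] by simp
    qed
    show "J \<subseteq> AP"
    proof
      fix x assume "x \<in> J"
      then obtain a a' where a: "a \<in> AP" "a' \<in> AP" "x = \<iota> t \<otimes> a \<oplus> e \<otimes> a'" using JE by blast
      then show "x \<in> AP" using AR(7)[OF AR(6)[OF tP(6) a(1)] AR(6)[OF eA a(2)]] by simp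
    qed
    show "u \<otimes> x \<in> J" if u: "u \<in> AP" and x: "x \<in> J" for u x
    proof -
      obtain a a' where a: "a \<in> AP" "a' \<in> AP" "x = \<iota> t \<otimes> a \<oplus> e \<otimes> a'" using JE[OF x] by blast
      have "u \<otimes> x = \<iota> t \<otimes> (u \<otimes> a) \<oplus> e \<otimes> (u \<otimes> a')" unfolding a(3) using Ac[OF a(1)] Ac[OF a(2)] Ac[OF u] tP(4) ec by algebra
      then show ?thesis using inJ[OF AR(6)[OF u a(1)] AR(6)[OF u a(2)]] by simp
    qed
    show "\<one> \<notin> J"
    proof
      assume "\<one> \<in> J"
      then obtain a a' where a: "a \<in> AP" "a' \<in> AP" "\<one> = \<iota> t \<otimes> a \<oplus> e \<otimes> a'" using JE by blast
      note ac = Ac[OF a(1)] Ac[OF a(2)]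
      have "\<delta> = (\<iota> t \<otimes> a \<oplus> e \<otimes> a') \<otimes> \<delta>" using a(3) cc(1) l_one by metis
      also have "\<dots> = \<iota> t \<otimes> (a \<otimes> \<delta>) \<oplus> (e \<otimes> \<delta>) \<otimes> a'" using ac cc(1) tP(4) ec by algebra
      also have "\<dots> = \<iota> t \<otimes> (a \<otimes> \<delta> \<oplus> \<iota> p \<otimes> a')" unfolding ed using ac cc tP(4) by algebra
      finally have "\<delta> \<in> dilate (\<iota> t) AP"
        unfolding dilate_def using AR(7)[OF AR(6)[OF a(1) dA] AR(6)[OF ibA(2) a(2)]] by blast
      then show False using residue_not_tA[OF b(1)] unfolding \<delta>_def by blast
    qed
  qed
  have "\<iota> t = \<iota> t \<otimes> \<one> \<oplus> e \<otimes> \<zero>" using tP(4) ec by simp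
  then have tJ: "\<iota> t \<in> J" using inJ[OF AR(3,2)] by metis
  have "e = \<iota> t \<otimes> \<zero> \<oplus> e \<otimes> \<one>" using tP(4) ec by simp
  then have eJ: "e \<in> J" using inJ[OF AR(2,3)] by metis
  obtain Q2 where Q2: "Q2 \<in> PD" "AP \<subseteq> Q2" "J \<subseteq> place_ideal M Q2" using place_over_pair[OF pr tJ tP(5)] by blast
  have t2: "\<iota> t \<in> place_ideal M Q2" using Q2(3) tJ by blast
  \<comment> \<open>e + c \<delta> = 1 with e in the maximal ideal, so \<delta> is a unit at Q2,
    whereas it vanishes at Q1.\<close>
  have "\<delta> \<notin> place_ideal M Q2"
  proof
    assume "\<delta> \<in> place_ideal M Q2"
    then have "c \<otimes> \<delta> \<in> place_ideal M Q2" using place_ideal_props(3)[OF Q2(1)] c(1) Q2(2) by blast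
    moreover have "e \<in> place_ideal M Q2" using eJ Q2(3) by blast
    ultimately have "e \<oplus> c \<otimes> \<delta> \<in> place_ideal M Q2" using additive_subgroup.a_closed[OF place_ideal_props(1)[OF Q2(1)]] by blast
    moreover have "e \<oplus> c \<otimes> \<delta> = \<one>" unfolding e_def using cc by algebra
    moreover have "inv \<one> = \<one>" by simp
    ultimately show False unfolding place_ideal_iff[OF Q2(1)] by simp
  qed
  moreover have "\<delta> \<in> place_ideal M Q1" using b(2) unfolding \<delta>_def fid_1[OF Q1(1)] .
  ultimately have "Q1 \<noteq> Q2" by (metis (no_types))
  then show ?thesis using Q1(1,2) Q2(1,2) t1 t2 by (intro bexI[of _ Q1] bexI[of _ Q2]) simp_all
qed

lemma doubled_place:
  "\<exists>Q1\<in>PD. \<exists>Q2\<in>PD. Q1 \<noteq> Q2 \<and> (\<forall>Q\<in>{Q1, Q2}. place_norm M Q = place_norm K P \<and> P = {x \<in> carrier K. \<iota> x \<in> Q})"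
proof -
  obtain Q1 Q2 where Q: "Q1 \<in> PD" "Q2 \<in> PD" "Q1 \<noteq> Q2" "\<forall>Q\<in>{Q1, Q2}. AP \<subseteq> Q \<and> \<iota> t \<in> place_ideal M Q"
    using two_places by (elim bexE conjE) (rule that)
  have "place_norm M Q = place_norm K P \<and> P = {x \<in> carrier K. \<iota> x \<in> Q}"
    if q: "Q \<in> PD" "AP \<subseteq> Q" "\<iota> t \<in> place_ideal M Q" for Q
  proof
    show "place_norm M Q = place_norm K P" using norm_eq[OF q] .
    show "P = {x \<in> carrier K. \<iota> x \<in> Q}" using over_iff[OF q] PK(1) by (intro Set.set_eqI) auto
  qed
  then show ?thesis using Q by (intro bexI[of _ Q1] bexI[of _ Q2]) simp_all
qed

end

text \<open>The place below Q is recovered as the preimage U(Q). So both choices of a place above P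
  are injective, and a common value would be one place chosen in both ways over the same P, which
  was excluded.\<close>

lemma inconsistent: False
proof -
  define U where "U Q = {x \<in> carrier K. \<iota> x \<in> Q}" for Q
  let ?R = "\<lambda>P Q. place_norm M Q = place_norm K P \<and> P = U Q"
  have "\<forall>P\<in>prime_divisors K. \<exists>S. fst S \<in> PD \<and> snd S \<in> PD \<and> fst S \<noteq> snd S \<and> ?R P (fst S) \<and> ?R P (snd S)"
  proof
    fix P assume P: "P \<in> prime_divisors K"
    obtain t where t: "t \<in> carrier K" "t \<noteq> \<zero>\<^bsub>K\<^esub>" "place_ord K P t = 1" by (rule K.uniformizer_ord[OF P])
    have dp: "\<exists>Q1\<in>PD. \<exists>Q2\<in>PD. Q1 \<noteq> Q2 \<and> (\<forall>Q\<in>{Q1, Q2}. ?R P Q)" unfolding U_def by (rule doubled_place[OF P t])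
    obtain Q1 Q2 where Q: "Q1 \<in> PD" "Q2 \<in> PD" "Q1 \<noteq> Q2" "\<forall>Q\<in>{Q1, Q2}. ?R P Q"
      using dp by (elim bexE conjE) (rule that)
    have R: "?R P Q1" "?R P Q2" using bspec[OF Q(4), of Q1] bspec[OF Q(4), of Q2] by blast+
    show "\<exists>S. fst S \<in> PD \<and> snd S \<in> PD \<and> fst S \<noteq> snd S \<and> ?R P (fst S) \<and> ?R P (snd S)"
      by (rule exI[of _ "(Q1, Q2)"], unfold fst_conv snd_conv, rule conjI[OF Q(1) conjI[OF Q(2) conjI[OF Q(3) conjI[OF R]]]])
  qed
  then obtain S where S: "\<forall>P\<in>prime_divisors K. fst (S P) \<in> PD \<and> snd (S P) \<in> PD \<and> fst (S P) \<noteq> snd (S P) \<and> ?R P (fst (S P)) \<and> ?R P (snd (S P))"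
    by (rule bchoice[THEN exE])
  have S': "fst (S P) \<in> PD" "snd (S P) \<in> PD" "fst (S P) \<noteq> snd (S P)" "place_norm M (fst (S P)) = place_norm K P"
    "U (fst (S P)) = P" "place_norm M (snd (S P)) = place_norm K P" "U (snd (S P)) = P"
    if P: "P \<in> prime_divisors K" for P using bspec[OF S P] by simp_all
  show False
  proof (rule doubled_places_degree[OF K.ffield_axioms ffield_axioms, of "\<lambda>P. fst (S P)" "\<lambda>P. snd (S P)"])
    show "(\<lambda>P. fst (S P)) ` prime_divisors K \<subseteq> PD" by (rule image_subsetI) (rule S')
    show "(\<lambda>P. snd (S P)) ` prime_divisors K \<subseteq> PD" by (rule image_subsetI) (rule S')
    show "inj_on (\<lambda>P. fst (S P)) (prime_divisors K)" by (rule inj_on_inverseI[of _ U]) (rule S')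
    show "inj_on (\<lambda>P. snd (S P)) (prime_divisors K)" by (rule inj_on_inverseI[of _ U]) (rule S')
    show "(\<lambda>P. fst (S P)) ` prime_divisors K \<inter> (\<lambda>P. snd (S P)) ` prime_divisors K = {}"
    proof (rule equals0I)
      fix Q assume "Q \<in> (\<lambda>P. fst (S P)) ` prime_divisors K \<inter> (\<lambda>P. snd (S P)) ` prime_divisors K"
      then obtain P P' where PP: "P \<in> prime_divisors K" "P' \<in> prime_divisors K" "fst (S P) = snd (S P')"
        by (elim IntE imageE) (metis (no_types))
      have "P = P'" by (rule trans[OF S'(5)[OF PP(1), symmetric] trans[OF arg_cong[OF PP(3), of U] S'(7)[OF PP(2)]]])
      then show False using PP(3) S'(3)[OF PP(1)] by simp
    qed
  qed (rule S', assumption)+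
qed

end

section \<open>Divisors of every degree\<close>

lemma (in field) pols_consistent:
  assumes "subring A R" shows "ring.pols (R\<lparr>carrier := A\<rparr>) S z n = pols S z n"
proof -
  interpret A: ring "R\<lparr>carrier := A\<rparr>" by (rule subring_is_ring[OF assms])
  show ?thesis by (induction n) (simp_all only: A.pols.simps pols.simps, simp)
qed

lemma (in field) pols_eq_simple_extension:
  assumes S: "subring S R" and z: "z \<in> carrier R" shows "(\<Union>n. pols S z n) = simple_extension S z"
proof
  note Sr = subringE[OF S] and Sa = subring_additive_subgroup[OF S]
  have "pols S z n \<subseteq> simple_extension S z" for n
  proof (induction n)
    case 0 then show ?case using simple_extension_incl[OF Sr(1) z] by simp
  next
    case (Suc n)
    show ?case
    proof
      fix x assume "x \<in> pols S z (Suc n)"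
      then obtain a b where ab: "a \<in> S" "b \<in> pols S z n" "x = a \<oplus> z \<otimes> b" by auto
      have "a \<in> carrier R" "b \<in> carrier R" using ab Sr(1) pols_in_carrier[OF Sa z] by auto
      then have "x = b \<otimes> z \<oplus> a" unfolding ab(3) using z by (simp add: m_comm a_comm)
      then show "x \<in> simple_extension S z" using simple_extension.lin[of b S z a] ab Suc by blast
    qed
  qed
  then show "(\<Union>n. pols S z n) \<subseteq> simple_extension S z" by blast
  have "\<exists>n. x \<in> pols S z n" if "x \<in> simple_extension S z" for x using that
  proof (induction rule: simple_extension.induct)
    case zero then show ?case using Sr(2) by (intro exI[of _ 0]) simp
  next
    case (lin b a)
    then obtain n where n: "b \<in> pols S z n" by blast
    have "a \<in> carrier R" "b \<in> carrier R" using lin(2) n Sr(1) pols_in_carrier[OF Sa z] by auto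
    then have "b \<otimes> z \<oplus> a = a \<oplus> z \<otimes> b" using z by (simp add: m_comm a_comm)
    then have "b \<otimes> z \<oplus> a \<in> pols S z (Suc n)" using lin(2) n by auto
    then show ?case by blast
  qed
  then show "simple_extension S z \<subseteq> (\<Union>n. pols S z n)" by blast
qed

text \<open>L is a large field that contains both K and \<theta>; the extension M is cut out of it
  as K[\<theta>]. The exponent N limits the number of coefficients needed to write its
  elements.\<close>

locale adjunction = field L + K: ffield K k q B C
  for L (structure) and K :: "('a, 'b) ring_scheme" and k q B C +
  fixes \<iota> \<theta> and N :: nat
  assumes hom: "\<iota> \<in> ring_hom K L" and th: "\<theta> \<in> carrier L" and N: "0 < N" "\<theta> [^] N = \<one>"
    and alg: "(algebraic over (\<iota> ` carrier K)) \<theta>"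
begin

sublocale h: ring_hom_ring K L \<iota>
  using ring_hom_ringI2[OF K.ring_axioms ring_axioms hom] .

lemma inj: assumes "x \<in> carrier K" "y \<in> carrier K" "\<iota> x = \<iota> y" shows "x = y"
  using inj_onD[OF non_trivial_field_hom_is_inj[OF hom K.field_axioms field_axioms] assms(3,1,2)] .

abbreviation KK where "KK \<equiv> \<iota> ` carrier K"

lemma KK_subfield: "subfield KK L"
  using h.img_is_subfield(2)[OF K.carrier_is_subfield] one_not_zero by blast

lemmas KK_subring = subfieldE(1)[OF KK_subfield]

definition A where "A = (\<Union>n. pols KK \<theta> n)"

lemma A_subfield: "subfield A L"
  unfolding A_def pols_eq_simple_extension[OF KK_subring th] using simple_extension_is_subfield[OF KK_subfield th] alg by blast

lemma KK_A: "KK \<subseteq> A" "\<theta> \<in> A" unfolding A_def using pols_subring[OF KK_subring th] by auto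

text \<open>Growth asks only for closure under addition. Since q is zero in K, the negative of an
  element is q - 1 times it.\<close>

lemma B_additive: "additive_subgroup (\<iota> ` B e) L"
proof (rule additive_subgroupI')
  note g = K.growth[unfolded growth_def]
  have Be: "B e \<subseteq> carrier K" "\<zero>\<^bsub>K\<^esub> \<in> B e" "\<And>a b. a \<in> B e \<Longrightarrow> b \<in> B e \<Longrightarrow> a \<oplus>\<^bsub>K\<^esub> b \<in> B e" using g by blast+
  show "\<iota> ` B e \<subseteq> carrier L" using Be(1) by auto
  show "\<zero> \<in> \<iota> ` B e" using Be(2) by (intro image_eqI[of _ _ "\<zero>\<^bsub>K\<^esub>"]) simp_all
  fix x assume "x \<in> \<iota> ` B e"
  then obtain a where a: "a \<in> B e" "x = \<iota> a" by blast
  have ac: "a \<in> carrier K" using a(1) Be(1) by blast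
  have pm: "add_pow K (m::nat) a \<in> B e" for m by (induction m) (use a(1) Be in auto)
  obtain r where r: "q = Suc r" using K.q_ge_2 by (cases q) auto
  have "add_pow K q a = \<zero>\<^bsub>K\<^esub>" using K.add_pow_ldistr[of "\<one>\<^bsub>K\<^esub>" a q] ac K.char_q by simp
  then have "add_pow K r a \<oplus>\<^bsub>K\<^esub> a = \<zero>\<^bsub>K\<^esub>" unfolding r by simp
  then have "\<ominus>\<^bsub>K\<^esub> a = add_pow K r a" using ac by (intro K.minus_equality) auto
  then have "\<ominus>\<^bsub>K\<^esub> a \<in> B e" using pm by simp
  then show "\<ominus> x \<in> \<iota> ` B e" unfolding a(2) using ac by (intro image_eqI[of _ _ "\<ominus>\<^bsub>K\<^esub> a"]) simp_all
  fix y assume "y \<in> \<iota> ` B e"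
  then obtain b where b: "b \<in> B e" "y = \<iota> b" by blast
  have "b \<in> carrier K" using b(1) Be(1) by blast
  then show "x \<oplus> y \<in> \<iota> ` B e" unfolding a(2) b(2) using ac Be(3)[OF a(1) b(1)] by (intro image_eqI[of _ _ "a \<oplus>\<^bsub>K\<^esub> b"]) simp_all
qed

text \<open>Multiplication by \<theta> produces degree N at most, and \<theta>^N = 1 folds the top
  term back to a constant.\<close>

lemma pols_reduce:
  assumes T: "additive_subgroup T L" and x: "x \<in> pols T \<theta> (N - 1)" shows "\<theta> \<otimes> x \<in> pols T \<theta> (N - 1)"
proof -
  have "\<theta> \<otimes> x \<in> pols T \<theta> (Suc (N - 1))" by (rule pols_shift[OF T th x])
  then obtain s a where s: "s \<in> pols T \<theta> (N - 1)" "a \<in> T" "\<theta> \<otimes> x = s \<oplus> a \<otimes> \<theta> [^] Suc (N - 1)"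
    using pols_top[OF T th] by blast
  have "a \<in> carrier L" using s(2) additive_subgroup.a_subset[OF T] by blast
  then have "\<theta> \<otimes> x = s \<oplus> a" using s(3) N by (simp del: nat_pow_Suc)
  then show ?thesis
    using additive_subgroup.a_closed[OF pols_additive_subgroup[OF T th] s(1)] pols_base[OF T th] s(2) by auto
qed

text \<open>Multiplication by y involves only the finitely many coefficients of y over K, collected
  in F. The denominator c and the groups S and T are quantified inside, so that one F serves all
  levels of the filtration.\<close>

lemma pols_mult_coeffs:
  assumes "y \<in> pols KK \<theta> n"
  shows "\<exists>F. finite F \<and> F \<subseteq> carrier K \<and> (\<forall>c\<in>carrier L. \<forall>S T. additive_subgroup S L \<longrightarrow> additive_subgroup T L \<longrightarrow>
     (\<forall>f\<in>F. \<forall>s\<in>S. (c \<otimes> \<iota> f) \<otimes> s \<in> T) \<longrightarrow> (\<forall>b\<in>pols S \<theta> (N - 1). (c \<otimes> y) \<otimes> b \<in> pols T \<theta> (N - 1)))"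
  using assms
proof (induction n arbitrary: y)
  case 0
  then obtain f where f: "f \<in> carrier K" "y = \<iota> f" by auto
  have "\<forall>c\<in>carrier L. \<forall>S T. additive_subgroup S L \<longrightarrow> additive_subgroup T L \<longrightarrow>
     (\<forall>f\<in>{f}. \<forall>s\<in>S. (c \<otimes> \<iota> f) \<otimes> s \<in> T) \<longrightarrow> (\<forall>b\<in>pols S \<theta> (N - 1). (c \<otimes> y) \<otimes> b \<in> pols T \<theta> (N - 1))"
  proof (intro ballI allI impI)
    fix c S T b assume a: "c \<in> carrier L" "additive_subgroup S L" "additive_subgroup T L"
      "\<forall>f\<in>{f}. \<forall>s\<in>S. (c \<otimes> \<iota> f) \<otimes> s \<in> T" "b \<in> pols S \<theta> (N - 1)"
    show "(c \<otimes> y) \<otimes> b \<in> pols T \<theta> (N - 1)"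
      by (rule pols_smult[OF a(2) th _ _ a(5)]) (use a(1,4) f in auto)
  qed
  then show ?case using f(1) by (intro exI[of _ "{f}"]) simp
next
  case (Suc n)
  then obtain a y' where y: "a \<in> carrier K" "y' \<in> pols KK \<theta> n" "y = \<iota> a \<oplus> \<theta> \<otimes> y'" by auto
  obtain F where F: "finite F" "F \<subseteq> carrier K" "\<forall>c\<in>carrier L. \<forall>S T. additive_subgroup S L \<longrightarrow> additive_subgroup T L \<longrightarrow>
     (\<forall>f\<in>F. \<forall>s\<in>S. (c \<otimes> \<iota> f) \<otimes> s \<in> T) \<longrightarrow> (\<forall>b\<in>pols S \<theta> (N - 1). (c \<otimes> y') \<otimes> b \<in> pols T \<theta> (N - 1))"
    using Suc.IH[OF y(2)] by blast
  have yc: "y' \<in> carrier L" "\<iota> a \<in> carrier L" using y pols_in_carrier[OF subring_additive_subgroup[OF KK_subring] th] by auto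
  have "\<forall>c\<in>carrier L. \<forall>S T. additive_subgroup S L \<longrightarrow> additive_subgroup T L \<longrightarrow>
     (\<forall>f\<in>insert a F. \<forall>s\<in>S. (c \<otimes> \<iota> f) \<otimes> s \<in> T) \<longrightarrow> (\<forall>b\<in>pols S \<theta> (N - 1). (c \<otimes> y) \<otimes> b \<in> pols T \<theta> (N - 1))"
  proof (intro ballI allI impI)
    fix c S T b assume g: "c \<in> carrier L" "additive_subgroup S L" "additive_subgroup T L"
      "\<forall>f\<in>insert a F. \<forall>s\<in>S. (c \<otimes> \<iota> f) \<otimes> s \<in> T" "b \<in> pols S \<theta> (N - 1)"
    have bc: "b \<in> carrier L" using pols_in_carrier[OF g(2) th] g(5) by blast
    have 1: "(c \<otimes> \<iota> a) \<otimes> b \<in> pols T \<theta> (N - 1)"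
      by (rule pols_smult[OF g(2) th _ _ g(5)]) (use g(1,4) yc in auto)
    have "\<forall>f\<in>F. \<forall>s\<in>S. (c \<otimes> \<iota> f) \<otimes> s \<in> T" using g(4) by simp
    then have "(c \<otimes> y') \<otimes> b \<in> pols T \<theta> (N - 1)" using F(3) g(1,2,3,5) by simp
    from pols_reduce[OF g(3) this] have 2: "\<theta> \<otimes> ((c \<otimes> y') \<otimes> b) \<in> pols T \<theta> (N - 1)" .
    have "(c \<otimes> y) \<otimes> b = (c \<otimes> \<iota> a) \<otimes> b \<oplus> \<theta> \<otimes> ((c \<otimes> y') \<otimes> b)"
      unfolding y(3) using g(1) yc bc th by algebra
    then show "(c \<otimes> y) \<otimes> b \<in> pols T \<theta> (N - 1)"
      using additive_subgroup.a_closed[OF pols_additive_subgroup[OF g(3) th] 1 2] by simp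
  qed
  then show ?case using F(1,2) y(1) by (intro exI[of _ "insert a F"]) simp
qed

abbreviation M where "M \<equiv> L\<lparr>carrier := A\<rparr>"

text \<open>Level e holds the polynomials in \<theta> of degree below N with coefficients in
  \<open>B e\<close>, whence the base C ^ N. For a finite set Y the growth condition of K is applied
  to all coefficients occurring in Y together.\<close>

lemma M_growth: "growth M (\<lambda>e. pols (\<iota> ` B e) \<theta> (N - 1)) (C ^ N)"
  unfolding growth_def
proof (intro conjI allI impI ballI)
  note g = K.growth[unfolded growth_def]
  have Be: "finite (B e)" "B e \<subseteq> carrier K" "card (B e) \<le> C ^ Suc e" "\<one>\<^bsub>K\<^esub> \<in> B 0" for e
    using spec[OF conjunct1[OF g], of e] conjunct1[OF conjunct2[OF g]] by simp_all
  fix e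
  show "finite (pols (\<iota> ` B e) \<theta> (N - 1))" using finite_pols_card(1) Be(1) by simp
  show "pols (\<iota> ` B e) \<theta> (N - 1) \<subseteq> carrier M"
  proof -
    have "pols (\<iota> ` B e) \<theta> n \<subseteq> pols KK \<theta> n" for n
      by (induction n) (use Be(2) in \<open>force+\<close>)
    then show ?thesis unfolding A_def by auto
  qed
  have "card (pols (\<iota> ` B e) \<theta> (N - 1)) \<le> card (\<iota> ` B e) ^ Suc (N - 1)" using finite_pols_card(2) Be(1) by blast
  also have "\<dots> \<le> (C ^ Suc e) ^ Suc (N - 1)" using card_image_le[OF Be(1), of \<iota> e] Be(3)[of e] by (intro power_mono) auto
  also have "\<dots> = (C ^ N) ^ Suc e" using N(1) by (simp add: power_mult[symmetric] mult.commute del: power_Suc)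
  finally show "card (pols (\<iota> ` B e) \<theta> (N - 1)) \<le> (C ^ N) ^ Suc e" .
  note pa = pols_additive_subgroup[OF B_additive th]
  show "\<zero>\<^bsub>M\<^esub> \<in> pols (\<iota> ` B e) \<theta> (N - 1)" using additive_subgroup.zero_closed[OF pa] by simp
  have "\<one> \<in> \<iota> ` B 0" using Be(4) by (intro image_eqI[of _ _ "\<one>\<^bsub>K\<^esub>"]) simp_all
  then show "\<one>\<^bsub>M\<^esub> \<in> pols (\<iota> ` B 0) \<theta> (N - 1)" using pols_base[OF B_additive th] by auto
  show "a \<oplus>\<^bsub>M\<^esub> b \<in> pols (\<iota> ` B e) \<theta> (N - 1)" if "a \<in> pols (\<iota> ` B e) \<theta> (N - 1)" "b \<in> pols (\<iota> ` B e) \<theta> (N - 1)" for a b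
    using additive_subgroup.a_closed[OF pa that] by simp
  fix Y assume Y: "finite Y" "Y \<subseteq> carrier M"
  let ?P = "\<lambda>y F. finite F \<and> F \<subseteq> carrier K \<and> (\<forall>c\<in>carrier L. \<forall>S T. additive_subgroup S L \<longrightarrow> additive_subgroup T L \<longrightarrow>
     (\<forall>f\<in>F. \<forall>s\<in>S. (c \<otimes> \<iota> f) \<otimes> s \<in> T) \<longrightarrow> (\<forall>b\<in>pols S \<theta> (N - 1). (c \<otimes> y) \<otimes> b \<in> pols T \<theta> (N - 1)))"
  have "\<forall>y\<in>Y. \<exists>F. ?P y F"
  proof
    fix y assume "y \<in> Y"
    then obtain n where "y \<in> pols KK \<theta> n" using Y(2) unfolding A_def by auto
    then show "\<exists>F. ?P y F" by (rule pols_mult_coeffs)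
  qed
  then obtain F where F: "\<forall>y\<in>Y. ?P y (F y)" by (rule bchoice[THEN exE])
  have FY: "finite (\<Union>y\<in>Y. F y)" "(\<Union>y\<in>Y. F y) \<subseteq> carrier K" using F Y(1) by auto
  have "\<exists>c\<in>carrier K - {\<zero>\<^bsub>K\<^esub>}. \<exists>d. \<forall>y\<in>(\<Union>y\<in>Y. F y). \<forall>m. \<forall>b\<in>B m. (c \<otimes>\<^bsub>K\<^esub> y) \<otimes>\<^bsub>K\<^esub> b \<in> B (m + d)"
    using mp[OF mp[OF spec[OF conjunct2[OF conjunct2[OF conjunct2[OF g]]]] FY(1)] FY(2)] .
  then obtain c d where c: "c \<in> carrier K" "c \<noteq> \<zero>\<^bsub>K\<^esub>" "\<forall>y\<in>(\<Union>y\<in>Y. F y). \<forall>m. \<forall>b\<in>B m. (c \<otimes>\<^bsub>K\<^esub> y) \<otimes>\<^bsub>K\<^esub> b \<in> B (m + d)"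
    by blast
  have cL: "\<iota> c \<in> carrier L" using c(1) by simp
  have "\<forall>y\<in>Y. \<forall>m. \<forall>b\<in>pols (\<iota> ` B m) \<theta> (N - 1). (\<iota> c \<otimes> y) \<otimes> b \<in> pols (\<iota> ` B (m + d)) \<theta> (N - 1)"
  proof (intro ballI allI)
    fix y m b assume y: "y \<in> Y" and b: "b \<in> pols (\<iota> ` B m) \<theta> (N - 1)"
    have "(\<iota> c \<otimes> \<iota> f) \<otimes> s \<in> \<iota> ` B (m + d)" if f: "f \<in> F y" and s: "s \<in> \<iota> ` B m" for f s
    proof -
      obtain u where u: "u \<in> B m" "s = \<iota> u" using s by blast
      have m: "(c \<otimes>\<^bsub>K\<^esub> f) \<otimes>\<^bsub>K\<^esub> u \<in> B (m + d)" using c(3) y f u(1) by blast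
      have fc: "f \<in> carrier K" "u \<in> carrier K" using f y FY(2) u(1) Be(2) by blast+
      have "(\<iota> c \<otimes> \<iota> f) \<otimes> s = \<iota> ((c \<otimes>\<^bsub>K\<^esub> f) \<otimes>\<^bsub>K\<^esub> u)" unfolding u(2) using c(1) fc by simp
      then show ?thesis using m by blast
    qed
    moreover have "?P y (F y)" using F y by blast
    ultimately show "(\<iota> c \<otimes> y) \<otimes> b \<in> pols (\<iota> ` B (m + d)) \<theta> (N - 1)"
      using cL B_additive b by (metis (no_types, lifting))
  qed
  moreover have "\<iota> c \<in> A" "\<iota> c \<noteq> \<zero>"
  proof -
    show "\<iota> c \<in> A" using KK_A(1) c(1) by blast
    show "\<iota> c \<noteq> \<zero>" using inj[OF c(1) K.zero_closed] c(2) h.hom_zero by metis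
  qed
  ultimately show "\<exists>c\<in>carrier M - {\<zero>\<^bsub>M\<^esub>}. \<exists>d. \<forall>y\<in>Y. \<forall>m. \<forall>b\<in>pols (\<iota> ` B m) \<theta> (N - 1).
      (c \<otimes>\<^bsub>M\<^esub> y) \<otimes>\<^bsub>M\<^esub> b \<in> pols (\<iota> ` B (m + d)) \<theta> (N - 1)"
    by (intro bexI[of _ "\<iota> c"] exI[of _ d]) simp_all
qed

lemma M_field: "field M" by (rule subfield_iff(2)[OF A_subfield])

lemma hom_M: "\<iota> \<in> ring_hom K M"
  by (rule ring_hom_memI) (use KK_A(1) in auto)

lemma M_pow: "x [^]\<^bsub>M\<^esub> (n::nat) = x [^] n" by (induction n) auto

lemma M_ffield: "ffield M (constant_field M) (card (constant_field M)) (\<lambda>e. pols (\<iota> ` B e) \<theta> (N - 1)) (C ^ N)"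
proof -
  interpret M: field M by (rule M_field)
  have hM: "ring_hom_ring K M \<iota>" by (rule ring_hom_ringI2[OF K.ring_axioms M.ring_axioms hom_M])
  have sf: "subfield (\<iota> ` k) M"
    using ring_hom_ring.img_is_subfield(2)[OF hM K.k_subfield] M.one_not_zero by blast
  have "prime_subfield M \<subseteq> \<iota> ` k" unfolding prime_subfield_def
    by (rule M.generate_field_min_subfield1[OF _ sf]) auto
  then have fin: "finite (prime_subfield M)" using K.k_finite finite_subset by blast
  obtain y where y: "y \<in> carrier K" "y \<notin> k" using K.nonconst by blast
  have "\<not> M.torsion (\<iota> y)"
  proof
    assume t: "M.torsion (\<iota> y)"
    have "y = \<zero>\<^bsub>K\<^esub>" if "\<iota> y = \<zero>" using inj[OF y(1) K.zero_closed] that h.hom_zero by metis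
    moreover have "y [^]\<^bsub>K\<^esub> m = \<one>\<^bsub>K\<^esub>" if "\<iota> y [^] m = \<one>" for m :: nat
      using inj[of "y [^]\<^bsub>K\<^esub> m" "\<one>\<^bsub>K\<^esub>"] that y(1) h.hom_nat_pow[OF y(1)] by simp
    ultimately show False using t y K.k_torsion[of y] unfolding M.torsion_def M_pow by (simp, blast)
  qed
  moreover have "\<iota> y \<in> carrier M" using y(1) KK_A(1) by auto
  ultimately show ?thesis using M.ffieldI[OF fin M_growth] by blast
qed

lemma M_const_ext:
  assumes "\<theta> \<notin> KK" "\<And>P. P \<in> prime_divisors K \<Longrightarrow> \<theta> [^] place_norm K P = \<theta>" shows False
proof -
  have gen: "carrier M = (\<Union>n. ring.pols M KK \<theta> n)"
    unfolding pols_consistent[OF subfieldE(1)[OF A_subfield]] by (simp add: A_def)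
  have "const_ext_axioms M K \<iota> \<theta> N"
    unfolding const_ext_axioms_def M_pow using hom_M KK_A(2) assms N gen by simp
  then have "const_ext M (constant_field M) (card (constant_field M)) (\<lambda>e. pols (\<iota> ` B e) \<theta> (N - 1)) (C ^ N) K k q B C \<iota> \<theta> N"
    using const_ext.intro[OF M_ffield K.ffield_axioms] by blast
  then show False by (rule const_ext.inconsistent)
qed

end

text \<open>The coefficients of \<open>1 + X ^ (m + 1) + \<dots> + X ^ (j (m + 1))\<close>. For \<open>m = q - 2\<close> and \<open>j + 1 = (q ^ d - 1) / (q - 1)\<close> this is
  \<open>(X ^ (q ^ d - 1) - 1) / (X ^ (q - 1) - 1)\<close>, which has no root in the constant field.\<close>

fun (in ring) gpol :: "nat \<Rightarrow> nat \<Rightarrow> 'a list" where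
  "gpol m 0 = [\<one>]"
| "gpol m (Suc j) = gpol m j @ (replicate m \<zero> @ [\<one>])"

lemma (in domain) gpol_props:
  shows "set (gpol m j) \<subseteq> carrier R" "gpol m j \<noteq> []" "hd (gpol m j) = \<one>" "length (gpol m j) = Suc (j * Suc m)"
proof -
  have "set (gpol m j) \<subseteq> carrier R \<and> gpol m j \<noteq> [] \<and> hd (gpol m j) = \<one> \<and> length (gpol m j) = Suc (j * Suc m)"
    by (induction j) auto
  then show "set (gpol m j) \<subseteq> carrier R" "gpol m j \<noteq> []" "hd (gpol m j) = \<one>" "length (gpol m j) = Suc (j * Suc m)" by auto
qed

lemma (in domain) gpol_eval:
  assumes a: "a \<in> carrier R"
  shows "eval (gpol m 0) a = \<one>" "eval (gpol m (Suc j)) a = eval (gpol m j) a \<otimes> a [^] Suc m \<oplus> \<one>"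
    "eval (gpol m j) a \<otimes> (a [^] Suc m \<ominus> \<one>) = (a [^] Suc m) [^] Suc j \<ominus> \<one>"
proof -
  have s: "eval (gpol m (Suc j)) a = eval (gpol m j) a \<otimes> a [^] Suc m \<oplus> \<one>" for j
  proof -
    have "eval (replicate m \<zero> @ [\<one>]) a = \<one>" using eval_replicate[of "[\<one>]" a m] a by simp
    moreover have "set (replicate m \<zero> @ [\<one>]) \<subseteq> carrier R" by auto
    ultimately show ?thesis using eval_append[OF gpol_props(1) _ a, of "replicate m \<zero> @ [\<one>]" m j] by simp
  qed
  show 0: "eval (gpol m 0) a = \<one>" using a by simp
  show "eval (gpol m (Suc j)) a = eval (gpol m j) a \<otimes> a [^] Suc m \<oplus> \<one>" by (rule s)
  define w where "w = a [^] Suc m"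
  have w: "w \<in> carrier R" unfolding w_def using a by simp
  have ec: "eval (gpol m j) a \<in> carrier R" for j using eval_in_carrier[OF gpol_props(1) a] .
  show "eval (gpol m j) a \<otimes> (a [^] Suc m \<ominus> \<one>) = (a [^] Suc m) [^] Suc j \<ominus> \<one>"
    unfolding w_def[symmetric]
  proof (induction j)
    case 0 then show ?case unfolding 0 using w by simp
  next
    case (Suc j)
    have "eval (gpol m (Suc j)) a \<otimes> (w \<ominus> \<one>) = (eval (gpol m j) a \<otimes> (w \<ominus> \<one>)) \<otimes> w \<oplus> (w \<ominus> \<one>)"
      unfolding s w_def[symmetric] using w ec[of j] by algebra
    also have "\<dots> = (w [^] Suc j \<ominus> \<one>) \<otimes> w \<oplus> (w \<ominus> \<one>)" unfolding Suc ..
    also have "\<dots> = w [^] Suc j \<otimes> w \<ominus> \<one>"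
    proof -
      define v where "v = w [^] Suc j"
      have "v \<in> carrier R" unfolding v_def using w by simp
      then show ?thesis unfolding v_def[symmetric] using w by algebra
    qed
    finally show ?case by simp
  qed
qed

lemma (in algebraically_closed) root_exists:
  assumes p: "p \<in> carrier (poly_ring L)" "1 < length p" obtains x where "x \<in> carrier L" "eval p x = \<zero>"
proof -
  have "size (roots p) = length p - 1" using roots_over_carrier[OF p(1)] unfolding splitted_def .
  then have "roots p \<noteq> {#}" using p(2) by auto
  then obtain x where "x \<in># roots p" by (meson multiset_nonemptyE)
  then show ?thesis using that roots_mem_iff_is_root[OF p(1)] unfolding is_root_def by blast
qed

lemma geometric_nat: "(\<Sum>i<d. Suc r ^ i) * r + 1 = Suc r ^ d"
  by (induction d) (auto simp: algebra_simps)

text \<open>Why the root \<theta> lies outside K: a root of unity in K belongs to \<open>k\<close>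
  and satisfies \<theta>^(q-1) = 1, so each of the n = (q^d - 1)/(q - 1) terms of the polynomial
  equals 1 and its value is n, which is 1 in K because n is 1 modulo q. Why its power with exponent
  |P| is \<theta>: the order of \<theta> divides q^d - 1, and d divides the degree of P.\<close>

theorem (in ffield) divisor_of_every_degree: "\<exists>D\<in>Div. deg D = m"
proof -
  obtain d :: nat where d: "0 < d" "\<And>D. D \<in> Div \<Longrightarrow> int d dvd deg D" "\<And>m::int. \<exists>D\<in>Div. deg D = m * int d"
    using degree_gcd by blast
  have "d = 1"
  proof (rule ccontr)
    assume "d \<noteq> 1"
    then have d2: "1 < d" using d(1) by simp
    \<comment> \<open>Writing q - 1 as \<open>Suc r\<close> also covers q = 2, where the polynomial
      is the plain sum of the powers of X below n.\<close>
    obtain r where r: "q = Suc (Suc r)" using q_ge_2 by (metis add_2_eq_Suc le_Suc_ex)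
    define n where "n = (\<Sum>i<d. q ^ i)"
    have n1: "n * Suc r + 1 = q ^ d" unfolding n_def r by (rule geometric_nat)
    obtain d' where d': "d = Suc (Suc d')" using d2 by (metis Suc_lessE less_imp_Suc_add One_nat_def add_Suc)
    have n2: "n = Suc (q * (\<Sum>i<Suc d'. q ^ i))"
      unfolding n_def d' sum.lessThan_Suc_shift[of _ "Suc d'"] sum_distrib_left by simp
    have n3: "1 < n" unfolding n2 using q_ge_2 by (auto simp: sum.lessThan_Suc)
    obtain L :: "((('a list \<times> nat) multiset) \<Rightarrow> 'a) ring" where L: "algebraic_closure L (indexed_const ` (carrier K))" "indexed_const \<in> ring_hom K L"
      by (rule exists_closure)
    define \<iota> where "\<iota> = (indexed_const :: 'a \<Rightarrow> ('a list \<times> nat) multiset \<Rightarrow> 'a)"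
    note L' = L[folded \<iota>_def]
    interpret L: algebraic_closure L "\<iota> ` carrier K" by (rule L'(1))
    let ?p = "L.gpol r (n - 1)"
    have "?p \<in> carrier (poly_ring L)"
      unfolding univ_poly_carrier[symmetric] polynomial_def using L.gpol_props[of r "n - 1"] by simp
    moreover have "1 < length ?p" unfolding L.gpol_props(4) using n3 by simp
    ultimately obtain \<theta> where th: "\<theta> \<in> carrier L" "L.eval ?p \<theta> = \<zero>\<^bsub>L\<^esub>" by (rule L.root_exists)
    define w where "w = \<theta> [^]\<^bsub>L\<^esub> Suc r"
    have wc: "w \<in> carrier L" unfolding w_def using th(1) by (rule L.nat_pow_closed)
    have Sn: "Suc (n - 1) = n" using n3 by simp
    have "w [^]\<^bsub>L\<^esub> n \<ominus>\<^bsub>L\<^esub> \<one>\<^bsub>L\<^esub> = \<zero>\<^bsub>L\<^esub>"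
      using L.gpol_eval(3)[OF th(1), of r "n - 1"] wc unfolding th(2) w_def[symmetric] Sn by simp
    then have "w [^]\<^bsub>L\<^esub> n = \<one>\<^bsub>L\<^esub>" using L.r_right_minus_eq[of "w [^]\<^bsub>L\<^esub> n" "\<one>\<^bsub>L\<^esub>"] wc by simp
    then have tN: "\<theta> [^]\<^bsub>L\<^esub> (n * Suc r) = \<one>\<^bsub>L\<^esub>" unfolding w_def using L.nat_pow_pow[OF th(1), of "Suc r" n] by (simp add: mult.commute)
    interpret E: adjunction L K k q B C \<iota> \<theta> "n * Suc r"
    proof (intro adjunction.intro adjunction_axioms.intro)
      show "0 < n * Suc r" using n3 by simp
    qed (use L.field_axioms ffield_axioms L'(2) th(1) tN L.algebraic_extension in auto)
    have frob1: "\<theta> [^]\<^bsub>L\<^esub> q ^ d = \<theta>" unfolding n1[symmetric] using tN th(1) L.nat_pow_mult[OF th(1), of "n * Suc r" 1] by simp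
    have frob2: "\<theta> [^]\<^bsub>L\<^esub> q ^ (d * i) = \<theta>" for i
    proof (induction i)
      case (Suc i)
      have "\<theta> [^]\<^bsub>L\<^esub> q ^ (d * Suc i) = (\<theta> [^]\<^bsub>L\<^esub> q ^ (d * i)) [^]\<^bsub>L\<^esub> q ^ d"
        using L.nat_pow_pow[OF th(1), of "q ^ (d * i)" "q ^ d"] by (simp add: power_add mult.commute)
      then show ?case using Suc frob1 by simp
    qed (use th(1) in simp)
    show False
    proof (rule E.M_const_ext)
      fix P assume P: "P \<in> PD"
      have "Poly_Mapping.single P 1 \<in> Div" unfolding Div_iff using P by simp
      from d(2)[OF this] have "d dvd place_degree K P" by simp
      then obtain i where "place_degree K P = d * i" by (elim dvdE)
      then show "\<theta> [^]\<^bsub>L\<^esub> place_norm K P = \<theta>" using place_norm_power(1)[OF P] frob2 by simp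
    next
      show "\<theta> \<notin> \<iota> ` carrier K"
      proof
        assume "\<theta> \<in> \<iota> ` carrier K"
        then obtain x where x: "x \<in> carrier K" "\<theta> = \<iota> x" by blast
        have "\<iota> (x [^] (n * Suc r)) = \<iota> \<one>" using tN E.h.hom_nat_pow[OF x(1)] unfolding x(2) by simp
        then have xN: "x [^] (n * Suc r) = \<one>" using E.inj x(1) by blast
        have pos: "0 < n * Suc r" using n3 by simp
        have xk: "x \<in> k" using k_torsion[of x] x(1) pos xN by blast
        interpret k: field "K\<lparr>carrier := k\<rparr>" by (rule subfield_iff(2)[OF k_subfield])
        have pw: "x [^]\<^bsub>K\<lparr>carrier := k\<rparr>\<^esub> m = x [^] m" for m :: nat by (induction m) auto
        have xq: "x [^] q = x" using finite_field_pow_card[OF k.field_axioms _ , of x] k_finite xk q unfolding pw by simp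
        have x0: "x \<noteq> \<zero>"
        proof
          assume "x = \<zero>"
          moreover obtain s where "n * Suc r = Suc s" using pos by (cases "n * Suc r") auto
          ultimately show False using xN one_not_zero by simp
        qed
        have "x [^] Suc r \<otimes> x = \<one> \<otimes> x" using xq x(1) unfolding r by simp
        then have xr: "x [^] Suc r = \<one>" using m_rcancel[OF x0 x(1) nat_pow_closed[OF x(1)] one_closed] by blast
        have w1: "\<theta> [^]\<^bsub>L\<^esub> Suc r = \<one>\<^bsub>L\<^esub>" using E.h.hom_nat_pow[OF x(1), of "Suc r"] xr unfolding x(2) by simp
        have ev: "L.eval (L.gpol r j) \<theta> = \<iota> (add_pow K (Suc j) \<one>)" for j
        proof (induction j)
          case 0 then show ?case using L.gpol_eval(1)[OF th(1)] by simp
        next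
          case (Suc j)
          have "add_pow K (Suc j) \<one> \<in> carrier K" by simp
          then show ?case unfolding L.gpol_eval(2)[OF th(1)] Suc w1 by simp
        qed
        have "\<iota> (add_pow K n \<one>) = \<iota> \<zero>" using ev[of "n - 1"] th(2) Sn by simp
        then have "add_pow K n \<one> = \<zero>" using E.inj[of "add_pow K n \<one>" \<zero>] by simp
        moreover have "add_pow K n \<one> = \<one>"
        proof -
          have "add_pow K (q * s) \<one> = \<zero>" for s :: nat
            using add.nat_pow_pow[of \<one> s q] char_q add.nat_pow_one unfolding add_pow_def by (simp add: mult.commute)
          then show ?thesis unfolding n2 by simp
        qed
        ultimately show False using one_not_zero by simp
      qed
    qed
  qed
  then show ?thesis using d(3)[of m] by simp
qed

section \<open>The asymptotic formula\<close>

lemma sum_inverse_squares_le: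
  assumes "0 < (m::nat)" shows "(\<Sum>k\<in>{m..n}. 1 / real k ^ 2) \<le> 2 / real m"
proof (cases "m \<le> n")
  case True
  then have "(\<Sum>k\<in>{m..n}. 1 / real k ^ 2) \<le> 2 / real m - 1 / real n"
  proof (induction n rule: dec_induct)
    case base
    have "1 / real m ^ 2 \<le> 1 / real m" using assms by (simp add: field_simps power2_eq_square)
    then show ?case by simp
  next
    case (step n)
    have n: "0 < real n" using step assms by simp
    have "1 / real (Suc n) ^ 2 \<le> 1 / (real n * real (Suc n))"
      using n by (intro divide_left_mono) (auto simp: power2_eq_square)
    also have "\<dots> = 1 / real n - 1 / real (Suc n)" using n by (simp add: field_simps)
    finally show ?case using step by (simp add: sum.cl_ivl_Suc)
  qed
  moreover have "0 \<le> 1 / real n" by simp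
  ultimately show ?thesis by linarith
qed simp

lemma poly_over_exp_tendsto_0:
  assumes "2 \<le> (q::nat)" shows "(\<lambda>n. real (Suc n) ^ t / real q ^ n) \<longlonglongrightarrow> 0"
proof -
  have q: "0 < ln (real q)" "0 < real q" using assms by auto
  have "filterlim (\<lambda>n. ln (real q) * real (Suc n)) at_top sequentially"
    by (rule filterlim_tendsto_pos_mult_at_top[OF tendsto_const q(1)])
       (rule filterlim_compose[OF filterlim_real_sequentially filterlim_Suc])
  from filterlim_compose[OF tendsto_power_div_exp_0[of t] this]
  have "(\<lambda>n. (ln (real q) * real (Suc n)) ^ t / exp (ln (real q) * real (Suc n))) \<longlonglongrightarrow> 0" .
  from tendsto_mult_right_zero[OF this, of "real q / ln (real q) ^ t"]
  have "(\<lambda>n. real q / ln (real q) ^ t * ((ln (real q) * real (Suc n)) ^ t / exp (ln (real q) * real (Suc n)))) \<longlonglongrightarrow> 0" .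
  moreover have "real q / ln (real q) ^ t * ((ln (real q) * real (Suc n)) ^ t / exp (ln (real q) * real (Suc n))) = real (Suc n) ^ t / real q ^ n" for n
  proof -
    have "exp (ln (real q) * real (Suc n)) = real q ^ Suc n"
      using exp_of_nat2_mult[of "ln (real q)" "Suc n"] q(2) by simp
    then show ?thesis using q by (simp only: power_mult_distrib power_Suc) simp
  qed
  ultimately show ?thesis by simp
qed

section \<open>Divisors sorted by their primes of maximal degree\<close>

context ffield begin

definition cnt :: "'a set set \<Rightarrow> nat \<Rightarrow> nat" where "cnt S j = card {P \<in> S. place_degree K P = j}"

text \<open>The quantity \<Psi>(n - j, j). For j > n truncated subtraction would count degree zero,
  which is why later sums over j < k0 carry the guard j <= n.\<close>

definition smooth :: "nat \<Rightarrow> nat \<Rightarrow> nat" where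
  "smooth n j = card {D \<in> Eff (n - j). \<forall>P\<in>Poly_Mapping.keys D. place_degree K P \<le> j}"

lemma Eff_keys:
  assumes "A \<in> Eff n" shows "P \<in> Poly_Mapping.keys A \<longleftrightarrow> 1 \<le> lkp A P" "P \<in> Poly_Mapping.keys A \<Longrightarrow> P \<in> PD \<and> place_degree K P \<le> n"
  using Eff_lkp(2,3)[OF assms, of P] by (auto simp: in_keys_iff)

lemma Eff_add_single:
  assumes P: "P \<in> PD" and D: "D \<in> Eff m"
  shows "D + Poly_Mapping.single P 1 \<in> Eff (m + place_degree K P)"
    "Poly_Mapping.keys (D + Poly_Mapping.single P 1) = insert P (Poly_Mapping.keys D)"
proof -
  have b: "D \<in> Div" "\<And>P. 0 \<le> lkp D P" "deg D = int m" using D unfolding Eff_def eff_iff by auto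
  have "0 \<le> lkp (D + Poly_Mapping.single P 1) Q" for Q using b(2)[of Q] by (simp add: lookup_add lookup_single when_def)
  then show "D + Poly_Mapping.single P 1 \<in> Eff (m + place_degree K P)"
    unfolding Eff_def eff_iff using Div_closed(2)[OF b(1) Div_closed(5)[OF P]] b(3) by (simp add: deg_add)
  show "Poly_Mapping.keys (D + Poly_Mapping.single P 1) = insert P (Poly_Mapping.keys D)"
  proof (rule Set.set_eqI)
    fix Q show "Q \<in> Poly_Mapping.keys (D + Poly_Mapping.single P 1) \<longleftrightarrow> Q \<in> insert P (Poly_Mapping.keys D)"
      using b(2)[of Q] by (auto simp: in_keys_iff lookup_add lookup_single when_def)
  qed
qed

lemma Eff_diff_single:
  assumes A: "A \<in> Eff n" and P: "P \<in> Poly_Mapping.keys A"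
  shows "A - Poly_Mapping.single P 1 \<in> Eff (n - place_degree K P)"
    "\<And>Q. Q \<noteq> P \<Longrightarrow> Q \<in> Poly_Mapping.keys (A - Poly_Mapping.single P 1) \<longleftrightarrow> Q \<in> Poly_Mapping.keys A"
proof -
  have a: "A \<in> Div" "\<And>P. 0 \<le> lkp A P" "deg A = int n" using A unfolding Eff_def eff_iff by auto
  have p: "1 \<le> lkp A P" "P \<in> PD" "place_degree K P \<le> n" using Eff_keys[OF A, of P] P by auto
  have "0 \<le> lkp (A - Poly_Mapping.single P 1) Q" for Q using a(2)[of Q] p(1) by (simp add: lookup_minus lookup_single when_def)
  then show "A - Poly_Mapping.single P 1 \<in> Eff (n - place_degree K P)"
    unfolding Eff_def eff_iff using Div_closed(4)[OF a(1) Div_closed(5)[OF p(2)]] a(3) p(3) by (simp add: deg_diff of_nat_diff)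
  show "Q \<in> Poly_Mapping.keys (A - Poly_Mapping.single P 1) \<longleftrightarrow> Q \<in> Poly_Mapping.keys A" if "Q \<noteq> P" for Q
    using that by (auto simp: in_keys_iff lookup_minus lookup_single when_def)
qed

lemma d_plus_eq_iff:
  assumes "P \<in> Poly_Mapping.keys A" "place_degree K P = j"
  shows "d_plus K A = j \<longleftrightarrow> (\<forall>Q\<in>Poly_Mapping.keys A. place_degree K Q \<le> j)"
proof -
  have nz: "A \<noteq> 0" using assms(1) by auto
  have "Max (place_degree K ` Poly_Mapping.keys A) = j \<longleftrightarrow> (\<forall>Q\<in>Poly_Mapping.keys A. place_degree K Q \<le> j)"
    using assms by (subst Max_eq_iff) auto
  then show ?thesis unfolding d_plus_def using nz by simp
qed

lemma d_plus_attained: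
  assumes "A \<in> Eff n" "0 < n" obtains P where "P \<in> Poly_Mapping.keys A" "place_degree K P = d_plus K A"
proof -
  have nz: "A \<noteq> 0" using assms unfolding Eff_def by auto
  then have "d_plus K A \<in> place_degree K ` Poly_Mapping.keys A" unfolding d_plus_def using Max_in[of "place_degree K ` Poly_Mapping.keys A"] by simp
  then show ?thesis using that by auto
qed

lemma card_with_max_prime:
  assumes P: "P \<in> PD" "place_degree K P = j" "j \<le> n"
  shows "card {A \<in> Eff n. P \<in> Poly_Mapping.keys A \<and> place_degree K P = d_plus K A} = smooth n j"
proof -
  have "bij_betw (\<lambda>D. D + Poly_Mapping.single P 1)
     {D \<in> Eff (n - j). \<forall>P\<in>Poly_Mapping.keys D. place_degree K P \<le> j}
     {A \<in> Eff n. P \<in> Poly_Mapping.keys A \<and> place_degree K P = d_plus K A}"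
  proof (rule bij_betw_byWitness[where f' = "\<lambda>A. A - Poly_Mapping.single P 1"])
    show "(\<lambda>D. D + Poly_Mapping.single P 1) ` {D \<in> Eff (n - j). \<forall>P\<in>Poly_Mapping.keys D. place_degree K P \<le> j}
       \<subseteq> {A \<in> Eff n. P \<in> Poly_Mapping.keys A \<and> place_degree K P = d_plus K A}"
    proof (rule image_subsetI)
      fix D assume D: "D \<in> {D \<in> Eff (n - j). \<forall>P\<in>Poly_Mapping.keys D. place_degree K P \<le> j}"
      then have BE: "D \<in> Eff (n - j)" by simp
      let ?A = "D + Poly_Mapping.single P 1"
      have j: "Poly_Mapping.keys ?A = insert P (Poly_Mapping.keys D)" by (rule Eff_add_single(2)[OF P(1) BE])
      have "d_plus K ?A = j" using d_plus_eq_iff[of P ?A j] P(2) D unfolding j by simp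
      then show "?A \<in> {A \<in> Eff n. P \<in> Poly_Mapping.keys A \<and> place_degree K P = d_plus K A}"
        using Eff_add_single(1)[OF P(1) BE] P(2,3) j by simp
    qed
    show "(\<lambda>A. A - Poly_Mapping.single P 1) ` {A \<in> Eff n. P \<in> Poly_Mapping.keys A \<and> place_degree K P = d_plus K A}
       \<subseteq> {D \<in> Eff (n - j). \<forall>P\<in>Poly_Mapping.keys D. place_degree K P \<le> j}"
    proof (rule image_subsetI)
      fix A assume "A \<in> {A \<in> Eff n. P \<in> Poly_Mapping.keys A \<and> place_degree K P = d_plus K A}"
      then have A: "A \<in> Eff n" "P \<in> Poly_Mapping.keys A" "place_degree K P = d_plus K A" by auto
      have le: "\<forall>Q\<in>Poly_Mapping.keys A. place_degree K Q \<le> j" using d_plus_eq_iff[OF A(2) P(2)] A(3) P(2) by simp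
      have "place_degree K Q \<le> j" if "Q \<in> Poly_Mapping.keys (A - Poly_Mapping.single P 1)" for Q
        using le that Eff_diff_single(2)[OF A(1,2), of Q] P(2) by (cases "Q = P") auto
      then show "A - Poly_Mapping.single P 1 \<in> {D \<in> Eff (n - j). \<forall>P\<in>Poly_Mapping.keys D. place_degree K P \<le> j}"
        using Eff_diff_single(1)[OF A(1,2)] P(2) by simp
    qed
  qed auto
  then show ?thesis unfolding smooth_def by (rule bij_betw_same_card[symmetric])
qed

lemma Q_count_sum:
  assumes S: "S \<subseteq> PD"
  shows "(\<Sum>A\<in>Eff n. Q_count K S A) = (\<Sum>j\<le>n. cnt S j * smooth n j)"
proof -
  let ?T = "{P \<in> S. place_degree K P \<le> n}"
  have fT: "finite ?T" by (rule finite_subset[OF _ place_degree_le_finite[of n]]) (use S in auto)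
  have "Q_count K S A = (\<Sum>P\<in>?T. if P \<in> Poly_Mapping.keys A \<and> place_degree K P = d_plus K A then 1 else 0)" if A: "A \<in> Eff n" for A
  proof -
    have "{P \<in> S. P \<in> Poly_Mapping.keys A \<and> place_degree K P = d_plus K A} = {P \<in> ?T. P \<in> Poly_Mapping.keys A \<and> place_degree K P = d_plus K A}"
      using Eff_keys(2)[OF A] by auto
    then show ?thesis unfolding Q_count_def using fT by (simp add: sum.If_cases Int_def)
  qed
  then have "(\<Sum>A\<in>Eff n. Q_count K S A) = (\<Sum>A\<in>Eff n. \<Sum>P\<in>?T. if P \<in> Poly_Mapping.keys A \<and> place_degree K P = d_plus K A then 1 else 0)" by simp
  also have "\<dots> = (\<Sum>P\<in>?T. \<Sum>A\<in>Eff n. if P \<in> Poly_Mapping.keys A \<and> place_degree K P = d_plus K A then 1 else 0)" by (rule sum.swap)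
  also have "\<dots> = (\<Sum>P\<in>?T. smooth n (place_degree K P))"
  proof (rule sum.cong[OF refl])
    fix P assume "P \<in> ?T"
    then have P: "P \<in> PD" "place_degree K P \<le> n" using S by auto
    have "(\<Sum>A\<in>Eff n. if P \<in> Poly_Mapping.keys A \<and> place_degree K P = d_plus K A then 1 else 0)
      = card {A \<in> Eff n. P \<in> Poly_Mapping.keys A \<and> place_degree K P = d_plus K A}"
      using Eff_finite[of n] by (simp add: sum.If_cases Int_def)
    then show "(\<Sum>A\<in>Eff n. if P \<in> Poly_Mapping.keys A \<and> place_degree K P = d_plus K A then 1 else 0) = smooth n (place_degree K P)"
      using card_with_max_prime[OF P(1) refl P(2)] by simp
  qed
  also have "\<dots> = (\<Sum>j\<le>n. \<Sum>P\<in>{P \<in> ?T. place_degree K P = j}. smooth n (place_degree K P))"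
    by (rule sum.group[symmetric]) (use fT in auto)
  also have "\<dots> = (\<Sum>j\<le>n. cnt S j * smooth n j)"
  proof (rule sum.cong[OF refl])
    fix j assume "j \<in> {..n}"
    then have "{P \<in> ?T. place_degree K P = j} = {P \<in> S. place_degree K P = j}" by auto
    then show "(\<Sum>P\<in>{P \<in> ?T. place_degree K P = j}. smooth n (place_degree K P)) = cnt S j * smooth n j"
      unfolding cnt_def by simp
  qed
  finally show ?thesis .
qed

text \<open>Such a divisor is determined by its multiplicities, between 0 and n, at the fixed finite
  set of places of degree at most k0.\<close>

lemma smooth_le:
  assumes "j \<le> k0" "j \<le> n" shows "smooth n j \<le> Suc n ^ card {P \<in> PD. place_degree K P \<le> k0}"
proof -
  let ?T = "{P \<in> PD. place_degree K P \<le> k0}" and ?X = "{D \<in> Eff (n - j). \<forall>P\<in>Poly_Mapping.keys D. place_degree K P \<le> j}"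
  have "(\<lambda>D. restrict (lkp D) ?T) ` ?X \<subseteq> ?T \<rightarrow>\<^sub>E {0..int n}"
  proof (rule image_subsetI)
    fix D assume "D \<in> ?X"
    then have D: "D \<in> Eff (n - j)" by simp
    show "restrict (lkp D) ?T \<in> ?T \<rightarrow>\<^sub>E {0..int n}"
    proof (rule restrict_PiE_iff[THEN iffD2], rule ballI)
      fix P
      have "int (n - j) \<le> int n" by simp
      then show "lkp D P \<in> {0..int n}" using Eff_lkp(3,4)[OF D, of P] by simp
    qed
  qed
  moreover have "inj_on (\<lambda>D. restrict (lkp D) ?T) ?X"
  proof (rule inj_onI, rule poly_mapping_eqI)
    fix D D' P assume D: "D \<in> ?X" "D' \<in> ?X" "restrict (lkp D) ?T = restrict (lkp D') ?T"
    show "lkp D P = lkp D' P"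
    proof (cases "P \<in> ?T")
      case True then show ?thesis using fun_cong[OF D(3), of P] by (simp only: restrict_apply')
    next
      case False
      have "P \<notin> Poly_Mapping.keys A" if A: "A \<in> ?X" for A using A False Eff_keys(2)[of A "n - j" P] assms(1) by auto
      then show ?thesis using D by (simp add: in_keys_iff)
    qed
  qed
  moreover have "finite (?T \<rightarrow>\<^sub>E {0..int n})" using place_degree_le_finite[of k0] by (intro finite_PiE) auto
  ultimately have "card ?X \<le> card (?T \<rightarrow>\<^sub>E {0..int n})" by (intro card_inj_on_le[of "\<lambda>D. restrict (lkp D) ?T"])
  also have "\<dots> = Suc n ^ card ?T"
  proof -
    have "card {0..int n} = Suc n" by (simp add: nat_add_distrib)
    then show ?thesis using card_PiE[OF place_degree_le_finite[of k0], of "\<lambda>_. {0..int n}"] by (simp only: prod_constant)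
  qed
  finally show ?thesis unfolding smooth_def .
qed

text \<open>Removing both primes injects into the divisors of degree n - 2j. The multiplied form
  also covers n < 2j, where the set is empty.\<close>

lemma card_two_primes:
  assumes a: "\<And>n. card (Eff n) \<le> a * q ^ n" and P: "place_degree K P = j" "place_degree K P' = j" "P \<noteq> P'"
  shows "card {A \<in> Eff n. P \<in> Poly_Mapping.keys A \<and> P' \<in> Poly_Mapping.keys A} * q ^ (2 * j) \<le> a * q ^ n"
proof -
  let ?X = "{A \<in> Eff n. P \<in> Poly_Mapping.keys A \<and> P' \<in> Poly_Mapping.keys A}"
  let ?f = "\<lambda>A. A - Poly_Mapping.single P 1 - Poly_Mapping.single P' 1"
  have f: "?f A \<in> Eff (n - 2 * j) \<and> 2 * j \<le> n" if "A \<in> ?X" for A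
  proof -
    have A: "A \<in> Eff n" "P \<in> Poly_Mapping.keys A" "P' \<in> Poly_Mapping.keys A" using that by auto
    have 1: "A - Poly_Mapping.single P 1 \<in> Eff (n - j)" using Eff_diff_single(1)[OF A(1,2)] P(1) by simp
    have 2: "P' \<in> Poly_Mapping.keys (A - Poly_Mapping.single P 1)" using Eff_diff_single(2)[OF A(1,2), of P'] A(3) P(3) by simp
    have "j \<le> n - j" "j \<le> n" using Eff_keys(2)[OF 1 2] Eff_keys(2)[OF A(1,2)] P by auto
    moreover have "?f A \<in> Eff (n - j - j)" using Eff_diff_single(1)[OF 1 2] P(2) by simp
    ultimately show ?thesis by (simp add: mult_2)
  qed
  show ?thesis
  proof (cases "?X = {}")
    case True then show ?thesis by (simp only: card.empty)
  next
    case False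
    then have j: "2 * j \<le> n" using f by blast
    have "card ?X \<le> card (Eff (n - 2 * j))"
      by (rule card_inj_on_le[of ?f]) (use f Eff_finite in \<open>auto intro!: inj_onI\<close>)
    also have "\<dots> \<le> a * q ^ (n - 2 * j)" by (rule a)
    finally have "card ?X * q ^ (2 * j) \<le> a * q ^ (n - 2 * j) * q ^ (2 * j)" by simp
    also have "\<dots> = a * q ^ n" using j by (simp add: power_add[symmetric])
    finally show ?thesis .
  qed
qed

text \<open>If the maximal degree is at least k0, fix one prime attaining it; paired with the others
  it gives Q(A) - 1 members of \<open>W A\<close>. Otherwise Q(A) itself is charged, through
  \<open>Dm\<close>, to the sum over j < k0. In the last term a comes from the divisors left after
  removing a pair, c^2 from the at most (c q^j / j)^2 pairs of degree j, and 2 / k0 from the tail of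
  the series of 1 / j^2.\<close>

lemma excess_bound:
  assumes n: "0 < n" and k0: "0 < k0"
    and a: "\<And>n. card (Eff n) \<le> a * q ^ n" and c: "\<And>e. e * cnt PD e \<le> c * q ^ e"
  shows "(\<Sum>A\<in>Eff n. real (Q_count K PD A)) \<le>
    real (card (Eff n)) + (\<Sum>j<k0. real (cnt PD j) * real (if j \<le> n then smooth n j else 0)) + (real a * real c ^ 2 * (2 / real k0)) * real q ^ n"
proof -
  let ?T = "{P \<in> PD. place_degree K P \<le> n}"
  let ?Z = "\<lambda>A. {P \<in> PD. P \<in> Poly_Mapping.keys A \<and> place_degree K P = d_plus K A}"
  define Dm where "Dm A = (if d_plus K A < k0 then Q_count K PD A else 0)" for A
  define W where "W A = {x \<in> ?T \<times> ?T. fst x \<noteq> snd x \<and> place_degree K (fst x) = place_degree K (snd x) \<and> k0 \<le> place_degree K (fst x)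
      \<and> fst x \<in> Poly_Mapping.keys A \<and> snd x \<in> Poly_Mapping.keys A}" for A :: "'a set \<Rightarrow>\<^sub>0 int"
  have fT: "finite ?T" by (rule place_degree_le_finite)
  have fW: "finite (W A)" for A unfolding W_def using fT by simp
  have one: "Q_count K PD A \<le> 1 + Dm A + card (W A)" if A: "A \<in> Eff n" for A
  proof (cases "d_plus K A < k0")
    case False
    have fZ: "finite (?Z A)" by (rule finite_subset[of _ "Poly_Mapping.keys A"]) auto
    show ?thesis
    proof (cases "?Z A = {}")
      case True then show ?thesis unfolding Q_count_def by (simp only: card.empty)
    next
      case ne: False
      then obtain P where P: "P \<in> ?Z A" by blast
      have "Pair P ` (?Z A - {P}) \<subseteq> W A"
      proof (rule image_subsetI)
        fix Q assume Q: "Q \<in> ?Z A - {P}"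
        have p: "P \<in> PD" "P \<in> Poly_Mapping.keys A" "place_degree K P = d_plus K A" using P by simp_all
        have r: "Q \<in> Poly_Mapping.keys A" "place_degree K Q = d_plus K A" "P \<noteq> Q" using Q by blast+
        show "(P, Q) \<in> W A" unfolding W_def using p r False Eff_keys(2)[OF A p(2)] Eff_keys(2)[OF A r(1)] by simp
      qed
      then have "card (Pair P ` (?Z A - {P})) \<le> card (W A)" by (rule card_mono[OF fW])
      moreover have "card (Pair P ` (?Z A - {P})) = card (?Z A - {P})" by (rule card_image) (auto intro: inj_onI)
      ultimately show ?thesis unfolding Q_count_def using fZ P by (simp only: card_Diff_singleton)
    qed
  qed (simp add: Dm_def)
  have "(\<Sum>A\<in>Eff n. Q_count K PD A) \<le> (\<Sum>A\<in>Eff n. 1 + Dm A + card (W A))" by (rule sum_mono) (rule one)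
  also have "\<dots> = card (Eff n) + (\<Sum>A\<in>Eff n. Dm A) + (\<Sum>A\<in>Eff n. card (W A))" by (simp only: sum.distrib) simp
  finally have m: "(\<Sum>A\<in>Eff n. Q_count K PD A) \<le> card (Eff n) + (\<Sum>A\<in>Eff n. Dm A) + (\<Sum>A\<in>Eff n. card (W A))" .
  have "(\<Sum>A\<in>Eff n. Dm A) \<le> (\<Sum>A\<in>Eff n. Q_count K {P \<in> PD. place_degree K P < k0} A)"
  proof (rule sum_mono)
    fix A show "Dm A \<le> Q_count K {P \<in> PD. place_degree K P < k0} A"
    proof (cases "d_plus K A < k0")
      case True
      then have "{P \<in> {P \<in> PD. place_degree K P < k0}. P \<in> Poly_Mapping.keys A \<and> place_degree K P = d_plus K A} = ?Z A" by auto
      then show ?thesis unfolding Dm_def Q_count_def by simp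
    qed (simp add: Dm_def)
  qed
  also have "\<dots> = (\<Sum>j\<le>n. cnt {P \<in> PD. place_degree K P < k0} j * smooth n j)" by (rule Q_count_sum) auto
  also have "\<dots> \<le> (\<Sum>j<k0. cnt PD j * (if j \<le> n then smooth n j else 0))"
  proof -
    have c0: "cnt {P \<in> PD. place_degree K P < k0} j = (if j < k0 then cnt PD j else 0)" for j
    proof (cases "j < k0")
      case True
      then have "{P \<in> {P \<in> PD. place_degree K P < k0}. place_degree K P = j} = {P \<in> PD. place_degree K P = j}" by auto
      then show ?thesis unfolding cnt_def using True by simp
    next
      case False
      then have "{P \<in> {P \<in> PD. place_degree K P < k0}. place_degree K P = j} = {}" by auto
      then show ?thesis unfolding cnt_def using False by (simp only: card.empty if_False)
    qed
    have "(\<Sum>j\<le>n. cnt {P \<in> PD. place_degree K P < k0} j * smooth n j) = (\<Sum>j\<in>{..n} \<inter> {..<k0}. cnt PD j * smooth n j)"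
      unfolding c0 by (rule sum.mono_neutral_cong_right) auto
    also have "\<dots> = (\<Sum>j<k0. cnt PD j * (if j \<le> n then smooth n j else 0))"
      by (rule sum.mono_neutral_cong_left) auto
    finally show ?thesis by simp
  qed
  finally have D: "(\<Sum>A\<in>Eff n. Dm A) \<le> (\<Sum>j<k0. cnt PD j * (if j \<le> n then smooth n j else 0))" .
  have E: "real (\<Sum>A\<in>Eff n. card (W A)) \<le> (real a * real c ^ 2 * (2 / real k0)) * real q ^ n"
  proof -
    let ?G = "{x \<in> ?T \<times> ?T. fst x \<noteq> snd x \<and> place_degree K (fst x) = place_degree K (snd x) \<and> k0 \<le> place_degree K (fst x)}"
    have fG: "finite ?G" using fT by simp
    have q0: "0 < real q" using q_ge_2 by simp
    have "card (W A) = (\<Sum>x\<in>?G. if fst x \<in> Poly_Mapping.keys A \<and> snd x \<in> Poly_Mapping.keys A then 1 else 0)" for A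
    proof -
      have "W A = {x \<in> ?G. fst x \<in> Poly_Mapping.keys A \<and> snd x \<in> Poly_Mapping.keys A}" unfolding W_def by blast
      then show ?thesis using fG by (simp only: sum.If_cases Int_def mem_Collect_eq) simp
    qed
    then have "(\<Sum>A\<in>Eff n. card (W A)) = (\<Sum>A\<in>Eff n. \<Sum>x\<in>?G. if fst x \<in> Poly_Mapping.keys A \<and> snd x \<in> Poly_Mapping.keys A then 1 else 0)" by (simp only:)
    also have "\<dots> = (\<Sum>x\<in>?G. \<Sum>A\<in>Eff n. if fst x \<in> Poly_Mapping.keys A \<and> snd x \<in> Poly_Mapping.keys A then 1 else 0)" by (rule sum.swap)
    also have "\<dots> = (\<Sum>x\<in>?G. card {A \<in> Eff n. fst x \<in> Poly_Mapping.keys A \<and> snd x \<in> Poly_Mapping.keys A})"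
      using Eff_finite[of n] by (simp add: sum.If_cases Int_def)
    finally have "real (\<Sum>A\<in>Eff n. card (W A)) = (\<Sum>x\<in>?G. real (card {A \<in> Eff n. fst x \<in> Poly_Mapping.keys A \<and> snd x \<in> Poly_Mapping.keys A}))" by simp
    also have "\<dots> \<le> (\<Sum>x\<in>?G. real a * real q ^ n / real q ^ (2 * place_degree K (fst x)))"
    proof (rule sum_mono)
      fix x assume x: "x \<in> ?G"
      have "card {A \<in> Eff n. fst x \<in> Poly_Mapping.keys A \<and> snd x \<in> Poly_Mapping.keys A} * q ^ (2 * place_degree K (fst x)) \<le> a * q ^ n"
        by (rule card_two_primes[OF a]) (use x in auto)
      then have "real (card {A \<in> Eff n. fst x \<in> Poly_Mapping.keys A \<and> snd x \<in> Poly_Mapping.keys A}) * real q ^ (2 * place_degree K (fst x)) \<le> real a * real q ^ n"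
        unfolding of_nat_mult[symmetric] of_nat_power[symmetric] of_nat_le_iff .
      then show "real (card {A \<in> Eff n. fst x \<in> Poly_Mapping.keys A \<and> snd x \<in> Poly_Mapping.keys A}) \<le> real a * real q ^ n / real q ^ (2 * place_degree K (fst x))"
        using q0 by (simp add: pos_le_divide_eq)
    qed
    also have "\<dots> = (\<Sum>j\<in>{k0..n}. \<Sum>x\<in>{x \<in> ?G. place_degree K (fst x) = j}. real a * real q ^ n / real q ^ (2 * place_degree K (fst x)))"
      by (rule sum.group[symmetric]) (use fG in auto)
    also have "\<dots> \<le> (\<Sum>j\<in>{k0..n}. real a * real c ^ 2 * real q ^ n * (1 / real j ^ 2))"
    proof (rule sum_mono)
      fix j assume j: "j \<in> {k0..n}"
      let ?S = "{P \<in> PD. place_degree K P = j}"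
      have "{x \<in> ?G. place_degree K (fst x) = j} \<subseteq> ?S \<times> ?S" by auto
      then have "card {x \<in> ?G. place_degree K (fst x) = j} \<le> card (?S \<times> ?S)" using place_degree_finite by (intro card_mono) auto
      also have "\<dots> = cnt PD j ^ 2" by (simp add: card_cartesian_product cnt_def power2_eq_square)
      finally have 1: "real (card {x \<in> ?G. place_degree K (fst x) = j}) \<le> real (cnt PD j) ^ 2" unfolding of_nat_power[symmetric] of_nat_le_iff .
      have kp: "0 < real j" using j k0 by auto
      have "real j * real (cnt PD j) \<le> real c * real q ^ j" using c[of j] unfolding of_nat_mult[symmetric] of_nat_power[symmetric] of_nat_le_iff .
      then have "real (cnt PD j) \<le> real c * real q ^ j / real j" using kp by (simp add: pos_le_divide_eq mult.commute)
      then have "real (cnt PD j) ^ 2 \<le> (real c * real q ^ j / real j) ^ 2" by (rule power_mono) simp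
      with 1 have 2: "real (card {x \<in> ?G. place_degree K (fst x) = j}) \<le> (real c * real q ^ j / real j) ^ 2" by linarith
      have "(\<Sum>x\<in>{x \<in> ?G. place_degree K (fst x) = j}. real a * real q ^ n / real q ^ (2 * place_degree K (fst x)))
        = (\<Sum>x\<in>{x \<in> ?G. place_degree K (fst x) = j}. real a * real q ^ n / real q ^ (2 * j))"
        by (rule sum.cong) auto
      also have "\<dots> = real (card {x \<in> ?G. place_degree K (fst x) = j}) * (real a * real q ^ n / real q ^ (2 * j))" by simp
      also have "\<dots> \<le> (real c * real q ^ j / real j) ^ 2 * (real a * real q ^ n / real q ^ (2 * j))"
        by (rule mult_right_mono[OF 2]) simp
      also have "\<dots> = real a * real c ^ 2 * real q ^ n * (1 / real j ^ 2)"
        using q0 kp by (simp add: field_simps power_mult power2_eq_square)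
      finally show "(\<Sum>x\<in>{x \<in> ?G. place_degree K (fst x) = j}. real a * real q ^ n / real q ^ (2 * place_degree K (fst x)))
         \<le> real a * real c ^ 2 * real q ^ n * (1 / real j ^ 2)" .
    qed
    also have "\<dots> = real a * real c ^ 2 * real q ^ n * (\<Sum>j\<in>{k0..n}. 1 / real j ^ 2)" by (simp add: sum_distrib_left)
    also have "\<dots> \<le> real a * real c ^ 2 * real q ^ n * (2 / real k0)"
      by (rule mult_left_mono[OF sum_inverse_squares_le[OF k0]]) simp
    finally show ?thesis by (simp only: mult_ac)
  qed
  have "real (\<Sum>A\<in>Eff n. Q_count K PD A) \<le> real (card (Eff n)) + real (\<Sum>A\<in>Eff n. Dm A) + real (\<Sum>A\<in>Eff n. card (W A))"
    using m by linarith
  also have "\<dots> \<le> real (card (Eff n)) + real (\<Sum>j<k0. cnt PD j * (if j \<le> n then smooth n j else 0)) + (real a * real c ^ 2 * (2 / real k0)) * real q ^ n"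
    using D E by (intro add_mono) (simp_all only: of_nat_le_iff order_refl)
  finally show ?thesis by simp
qed

text \<open>A divisor of positive degree has a prime of maximal degree. For n = 0 the inequality
  fails, as the zero divisor has Q = 0.\<close>

lemma excess_nonneg:
  assumes n: "0 < n" shows "real (card (Eff n)) \<le> (\<Sum>A\<in>Eff n. real (Q_count K PD A))"
proof -
  have "1 \<le> Q_count K PD A" if A: "A \<in> Eff n" for A
  proof -
    obtain P where P: "P \<in> Poly_Mapping.keys A" "place_degree K P = d_plus K A" by (rule d_plus_attained[OF A n])
    have "P \<in> {P \<in> PD. P \<in> Poly_Mapping.keys A \<and> place_degree K P = d_plus K A}" using P Eff_keys(2)[OF A P(1)] by simp
    moreover have "finite {P \<in> PD. P \<in> Poly_Mapping.keys A \<and> place_degree K P = d_plus K A}"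
      by (rule finite_subset[of _ "Poly_Mapping.keys A"]) auto
    ultimately have "0 < Q_count K PD A" unfolding Q_count_def card_gt_0_iff by blast
    then show ?thesis by simp
  qed
  then have "(\<Sum>A\<in>Eff n. 1) \<le> (\<Sum>A\<in>Eff n. real (Q_count K PD A))" by (intro sum_mono) auto
  then show ?thesis by simp
qed

text \<open>For large n the exact count differs from c_K q^n by the constant h/(q - 1). No degree is
  skipped, because each is the degree of a divisor.\<close>

lemma eff_asymptotic:
  "\<exists>h n1. 0 \<le> h \<and> (\<forall>n\<ge>n1. \<bar>real (card (Eff n)) - c_const K * real q ^ n\<bar> \<le> h)"
proof -
  obtain n0 where n0: "\<forall>n. \<forall>D0\<in>Div. deg D0 = int n \<longrightarrow> n0 \<le> int n \<longrightarrow>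
     genus K \<le> int n \<and> (q - 1) * card (Eff n) = class_number K * (q ^ nat (int n + 1 - genus K) - 1) \<and> 0 < class_number K"
    using eff_count by (rule exE)
  let ?h = "real (class_number K) / (real q - 1)"
  have q1: "0 < real q - 1" using q_ge_2 by simp
  have "\<bar>real (card (Eff n)) - c_const K * real q ^ n\<bar> \<le> ?h" if n: "nat n0 \<le> n" for n
  proof -
    obtain D where D: "D \<in> Div" "deg D = int n" using divisor_of_every_degree[of "int n"] by (rule bexE)
    have e: "genus K \<le> int n" "(q - 1) * card (Eff n) = class_number K * (q ^ nat (int n + 1 - genus K) - 1)"
      using mp[OF mp[OF bspec[OF spec[OF n0] D(1)] D(2)]] n by simp_all
    have "real ((q - 1) * card (Eff n)) = real (class_number K * (q ^ nat (int n + 1 - genus K) - 1))" unfolding e(2) ..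
    then have "(real q - 1) * real (card (Eff n)) = real (class_number K) * (real q ^ nat (int n + 1 - genus K) - 1)"
      using q_ge_2 by (simp add: of_nat_diff)
    moreover have "real q ^ nat (int n + 1 - genus K) = real q powi (1 - genus K) * real q ^ n"
    proof -
      have "real q ^ nat (int n + 1 - genus K) = real q powi (int n + 1 - genus K)" using e(1) by (simp add: power_int_def)
      also have "\<dots> = real q powi ((1 - genus K) + int n)" by (simp add: algebra_simps)
      also have "\<dots> = real q powi (1 - genus K) * real q powi int n" using q_ge_2 by (intro power_int_add) auto
      finally show ?thesis by simp
    qed
    ultimately have "(real q - 1) * real (card (Eff n)) = real (class_number K) * (real q powi (1 - genus K) * real q ^ n - 1)"
      by (simp only:)
    then have "real (card (Eff n)) = real (class_number K) * (real q powi (1 - genus K) * real q ^ n - 1) / (real q - 1)"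
      using q1 by (simp only: nonzero_eq_divide_eq mult.commute)
    also have "\<dots> = real (class_number K) * real q powi (1 - genus K) / (real q - 1) * real q ^ n - ?h"
      by (simp add: diff_divide_distrib right_diff_distrib mult.assoc)
    finally have "real (card (Eff n)) = c_const K * real q ^ n - ?h"
      unfolding c_const_def Let_def k[symmetric] q[symmetric] .
    then show ?thesis using q1 by simp
  qed
  then show ?thesis using q1 by (intro exI[of _ ?h] exI[of _ "nat n0"]) auto
qed

lemma smooth_negligible:
  assumes "0 < \<eta>"
  shows "\<forall>\<^sub>F n in sequentially. (\<Sum>j<k0. real (cnt PD j) * real (if j \<le> n then smooth n j else 0)) \<le> \<eta> * real q ^ n"
proof -
  define t where "t = card {P \<in> PD. place_degree K P \<le> k0}"
  define m where "m = (\<Sum>j<k0. real (cnt PD j))"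
  have "(\<lambda>n. m * (real (Suc n) ^ t / real q ^ n)) \<longlonglongrightarrow> 0"
    by (rule tendsto_mult_right_zero[OF poly_over_exp_tendsto_0[OF q_ge_2]])
  then have "\<forall>\<^sub>F n in sequentially. m * (real (Suc n) ^ t / real q ^ n) < \<eta>" using assms by (rule order_tendstoD(2))
  then show ?thesis
  proof eventually_elim
    case (elim n)
    have "(\<Sum>j<k0. real (cnt PD j) * real (if j \<le> n then smooth n j else 0)) \<le> (\<Sum>j<k0. real (cnt PD j) * real (Suc n) ^ t)"
    proof (rule sum_mono, rule mult_left_mono)
      fix j assume "j \<in> {..<k0}"
      then have "(if j \<le> n then smooth n j else 0) \<le> Suc n ^ t" using smooth_le[of j k0 n] unfolding t_def by auto
      then show "real (if j \<le> n then smooth n j else 0) \<le> real (Suc n) ^ t" unfolding of_nat_power[symmetric] of_nat_le_iff .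
    qed simp
    also have "\<dots> = m * real (Suc n) ^ t" unfolding m_def by (simp add: sum_distrib_right)
    also have "\<dots> \<le> \<eta> * real q ^ n" using elim q_ge_2 by (simp add: divide_less_eq)
    finally show ?case .
  qed
qed

text \<open>Sort both sums by the maximal degree j. From k0 on the density is within \<epsilon>;
  below k0 nothing is known about \<open>S\<close>, and the trivial bound 1 + |\<delta>| is
  used.\<close>

lemma density_comparison:
  assumes S: "S \<subseteq> PD" and d: "\<And>j. k0 \<le> j \<Longrightarrow> \<bar>real (cnt S j) - \<delta> * real (cnt PD j)\<bar> \<le> \<epsilon> * real (cnt PD j)" and e: "0 \<le> \<epsilon>"
  shows "\<bar>(\<Sum>A\<in>Eff n. real (Q_count K S A)) - \<delta> * (\<Sum>A\<in>Eff n. real (Q_count K PD A))\<bar>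
    \<le> \<epsilon> * (\<Sum>A\<in>Eff n. real (Q_count K PD A)) + (1 + \<bar>\<delta>\<bar>) * (\<Sum>j<k0. real (cnt PD j) * real (if j \<le> n then smooth n j else 0))"
proof -
  have sm: "(\<Sum>A\<in>Eff n. real (Q_count K S A)) = (\<Sum>j\<le>n. real (cnt S j) * real (smooth n j))" if "S \<subseteq> PD" for S
  proof -
    have "(\<Sum>A\<in>Eff n. real (Q_count K S A)) = real (\<Sum>A\<in>Eff n. Q_count K S A)" by simp
    then show ?thesis unfolding Q_count_sum[OF that] by simp
  qed
  let ?r = "\<lambda>j. (real (cnt S j) - \<delta> * real (cnt PD j)) * real (smooth n j)"
  have SP: "cnt S j \<le> cnt PD j" for j unfolding cnt_def using S place_degree_finite by (intro card_mono) auto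
  have "(\<Sum>A\<in>Eff n. real (Q_count K S A)) - \<delta> * (\<Sum>A\<in>Eff n. real (Q_count K PD A)) = (\<Sum>j\<le>n. ?r j)"
    unfolding sm[OF S] sm[OF order_refl] by (simp add: sum_distrib_left sum_subtractf algebra_simps)
  also have "\<bar>\<dots>\<bar> \<le> (\<Sum>j\<le>n. \<bar>?r j\<bar>)" by (rule sum_abs)
  also have "\<dots> \<le> (\<Sum>j\<le>n. \<epsilon> * (real (cnt PD j) * real (smooth n j)) + (1 + \<bar>\<delta>\<bar>) * (if j < k0 then real (cnt PD j) * real (smooth n j) else 0))"
  proof (rule sum_mono)
    fix j
    show "\<bar>?r j\<bar> \<le> \<epsilon> * (real (cnt PD j) * real (smooth n j)) + (1 + \<bar>\<delta>\<bar>) * (if j < k0 then real (cnt PD j) * real (smooth n j) else 0)"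
    proof (cases "j < k0")
      case True
      have "\<bar>real (cnt S j) - \<delta> * real (cnt PD j)\<bar> \<le> \<bar>real (cnt S j)\<bar> + \<bar>\<delta> * real (cnt PD j)\<bar>" by (rule abs_triangle_ineq4)
      also have "\<dots> \<le> (1 + \<bar>\<delta>\<bar>) * real (cnt PD j)" using SP[of j] by (simp add: abs_mult algebra_simps)
      finally have "\<bar>?r j\<bar> \<le> (1 + \<bar>\<delta>\<bar>) * real (cnt PD j) * real (smooth n j)" by (simp add: abs_mult mult_right_mono)
      moreover have "0 \<le> \<epsilon> * (real (cnt PD j) * real (smooth n j))" using e by simp
      ultimately show ?thesis using True by (simp add: mult.assoc)
    next
      case False
      then have "\<bar>?r j\<bar> \<le> \<epsilon> * real (cnt PD j) * real (smooth n j)" using d[of j] by (simp add: abs_mult mult_right_mono)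
      then show ?thesis using False by (simp add: mult.assoc)
    qed
  qed
  also have "\<dots> = \<epsilon> * (\<Sum>j\<le>n. real (cnt PD j) * real (smooth n j)) + (1 + \<bar>\<delta>\<bar>) * (\<Sum>j\<le>n. if j < k0 then real (cnt PD j) * real (smooth n j) else 0)"
    by (simp only: sum.distrib sum_distrib_left)
  also have "(\<Sum>j\<le>n. if j < k0 then real (cnt PD j) * real (smooth n j) else 0) = (\<Sum>j\<in>{..n} \<inter> {..<k0}. real (cnt PD j) * real (smooth n j))"
    by (rule sum.mono_neutral_cong_right) auto
  also have "\<dots> = (\<Sum>j<k0. real (cnt PD j) * real (if j \<le> n then smooth n j else 0))"
    by (rule sum.mono_neutral_cong_left) auto
  finally show ?thesis unfolding sm[OF order_refl] .
qed

text \<open>With F and G the sums for \<open>S\<close> and for all primes, E the number of divisors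
  and Z = q^n, split F - \<delta> c_K Z into F - \<delta> G, \<delta> (G - E) and \<delta> (E - c_K
  Z). All contributions of maximal degree below k0 are collected in V and estimated jointly, which
  makes four pieces of at most \<eta>/5 Z each. The choices are made in the order \<epsilon>, k0,
  \<mu>, n.\<close>

theorem Q_count_asymptotic:
  assumes S: "S \<subseteq> PD" and dens: "has_natural_density K S \<delta>"
  shows "(\<lambda>n. (\<Sum>A\<in>Eff n. real (Q_count K S A)) - \<delta> * c_const K * real q ^ n) \<in> o(\<lambda>n. real q ^ n)"
proof (rule landau_o.smallI)
  fix \<eta> :: real assume eta: "0 < \<eta>"
  obtain a :: nat where a: "\<And>n. card (Eff n) \<le> a * q ^ n" using eff_upper by (elim exE) (rule that, erule spec)
  obtain c :: nat where c: "\<And>e. e * cnt PD e \<le> c * q ^ e"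
  proof -
    obtain c where c: "\<forall>e. finite {P \<in> PD. place_degree K P = e} \<and> e * card {P \<in> PD. place_degree K P = e} \<le> c * q ^ e"
      using prime_count_bound by (rule exE)
    show thesis by (rule that[of c]) (unfold cnt_def, rule conjunct2[OF spec[OF c]])
  qed
  obtain h n1 where h: "0 \<le> h" "\<And>n. n1 \<le> n \<Longrightarrow> \<bar>real (card (Eff n)) - c_const K * real q ^ n\<bar> \<le> h" using eff_asymptotic by blast
  define r where "r = real a * real c ^ 2 * 2"
  have r0: "0 \<le> r" unfolding r_def by simp
  \<comment> \<open>Up to V, the sum G is at most (a + r + 1) Z, so \<epsilon> G stays below
    \<eta>/5 Z.\<close>
  define \<epsilon> where "\<epsilon> = \<eta> / (5 * (real a + r + 1))"
  have ep: "0 < \<epsilon>" "\<epsilon> * (real a + r + 1) = \<eta> / 5"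
  proof -
    have "\<eta> / (5 * y) * y = \<eta> / 5 \<and> 0 < \<eta> / (5 * y)" if "0 < y" for y using that eta by simp
    from this[of "real a + r + 1"] show "0 < \<epsilon>" "\<epsilon> * (real a + r + 1) = \<eta> / 5" unfolding \<epsilon>_def using r0 by simp_all
  qed
  have "\<forall>\<^sub>F j in sequentially. \<bar>real (cnt S j) / real (cnt PD j) - \<delta>\<bar> < \<epsilon>"
    using tendstoD[OF dens[unfolded has_natural_density_def] ep(1)] unfolding cnt_def dist_real_def .
  then obtain k1 where k1: "\<And>j. k1 \<le> j \<Longrightarrow> \<bar>real (cnt S j) / real (cnt PD j) - \<delta>\<bar> < \<epsilon>" unfolding eventually_sequentially by blast
  \<comment> \<open>Ensures |\<delta>| r / k0 <= \<eta>/5, which controls the pairs of distinct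
    primes of equal degree.\<close>
  obtain k2 :: nat where k2: "\<bar>\<delta>\<bar> * r * 5 / \<eta> < real k2" using reals_Archimedean2 by blast
  define k0 where "k0 = Suc (max k1 k2)"
  have k0: "0 < k0" "k1 \<le> k0" "\<bar>\<delta>\<bar> * r * 5 / \<eta> < real k0" using k2 unfolding k0_def by auto
  have dr: "\<bar>\<delta>\<bar> * (r / real k0) \<le> \<eta> / 5"
  proof -
    have "\<bar>\<delta>\<bar> * r * 5 < real k0 * \<eta>" using k0(3) eta by (simp add: pos_divide_less_eq)
    then show ?thesis using k0(1) by (simp add: field_simps)
  qed
  have rk: "r / real k0 \<le> r" using r0 k0(1) divide_left_mono[of 1 "real k0" r] by simp
  \<comment> \<open>In a degree without places the quotient in the density is 0/0 = 0 and carries no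
    information, but then both counts vanish.\<close>
  have d: "\<bar>real (cnt S j) - \<delta> * real (cnt PD j)\<bar> \<le> \<epsilon> * real (cnt PD j)" if j: "k0 \<le> j" for j
  proof (cases "cnt PD j = 0")
    case True
    have "cnt S j \<le> cnt PD j" unfolding cnt_def using S place_degree_finite by (intro card_mono) auto
    then show ?thesis using True by simp
  next
    case False
    then have p: "0 < real (cnt PD j)" by simp
    have "\<bar>real (cnt S j) / real (cnt PD j) - \<delta>\<bar> * real (cnt PD j) \<le> \<epsilon> * real (cnt PD j)"
      using k1[of j] j k0(2) p by (intro mult_right_mono) auto
    moreover have "real (cnt S j) - \<delta> * real (cnt PD j) = (real (cnt S j) / real (cnt PD j) - \<delta>) * real (cnt PD j)" using p by (simp add: field_simps)
    then have "\<bar>real (cnt S j) - \<delta> * real (cnt PD j)\<bar> = \<bar>real (cnt S j) / real (cnt PD j) - \<delta>\<bar> * real (cnt PD j)" using p by (simp add: abs_mult)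
    ultimately show ?thesis by simp
  qed
  \<comment> \<open>The divisor contains \<epsilon> + 1 + 2 |\<delta>|, the total coefficient with
    which V enters the three parts of the splitting.\<close>
  define \<mu> where "\<mu> = \<eta> / (5 * (\<epsilon> + 1 + 2 * \<bar>\<delta>\<bar>))"
  have mu: "0 < \<mu>" "(\<epsilon> + 1 + 2 * \<bar>\<delta>\<bar>) * \<mu> = \<eta> / 5"
  proof -
    have "y * (\<eta> / (5 * y)) = \<eta> / 5 \<and> 0 < \<eta> / (5 * y)" if "0 < y" for y using that eta by simp
    from this[of "\<epsilon> + 1 + 2 * \<bar>\<delta>\<bar>"] show "0 < \<mu>" "(\<epsilon> + 1 + 2 * \<bar>\<delta>\<bar>) * \<mu> = \<eta> / 5" unfolding \<mu>_def using ep(1) by simp_all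
  qed
  have "(\<lambda>n. \<bar>\<delta>\<bar> * h * (real (Suc n) ^ 0 / real q ^ n)) \<longlonglongrightarrow> 0"
    by (rule tendsto_mult_right_zero[OF poly_over_exp_tendsto_0[OF q_ge_2]])
  then have ev1: "\<forall>\<^sub>F n in sequentially. \<bar>\<delta>\<bar> * h * (real (Suc n) ^ 0 / real q ^ n) < \<eta> / 5" by (rule order_tendstoD(2)) (use eta in simp)
  show "\<forall>\<^sub>F n in sequentially. norm ((\<Sum>A\<in>Eff n. real (Q_count K S A)) - \<delta> * c_const K * real q ^ n) \<le> \<eta> * norm (real q ^ n)"
    using ev1 smooth_negligible[OF mu(1), of k0] eventually_ge_at_top[of "Suc n1"]
  proof eventually_elim
    case (elim n)
    define F where "F = (\<Sum>A\<in>Eff n. real (Q_count K S A))"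
    define G where "G = (\<Sum>A\<in>Eff n. real (Q_count K PD A))"
    define V where "V = (\<Sum>j<k0. real (cnt PD j) * real (if j \<le> n then smooth n j else 0))"
    define Z where "Z = real q ^ n"
    define E where "E = real (card (Eff n))"
    have Z0: "0 < Z" unfolding Z_def using q_ge_2 by simp
    have n: "0 < n" "n1 \<le> n" using elim(3) by auto
    have V: "V \<le> \<mu> * Z" using elim(2) unfolding V_def Z_def .
    have V0: "0 \<le> V" unfolding V_def by (intro sum_nonneg) simp
    have h1: "\<bar>\<delta>\<bar> * h \<le> \<eta> / 5 * Z" using elim(1) Z0 unfolding Z_def by (simp add: pos_divide_less_eq)
    have "G \<le> E + V + (real a * real c ^ 2 * (2 / real k0)) * Z"
      using excess_bound[OF n(1) k0(1) a c] unfolding G_def E_def V_def Z_def .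
    moreover have "real a * real c ^ 2 * (2 / real k0) = r / real k0" unfolding r_def by simp
    ultimately have G1: "G \<le> E + V + r / real k0 * Z" by (simp only:)
    have G2: "E \<le> G" using excess_nonneg[OF n(1)] unfolding G_def E_def .
    have Ea: "E \<le> real a * Z" using a[of n] unfolding E_def Z_def unfolding of_nat_mult[symmetric] of_nat_power[symmetric] of_nat_le_iff .
    have H: "\<bar>E - c_const K * Z\<bar> \<le> h" using h(2)[OF n(2)] unfolding E_def Z_def .
    have FG: "\<bar>F - \<delta> * G\<bar> \<le> \<epsilon> * G + (1 + \<bar>\<delta>\<bar>) * V"
      unfolding F_def G_def V_def by (rule density_comparison[OF S d less_imp_le[OF ep(1)]])
    have t1: "\<epsilon> * G \<le> \<eta> / 5 * Z + \<epsilon> * V"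
    proof -
      have "r / real k0 * Z \<le> r * Z" using rk Z0 by (intro mult_right_mono) auto
      then have "G \<le> (real a + r + 1) * Z + V" using G1 Ea Z0 by (simp add: algebra_simps)
      then have "\<epsilon> * G \<le> \<epsilon> * ((real a + r + 1) * Z + V)" using ep(1) by (intro mult_left_mono) auto
      also have "\<dots> = (\<epsilon> * (real a + r + 1)) * Z + \<epsilon> * V" by (simp add: algebra_simps)
      finally show ?thesis unfolding ep(2) .
    qed
    have t2: "\<bar>\<delta>\<bar> * \<bar>G - E\<bar> \<le> \<bar>\<delta>\<bar> * V + \<eta> / 5 * Z"
    proof -
      have "\<bar>\<delta>\<bar> * \<bar>G - E\<bar> \<le> \<bar>\<delta>\<bar> * (V + r / real k0 * Z)" using G1 G2 by (intro mult_left_mono) auto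
      also have "\<dots> = \<bar>\<delta>\<bar> * V + \<bar>\<delta>\<bar> * (r / real k0) * Z" by (simp add: algebra_simps)
      also have "\<dots> \<le> \<bar>\<delta>\<bar> * V + \<eta> / 5 * Z" using mult_right_mono[OF dr, of Z] Z0 by simp
      finally show ?thesis .
    qed
    have t3: "\<bar>\<delta>\<bar> * \<bar>E - c_const K * Z\<bar> \<le> \<eta> / 5 * Z" using mult_left_mono[OF H, of "\<bar>\<delta>\<bar>"] h1 by simp
    have t4: "\<epsilon> * V + (1 + \<bar>\<delta>\<bar>) * V + \<bar>\<delta>\<bar> * V \<le> \<eta> / 5 * Z"
    proof -
      have "\<epsilon> * V + (1 + \<bar>\<delta>\<bar>) * V + \<bar>\<delta>\<bar> * V = (\<epsilon> + 1 + 2 * \<bar>\<delta>\<bar>) * V" by (simp add: algebra_simps)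
      also have "\<dots> \<le> (\<epsilon> + 1 + 2 * \<bar>\<delta>\<bar>) * (\<mu> * Z)" using V ep(1) by (intro mult_left_mono) auto
      also have "\<dots> = \<eta> / 5 * Z" unfolding mult.assoc[symmetric] mu(2) ..
      finally show ?thesis .
    qed
    have "F - \<delta> * c_const K * Z = (F - \<delta> * G) + \<delta> * (G - E) + \<delta> * (E - c_const K * Z)" by (simp add: algebra_simps)
    then have "\<bar>F - \<delta> * c_const K * Z\<bar> \<le> \<bar>F - \<delta> * G\<bar> + \<bar>\<delta>\<bar> * \<bar>G - E\<bar> + \<bar>\<delta>\<bar> * \<bar>E - c_const K * Z\<bar>"
      unfolding abs_mult[symmetric] by linarith
    then have "\<bar>F - \<delta> * c_const K * Z\<bar> \<le> \<eta> * Z" using FG t1 t2 t3 t4 mult_pos_pos[OF eta Z0] by linarith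
    then show ?case unfolding F_def[symmetric] Z_def[symmetric] using Z0 by simp
  qed
qed

end

theorem theorem4p4:
  fixes K :: "('a, 'b) ring_scheme" and q :: nat and S :: "'a set set" and \<delta> :: real
  assumes "global_function_field K"
    and "q = card (constant_field K)"
    and "S \<subseteq> prime_divisors K"
    and "has_natural_density K S \<delta>"
  shows "(\<lambda>n::nat. (\<Sum>A | A \<in> effective_divisors K \<and> divisor_degree K A = int n.
            real (Q_count K S A)) - \<delta> * c_const K * real q ^ n)
         \<in> o(\<lambda>n. real q ^ n)"
proof -
  obtain B C where "ffield K (constant_field K) q B C"
    using global_function_field.ffield[OF assms(1)] unfolding assms(2) by blast
  then interpret ffield K "constant_field K" q B C .
  show ?thesis using Q_count_asymptotic[OF assms(3,4)] unfolding Eff_def .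
qed

end
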